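(* Let $\gamma\subset\mathbf R^2$ be a simple closed centrally-symmetric $C^2$ curve of positive curvature. If a neighborhood of the boundary $\gamma$ of the billiard domain (inside the domain bounded by $\gamma$) is $C^1$-foliated by convex caustics whose rotation numbers fill the interval $(0,1/4]$, then $\gamma$ is an ellipse.
   Context: The billiard domain is the region bounded by $\gamma$. A convex caustic of the billiard in $\gamma$ is a simple closed convex curve $C$ inside the domain such that whenever an oriented line is tangent to $C$, the line obtained from it by billiard reflection in $\gamma$ is again tangent to $C$. The oriented lines tangent to a convex caustic and going around it counterclockwise form a curve in the space of oriented lines intersecting the domain; this curve winds once around that cylinder and is invariant under the billiard ball map $T$ (which sends an oriented line to its reflection in $\gamma$ at the point where it leaves the domain). The rotation number of the caustic is the rotation number of the induced circle homeomorphism (average number of counterclockwise turns around $\gamma$ per reflection); it tends to $0$ for caustics approaching $\gamma$. Circles are regarded as ellipses. *)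

theory Defs
  imports "HOL-Analysis.Analysis" "HOL-Library.Disjoint_Sets"
begin

text \<open>The plane is the type \<^typ>\<open>complex\<close>; there \<open>Im (cnj v * w)\<close> is the determinant of the pair \<open>(v, w)\<close>.\<close>

section \<open>The billiard table\<close>

abbreviation velocity :: "(real \<Rightarrow> complex) \<Rightarrow> real \<Rightarrow> complex" where
  "velocity \<gamma> t \<equiv> vector_derivative \<gamma> (at t)"

text \<open>A closed curve is given by a regular parametrization of period 1 on the whole line, so that
  the condition at the closing point needs no separate treatment.\<close>

definition simple_closed_C2_curve :: "(real \<Rightarrow> complex) \<Rightarrow> bool" where
  "simple_closed_C2_curve \<gamma> \<longleftrightarrow>
     (\<forall>t. \<gamma> (t + 1) = \<gamma> t) \<and> inj_on \<gamma> {0..<1} \<and>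
     \<gamma> C1_differentiable_on UNIV \<and> velocity \<gamma> C1_differentiable_on UNIV \<and>
     (\<forall>t. velocity \<gamma> t \<noteq> 0)"

text \<open>Signed curvature. For a simple closed curve, positivity everywhere means nonvanishing curvature
  together with the choice of the counterclockwise orientation.\<close>

definition curvature :: "(real \<Rightarrow> complex) \<Rightarrow> real \<Rightarrow> real" where
  "curvature \<gamma> t = Im (cnj (velocity \<gamma> t) * velocity (velocity \<gamma>) t) / norm (velocity \<gamma> t) ^ 3"

definition centrally_symmetric :: "complex set \<Rightarrow> bool" where
  "centrally_symmetric S \<longleftrightarrow> (\<exists>c. \<forall>z\<in>S. 2 * c - z \<in> S)"

definition is_ellipse :: "complex set \<Rightarrow> bool" where
  "is_ellipse E \<longleftrightarrow> (\<exists>f\<^sub>1 f\<^sub>2 d. dist f\<^sub>1 f\<^sub>2 < d \<and> E = {z. dist z f\<^sub>1 + dist z f\<^sub>2 = d})"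

abbreviation domain :: "(real \<Rightarrow> complex) \<Rightarrow> complex set" where
  "domain \<gamma> \<equiv> inside (range \<gamma>)"


section \<open>Oriented lines and the billiard ball map\<close>

text \<open>The oriented line with unit direction \<open>v\<close> and signed distance \<open>r\<close> is the pair \<open>(v, r)\<close>; its points are
  the \<open>z\<close> with \<open>det (v, z) = r\<close>, and the points to its left are those with \<open>det (v, z) > r\<close>. Each oriented line
  corresponds to exactly one pair.\<close>

type_synonym oriented_line = "complex \<times> real"

definition oriented_lines :: "oriented_line set" where
  "oriented_lines = sphere 0 1 \<times> UNIV"

definition direction :: "oriented_line \<Rightarrow> complex" where
  "direction l = fst l"

definition line_height :: "oriented_line \<Rightarrow> complex \<Rightarrow> real" where
  "line_height l z = Im (cnj (direction l) * z) - snd l"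

definition line_points :: "oriented_line \<Rightarrow> complex set" where
  "line_points l = {z. line_height l z = 0}"

definition line_through :: "complex \<Rightarrow> complex \<Rightarrow> oriented_line" where
  "line_through p v = (v, Im (cnj v * p))"

definition enters_at :: "(real \<Rightarrow> complex) \<Rightarrow> oriented_line \<Rightarrow> real \<Rightarrow> bool" where
  "enters_at \<gamma> l t \<longleftrightarrow> \<gamma> t \<in> line_points l \<and>
     (\<exists>e>0. \<forall>s\<in>{0<..<e}. \<gamma> t + s *\<^sub>R direction l \<in> domain \<gamma>)"

definition leaves_at :: "(real \<Rightarrow> complex) \<Rightarrow> oriented_line \<Rightarrow> real \<Rightarrow> bool" where
  "leaves_at \<gamma> l t \<longleftrightarrow> \<gamma> t \<in> line_points l \<and>
     (\<exists>e>0. \<forall>s\<in>{0<..<e}. \<gamma> t - s *\<^sub>R direction l \<in> domain \<gamma>)"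

definition reflect :: "complex \<Rightarrow> complex \<Rightarrow> complex" where
  "reflect w v = (2 * (v \<bullet> sgn w)) *\<^sub>R sgn w - v"

text \<open>When \<open>\<gamma>\<close> bounds a strictly convex domain and \<open>l\<close> meets that domain, the parameter at which \<open>l\<close>
  leaves is unique up to the period of \<open>\<gamma>\<close>, so the choice is immaterial. Other lines are irrelevant.\<close>

definition billiard_map :: "(real \<Rightarrow> complex) \<Rightarrow> oriented_line \<Rightarrow> oriented_line" where
  "billiard_map \<gamma> l =
     (let t = (SOME t. leaves_at \<gamma> l t)
      in line_through (\<gamma> t) (reflect (velocity \<gamma> t) (direction l)))"


section \<open>Convex caustics\<close>

definition simple_closed_convex_curve :: "complex set \<Rightarrow> bool" where
  "simple_closed_convex_curve C \<longleftrightarrow>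
     (\<exists>c. simple_path c \<and> pathfinish c = pathstart c \<and> path_image c = C) \<and> convex (inside C)"

text \<open>A convex curve need not be smooth, so a tangent line is one that touches the curve and has it on one
  side. The tangent lines with the curve on the left are those going around it counterclockwise.\<close>

definition ccw_tangents :: "complex set \<Rightarrow> oriented_line set" where
  "ccw_tangents C =
     {l \<in> oriented_lines. line_points l \<inter> C \<noteq> {} \<and> (\<forall>z\<in>C. line_height l z \<ge> 0)}"

definition cw_tangents :: "complex set \<Rightarrow> oriented_line set" where
  "cw_tangents C =
     {l \<in> oriented_lines. line_points l \<inter> C \<noteq> {} \<and> (\<forall>z\<in>C. line_height l z \<le> 0)}"

definition tangents :: "complex set \<Rightarrow> oriented_line set" where
  "tangents C = ccw_tangents C \<union> cw_tangents C"

definition convex_caustic :: "(real \<Rightarrow> complex) \<Rightarrow> complex set \<Rightarrow> bool" where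
  "convex_caustic \<gamma> C \<longleftrightarrow> simple_closed_convex_curve C \<and> C \<subseteq> domain \<gamma> \<and>
     (\<forall>l\<in>tangents C. billiard_map \<gamma> l \<in> tangents C)"

text \<open>The invariant circle \<open>ccw_tangents C\<close> is parametrized by the point of \<open>\<gamma>\<close> at which a line enters the
  domain. The conditions on \<open>\<tau>\<close> say that it is an orbit of the lift, to the parameter line of \<open>\<gamma>\<close>, of the circle
  homeomorphism induced by the billiard map, for the lift that advances by less than one counterclockwise
  turn per reflection.\<close>

definition rotation_number :: "(real \<Rightarrow> complex) \<Rightarrow> complex set \<Rightarrow> real" where
  "rotation_number \<gamma> C =
     (THE \<rho>. \<forall>l\<in>ccw_tangents C. \<forall>\<tau> :: nat \<Rightarrow> real.
        (\<forall>n. enters_at \<gamma> ((billiard_map \<gamma> ^^ n) l) (\<tau> n) \<and> \<tau> n < \<tau> (Suc n) \<and> \<tau> (Suc n) < \<tau> n + 1)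
        \<longrightarrow> (\<lambda>n. \<tau> n / real n) \<longlonglongrightarrow> \<rho>)"


section \<open>Foliations of class C1\<close>

definition C1_map_on :: "'a::real_normed_vector set \<Rightarrow> ('a \<Rightarrow> 'b::real_normed_vector) \<Rightarrow> bool" where
  "C1_map_on S f \<longleftrightarrow>
     (\<exists>f' :: 'a \<Rightarrow> 'a \<Rightarrow>\<^sub>L 'b. (\<forall>x\<in>S. (f has_derivative blinfun_apply (f' x)) (at x)) \<and> continuous_on S f')"

text \<open>A partition of a planar region \<open>U\<close> into the leaves of a one-dimensional C1 foliation: near each point
  there is a C1 chart onto the open square in which the leaves are locally the horizontal segments. The
  second alternative for \<open>U \<inter> V\<close> is the half-chart of a surface with boundary; it allows \<open>U\<close> to contain
  boundary leaves, the foliation being C1 up to them.\<close>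

definition C1_foliation :: "complex set \<Rightarrow> complex set set \<Rightarrow> bool" where
  "C1_foliation U \<F> \<longleftrightarrow> partition_on U \<F> \<and> (\<forall>L\<in>\<F>. connected L) \<and>
     (\<forall>p\<in>U. \<exists>V (\<phi> :: complex \<Rightarrow> real \<times> real) \<psi>.
        open V \<and> p \<in> V \<and>
        homeomorphism V ({-1<..<1} \<times> {-1<..<1}) \<phi> \<psi> \<and>
        C1_map_on V \<phi> \<and> C1_map_on ({-1<..<1} \<times> {-1<..<1}) \<psi> \<and>
        (U \<inter> V = V \<or> U \<inter> V = {z\<in>V. snd (\<phi> z) \<ge> 0}) \<and>
        (\<forall>L\<in>\<F>. \<forall>K\<in>components (L \<inter> V). \<exists>c. K = {z\<in>V. snd (\<phi> z) = c}))"

end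

theory Submission
  imports Defs
begin

text \<open>
  Describe \<open>\<gamma>\<close> by its support function \<open>h\<close>, as a function of the direction of the outer normal. Two consecutive lines of a billiard
  orbit, with normal angles \<open>x < y\<close>, meet at the boundary point of normal angle \<open>(x + y)/2\<close>, and \<open>2 h((x + y)/2) sin((y - x)/2)\<close> is a
  generating function of the billiard map. A convex caustic is an invariant graph of this twist map. The caustic of rotation number
  \<open>1/4\<close> consists of periodic orbits; by central symmetry these are parallelograms, which gives \<open>h(m)^2 + h(m + \<pi>/2)^2 = R^2\<close>.
  The invariant graphs foliate the part of the phase space between this caustic and the boundary. Each of them is calibrated by a
  potential: moving two consecutive lines along the graph can only decrease the action gauged by the potential. On averaging
  over the foliated region with respect to the invariant measure, the potentials cancel, and the second variation yields an integral
  inequality for \<open>h\<close>. Added to its translate by a quarter turn it becomes, for \<open>v = h h'\<close>, the reverse of Wirtinger's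
  inequality \<open>\<integral> 4 v^2 \<le> \<integral> v'^2\<close> for functions with \<open>v(m + \<pi>/2) = - v(m)\<close>. The equality case gives
  \<open>h(m)^2 = A + B cos 2(m - b)\<close>, the squared support function of an ellipse.
\<close>

section \<open>Rotation numbers of lifts\<close>

text \<open>The graphs are only Lipschitz and depend only continuously on the leaf, so no second
  variation of a leaf potential can be taken. The inequality for a finite displacement is therefore
  averaged, and \<epsilon> tends to 0 only when the potentials are gone and \<open>h\<close> alone
  is differentiated. A line \<open>(x, p)\<close> is displaced to the normal angle
  \<open>x + \<epsilon> * p\<close>: this depends on the line alone, so the potential terms at the
  two ends of a chord are values of one function on phase space and have the same mean. The
  averaging needs a phase space without gaps. If a neighbouring caustic differs by between
  \<open>d\<close> and \<open>D\<close>, deficits are of order \<open>D\<close> squared, while an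
  orbit that fails to close shows up at order \<open>d\<close>. C1 charts bound
  \<open>D / d\<close>, so on a caustic of rational rotation number every orbit closes; then graphs
  are determined by their rotation number and vary continuously with it. Adding the translate by a
  quarter turn is forced by the integral over the angle: it contains
  \<open>quartic_mixed (d m)\<close>, whose values at \<open>m\<close> and \<open>m + pi / 2\<close>
  have a constant sum, so that in the total it survives only inside an exact derivative.\<close>

definition degree_one :: "(real \<Rightarrow> real) \<Rightarrow> bool" where
  "degree_one f \<longleftrightarrow> strict_mono f \<and> continuous_on UNIV f \<and> (\<forall>x. f (x + 2 * pi) = f x + 2 * pi)"

text \<open>The number of turns per step, with an error bounded uniformly in \<open>n\<close> and
  \<open>x\<close>. A mere limit of \<open>(f ^^ n) x / n\<close> would not do: sums over
  \<open>n\<close> steps are compared below up to a bounded error.\<close>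

definition has_rotation :: "(real \<Rightarrow> real) \<Rightarrow> real \<Rightarrow> bool" where
  "has_rotation f r \<longleftrightarrow> (\<exists>K. \<forall>n x. \<bar>(f ^^ n) x - x - 2 * pi * r * real n\<bar> \<le> K)"

lemma shift_int:
  fixes f :: "real \<Rightarrow> real"
  assumes "\<And>x. f (x + T) = f x + D"
  shows "f (x + T * of_int k) = f x + D * of_int k"
proof -
  have nat: "f (x + T * real n) = f x + D * real n" for x n
  proof (induction n)
    case (Suc n)
    have "f (x + T * real (Suc n)) = f ((x + T * real n) + T)" by (simp add: algebra_simps)
    also have "\<dots> = f x + D * real (Suc n)" unfolding assms Suc by (simp add: algebra_simps)
    finally show ?case .
  qed simp
  show ?thesis
  proof (cases "k \<ge> 0")
    case True
    then show ?thesis using nat[of x "Suc 0"] nat[of x "nat k"] by simp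
  next
    case False
    then show ?thesis using nat[of "x + T * of_int k" "nat (-k)"] by simp
  qed
qed

lemma periodic_int:
  fixes f :: "real \<Rightarrow> 'a"
  assumes "\<And>x. f (x + T) = f x"
  shows "f (x + T * of_int k) = f x"
proof -
  have nat: "f (x + T * real n) = f x" for x n
  proof (induction n)
    case (Suc n)
    have "f (x + T * real (Suc n)) = f ((x + T * real n) + T)" by (simp add: algebra_simps)
    then show ?case using assms Suc by simp
  qed simp
  show ?thesis
  proof (cases "k \<ge> 0")
    case True
    then show ?thesis using nat[of x "nat k"] by simp
  next
    case False
    then show ?thesis using nat[of "x + T * of_int k" "nat (-k)"] by simp
  qed
qed

lemma reduce_mod_period:
  fixes x T :: real
  assumes "T > 0"
  obtains k :: int and y where "x = y + T * of_int k" "0 \<le> y" "y < T"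
proof
  let ?k = "\<lfloor>x / T\<rfloor>"
  show "x = (x - T * of_int ?k) + T * of_int ?k" by simp
  have "of_int ?k \<le> x / T" "x / T < of_int ?k + 1" by linarith+
  then show "0 \<le> x - T * of_int ?k" "x - T * of_int ?k < T"
    using assms by (simp_all only: pos_le_divide_eq pos_divide_less_eq) (simp_all add: algebra_simps)
qed

lemma degree_one_funpow:
  assumes "degree_one f" shows "degree_one (f ^^ n)"
proof (induction n)
  case 0 show ?case by (simp add: degree_one_def strict_mono_def)
next
  case (Suc n)
  have "continuous_on UNIV (f \<circ> (f ^^ n))"
    using assms Suc by (intro continuous_on_compose) (auto simp: degree_one_def intro: continuous_on_subset)
  then show ?case using assms Suc by (auto simp: degree_one_def strict_mono_def)
qed

lemma degree_one_displacement:
  assumes "degree_one f" shows "\<bar>f x - x - f 0\<bar> \<le> 2 * pi"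
proof -
  obtain k y where k: "x = y + 2 * pi * of_int k" "0 \<le> y" "y < 2 * pi"
    using reduce_mod_period[of "2 * pi" x] by (metis pi_gt_zero zero_less_mult_iff zero_less_numeral)
  have m: "mono f" using assms by (simp add: degree_one_def strict_mono_mono)
  have s: "\<And>x. f (x + 2 * pi) = f x + 2 * pi" using assms by (simp add: degree_one_def)
  have "f x = f y + 2 * pi * of_int k" using shift_int[of f, OF s] k by simp
  moreover have "f 0 \<le> f y" "f y \<le> f (0 + 2 * pi)" using k m by (auto intro: monoD)
  ultimately show ?thesis using k s[of 0] by auto
qed

text \<open>Poincare's argument. All points are displaced by \<open>f ^^ n\<close> equally up to one
  turn, so \<open>A\<close> is additive up to a bounded error. Evaluating \<open>A (m * n)\<close>
  in two ways makes \<open>A n / n\<close> Cauchy with a rate of order \<open>1 / n\<close>, and it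
  is this rate that bounds the deviation.\<close>

lemma degree_one_rotation_exists:
  assumes f: "degree_one f" shows "\<exists>r. has_rotation f r"
proof -
  define A where "A n = (f ^^ n) 0" for n
  have disp: "\<bar>(f ^^ n) x - x - A n\<bar> \<le> 2 * pi" for n x
    unfolding A_def using degree_one_displacement[OF degree_one_funpow[OF f]] .
  have mul: "\<bar>A (m * n) - real m * A n\<bar> \<le> real m * (2 * pi)" for m n
  proof (induction m)
    case 0 show ?case by (simp add: A_def)
  next
    case (Suc m)
    have "A (Suc m * n) = (f ^^ n) (A (m * n))"
      by (simp add: A_def funpow_add)
    moreover have "\<bar>(f ^^ n) (A (m * n)) - A (m * n) - A n\<bar> \<le> 2 * pi" by (rule disp)
    ultimately show ?case using Suc by (simp add: algebra_simps abs_le_iff)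
  qed
  have comp: "\<bar>A m / real m - A n / real n\<bar> \<le> 2 * pi * (1 / real m + 1 / real n)"
    if "m > 0" "n > 0" for m n
  proof -
    have "\<bar>A (m * n) - real m * A n\<bar> \<le> real m * (2 * pi)" "\<bar>A (m * n) - real n * A m\<bar> \<le> real n * (2 * pi)"
      using mul[of m n] mul[of n m] by (simp_all add: mult.commute)
    then have "\<bar>real n * A m - real m * A n\<bar> \<le> (real m + real n) * (2 * pi)"
      by (simp add: abs_le_iff algebra_simps)
    then have "\<bar>real n * A m - real m * A n\<bar> / (real m * real n) \<le> (real m + real n) * (2 * pi) / (real m * real n)"
      using that by (intro divide_right_mono) auto
    moreover have "\<bar>real n * A m - real m * A n\<bar> / (real m * real n) = \<bar>A m / real m - A n / real n\<bar>"
    proof -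
      have "A m / real m - A n / real n = (real n * A m - real m * A n) / (real m * real n)"
        using that by (simp add: field_simps)
      then show ?thesis by (simp add: abs_mult)
    qed
    ultimately show ?thesis using that by (simp add: field_simps)
  qed
  have "Cauchy (\<lambda>n. A n / real n)"
  proof (rule CauchyI)
    fix e :: real assume "e > 0"
    obtain M where M: "real M > 4 * pi / e" "M > 0"
      by (metis reals_Archimedean2 gr0I of_nat_0 divide_pos_pos mult_pos_pos pi_gt_zero \<open>e > 0\<close> not_less_iff_gr_or_eq zero_less_numeral)
    have "norm (A m / real m - A n / real n) < e" if "m \<ge> M" "n \<ge> M" for m n
    proof -
      have "1 / real m \<le> 1 / real M" "1 / real n \<le> 1 / real M" using that M by (auto simp: frac_le)
      then have "2 * pi * (1 / real m + 1 / real n) \<le> 2 * pi * (1 / real M + 1 / real M)"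
        by (intro mult_left_mono) auto
      also have "\<dots> = 4 * pi / real M" by simp
      also have "\<dots> < e" using M \<open>e > 0\<close> by (simp add: field_simps)
      finally show ?thesis using comp[of m n] that M by auto
    qed
    then show "\<exists>M. \<forall>m\<ge>M. \<forall>n\<ge>M. norm (A m / real m - A n / real n) < e" by blast
  qed
  then obtain L where L: "(\<lambda>n. A n / real n) \<longlonglongrightarrow> L" using Cauchy_convergent_iff convergent_def by blast
  have lim: "\<bar>A n - L * real n\<bar> \<le> 2 * pi" if n: "n > 0" for n
  proof -
    have "(\<lambda>m. \<bar>A n / real n - A m / real m\<bar>) \<longlonglongrightarrow> \<bar>A n / real n - L\<bar>"
      by (intro tendsto_intros L)
    moreover have "(\<lambda>m. 2 * pi * (1 / real n + 1 / real m)) \<longlonglongrightarrow> 2 * pi * (1 / real n + 0)"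
      by (intro tendsto_intros lim_1_over_n)
    moreover have "\<forall>\<^sub>F m in sequentially. \<bar>A n / real n - A m / real m\<bar> \<le> 2 * pi * (1 / real n + 1 / real m)"
      using eventually_gt_at_top[of 0] by eventually_elim (use comp n in auto)
    ultimately have "\<bar>A n / real n - L\<bar> \<le> 2 * pi * (1 / real n + 0)"
      by (intro tendsto_le[OF sequentially_bot]) auto
    moreover have "\<bar>A n / real n - L\<bar> = \<bar>A n - L * real n\<bar> / real n"
    proof -
      have "A n / real n - L = (A n - L * real n) / real n" using n by (simp add: field_simps)
      then show ?thesis by simp
    qed
    ultimately show ?thesis using n by (simp add: field_simps)
  qed
  have "\<bar>(f ^^ n) x - x - 2 * pi * (L / (2 * pi)) * real n\<bar> \<le> 4 * pi" for n x
  proof (cases "n = 0")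
    case False
    then show ?thesis using disp[of n x] lim[of n] by simp
  qed simp
  then show ?thesis unfolding has_rotation_def by blast
qed

lemma linear_bounded_imp_le:
  assumes "\<And>n. real n * s \<le> K" shows "s \<le> 0"
proof (rule ccontr)
  assume "\<not> s \<le> 0"
  then obtain n where "K < real n * s" using reals_Archimedean3[of s] by auto
  then show False using assms[of n] by simp
qed

lemma funpow_mono_le:
  fixes f g :: "real \<Rightarrow> real"
  assumes "mono g" "\<And>x. f x \<le> g x" shows "(f ^^ n) x \<le> (g ^^ n) x"
  by (induction n) (auto intro: order_trans[OF assms(2) monoD[OF assms(1)]])

lemma has_rotation_mono:
  assumes "mono g" "\<And>x. f x \<le> g x" "has_rotation f r" "has_rotation g s"
  shows "r \<le> s"
proof -
  obtain K K' where K: "\<And>n x. \<bar>(f ^^ n) x - x - 2 * pi * r * real n\<bar> \<le> K"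
      "\<And>n x. \<bar>(g ^^ n) x - x - 2 * pi * s * real n\<bar> \<le> K'"
    using assms unfolding has_rotation_def by metis
  have "real n * (2 * pi * (r - s)) \<le> K + K'" for n
    using K(1)[of n 0] K(2)[of n 0] funpow_mono_le[of g f n 0] assms by (simp add: algebra_simps abs_le_iff)
  then have "2 * pi * (r - s) \<le> 0" by (rule linear_bounded_imp_le)
  then show ?thesis using pi_gt_zero by (auto simp: mult_le_0_iff)
qed

lemma has_rotation_funpow:
  assumes "has_rotation f r" shows "has_rotation (f ^^ q) (real q * r)"
proof -
  obtain K where K: "\<And>n x. \<bar>(f ^^ n) x - x - 2 * pi * r * real n\<bar> \<le> K"
    using assms unfolding has_rotation_def by metis
  have "\<bar>((f ^^ q) ^^ n) x - x - 2 * pi * (real q * r) * real n\<bar> \<le> K" for n x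
    using K[of "q * n" x] by (simp add: funpow_mult algebra_simps)
  then show ?thesis unfolding has_rotation_def by blast
qed

lemma has_rotation_translation: "has_rotation (\<lambda>x. x + t) (t / (2 * pi))"
proof -
  have "((\<lambda>x. x + t) ^^ n) x = x + real n * t" for n x
    by (induction n) (auto simp: algebra_simps)
  then show ?thesis unfolding has_rotation_def by (intro exI[of _ 0]) (auto simp: algebra_simps)
qed

lemma has_rotation_ge:
  assumes "degree_one f" "has_rotation f r" "\<And>x. x + t \<le> f x" shows "t \<le> 2 * pi * r"
proof -
  have "t / (2 * pi) \<le> r"
    by (rule has_rotation_mono[OF _ _ has_rotation_translation assms(2)])
      (use assms in \<open>auto simp: degree_one_def strict_mono_mono\<close>)
  then show ?thesis by (simp add: field_simps)
qed

lemma has_rotation_le: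
  assumes "degree_one f" "has_rotation f r" "\<And>x. f x \<le> x + t" shows "2 * pi * r \<le> t"
proof -
  have "r \<le> t / (2 * pi)"
    by (rule has_rotation_mono[OF _ _ assms(2) has_rotation_translation])
      (use assms in \<open>auto simp: mono_def\<close>)
  then show ?thesis by (simp add: field_simps)
qed

lemma has_rotation_tendsto:
  assumes "has_rotation f r" shows "(\<lambda>n. (f ^^ n) x / real n) \<longlonglongrightarrow> 2 * pi * r"
proof -
  obtain K where K: "\<And>n x. \<bar>(f ^^ n) x - x - 2 * pi * r * real n\<bar> \<le> K"
    using assms unfolding has_rotation_def by metis
  have "(\<lambda>n. (f ^^ n) x / real n - 2 * pi * r) \<longlonglongrightarrow> 0"
  proof (rule tendsto_rabs_zero_cancel, rule tendsto_sandwich[OF _ _ tendsto_const])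
    show "(\<lambda>n. (K + \<bar>x\<bar>) * (1 / real n)) \<longlonglongrightarrow> 0" by (rule tendsto_mult_right_zero[OF lim_1_over_n])
    show "\<forall>\<^sub>F n in sequentially. \<bar>(f ^^ n) x / real n - 2 * pi * r\<bar> \<le> (K + \<bar>x\<bar>) * (1 / real n)"
      using eventually_gt_at_top[of 0]
    proof eventually_elim
      case (elim n)
      have "(f ^^ n) x / real n - 2 * pi * r = ((f ^^ n) x - 2 * pi * r * real n) / real n"
        using elim by (simp add: field_simps)
      moreover have "\<bar>(f ^^ n) x - 2 * pi * r * real n\<bar> \<le> K + \<bar>x\<bar>" using K[of n x] by linarith
      ultimately show ?case using elim by (simp add: divide_right_mono)
    qed
  qed auto
  then show ?thesis by (simp add: LIM_zero_iff)
qed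

lemma periodic_point_rotation:
  assumes "degree_one f" "has_rotation f r" "(f ^^ q) x = x + 2 * pi * of_int p" "q > 0"
  shows "r = of_int p / real q"
proof -
  let ?F = "f ^^ q"
  have F: "degree_one ?F" by (rule degree_one_funpow[OF assms(1)])
  have "(?F ^^ n) x = x + 2 * pi * of_int (int n * p)" for n
  proof (induction n)
    case (Suc n)
    have "(?F ^^ Suc n) x = ?F (x + 2 * pi * of_int (int n * p))" using Suc by simp
    also have "\<dots> = ?F x + 2 * pi * of_int (int n * p)"
      using F by (intro shift_int) (auto simp: degree_one_def)
    finally show ?case using assms(3) by (simp add: algebra_simps)
  qed simp
  moreover have "(\<lambda>n. (?F ^^ n) x / real n) \<longlonglongrightarrow> 2 * pi * (real q * r)"
    by (rule has_rotation_tendsto[OF has_rotation_funpow[OF assms(2)]])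
  moreover have "(\<lambda>n. (x + 2 * pi * of_int (int n * p)) / real n) \<longlonglongrightarrow> 2 * pi * of_int p"
  proof -
    have "(\<lambda>n. x * (1 / real n) + 2 * pi * of_int p) \<longlonglongrightarrow> x * 0 + 2 * pi * of_int p"
      by (intro tendsto_intros lim_1_over_n)
    moreover have "\<forall>\<^sub>F n in sequentially. x * (1 / real n) + 2 * pi * of_int p = (x + 2 * pi * of_int (int n * p)) / real n"
      using eventually_gt_at_top[of 0] by eventually_elim (simp add: field_simps)
    ultimately show ?thesis using tendsto_cong by force
  qed
  ultimately have "2 * pi * (real q * r) = 2 * pi * of_int p" by (metis (no_types, lifting) ext LIMSEQ_unique)
  then show ?thesis using assms(4) by (simp add: field_simps)
qed

lemma periodic_attains_inf:
  fixes k :: "real \<Rightarrow> real"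
  assumes "continuous_on UNIV k" "\<And>x. k (x + T) = k x" "T > 0"
  obtains z where "\<And>x. k z \<le> k x"
proof -
  have "continuous_on {0..T} k" using assms(1) continuous_on_subset by blast
  then obtain z where z: "\<And>y. y \<in> {0..T} \<Longrightarrow> k z \<le> k y"
    using continuous_attains_inf[of "{0..T}" k] assms(3) by (metis atLeastatMost_empty_iff compact_Icc less_le_not_le)
  have "k z \<le> k x" for x
  proof -
    obtain j y where "x = y + T * of_int j" "0 \<le> y" "y < T" using reduce_mod_period[OF assms(3)] .
    then show ?thesis using z[of y] periodic_int[of k T y j] assms(2) by simp
  qed
  then show thesis using that by blast
qed

text \<open>A displacement of \<open>f ^^ q\<close> that never equals \<open>2 * pi * p\<close>
  stays on one side of it and, being continuous and periodic, at a positive distance; the rotation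
  number would then lie strictly on that side.\<close>

lemma rational_rotation_periodic_point:
  assumes f: "degree_one f" and r: "has_rotation f (of_int p / real q)" and q: "q > 0"
  shows "\<exists>x. (f ^^ q) x = x + 2 * pi * of_int p"
proof (rule ccontr)
  assume no: "\<nexists>x. (f ^^ q) x = x + 2 * pi * of_int p"
  let ?F = "f ^^ q"
  define k where "k x = ?F x - x - 2 * pi * of_int p" for x
  have F: "degree_one ?F" by (rule degree_one_funpow[OF f])
  have rF: "has_rotation ?F (of_int p)" using has_rotation_funpow[OF r, of q] q by simp
  have kc: "continuous_on UNIV k" unfolding k_def using F by (intro continuous_intros) (auto simp: degree_one_def)
  have kp: "k (x + 2 * pi) = k x" for x using F by (simp add: k_def degree_one_def)
  have k0: "k x \<noteq> 0" for x using no by (auto simp: k_def algebra_simps)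
  have sign: "(\<forall>x. 0 < k x) \<or> (\<forall>x. k x < 0)"
  proof (rule ccontr)
    assume "\<not> ?thesis"
    then obtain x y where xy: "k x < 0" "0 < k y" by (meson k0 linorder_neqE_linordered_idom)
    have "connected (range k)" using connected_continuous_image[OF kc] by simp
    then have "0 \<in> range k" using connectedD_interval[of "range k" "k x" "k y" 0] xy by auto
    then show False using k0 by auto
  qed
  then show False
  proof
    assume pos: "\<forall>x. 0 < k x"
    obtain z where z: "\<And>x. k z \<le> k x" using periodic_attains_inf[OF kc kp] by auto
    have "2 * pi * of_int p + k z \<le> 2 * pi * of_int p"
      by (rule has_rotation_ge[OF F rF]) (use z in \<open>auto simp: k_def algebra_simps\<close>)
    then show False using pos[rule_format, of z] by simp
  next
    assume neg: "\<forall>x. k x < 0"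
    obtain z where z: "\<And>x. - k z \<le> - k x"
      using periodic_attains_inf[of "\<lambda>x. - k x" "2 * pi"] kc kp by (auto intro: continuous_intros)
    have "2 * pi * of_int p \<le> 2 * pi * of_int p + k z"
      by (rule has_rotation_le[OF F rF]) (use z in \<open>auto simp: k_def algebra_simps\<close>)
    then show False using neg[rule_format, of z] by simp
  qed
qed

section \<open>Invariant graphs of the billiard in an oval\<close>

text \<open>\<open>h\<close> is a support function as a function of the normal angle,
  \<open>h1\<close> its derivative, and \<rho> = h + h'' the radius of curvature. Invariant graphs
  can be studied from these data alone.\<close>

locale oval =
  fixes h h1 \<rho> :: "real \<Rightarrow> real"
  assumes h_deriv: "(h has_real_derivative h1 x) (at x)"
    and h1_deriv: "(h1 has_real_derivative \<rho> x - h x) (at x)"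
    and rho_cont: "continuous_on UNIV \<rho>"
    and rho_pos: "0 < \<rho> x"
    and h_periodic: "h (x + 2 * pi) = h x"
begin

lemma h_cont: "continuous_on S h"
  using h_deriv by (meson DERIV_isCont continuous_at_imp_continuous_on)

lemma h1_cont: "continuous_on S h1"
  using h1_deriv by (meson DERIV_isCont continuous_at_imp_continuous_on)

lemma h_cont_o [continuous_intros]: "continuous_on S g \<Longrightarrow> continuous_on S (\<lambda>x. h (g x))"
  by (rule continuous_on_compose2[OF h_cont[of UNIV]]) auto

lemma h1_cont_o [continuous_intros]: "continuous_on S g \<Longrightarrow> continuous_on S (\<lambda>x. h1 (g x))"
  by (rule continuous_on_compose2[OF h1_cont[of UNIV]]) auto

lemma rho_cont_o [continuous_intros]: "continuous_on S g \<Longrightarrow> continuous_on S (\<lambda>x. \<rho> (g x))"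
  by (rule continuous_on_compose2[OF rho_cont]) auto

lemmas h_deriv_o [derivative_intros] = DERIV_chain2[OF h_deriv]
lemmas h1_deriv_o [derivative_intros] = DERIV_chain2[OF h1_deriv]

lemma h1_periodic: "h1 (x + 2 * pi) = h1 x"
proof -
  have "((\<lambda>x. h (x + 2 * pi)) has_real_derivative h1 (x + 2 * pi) * 1) (at x)"
    by (auto intro!: derivative_eq_intros)
  then have "(h has_real_derivative h1 (x + 2 * pi)) (at x)" by (simp add: h_periodic)
  then show ?thesis using DERIV_unique[OF _ h_deriv] by blast
qed

text \<open>The chord from the line with normal angle \<open>x\<close> to the line with normal angle \<open>y\<close> reflects at the point
  with normal angle \<open>(x + y) / 2\<close>, where the angle with the tangent is \<open>(y - x) / 2\<close>. The numbers
  \<open>p_in x y\<close> and \<open>p_out x y\<close> are the distances of the two lines from the origin, and \<open>action\<close> is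
  the generating function of the billiard map in these coordinates.\<close>

definition action :: "real \<Rightarrow> real \<Rightarrow> real" where
  "action x y = 2 * h ((x + y) / 2) * sin ((y - x) / 2)"

definition p_in :: "real \<Rightarrow> real \<Rightarrow> real" where
  "p_in x y = h ((x + y) / 2) * cos ((y - x) / 2) - h1 ((x + y) / 2) * sin ((y - x) / 2)"

definition p_out :: "real \<Rightarrow> real \<Rightarrow> real" where
  "p_out x y = h ((x + y) / 2) * cos ((y - x) / 2) + h1 ((x + y) / 2) * sin ((y - x) / 2)"

lemma action_deriv1: "((\<lambda>x. action x y) has_real_derivative - p_in x y) (at x)"
  unfolding action_def p_in_def by (auto intro!: derivative_eq_intros simp: field_simps)

lemma action_deriv2: "((\<lambda>y. action x y) has_real_derivative p_out x y) (at y)"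
  unfolding action_def p_out_def by (auto intro!: derivative_eq_intros simp: field_simps)

text \<open>The twist condition. Positive curvature makes the mixed derivative of
  \<open>action\<close> positive whenever the half difference lies strictly between 0 and \<pi>, so
  for a given \<open>x\<close> the distance \<open>p_in\<close> and the next normal angle determine
  each other.\<close>

lemma p_in_deriv2: "((\<lambda>y. p_in x y) has_real_derivative - (\<rho> ((x + y) / 2) * sin ((y - x) / 2) / 2)) (at y)"
  unfolding p_in_def by (auto intro!: derivative_eq_intros simp: field_simps)

lemma p_out_deriv1: "((\<lambda>x. p_out x y) has_real_derivative \<rho> ((x + y) / 2) * sin ((y - x) / 2) / 2) (at x)"
  unfolding p_out_def by (auto intro!: derivative_eq_intros simp: field_simps)

lemma p_in_cont [continuous_intros]:
  fixes S :: "'a::t2_space set"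
  shows "continuous_on S f \<Longrightarrow> continuous_on S g \<Longrightarrow> continuous_on S (\<lambda>z. p_in (f z) (g z))"
  unfolding p_in_def by (intro continuous_on_sin continuous_on_cos continuous_intros) auto

lemma p_out_cont [continuous_intros]:
  fixes S :: "'a::t2_space set"
  shows "continuous_on S f \<Longrightarrow> continuous_on S g \<Longrightarrow> continuous_on S (\<lambda>z. p_out (f z) (g z))"
  unfolding p_out_def by (intro continuous_on_sin continuous_on_cos continuous_intros) auto

lemma action_cont [continuous_intros]:
  fixes S :: "'a::t2_space set"
  shows "continuous_on S f \<Longrightarrow> continuous_on S g \<Longrightarrow> continuous_on S (\<lambda>z. action (f z) (g z))"
  unfolding action_def by (intro continuous_on_sin continuous_on_cos continuous_intros) auto

lemma shift_mid: "((x + 2 * pi) + (y + 2 * pi)) / 2 = (x + y) / 2 + 2 * pi" by simp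

lemma p_in_shift: "p_in (x + 2 * pi) (y + 2 * pi) = p_in x y"
  unfolding p_in_def shift_mid h_periodic h1_periodic by simp

lemma p_out_shift: "p_out (x + 2 * pi) (y + 2 * pi) = p_out x y"
  unfolding p_out_def shift_mid h_periodic h1_periodic by simp

lemma action_shift: "action (x + 2 * pi) (y + 2 * pi) = action x y"
  unfolding action_def shift_mid h_periodic h1_periodic by simp

lemma p_in_strict:
  assumes "x \<le> y" "y < y'" "y' \<le> x + 2 * pi" shows "p_in x y' < p_in x y"
proof (rule DERIV_neg_imp_decreasing_open[OF assms(2)])
  fix t assume t: "y < t" "t < y'"
  have "0 < sin ((t - x) / 2)" using t assms by (intro sin_gt_zero) auto
  then have "- (\<rho> ((x + t) / 2) * sin ((t - x) / 2) / 2) < 0" using rho_pos by simp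
  then show "\<exists>D. ((\<lambda>y. p_in x y) has_real_derivative D) (at t) \<and> D < 0"
    using p_in_deriv2 by blast
qed (intro continuous_intros)

lemma p_out_strict:
  assumes "y - 2 * pi \<le> x" "x < x'" "x' \<le> y" shows "p_out x y < p_out x' y"
proof (rule DERIV_pos_imp_increasing_open[OF assms(2)])
  fix t assume t: "x < t" "t < x'"
  have "0 < sin ((y - t) / 2)" using t assms by (intro sin_gt_zero) auto
  then have "\<rho> ((t + y) / 2) * sin ((y - t) / 2) / 2 > 0" using rho_pos by simp
  then show "\<exists>D. ((\<lambda>x. p_out x y) has_real_derivative D) (at t) \<and> D > 0"
    using p_out_deriv1 by blast
qed (intro continuous_intros)

lemma p_in_less_iff:
  assumes "x \<le> y" "y \<le> x + 2 * pi" "x \<le> y'" "y' \<le> x + 2 * pi"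
  shows "p_in x y < p_in x y' \<longleftrightarrow> y' < y"
  using p_in_strict[of x y y'] p_in_strict[of x y' y] assms by (cases y y' rule: linorder_cases) auto

lemma p_out_less_iff:
  assumes "y - 2 * pi \<le> x" "x \<le> y" "y - 2 * pi \<le> x'" "x' \<le> y"
  shows "p_out x y < p_out x' y \<longleftrightarrow> x < x'"
  using p_out_strict[of y x x'] p_out_strict[of y x' x] assms by (cases x x' rule: linorder_cases) auto

text \<open>An implicit function argument by monotonicity: \<open>p_in x\<close> strictly decreases
  in its second argument, so a bound on \<open>f x\<close> is a strict inequality between continuous
  functions of \<open>x\<close>. As \<open>P\<close> is only continuous, nothing could be
  differentiated here.\<close>

lemma chord_map_cont:
  assumes "continuous_on UNIV P" "\<And>x. x < f x" "\<And>x. f x < x + 2 * pi" "\<And>x. p_in x (f x) = P x"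
  shows "continuous_on S f"
proof -
  have below_f_iff: "x \<le> y \<Longrightarrow> y \<le> x + 2 * pi \<Longrightarrow> P x < p_in x y \<longleftrightarrow> y < f x" for x y
    using p_in_less_iff[of x "f x" y] assms(2-4)[of x] by auto
  have above_f_iff: "x \<le> y \<Longrightarrow> y \<le> x + 2 * pi \<Longrightarrow> p_in x y < P x \<longleftrightarrow> f x < y" for x y
    using p_in_less_iff[of x y "f x"] assms(2-4)[of x] by auto
  show ?thesis
proof (intro continuous_at_imp_continuous_on ballI)
  fix x :: real
  have P: "isCont P x" using assms(1) continuous_on_eq_continuous_at[of UNIV] by auto
  have pin: "isCont (\<lambda>z. p_in z y) x" for y
    by (rule continuous_on_interior[of UNIV]) (auto intro!: continuous_intros)
  show "isCont f x" unfolding isCont_def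
  proof (rule order_tendstoI)
    fix l assume "l < f x"
    define l' where "l' = max l ((x + f x) / 2)"
    have l': "x < l'" "l' < f x" "l' < x + 2 * pi" "l \<le> l'" using \<open>l < f x\<close> assms(2,3)[of x] by (auto simp: l'_def max_def)
    then have "P x < p_in x l'" using below_f_iff by simp
    then have "\<forall>\<^sub>F z in at x. 0 < p_in z l' - P z"
      using P pin[of l'] by (intro order_tendstoD(1)[where y = "p_in x l' - P x"]) (auto simp: isCont_def intro!: tendsto_diff)
    moreover have "\<forall>\<^sub>F z in at x. z < l'" using l' by (intro order_tendstoD(2)[OF tendsto_ident_at]) auto
    moreover have "\<forall>\<^sub>F z in at x. l' - 2 * pi < z" using l' by (intro order_tendstoD(1)[OF tendsto_ident_at]) auto
    ultimately show "\<forall>\<^sub>F z in at x. l < f z"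
      by eventually_elim (use l' below_f_iff in force)
  next
    fix l assume "f x < l"
    define l' where "l' = min l ((x + 2 * pi + f x) / 2)"
    have l': "x < l'" "f x < l'" "l' < x + 2 * pi" "l' \<le> l"
      using \<open>f x < l\<close> assms(2,3)[of x] unfolding l'_def by (auto simp: min_def)
    then have "p_in x l' < P x" using above_f_iff by simp
    then have "\<forall>\<^sub>F z in at x. 0 < P z - p_in z l'"
      using P pin[of l'] by (intro order_tendstoD(1)[where y = "P x - p_in x l'"]) (auto simp: isCont_def intro!: tendsto_diff)
    moreover have "\<forall>\<^sub>F z in at x. z < l'" using l' by (intro order_tendstoD(2)[OF tendsto_ident_at]) auto
    moreover have "\<forall>\<^sub>F z in at x. l' - 2 * pi < z" using l' by (intro order_tendstoD(1)[OF tendsto_ident_at]) auto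
    ultimately show "\<forall>\<^sub>F z in at x. f z < l"
      by eventually_elim (use l' above_f_iff in force)
  qed
qed
qed

text \<open>The graph of \<open>P\<close>, a curve of lines, is invariant under the billiard map, which acts on the normal
  angles by \<open>f\<close>.\<close>

definition invariant_graph :: "(real \<Rightarrow> real) \<Rightarrow> (real \<Rightarrow> real) \<Rightarrow> bool" where
  "invariant_graph P f \<longleftrightarrow> continuous_on UNIV P \<and> (\<forall>x. P (x + 2 * pi) = P x) \<and>
     (\<forall>x. x < f x \<and> f x < x + 2 * pi \<and> p_in x (f x) = P x \<and> p_out x (f x) = P (f x))"

lemma invariant_graphD:
  assumes "invariant_graph P f"
  shows "continuous_on S P" "P (x + 2 * pi) = P x" "x < f x" "f x < x + 2 * pi"
    "p_in x (f x) = P x" "p_out x (f x) = P (f x)"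
  using assms continuous_on_subset unfolding invariant_graph_def by auto

context
  fixes P f assumes ig: "invariant_graph P f"
begin

lemmas igD = invariant_graphD[OF ig]

lemma below_f_iff: "x \<le> y \<Longrightarrow> y \<le> x + 2 * pi \<Longrightarrow> P x < p_in x y \<longleftrightarrow> y < f x"
  using p_in_less_iff[of x "f x" y] igD(2-6)[of x] by auto

lemma above_f_iff: "x \<le> y \<Longrightarrow> y \<le> x + 2 * pi \<Longrightarrow> p_in x y < P x \<longleftrightarrow> f x < y"
  using p_in_less_iff[of x y "f x"] igD(2-6)[of x] by auto

lemma eq_f_iff: "x \<le> y \<Longrightarrow> y \<le> x + 2 * pi \<Longrightarrow> p_in x y = P x \<longleftrightarrow> y = f x"
  using below_f_iff[of x y] above_f_iff[of x y] by linarith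

lemma f_shift: "f (x + 2 * pi) = f x + 2 * pi"
proof -
  have "p_in (x + 2 * pi) (f x + 2 * pi) = P (x + 2 * pi)" using igD(2-6)[of x] by (simp add: p_in_shift)
  then show ?thesis using igD(2-6)[of x] igD(2-6)[of "x + 2 * pi"]
      eq_f_iff[of "x + 2 * pi" "f x + 2 * pi"] by simp
qed

lemma f_cont: "continuous_on S f"
  by (rule chord_map_cont[where P = P]) (use igD in auto)

lemma inj_f: "inj f"
proof (rule injI)
  fix x x' assume e: "f x = f x'"
  have "p_out x (f x) = p_out x' (f x)" using igD(6)[of x] igD(6)[of x'] e by simp
  then show "x = x'"
    using p_out_strict[of "f x" x x'] p_out_strict[of "f x" x' x] igD(3,4)[of x] igD(3,4)[of x'] e by argo
qed

text \<open>A continuous injection of the line is monotone; comparing \<open>x\<close> with a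
  translate by full turns beyond \<open>x'\<close> excludes the decreasing case.\<close>

lemma strict_mono_f: "strict_mono f"
proof (rule strict_monoI)
  fix x x' :: real assume "x < x'"
  obtain k :: nat where k: "(x' - x) < real k * (2 * pi)" using reals_Archimedean3[of "2 * pi"] by auto
  define z where "z = x + 2 * pi * of_int (int k)"
  have z: "f z = f x + 2 * pi * of_int (int k)" unfolding z_def by (rule shift_int[of f, OF f_shift])
  have "x' < z" using k by (simp add: z_def algebra_simps)
  have "f x < f z" using z k \<open>x < x'\<close> by (simp add: algebra_simps)
  then show "f x < f x'"
    using continuous_inj_imp_mono[OF \<open>x < x'\<close> \<open>x' < z\<close> f_cont inj_on_subset[OF inj_f subset_UNIV]] by argo
qed

lemma degree_one_f: "degree_one f"
  unfolding degree_one_def using strict_mono_f f_cont f_shift by blast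

lemma f_less_iff: "f x < f y \<longleftrightarrow> x < y"
  using strict_mono_f strict_mono_less by blast

lemma surj_f: obtains x where "f x = y" "x < y" "y < x + 2 * pi"
proof -
  have "\<exists>x. y - 2 * pi \<le> x \<and> x \<le> y \<and> f x = y"
    using igD(3,4)[of y] igD(3,4)[of "y - 2 * pi"] f_cont by (intro IVT') auto
  then show thesis using that igD(3,4) by blast
qed

text \<open>The order of chords seen from their outgoing line: the graph point over \<open>y\<close>
  comes from the preimage \<open>w\<close> of \<open>y\<close>, and \<open>p_out\<close> increases
  with the tail of the chord, so comparing with the graph means comparing \<open>x\<close> with
  \<open>w\<close>.\<close>

lemma head_below_iff:
  assumes "x \<le> y" "y \<le> x + 2 * pi" shows "P y < p_out x y \<longleftrightarrow> y < f x"
proof -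
  obtain w where w: "f w = y" "w < y" "y < w + 2 * pi" by (rule surj_f)
  have "P y = p_out w y" using igD(6)[of w] w by simp
  then have "P y < p_out x y \<longleftrightarrow> w < x" using p_out_less_iff[of y w x] w assms by auto
  then show ?thesis using f_less_iff w by blast
qed

lemma head_above_iff:
  assumes "x \<le> y" "y \<le> x + 2 * pi" shows "p_out x y < P y \<longleftrightarrow> f x < y"
proof -
  obtain w where w: "f w = y" "w < y" "y < w + 2 * pi" by (rule surj_f)
  have "P y = p_out w y" using igD(6)[of w] w by simp
  then have "p_out x y < P y \<longleftrightarrow> x < w" using p_out_less_iff[of y x w] w assms by auto
  then show ?thesis using f_less_iff w by blast
qed

end

section \<open>Potentials and calibration\<close>

definition potential :: "(real \<Rightarrow> real) \<Rightarrow> real \<Rightarrow> real" where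
  "potential P = (SOME u. \<forall>x. (u has_real_derivative P x) (at x))"

lemma potential_deriv:
  assumes "continuous_on UNIV P" shows "(potential P has_real_derivative P x) (at x)"
proof -
  have "\<exists>u. \<forall>x. - \<infinity> < ereal x \<longrightarrow> ereal x < \<infinity> \<longrightarrow> (u has_vector_derivative P x) (at x)"
    using assms by (intro einterval_antiderivative) (auto simp: continuous_on_eq_continuous_at)
  then have "\<exists>u. \<forall>x. (u has_real_derivative P x) (at x)"
    by (simp add: has_real_derivative_iff_has_vector_derivative)
  then have "\<forall>x. (potential P has_real_derivative P x) (at x)" unfolding potential_def by (rule someI_ex)
  then show ?thesis by blast
qed

text \<open>The calibration of weak KAM theory. Subtracting the increment of the potential makes the
  chords belonging to the graph maximal among all chords; \<open>crit\<close> is their common value,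
  and \<open>flux\<close>, the integral of the graph over a turn, is its cohomology class.\<close>

definition gauged_action :: "(real \<Rightarrow> real) \<Rightarrow> real \<Rightarrow> real \<Rightarrow> real" where
  "gauged_action P x y = action x y - (potential P y - potential P x)"

definition crit :: "(real \<Rightarrow> real) \<Rightarrow> (real \<Rightarrow> real) \<Rightarrow> real" where
  "crit P f = gauged_action P 0 (f 0)"

definition flux :: "(real \<Rightarrow> real) \<Rightarrow> real" where
  "flux P = potential P (2 * pi) - potential P 0"

context
  fixes P f assumes ig: "invariant_graph P f"
begin

lemmas u_deriv = potential_deriv[OF invariant_graphD(1)[OF ig]]

lemma u_cont: "continuous_on S (potential P)"
  using u_deriv by (meson DERIV_isCont continuous_at_imp_continuous_on)

lemma u_cont_o: "continuous_on S g \<Longrightarrow> continuous_on S (\<lambda>x. potential P (g x))"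
  by (rule continuous_on_compose2[OF u_cont[of UNIV]]) auto

lemma u_shift: "potential P (x + 2 * pi) = potential P x + flux P"
proof -
  have "((\<lambda>x. potential P (x + 2 * pi) - potential P x) has_real_derivative P (x + 2 * pi) * 1 - P x) (at x)" for x
    by (auto intro!: derivative_eq_intros DERIV_chain2[OF u_deriv])
  then have "((\<lambda>x. potential P (x + 2 * pi) - potential P x) has_real_derivative 0) (at x)" for x
    using invariant_graphD(2)[OF ig] by simp
  then have "potential P (x + 2 * pi) - potential P x = potential P (0 + 2 * pi) - potential P 0"
    using DERIV_isconst_all by blast
  then show ?thesis by (simp add: flux_def)
qed

lemma gauged_deriv1: "((\<lambda>x. gauged_action P x y) has_real_derivative P x - p_in x y) (at x)"
  unfolding gauged_action_def by (rule derivative_eq_intros action_deriv1 u_deriv refl)+ simp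

lemma gauged_deriv2: "((\<lambda>y. gauged_action P x y) has_real_derivative p_out x y - P y) (at y)"
  unfolding gauged_action_def by (rule derivative_eq_intros action_deriv2 u_deriv refl)+ simp

lemma gauged_cont [continuous_intros]:
  fixes S :: "'a::t2_space set"
  shows "continuous_on S k \<Longrightarrow> continuous_on S g \<Longrightarrow> continuous_on S (\<lambda>z. gauged_action P (k z) (g z))"
  unfolding gauged_action_def by (intro continuous_intros u_cont_o)

text \<open>The derivative in the second variable is \<open>p_out x y - P y\<close>, which is
  positive before \<open>f x\<close> and negative after it.\<close>

lemma gauged_less_max:
  assumes "x \<le> y" "y \<le> x + 2 * pi" "y \<noteq> f x"
  shows "gauged_action P x y < gauged_action P x (f x)"
proof (cases "y < f x")
  case True
  show ?thesis
  proof (rule DERIV_pos_imp_increasing_open[OF True])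
    fix t assume "y < t" "t < f x"
    then have "0 < p_out x t - P t" using head_below_iff[OF ig, of x t] assms invariant_graphD(4)[OF ig, of x] by simp
    then show "\<exists>D. ((\<lambda>y. gauged_action P x y) has_real_derivative D) (at t) \<and> D > 0"
      using gauged_deriv2 by blast
  qed (intro continuous_intros)
next
  case False
  then have l: "f x < y" using assms by simp
  show ?thesis
  proof (rule DERIV_neg_imp_decreasing_open[OF l])
    fix t assume "f x < t" "t < y"
    then have "p_out x t - P t < 0" using head_above_iff[OF ig, of x t] assms invariant_graphD(3)[OF ig, of x] by simp
    then show "\<exists>D. ((\<lambda>y. gauged_action P x y) has_real_derivative D) (at t) \<and> D < 0"
      using gauged_deriv2 by blast
  qed (intro continuous_intros)
qed

lemma gauged_le_max:
  assumes "x \<le> y" "y \<le> x + 2 * pi"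
  shows "gauged_action P x y \<le> gauged_action P x (f x)"
  using gauged_less_max[OF assms] by fastforce

text \<open>By maximality in the second variable, the increments of \<open>\<lambda>x. gauged_action P x (f x)\<close> are squeezed
  between increments in the first variable alone, where the derivative vanishes on the graph.\<close>

lemma gauged_graph: "gauged_action P x (f x) = crit P f"
proof -
  define m where "m x = gauged_action P x (f x)" for x
  have "(m has_real_derivative 0) (at x)" for x
  proof -
    have "\<forall>\<^sub>F z in at x. \<bar>(m z - m x) / (z - x)\<bar> \<le> e" if e: "e > 0" for e
    proof -
      define k where "k w = P (fst w) - p_in (fst w) (snd w)" for w
      have "continuous_on UNIV k" unfolding k_def
        by (intro continuous_intros continuous_on_compose2[OF invariant_graphD(1)[OF ig, of UNIV]]) auto
      then have "isCont k (x, f x)" by (simp add: continuous_on_eq_continuous_at)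
      moreover have "k (x, f x) = 0" using invariant_graphD(5)[OF ig] by (simp add: k_def)
      ultimately obtain d where d: "d > 0" "\<And>w. dist w (x, f x) < d \<Longrightarrow> \<bar>k w\<bar> < e"
        using e unfolding continuous_at_eps_delta by (metis dist_0_norm dist_commute real_norm_def)
      have fc: "isCont f x" using f_cont[OF ig, of UNIV] by (simp add: continuous_on_eq_continuous_at)
      have "\<forall>\<^sub>F z in at x. dist z x < d / 2" using d by (intro tendstoD tendsto_ident_at) simp
      moreover have "\<forall>\<^sub>F z in at x. dist (f z) (f x) < d / 2" using fc d by (intro tendstoD) (auto simp: isCont_def)
      moreover have "\<forall>\<^sub>F z in at x. z < f x"
        using invariant_graphD(3)[OF ig, of x] by (intro order_tendstoD(2)[OF tendsto_ident_at])
      moreover have "\<forall>\<^sub>F z in at x. f x - 2 * pi < z"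
        using invariant_graphD(4)[OF ig, of x] by (intro order_tendstoD(1)[OF tendsto_ident_at]) simp
      moreover have "\<forall>\<^sub>F z in at x. x < f z"
        using invariant_graphD(3)[OF ig, of x] fc by (intro order_tendstoD(1)[of f]) (auto simp: isCont_def)
      moreover have "\<forall>\<^sub>F z in at x. f z < x + 2 * pi"
        using invariant_graphD(4)[OF ig, of x] fc by (intro order_tendstoD(2)[of f]) (auto simp: isCont_def)
      moreover have "\<forall>\<^sub>F z in at x. z \<noteq> x" by (simp add: eventually_at_filter)
      ultimately show ?thesis
      proof eventually_elim
        case (elim z)
        have incr: "\<bar>gauged_action P z y - gauged_action P x y\<bar> \<le> e * \<bar>z - x\<bar>" if y: "dist y (f x) < d / 2" for y
        proof -
          have "norm (gauged_action P z y - gauged_action P x y) \<le> e * norm (z - x)"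
          proof (rule field_differentiable_bound[where S = "closed_segment x z" and f' = "\<lambda>t. P t - p_in t y"])
            fix t assume t: "t \<in> closed_segment x z"
            show "((\<lambda>x. gauged_action P x y) has_real_derivative P t - p_in t y) (at t within closed_segment x z)"
              using gauged_deriv1 by (rule has_field_derivative_at_within)
            have "dist (t, y) (x, f x) \<le> dist t x + dist y (f x)"
              by (simp add: dist_Pair_Pair sqrt_sum_squares_le_sum)
            also have "dist t x \<le> dist z x" using dist_in_closed_segment[OF t] by (metis dist_commute)
            finally have "dist (t, y) (x, f x) < d" using y elim by simp
            then show "norm (P t - p_in t y) \<le> e" using d(2)[of "(t, y)"] by (simp add: k_def)
          qed auto
          then show ?thesis by simp
        qed
        have "m z - m x \<le> gauged_action P z (f z) - gauged_action P x (f z)"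
          unfolding m_def using gauged_le_max[of x "f z"] elim by simp
        also have "\<dots> \<le> e * \<bar>z - x\<bar>" using incr[of "f z"] elim by linarith
        finally have 1: "m z - m x \<le> e * \<bar>z - x\<bar>" .
        have "m x - m z \<le> gauged_action P x (f x) - gauged_action P z (f x)"
          unfolding m_def using gauged_le_max[of z "f x"] elim by simp
        also have "\<dots> \<le> e * \<bar>z - x\<bar>" using incr[of "f x"] d by (simp add: abs_le_iff)
        finally have "\<bar>m z - m x\<bar> \<le> e * \<bar>z - x\<bar>" using 1 by linarith
        then show ?case using elim by (simp add: divide_le_eq)
      qed
    qed
    note bound = this
    have "((\<lambda>z. (m z - m x) / (z - x)) \<longlongrightarrow> 0) (at x)"
    proof (rule tendstoI)
      fix e :: real assume "e > 0"
      then have "\<forall>\<^sub>F z in at x. \<bar>(m z - m x) / (z - x)\<bar> \<le> e / 2" using bound[of "e / 2"] by (simp only: half_gt_zero)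
      then show "\<forall>\<^sub>F z in at x. dist ((m z - m x) / (z - x)) 0 < e"
      proof eventually_elim
        case (elim z)
        then show ?case unfolding dist_real_def diff_zero using \<open>e > 0\<close> by argo
      qed
    qed
    then show ?thesis by (simp add: has_field_derivative_iff)
  qed
  then have "m x = m 0" using DERIV_isconst_all by blast
  then show ?thesis by (simp add: m_def crit_def)
qed

lemma gauged_le: "x \<le> y \<Longrightarrow> y \<le> x + 2 * pi \<Longrightarrow> gauged_action P x y \<le> crit P f"
  using gauged_le_max gauged_graph by metis

lemma gauged_eq_iff: "x \<le> y \<Longrightarrow> y \<le> x + 2 * pi \<Longrightarrow> gauged_action P x y = crit P f \<longleftrightarrow> y = f x"
  using gauged_less_max gauged_graph by (metis less_irrefl)

end

end

lemma periodic_attains_bounds: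
  fixes k :: "real \<Rightarrow> real"
  assumes "continuous_on UNIV k" "\<And>x. k (x + 2 * pi) = k x"
  shows "\<exists>z. \<forall>x. k z \<le> k x" "\<exists>z. \<forall>x. k x \<le> k z"
proof -
  have p: "0 < 2 * pi" by simp
  show "\<exists>z. \<forall>x. k z \<le> k x"
    using periodic_attains_inf[OF assms p, of "\<exists>z. \<forall>x. k z \<le> k x"] by blast
  have c: "continuous_on UNIV (\<lambda>x. - k x)" by (intro continuous_intros assms)
  show "\<exists>z. \<forall>x. k x \<le> k z"
    using periodic_attains_inf[of "\<lambda>x. - k x", OF c _ p, of "\<exists>z. \<forall>x. k x \<le> k z"] assms(2) by (simp only: neg_le_iff_le) blast
qed

section \<open>Comparing two invariant graphs\<close>

context oval
begin

text \<open>Invariant graphs with the same rotation number are compared through the sums of the deficits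
  \<open>crit P f - gauged_action P x (f' x)\<close> along the orbits of \<open>f'\<close>: the terms are nonnegative, vanish only
  where \<open>f x = f' x\<close>, and telescope.\<close>

lemma deficit_eq:
  assumes "invariant_graph P f" "invariant_graph P' f'"
  shows "crit P f - gauged_action P x (f' x)
    = (crit P f - crit P' f') - ((potential P' (f' x) - potential P (f' x)) - (potential P' x - potential P x))"
  using gauged_graph[OF assms(2), of x] by (simp add: gauged_action_def)

lemma deficit_sum:
  assumes "invariant_graph P f" "invariant_graph P' f'"
  shows "(\<Sum>i<n. crit P f - gauged_action P ((f' ^^ i) x) (f' ((f' ^^ i) x)))
    = real n * (crit P f - crit P' f')
      - ((potential P' ((f' ^^ n) x) - potential P ((f' ^^ n) x)) - (potential P' x - potential P x))"
  by (induction n) (auto simp: deficit_eq[OF assms] algebra_simps)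

lemma deficit_nonneg:
  assumes "invariant_graph P f" "invariant_graph P' f'"
  shows "0 \<le> crit P f - gauged_action P x (f' x)"
  using gauged_le[OF assms(1), of x "f' x"] invariant_graphD(3,4)[OF assms(2), of x] by simp

lemma potential_affine_bound:
  assumes "invariant_graph P f"
  shows "\<exists>K. \<forall>x y. \<bar>potential P y - potential P x - flux P / (2 * pi) * (y - x)\<bar> \<le> K"
proof -
  define k where "k x = potential P x - flux P / (2 * pi) * x" for x
  have kc: "continuous_on UNIV k" unfolding k_def by (intro continuous_intros u_cont[OF assms])
  have kp: "k (x + 2 * pi) = k x" for x by (simp add: k_def u_shift[OF assms] distrib_left)
  obtain z where z: "\<And>x. k z \<le> k x" using periodic_attains_bounds(1)[OF kc kp] by blast
  obtain w where w: "\<And>x. k x \<le> k w" using periodic_attains_bounds(2)[OF kc kp] by blast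
  have "\<bar>potential P y - potential P x - flux P / (2 * pi) * (y - x)\<bar> \<le> k w - k z" for x y
  proof -
    have "potential P y - potential P x - flux P / (2 * pi) * (y - x) = k y - k x"
      by (simp add: k_def right_diff_distrib)
    then show ?thesis using z[of x] z[of y] w[of x] w[of y] by linarith
  qed
  then show ?thesis by blast
qed

text \<open>Up to a bounded error a potential is linear with slope \<open>flux / (2 * pi)\<close>,
  and orbits of \<open>f'\<close> advance by \<open>2 * pi * r\<close> per step, so the telescoped
  sum is linear in \<open>n\<close> up to a bounded error.\<close>

lemma deficit_sum_approx:
  assumes ig: "invariant_graph P f" and ig': "invariant_graph P' f'" and rot: "has_rotation f' r"
  shows "\<exists>K. \<forall>n x. \<bar>(\<Sum>i<n. crit P f - gauged_action P ((f' ^^ i) x) (f' ((f' ^^ i) x)))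
    - real n * ((crit P f + r * flux P) - (crit P' f' + r * flux P'))\<bar> \<le> K"
proof -
  obtain K where K: "\<And>x y. \<bar>potential P y - potential P x - flux P / (2 * pi) * (y - x)\<bar> \<le> K"
    using potential_affine_bound[OF ig] by blast
  obtain K' where K': "\<And>x y. \<bar>potential P' y - potential P' x - flux P' / (2 * pi) * (y - x)\<bar> \<le> K'"
    using potential_affine_bound[OF ig'] by blast
  obtain R where R: "\<And>n x. \<bar>(f' ^^ n) x - x - 2 * pi * r * real n\<bar> \<le> R"
    using rot unfolding has_rotation_def by blast
  define \<Delta> where "\<Delta> = flux P' - flux P"
  have "\<bar>(\<Sum>i<n. crit P f - gauged_action P ((f' ^^ i) x) (f' ((f' ^^ i) x)))
    - real n * ((crit P f + r * flux P) - (crit P' f' + r * flux P'))\<bar> \<le> K + K' + \<bar>\<Delta>\<bar> / (2 * pi) * R" for n x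
  proof -
    let ?y = "(f' ^^ n) x"
    define A where "A = potential P ?y - potential P x - flux P / (2 * pi) * (?y - x)"
    define B where "B = potential P' ?y - potential P' x - flux P' / (2 * pi) * (?y - x)"
    define C where "C = \<Delta> / (2 * pi) * (?y - x - 2 * pi * r * real n)"
    have "(\<Sum>i<n. crit P f - gauged_action P ((f' ^^ i) x) (f' ((f' ^^ i) x)))
      - real n * ((crit P f + r * flux P) - (crit P' f' + r * flux P')) = A - B - C"
      unfolding deficit_sum[OF ig ig'] A_def B_def C_def \<Delta>_def by (simp add: field_simps)
    moreover have "\<bar>A\<bar> \<le> K" "\<bar>B\<bar> \<le> K'" using K K' by (auto simp: A_def B_def)
    moreover have "\<bar>C\<bar> = \<bar>\<Delta>\<bar> / (2 * pi) * \<bar>?y - x - 2 * pi * r * real n\<bar>"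
      by (simp add: C_def abs_mult)
    moreover have "\<dots> \<le> \<bar>\<Delta>\<bar> / (2 * pi) * R" using R[of n x] by (intro mult_left_mono) auto
    ultimately show ?thesis by linarith
  qed
  then show ?thesis by blast
qed

text \<open>On the left stands the mean action of the orbits of \<open>f'\<close>. Calibration by
  any other graph bounds the mean action of orbits with rotation number \<open>r\<close> by its own
  value of \<open>crit + r * flux\<close>. For two graphs of equal rotation number the values
  therefore agree (Mather's mean action function).\<close>

lemma crit_flux_le:
  assumes ig: "invariant_graph P f" and ig': "invariant_graph P' f'" and rot: "has_rotation f' r"
  shows "crit P' f' + r * flux P' \<le> crit P f + r * flux P"
proof -
  obtain K where K: "\<And>n x. \<bar>(\<Sum>i<n. crit P f - gauged_action P ((f' ^^ i) x) (f' ((f' ^^ i) x)))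
    - real n * ((crit P f + r * flux P) - (crit P' f' + r * flux P'))\<bar> \<le> K"
    using deficit_sum_approx[OF assms] by blast
  have "real n * ((crit P' f' + r * flux P') - (crit P f + r * flux P)) \<le> K" for n
  proof -
    have "0 \<le> (\<Sum>i<n. crit P f - gauged_action P ((f' ^^ i) 0) (f' ((f' ^^ i) 0)))"
      by (intro sum_nonneg deficit_nonneg[OF ig ig'])
    then show ?thesis using K[where n = n and x = 0] by (simp add: abs_le_iff algebra_simps)
  qed
  then show ?thesis using linear_bounded_imp_le by fastforce
qed

lemma crit_flux_eq:
  assumes "invariant_graph P f" "invariant_graph P' f'" "has_rotation f r" "has_rotation f' r"
  shows "crit P' f' + r * flux P' = crit P f + r * flux P"
  using crit_flux_le assms by (meson antisym)

section \<open>The order of invariant graphs\<close>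

lemma graph_less_imp_map_less:
  assumes "invariant_graph P f" "invariant_graph P' f'" "P x < P' x" shows "f' x < f x"
  using below_f_iff[OF assms(1), of x "f' x"] invariant_graphD(3-5)[OF assms(2), of x] assms(3) by simp

lemma graph_eq_iff_map_eq:
  assumes "invariant_graph P f" "invariant_graph P' f'" shows "P x = P' x \<longleftrightarrow> f x = f' x"
  using eq_f_iff[OF assms(2), of x "f x"] invariant_graphD(3-5)[OF assms(1), of x]
    invariant_graphD(5)[OF assms(2), of x] by auto

lemma graph_eq_step:
  assumes "invariant_graph P f" "invariant_graph P' f'" "P x = P' x"
  shows "f x = f' x" "P (f x) = P' (f x)"
proof -
  show f: "f x = f' x" using graph_eq_iff_map_eq[OF assms(1,2)] assms(3) by blast
  show "P (f x) = P' (f x)"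
    using invariant_graphD(6)[OF assms(1), of x] invariant_graphD(6)[OF assms(2), of x] f by simp
qed

lemma graph_eq_step_back:
  assumes "invariant_graph P f" "invariant_graph P' f'" "P (f x) = P' (f x)" shows "P x = P' x"
proof -
  have b: "x \<le> f x" "f x \<le> x + 2 * pi" using invariant_graphD(3,4)[OF assms(1), of x] by simp_all
  have "p_out x (f x) = P' (f x)" using invariant_graphD(6)[OF assms(1), of x] assms(3) by simp
  then have "f x = f' x" using head_below_iff[OF assms(2) b] head_above_iff[OF assms(2) b] by linarith
  then show ?thesis using graph_eq_iff_map_eq[OF assms(1,2)] by blast
qed

lemma graph_eq_orbit:
  assumes "invariant_graph P f" "invariant_graph P' f'" "P x = P' x"
  shows "(f ^^ n) x = (f' ^^ n) x \<and> P ((f ^^ n) x) = P' ((f ^^ n) x)"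
proof (induction n)
  case (Suc n)
  then have "(f' ^^ n) x = (f ^^ n) x" "P ((f ^^ n) x) = P' ((f ^^ n) x)" by metis+
  then show ?case using graph_eq_step[OF assms(1,2), of "(f ^^ n) x"] by simp
qed (use assms in simp)

lemma graph_eq_imp_rotation_eq:
  assumes "invariant_graph P f" "invariant_graph P' f'" "P x = P' x" "has_rotation f r" "has_rotation f' r'"
  shows "r = r'"
proof -
  have "(\<lambda>n. (f ^^ n) x / real n) \<longlonglongrightarrow> 2 * pi * r'"
    using has_rotation_tendsto[OF assms(5), of x] graph_eq_orbit[OF assms(1-3)] by simp
  then show ?thesis using has_rotation_tendsto[OF assms(4), of x] LIMSEQ_unique by fastforce
qed

lemma graph_less_trichotomy:
  assumes "invariant_graph P f" "invariant_graph P' f'" "\<And>x. P x \<noteq> P' x"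
  shows "(\<forall>x. P x < P' x) \<or> (\<forall>x. P' x < P x)"
proof (rule ccontr)
  assume "\<not> ?thesis"
  then obtain x y where xy: "P x - P' x < 0" "0 < P y - P' y" by (metis assms(3) diff_gt_0_iff_gt diff_less_0_iff_less linorder_neqE)
  have "connected (range (\<lambda>x. P x - P' x))"
    by (intro connected_continuous_image continuous_intros invariant_graphD(1)[OF assms(1)] invariant_graphD(1)[OF assms(2)]) auto
  then have "0 \<in> range (\<lambda>x. P x - P' x)" using connectedD_interval[of "range (\<lambda>x. P x - P' x)" "P x - P' x" "P y - P' y" 0] xy by auto
  then show False using assms(3) by auto
qed

text \<open>The higher graph consists of lines nearer to the boundary, which advance less at each
  reflection.\<close>

lemma graph_le_imp_rotation_le:
  assumes "invariant_graph P f" "invariant_graph P' f'" "\<And>x. P x \<le> P' x" "has_rotation f r" "has_rotation f' r'"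
  shows "r' \<le> r"
proof (rule has_rotation_mono[OF _ _ assms(5,4)])
  show "mono f" using strict_mono_f[OF assms(1)] strict_mono_mono by blast
  show "f' x \<le> f x" for x
    using graph_less_imp_map_less[OF assms(1,2), of x] graph_eq_iff_map_eq[OF assms(1,2), of x] assms(3)[of x] by fastforce
qed

text \<open>A common point has a common orbit, so graphs with different rotation numbers are
  disjoint and hence ordered; the other order would contradict the monotonicity of the rotation
  number.\<close>

lemma smaller_rotation_above:
  assumes "invariant_graph P f" "invariant_graph P' f'" "has_rotation f r" "has_rotation f' r'" "r < r'"
  shows "P' x < P x"
proof -
  have ne: "P x \<noteq> P' x" for x using graph_eq_imp_rotation_eq[OF assms(1,2) _ assms(3,4)] assms(5) by blast
  have "\<not> (\<forall>x. P x < P' x)"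
    using graph_le_imp_rotation_le[OF assms(1,2) _ assms(3,4)] assms(5) by (meson less_imp_le not_le)
  then show ?thesis using graph_less_trichotomy[OF assms(1,2) ne] by blast
qed

lemma potential_shift_int:
  assumes "invariant_graph P f"
  shows "potential P (x + 2 * pi * of_int k) = potential P x + flux P * of_int k"
  using shift_int[of "potential P", OF u_shift[OF assms]] .

text \<open>Over \<open>q\<close> steps of \<open>f'\<close> the potentials change by exactly
  \<open>p\<close> times their flux, so the sum of the deficits equals a difference of mean actions
  and vanishes. Its terms are nonnegative; each is zero, and every chord of \<open>f'\<close> is a
  chord of \<open>f\<close>.\<close>

lemma periodic_graph_unique:
  assumes ig: "invariant_graph P f" and ig': "invariant_graph P' f'"
    and rot: "has_rotation f (of_int p / real q)" and q: "q > 0"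
    and per: "\<And>x. (f' ^^ q) x = x + 2 * pi * of_int p"
  shows "P x = P' x"
proof -
  have "has_rotation f' (of_int p / real q)"
    using degree_one_rotation_exists[OF degree_one_f[OF ig']] periodic_point_rotation[OF degree_one_f[OF ig'] _ per q] by auto
  then have eq: "crit P' f' + (of_int p / real q) * flux P' = crit P f + (of_int p / real q) * flux P"
    by (rule crit_flux_eq[OF ig ig' rot])
  have "(\<Sum>i<q. crit P f - gauged_action P ((f' ^^ i) x) (f' ((f' ^^ i) x)))
     = real q * (crit P f - crit P' f') - of_int p * (flux P' - flux P)"
    unfolding deficit_sum[OF ig ig'] per potential_shift_int[OF ig] potential_shift_int[OF ig'] by (simp add: algebra_simps)
  also have "\<dots> = real q * ((crit P f + (of_int p / real q) * flux P) - (crit P' f' + (of_int p / real q) * flux P'))"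
    using q by (simp add: field_simps)
  also have "\<dots> = 0" using eq by simp
  finally have "\<forall>i\<in>{..<q}. crit P f - gauged_action P ((f' ^^ i) x) (f' ((f' ^^ i) x)) = 0"
    by (subst (asm) sum_nonneg_eq_0_iff) (simp_all only: finite_lessThan deficit_nonneg[OF ig ig'])
  then have "crit P f - gauged_action P x (f' x) = 0" using q by (metis funpow_0 lessThan_iff)
  then have "f' x = f x"
    using gauged_eq_iff[OF ig, of x "f' x"] invariant_graphD(3,4)[OF ig', of x] by simp
  then show ?thesis using graph_eq_iff_map_eq[OF ig ig'] by metis
qed

lemma deficit_continuous:
  assumes "invariant_graph P f" "invariant_graph P' f'"
  shows "continuous_on UNIV (\<lambda>x. crit P f - gauged_action P x (f' x))"
  by (intro continuous_intros gauged_cont[OF assms(1)] f_cont[OF assms(2)])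

lemma deficit_periodic:
  assumes "invariant_graph P f" "invariant_graph P' f'"
  shows "crit P f - gauged_action P (x + 2 * pi) (f' (x + 2 * pi)) = crit P f - gauged_action P x (f' x)"
  by (simp add: gauged_action_def action_shift u_shift[OF assms(1)] f_shift[OF assms(2)])

text \<open>For disjoint graphs the deficits would have a positive minimum, and their sum would grow
  linearly although equal mean actions keep it bounded.\<close>

lemma same_rotation_meet:
  assumes ig: "invariant_graph P f" and ig': "invariant_graph P' f'"
    and rot: "has_rotation f r" "has_rotation f' r"
  shows "\<exists>z. P z = P' z"
proof (rule ccontr)
  assume no: "\<nexists>z. P z = P' z"
  let ?e = "\<lambda>x. crit P f - gauged_action P x (f' x)"
  obtain z where z: "\<And>x. ?e z \<le> ?e x"
    using periodic_attains_bounds(1)[OF deficit_continuous[OF ig ig'] deficit_periodic[OF ig ig']] by blast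
  have "f' z \<noteq> f z" using no graph_eq_iff_map_eq[OF ig ig'] by metis
  then have pos: "0 < ?e z"
    using gauged_eq_iff[OF ig, of z "f' z"] deficit_nonneg[OF ig ig', of z] invariant_graphD(3,4)[OF ig', of z] by simp
  obtain K where K: "\<And>n x. \<bar>(\<Sum>i<n. ?e ((f' ^^ i) x)) - real n * ((crit P f + r * flux P) - (crit P' f' + r * flux P'))\<bar> \<le> K"
    using deficit_sum_approx[OF ig ig' rot(2)] by blast
  have "real n * ?e z \<le> K" for n
  proof -
    have "real n * ?e z \<le> (\<Sum>i<n. ?e ((f' ^^ i) 0))" using sum_bounded_below[of "{..<n}" "?e z"] z by simp
    then show ?thesis using K[where n = n and x = 0] crit_flux_eq[OF ig ig' rot] by simp
  qed
  then show False using linear_bounded_imp_le[of "?e z" K] pos by simp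
qed

lemma graph_bounded:
  assumes "invariant_graph P f" shows "\<exists>B. \<forall>x. \<bar>P x\<bar> \<le> B"
proof -
  have "continuous_on UNIV (\<lambda>x. \<bar>P x\<bar>)" by (intro continuous_intros invariant_graphD(1)[OF assms])
  then obtain w where "\<forall>x. \<bar>P x\<bar> \<le> \<bar>P w\<bar>"
    using periodic_attains_bounds(2)[of "\<lambda>x. \<bar>P x\<bar>"] invariant_graphD(2)[OF assms] by auto
  then show ?thesis by blast
qed

text \<open>On a gap between the graphs the enclosed area is positive and is transported by the dynamics; for an
  irrational rotation number the images of a gap are disjoint, so there would be infinitely many of them.\<close>

lemma irrational_graph_unique:
  assumes ig: "invariant_graph P f" and ig': "invariant_graph P' f'"
    and rot: "has_rotation f r" "has_rotation f' r" and irr: "r \<notin> \<rat>"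
    and le: "\<And>x. P x \<le> P' x"
  shows "P x = P' x"
proof (rule ccontr)
  assume "P x \<noteq> P' x"
  then have lt: "P x < P' x" using le[of x] by simp
  define Z where "Z = {z. P z = P' z}"
  obtain z0 where z0: "z0 \<in> Z" using same_rotation_meet[OF ig ig' rot] by (auto simp: Z_def)
  have Zper: "z + 2 * pi * of_int k \<in> Z" if "z \<in> Z" for z k
    using that periodic_int[of P "2 * pi" z k] periodic_int[of P' "2 * pi" z k]
      invariant_graphD(2)[OF ig] invariant_graphD(2)[OF ig'] by (simp add: Z_def)
  have Zclosed: "closed Z"
    unfolding Z_def by (intro closed_Collect_eq invariant_graphD(1)[OF ig] invariant_graphD(1)[OF ig'])
  have "\<exists>z\<in>Z. z < x"
  proof -
    obtain k y where k: "z0 - x = y + 2 * pi * of_int k" "0 \<le> y" "y < 2 * pi"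
      using reduce_mod_period[of "2 * pi" "z0 - x"] by (metis pi_gt_zero zero_less_mult_iff zero_less_numeral)
    have "z0 + 2 * pi * of_int (- k - 1) < x" using k by (simp add: algebra_simps)
    then show ?thesis using Zper[OF z0] by blast
  qed
  then obtain z1 where z1: "z1 \<in> Z" "z1 < x" by blast
  have "\<exists>z\<in>Z. x < z"
  proof -
    obtain k y where k: "z0 - x = y + 2 * pi * of_int k" "0 \<le> y" "y < 2 * pi"
      using reduce_mod_period[of "2 * pi" "z0 - x"] by (metis pi_gt_zero zero_less_mult_iff zero_less_numeral)
    have "x < z0 + 2 * pi * of_int (- k + 1)" using k by (simp add: algebra_simps)
    then show ?thesis using Zper[OF z0] by blast
  qed
  then obtain z2 where z2: "z2 \<in> Z" "x < z2" by blast
  \<comment> \<open>The interval from \<open>a\<close> to \<open>b\<close> is the gap of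
    \<open>Z\<close> that contains \<open>x\<close>.\<close>
  define a where "a = Sup (Z \<inter> {..x})"
  define b where "b = Inf (Z \<inter> {x..})"
  have aZ: "a \<in> Z \<inter> {..x}" unfolding a_def
    by (intro closed_contains_Sup closed_Int Zclosed) (use z1 in \<open>auto intro!: bdd_aboveI[of _ x]\<close>)
  have bZ: "b \<in> Z \<inter> {x..}" unfolding b_def
    by (intro closed_contains_Inf closed_Int Zclosed) (use z2 in \<open>auto intro!: bdd_belowI[of _ x]\<close>)
  have ab: "a < x" "x < b" using aZ bZ lt by (auto simp: Z_def order_less_le)
  have gap: "z \<notin> Z" if "a < z" "z < b" for z
  proof
    assume "z \<in> Z"
    show False
    proof (cases "z \<le> x")
      case True
      then have "z \<le> a" unfolding a_def using \<open>z \<in> Z\<close> by (intro cSup_upper) (auto intro!: bdd_aboveI[of _ x])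
      then show False using that by simp
    next
      case False
      then have "b \<le> z" unfolding b_def using \<open>z \<in> Z\<close> by (intro cInf_lower) (auto intro!: bdd_belowI[of _ x])
      then show False using that by simp
    qed
  qed
  define v where "v x = potential P' x - potential P x" for x
  have v_deriv: "(v has_real_derivative P' x - P x) (at x)" for x
    unfolding v_def by (intro derivative_intros u_deriv[OF ig] u_deriv[OF ig'])
  have v_mono: "v s \<le> v t" if "s \<le> t" for s t
    by (rule DERIV_nonneg_imp_nondecreasing[OF that]) (use v_deriv le in \<open>force intro: exI[of _ "P' _ - P _"]\<close>)
  define \<kappa> where "\<kappa> = v b - v a"
  have "v a < v b"
  proof (rule DERIV_pos_imp_increasing_open[of a b])
    fix t assume "a < t" "t < b"
    then have "0 < P' t - P t" using gap[of t] le[of t] by (simp add: Z_def)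
    then show "\<exists>D. (v has_real_derivative D) (at t) \<and> D > 0" using v_deriv by blast
  qed (use ab v_deriv in \<open>auto intro: DERIV_isCont continuous_at_imp_continuous_on\<close>)
  then have \<kappa>: "0 < \<kappa>" by (simp add: \<kappa>_def)
  have orbZ: "(f ^^ n) z \<in> Z" if "z \<in> Z" for z n using graph_eq_orbit[OF ig ig', of z n] that unfolding Z_def by blast
  \<comment> \<open>Over a common point both graphs have the same chord, so the two gauged actions
    differ through \<open>v\<close> only; the constant drops out of the difference between the two
    ends of a gap.\<close>
  have step: "v (f z) = v z + (crit P f - crit P' f')" if "z \<in> Z" for z
    using gauged_graph[OF ig, of z] gauged_graph[OF ig', of z] graph_eq_step(1)[OF ig ig', of z] that
    by (simp add: gauged_action_def v_def Z_def)
  have jump: "v ((f ^^ n) b) - v ((f ^^ n) a) = \<kappa>" for n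
  proof (induction n)
    case (Suc n)
    then show ?case using step[OF orbZ, of a n] step[OF orbZ, of b n] aZ bZ by simp
  qed (simp add: \<kappa>_def)
  have nogap: "z \<notin> Z" if "(f ^^ n) a < z" "z < (f ^^ n) b" for z n
    using that
  proof (induction n arbitrary: z)
    case 0 then show ?case using gap by simp
  next
    case (Suc n)
    obtain w where w: "f w = z" by (rule surj_f[OF ig])
    then have "(f ^^ n) a < w" "w < (f ^^ n) b" using Suc.prems f_less_iff[OF ig] by auto
    then have "w \<notin> Z" by (rule Suc.IH)
    then show ?case using graph_eq_step_back[OF ig ig', of w] w by (auto simp: Z_def)
  qed
  define A where "A = {y. \<exists>n k. y = (f ^^ n) a + 2 * pi * of_int k}"
  have AZ: "A \<subseteq> Z" unfolding A_def using orbZ Zper aZ by blast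
  have vper: "v (y + 2 * pi * of_int k) = v y + (flux P' - flux P) * of_int k" for y k
    unfolding v_def potential_shift_int[OF ig] potential_shift_int[OF ig'] by (simp add: algebra_simps)
  \<comment> \<open>A point of \<open>A\<close> is the left end of a translated image of the gap.
    The image contains no point of \<open>Z\<close>, so a later point of \<open>A\<close> lies
    beyond it, and crossing it raises \<open>v\<close> by \<kappa>.\<close>
  have sep: "\<kappa> \<le> v t - v s" if s: "s \<in> A" and t: "t \<in> A" and st: "s < t" for s t
  proof -
    obtain n k where s: "s = (f ^^ n) a + 2 * pi * of_int k" using s by (auto simp: A_def)
    have tk: "t + 2 * pi * of_int (- k) \<in> Z" using t AZ Zper by blast
    have "(f ^^ n) b \<le> t + 2 * pi * of_int (- k)"
    proof (rule ccontr)
      assume "\<not> ?thesis"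
      then show False using nogap[of n "t + 2 * pi * of_int (- k)"] tk st s by simp
    qed
    then have "v ((f ^^ n) b) \<le> v (t + 2 * pi * of_int (- k))" by (rule v_mono)
    also have "\<dots> = v t - (flux P' - flux P) * of_int k" using vper[of t "- k"] by simp
    finally have "v ((f ^^ n) b) + (flux P' - flux P) * of_int k \<le> v t" by simp
    moreover have "v s = v ((f ^^ n) a) + (flux P' - flux P) * of_int k" using vper s by simp
    ultimately show ?thesis using jump[of n] by linarith
  qed
  obtain B where B: "\<And>x. \<bar>P x\<bar> \<le> B" using graph_bounded[OF ig] by blast
  obtain B' where B': "\<And>x. \<bar>P' x\<bar> \<le> B'" using graph_bounded[OF ig'] by blast
  define L where "L = B + B' + 1"
  have L: "0 < L" "P' y - P y \<le> L" for y using B[of y] B'[of y] by (auto simp: L_def)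
  have sep': "\<kappa> / L \<le> t - s" if st: "s \<in> A" "t \<in> A" "s < t" for s t
  proof -
    obtain y where y: "v t - v s = (t - s) * (P' y - P y)" using MVT2[OF st(3), of v "\<lambda>x. P' x - P x"] v_deriv by blast
    moreover have "(t - s) * (P' y - P y) \<le> (t - s) * L" using L(2)[of y] st(3) by (intro mult_left_mono) auto
    ultimately have "\<kappa> \<le> (t - s) * L" using sep[OF st] by simp
    then show ?thesis using L by (simp add: field_simps)
  qed
  \<comment> \<open>Brought into one period, the left ends are pairwise distinct, since a
    coincidence would make \<open>r\<close> rational; but they keep a distance of
    \<open>\<kappa> / L\<close> from each other, which a bounded interval does not allow for
    infinitely many points.\<close>
  define y where "y n = (f ^^ n) a - 2 * pi * of_int \<lfloor>(f ^^ n) a / (2 * pi)\<rfloor>" for n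
  have yA: "y n \<in> A" for n unfolding A_def y_def
    by (intro CollectI exI[of _ n] exI[of _ "- \<lfloor>(f ^^ n) a / (2 * pi)\<rfloor>"]) simp
  have yI: "y n \<in> {0..2 * pi}" for n
  proof -
    have "of_int \<lfloor>(f ^^ n) a / (2 * pi)\<rfloor> \<le> (f ^^ n) a / (2 * pi)" "(f ^^ n) a / (2 * pi) \<le> of_int \<lfloor>(f ^^ n) a / (2 * pi)\<rfloor> + 1" by linarith+
    moreover have "0 < 2 * pi" by simp
    ultimately show ?thesis
      unfolding y_def atLeastAtMost_iff pos_le_divide_eq[OF \<open>0 < 2 * pi\<close>] pos_divide_le_eq[OF \<open>0 < 2 * pi\<close>]
      by (simp add: algebra_simps)
  qed
  have ne: "y n \<noteq> y m" if "n < m" for n m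
  proof
    assume "y n = y m"
    then have "(f ^^ m) a = (f ^^ n) a + 2 * pi * of_int (\<lfloor>(f ^^ m) a / (2 * pi)\<rfloor> - \<lfloor>(f ^^ n) a / (2 * pi)\<rfloor>)"
      unfolding y_def of_int_diff right_diff_distrib by linarith
    then obtain k where k: "(f ^^ m) a = (f ^^ n) a + 2 * pi * of_int k" by blast
    have "(f ^^ (m - n)) ((f ^^ n) a) = (f ^^ n) a + 2 * pi * of_int k"
      using k funpow_add[of "m - n" n f] that by simp
    then have "r = of_int k / real (m - n)"
      by (rule periodic_point_rotation[OF degree_one_f[OF ig] rot(1)]) (use that in simp)
    then show False using irr by simp
  qed
  have "inj y"
  proof (rule injI)
    fix n m assume "y n = y m"
    then show "n = m" using ne[of n m] ne[of m n] by (cases n m rule: linorder_cases) auto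
  qed
  then have "infinite (range y)" using finite_imageD by auto
  moreover have "range y \<subseteq> {0..2 * pi}" using yI by blast
  ultimately obtain l where "l islimpt range y"
    using compact_eq_Bolzano_Weierstrass[of "{0..2 * pi}"] compact_Icc by blast
  moreover define \<epsilon> where "\<epsilon> = \<kappa> / L / 2"
  ultimately have "infinite (range y \<inter> ball l (\<epsilon>))" using \<kappa> L(1) by (simp add: islimpt_eq_infinite_ball)
  then have inf: "infinite (range y \<inter> ball l (\<epsilon>))" .
  obtain s0 where s0: "s0 \<in> range y \<inter> ball l (\<epsilon>)" using infinite_imp_nonempty[OF inf] by blast
  have "infinite (range y \<inter> ball l (\<epsilon>) - {s0})" using inf by simp
  then obtain t0 where t0: "t0 \<in> range y \<inter> ball l (\<epsilon>)" "t0 \<noteq> s0" using infinite_imp_nonempty by blast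
  obtain s t where st: "s \<in> range y \<inter> ball l (\<epsilon>)" "t \<in> range y \<inter> ball l (\<epsilon>)" "s < t"
  proof (cases "s0 < t0")
    case True then show ?thesis using that s0 t0 by blast
  next
    case False then show ?thesis using that[of t0 s0] s0 t0 by simp
  qed
  have "\<bar>l - s\<bar> < \<epsilon>" "\<bar>l - t\<bar> < \<epsilon>" using st by (auto simp: dist_real_def)
  then have "t - s < 2 * \<epsilon>" by linarith
  then have "t - s < \<kappa> / L" by (simp add: \<epsilon>_def)
  then show False using sep'[of s t] st yA by auto
qed

text \<open>The rigidity behind the role of the \<open>C\<^sup>1\<close> hypothesis: comparing the deficits of a periodic and of an
  arbitrary orbit along nearby invariant graphs shows that all orbits are periodic.\<close>

lemma displacement_bounds:
  assumes ig: "invariant_graph P f"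
  obtains s where "0 < s" "s \<le> pi" "\<And>x. x + s \<le> f x" "\<And>x. f x \<le> x + 2 * pi - s"
proof -
  have c: "continuous_on UNIV (\<lambda>x. f x - x)" by (intro continuous_intros f_cont[OF ig])
  have p: "f (x + 2 * pi) - (x + 2 * pi) = f x - x" for x by (simp add: f_shift[OF ig])
  obtain z where z: "\<And>x. f z - z \<le> f x - x" using periodic_attains_bounds(1)[OF c p] by blast
  obtain w where w: "\<And>x. f x - x \<le> f w - w" using periodic_attains_bounds(2)[OF c p] by blast
  define s where "s = min pi (min (f z - z) (2 * pi - (f w - w)))"
  have "s \<le> pi" "s \<le> f z - z" "s \<le> 2 * pi - (f w - w)" by (simp_all add: s_def)
  moreover have "0 < s" using invariant_graphD(3)[OF ig, of z] invariant_graphD(4)[OF ig, of w] by (simp add: s_def)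
  moreover have "x + s \<le> f x" "f x \<le> x + 2 * pi - s" for x using z[of x] w[of x] calculation by linarith+
  ultimately show thesis using that by blast
qed

lemma sin_ge_on:
  assumes "0 \<le> a" "a \<le> t" "t \<le> pi - a" shows "sin a \<le> sin t"
proof (cases "t \<le> pi / 2")
  case True
  then show ?thesis using assms by (intro sin_monotone_2pi_le) auto
next
  case False
  then have "sin a \<le> sin (pi - t)" using assms by (intro sin_monotone_2pi_le) auto
  then show ?thesis by simp
qed

lemma rho_periodic: "\<rho> (x + 2 * pi) = \<rho> x"
proof -
  have "((\<lambda>x. h1 (x + 2 * pi)) has_real_derivative (\<rho> (x + 2 * pi) - h (x + 2 * pi)) * 1) (at x)"
    by (auto intro!: derivative_eq_intros)
  then have "(h1 has_real_derivative \<rho> (x + 2 * pi) - h x) (at x)" by (simp add: h_periodic h1_periodic)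
  then show ?thesis using DERIV_unique[OF _ h1_deriv] by fastforce
qed

lemma rho_lower: obtains r0 where "0 < r0" "\<And>x. r0 \<le> \<rho> x"
  using periodic_attains_bounds(1)[OF rho_cont rho_periodic] rho_pos by blast

text \<open>By periodicity the advance \<open>f x - x\<close> stays away from 0 and from a full
  turn, so near the graph the twist has a uniform positive lower bound.\<close>

lemma twist_lower:
  assumes ig: "invariant_graph P f"
  obtains m \<kappa> where "0 < m" "0 < \<kappa>"
    "\<And>x y y'. \<bar>y - f x\<bar> \<le> \<kappa> \<Longrightarrow> \<bar>y' - f x\<bar> \<le> \<kappa> \<Longrightarrow> m * \<bar>y - y'\<bar> \<le> \<bar>p_in x y - p_in x y'\<bar>"
proof -
  obtain s where s: "0 < s" "s \<le> pi" "\<And>x. x + s \<le> f x" "\<And>x. f x \<le> x + 2 * pi - s"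
    using displacement_bounds[OF ig] by blast
  obtain r0 where r0: "0 < r0" "\<And>x. r0 \<le> \<rho> x" using rho_lower by blast
  define m where "m = r0 * sin (s / 4) / 2"
  have "0 < sin (s / 4)" using s by (intro sin_gt_zero) auto
  then have m: "0 < m" using r0 by (simp add: m_def)
  have *: "m * (y' - y) \<le> p_in x y - p_in x y'"
    if lt: "y < y'" and that: "\<bar>y - f x\<bar> \<le> s / 2" "\<bar>y' - f x\<bar> \<le> s / 2" for x y y'
  proof -
    obtain t where t: "y < t" "t < y'"
      "p_in x y' - p_in x y = (y' - y) * - (\<rho> ((x + t) / 2) * sin ((t - x) / 2) / 2)"
      using MVT2[OF lt, of "\<lambda>y. p_in x y" "\<lambda>t. - (\<rho> ((x + t) / 2) * sin ((t - x) / 2) / 2)"] p_in_deriv2 by blast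
    have "f x - s / 2 \<le> y" "y' \<le> f x + s / 2" using that by linarith+
    then have "s / 4 \<le> (t - x) / 2" "(t - x) / 2 \<le> pi - s / 4" using t(1,2) s(3)[of x] s(4)[of x] by simp_all
    then have "sin (s / 4) \<le> sin ((t - x) / 2)" using s(1) by (intro sin_ge_on) auto
    then have "r0 * sin (s / 4) \<le> \<rho> ((x + t) / 2) * sin ((t - x) / 2)"
      using r0 \<open>0 < sin (s / 4)\<close> by (intro mult_mono) (auto intro: less_imp_le order_trans)
    then have "m \<le> \<rho> ((x + t) / 2) * sin ((t - x) / 2) / 2" by (simp add: m_def)
    then have "(y' - y) * m \<le> (y' - y) * (\<rho> ((x + t) / 2) * sin ((t - x) / 2) / 2)"
      using lt by (intro mult_left_mono) auto
    then show ?thesis using t(3) by (simp add: mult.commute)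
  qed
  show thesis
  proof (rule that[OF m, of "s / 2"])
    fix x y y' assume "\<bar>y - f x\<bar> \<le> s / 2" "\<bar>y' - f x\<bar> \<le> s / 2"
    then show "m * \<bar>y - y'\<bar> \<le> \<bar>p_in x y - p_in x y'\<bar>"
      using *[of y y' x] *[of y' y x] by (cases y y' rule: linorder_cases) (auto simp: abs_if)
  qed (use s in simp)
qed

text \<open>The twist bound is local. If \<open>f' x\<close> were farther than \<kappa> from
  \<open>f x\<close>, then by monotonicity the graphs would already differ over \<open>x\<close> by
  more than \<open>m * \<kappa>\<close>.\<close>

lemma map_close:
  assumes ig: "invariant_graph P f" and ig': "invariant_graph P' f'"
    and tw: "0 < m" "0 < \<kappa>"
      "\<And>x y y'. \<bar>y - f x\<bar> \<le> \<kappa> \<Longrightarrow> \<bar>y' - f x\<bar> \<le> \<kappa> \<Longrightarrow> m * \<bar>y - y'\<bar> \<le> \<bar>p_in x y - p_in x y'\<bar>"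
    and D: "\<bar>P' x - P x\<bar> \<le> D" "D < m * \<kappa>"
  shows "m * \<bar>f' x - f x\<bar> \<le> D"
proof -
  have d: "x < f x" "f x < x + 2 * pi" "p_in x (f x) = P x" "x < f' x" "f' x < x + 2 * pi" "p_in x (f' x) = P' x"
    using invariant_graphD(3-5)[OF ig, of x] invariant_graphD(3-5)[OF ig', of x] by auto
  have "\<bar>f' x - f x\<bar> \<le> \<kappa>"
  proof (rule ccontr)
    assume "\<not> ?thesis"
    then consider "f x + \<kappa> < f' x" | "f' x < f x - \<kappa>" by linarith
    then show False
    proof cases
      case 1
      then have "p_in x (f' x) < p_in x (f x + \<kappa>)" using d tw(2) by (intro p_in_strict) auto
      moreover have "p_in x (f x + \<kappa>) < p_in x (f x)" using 1 d tw(2) by (intro p_in_strict) auto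
      ultimately show False using tw(3)[of "f x + \<kappa>" x "f x"] tw(2) D d by simp
    next
      case 2
      then have "p_in x (f x - \<kappa>) < p_in x (f' x)" using d tw(2) by (intro p_in_strict) auto
      moreover have "p_in x (f x) < p_in x (f x - \<kappa>)" using 2 d tw(2) by (intro p_in_strict) auto
      ultimately show False using tw(3)[of "f x - \<kappa>" x "f x"] tw(2) D d by simp
    qed
  qed
  then show ?thesis using tw(3)[of "f' x" x "f x"] tw(2) D d by simp
qed

text \<open>For \<open>y\<close> between \<open>f x\<close> and \<open>f' x\<close> the value
  \<open>p_out x y\<close> lies between the two graphs over \<open>y\<close>, so the derivative of
  the gauged action is at most their distance there. The deficit is thus a product of two small
  factors, quadratic in the distance of the graphs.\<close>

lemma deficit_le:
  assumes ig: "invariant_graph P f" and ig': "invariant_graph P' f'"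
    and D: "\<And>y. \<bar>P' y - P y\<bar> \<le> D"
  shows "crit P' f' - gauged_action P' x (f x) \<le> D * \<bar>f' x - f x\<bar>"
proof -
  have d: "x < f x" "f x < x + 2 * pi" "x < f' x" "f' x < x + 2 * pi"
    using invariant_graphD(3,4)[OF ig, of x] invariant_graphD(3,4)[OF ig', of x] by auto
  have "norm (gauged_action P' x (f' x) - gauged_action P' x (f x)) \<le> D * norm (f' x - f x)"
  proof (rule field_differentiable_bound[where S = "closed_segment (f x) (f' x)" and f' = "\<lambda>y. p_out x y - P' y"])
    fix y assume "y \<in> closed_segment (f x) (f' x)"
    then have y: "f x \<le> y \<and> y \<le> f' x \<or> f' x \<le> y \<and> y \<le> f x" by (auto simp: closed_segment_eq_real_ivl split: if_splits)
    show "((\<lambda>y. gauged_action P' x y) has_real_derivative p_out x y - P' y) (at y within closed_segment (f x) (f' x))"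
      using gauged_deriv2[OF ig'] by (rule has_field_derivative_at_within)
    have b: "x \<le> y" "y \<le> x + 2 * pi" using y d by auto
    have "\<bar>p_out x y - P' y\<bar> \<le> \<bar>P' y - P y\<bar>"
      using y head_below_iff[OF ig b] head_above_iff[OF ig b] head_below_iff[OF ig' b] head_above_iff[OF ig' b] by argo
    then show "norm (p_out x y - P' y) \<le> D" using D[of y] by simp
  qed auto
  then show ?thesis using gauged_graph[OF ig', of x] by (simp add: abs_le_iff)
qed

text \<open>For a graph at distance between \<open>d\<close> and \<open>D\<close>, the deficits
  along orbits of \<open>f\<close> are at most \<open>D\<close> squared over \<open>m\<close>. The
  difference \<open>v\<close> of the potentials has slope at least \<open>d\<close> in absolute
  value, so an orbit that misses closing by \<open>g\<close> produces a discrepancy of at least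
  \<open>d * g\<close>. Hence \<open>g\<close> is of order \<open>D\<close> squared over
  \<open>d\<close>, which \<open>near\<close> makes arbitrarily small.\<close>

lemma perturbation_periodic:
  assumes ig: "invariant_graph P f" and rot: "has_rotation f (of_int p / real q)" and q: "q > 0"
    and near: "\<And>\<eta>. 0 < \<eta> \<Longrightarrow> \<exists>P' f' d D. invariant_graph P' f' \<and> 0 < d \<and> D\<^sup>2 \<le> \<eta> * d \<and>
      ((\<forall>x. d \<le> P' x - P x \<and> P' x - P x \<le> D) \<or> (\<forall>x. d \<le> P x - P' x \<and> P x - P' x \<le> D))"
  shows "(f ^^ q) x = x + 2 * pi * of_int p"
proof -
  obtain z where z: "(f ^^ q) z = z + 2 * pi * of_int p"
    using rational_rotation_periodic_point[OF degree_one_f[OF ig] rot q] by blast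
  obtain m \<kappa> where tw: "0 < m" "0 < \<kappa>"
    "\<And>x y y'. \<bar>y - f x\<bar> \<le> \<kappa> \<Longrightarrow> \<bar>y' - f x\<bar> \<le> \<kappa> \<Longrightarrow> m * \<bar>y - y'\<bar> \<le> \<bar>p_in x y - p_in x y'\<bar>"
    using twist_lower[OF ig] by blast
  let ?g = "\<bar>(f ^^ q) x - (x + 2 * pi * of_int p)\<bar>"
  have main: "?g \<le> real q * \<eta> / m" if \<eta>: "0 < \<eta>" "\<eta> < m * \<kappa>" for \<eta>
  proof -
    obtain P' f' d D where ig': "invariant_graph P' f'" and d: "0 < d" and D: "D\<^sup>2 \<le> \<eta> * d"
      and alt: "(\<forall>x. d \<le> P' x - P x \<and> P' x - P x \<le> D) \<or> (\<forall>x. d \<le> P x - P' x \<and> P x - P' x \<le> D)"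
      using near[OF \<eta>(1)] by blast
    have dD: "d \<le> D" using alt order_trans by blast
    have abs: "\<bar>P' y - P y\<bar> \<le> D" for y using alt d by (metis abs_minus_commute abs_of_pos less_le_trans)
    have "D * D \<le> \<eta> * D" using D dD \<eta> by (metis mult_left_mono order_less_imp_le order_trans power2_eq_square)
    then have "D \<le> \<eta>" using d dD by simp
    then have Dm: "D < m * \<kappa>" using \<eta> by simp
    let ?e = "\<lambda>x. crit P' f' - gauged_action P' x (f x)"
    have e: "?e y \<le> D\<^sup>2 / m" for y
    proof -
      have "\<bar>f' y - f y\<bar> \<le> D / m" using map_close[OF ig ig' tw abs Dm] tw(1) by (simp add: field_simps)
      then have "D * \<bar>f' y - f y\<bar> \<le> D * (D / m)" using d dD by (intro mult_left_mono) auto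
      then show ?thesis using deficit_le[OF ig ig' abs, of y] by (simp add: power2_eq_square)
    qed
    define T where "T y = (\<Sum>i<q. ?e ((f ^^ i) y))" for y
    have T: "0 \<le> T y" "T y \<le> real q * (D\<^sup>2 / m)" for y
      unfolding T_def using sum_nonneg deficit_nonneg[OF ig' ig] sum_bounded_above[of "{..<q}"  "\<lambda>i. ?e ((f ^^ i) y)" "D\<^sup>2 / m"] e
      by (auto intro!: sum_nonneg simp del: diff_ge_0_iff_ge)
    define v where "v y = potential P y - potential P' y" for y
    have v_deriv: "(v has_real_derivative P y - P' y) (at y)" for y
      unfolding v_def by (intro derivative_intros u_deriv[OF ig] u_deriv[OF ig'])
    have vs: "v (y + 2 * pi * of_int p) = v y + (flux P - flux P') * of_int p" for y
      unfolding v_def potential_shift_int[OF ig] potential_shift_int[OF ig'] by (simp add: algebra_simps)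
    have Tv: "T y = real q * (crit P' f' - crit P f) - (v ((f ^^ q) y) - v y)" for y
      unfolding T_def v_def using deficit_sum[OF ig' ig, where n = q and x = y] by simp
    \<comment> \<open>Subtracting the sum along the known periodic orbit of \<open>z\<close>
      eliminates the unknown \<open>crit\<close> and \<open>flux\<close> of both graphs.\<close>
    have "v ((f ^^ q) x) - v (x + 2 * pi * of_int p) = T z - T x"
      unfolding Tv z vs by (simp add: algebra_simps)
    then have small: "\<bar>v ((f ^^ q) x) - v (x + 2 * pi * of_int p)\<bar> \<le> real q * (D\<^sup>2 / m)"
      using T[of z] T[of x] by linarith
    have lower: "d * (t - s) \<le> \<bar>v t - v s\<bar>" if lt: "s < t" for s t
    proof -
      obtain y where y: "v t - v s = (t - s) * (P y - P' y)" using MVT2[OF lt, of v "\<lambda>x. P x - P' x"] v_deriv by blast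
      have "d \<le> \<bar>P y - P' y\<bar>" using alt by (metis abs_ge_self abs_minus_commute order_trans)
      then have "(t - s) * d \<le> (t - s) * \<bar>P y - P' y\<bar>" using lt by (intro mult_left_mono) auto
      then show ?thesis using lt y by (simp add: abs_mult mult.commute)
    qed
    have "d * ?g \<le> \<bar>v ((f ^^ q) x) - v (x + 2 * pi * of_int p)\<bar>"
      using lower[of "(f ^^ q) x" "x + 2 * pi * of_int p"] lower[of "x + 2 * pi * of_int p" "(f ^^ q) x"]
      by (cases "(f ^^ q) x" "x + 2 * pi * of_int p" rule: linorder_cases) (auto simp: abs_minus_commute)
    also have "\<dots> \<le> real q * (D\<^sup>2 / m)" by (rule small)
    also have "\<dots> \<le> real q * (\<eta> * d / m)" using D tw(1) by (intro mult_left_mono divide_right_mono) auto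
    also have "\<dots> = d * (real q * \<eta> / m)" by simp
    finally show ?thesis using d by (metis mult_le_cancel_left_pos)
  qed
  have "?g \<le> 0"
  proof (rule ccontr)
    assume "\<not> ?g \<le> 0"
    then have g: "0 < ?g" by simp
    define \<eta> where "\<eta> = min (m * \<kappa> / 2) (?g * m / (2 * real q))"
    have "0 < \<eta>" using tw(1,2) g q by (simp add: \<eta>_def)
    moreover have "\<eta> \<le> m * \<kappa> / 2" unfolding \<eta>_def by (rule min.cobounded1)
    moreover have "0 < m * \<kappa>" using tw(1,2) by simp
    ultimately have "\<eta> < m * \<kappa>" by linarith
    with \<open>0 < \<eta>\<close> have "?g \<le> real q * \<eta> / m" by (rule main)
    also have "\<dots> \<le> real q * (?g * m / (2 * real q)) / m"
      using tw(1) q by (intro divide_right_mono mult_left_mono) (auto simp: \<eta>_def)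
    also have "\<dots> = ?g / 2" using tw(1) q by simp
    finally show False using g by simp
  qed
  then show ?thesis by simp
qed

end

section \<open>The family of caustics fills the phase space near the boundary\<close>

context oval
begin

lemma p_in_diag: "p_in x x = h x" by (simp add: p_in_def)

lemma p_out_diag: "p_out x x = h x" by (simp add: p_out_def)

lemma graph_below_h:
  assumes "invariant_graph P f" shows "P x < h x"
  using p_in_strict[of x x "f x"] invariant_graphD(3-5)[OF assms, of x] by (simp add: p_in_diag)

text \<open>The graphs \<open>L\<close> and \<open>U\<close> keep the limit where the twist produces
  a chord map. The common Lipschitz constant allows the limit in \<open>Q n (f n x)\<close>, where
  the function and its argument vary together.\<close>

lemma limit_graph:
  assumes ig: "\<And>n. invariant_graph (Q n) (f n)"
    and lip: "\<And>n x y. \<bar>Q n x - Q n y\<bar> \<le> M * \<bar>x - y\<bar>"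
    and conv: "\<And>x. (\<lambda>n. Q n x) \<longlonglongrightarrow> R x"
    and L: "invariant_graph L fL" "\<And>x. L x \<le> R x" and U: "invariant_graph U fU" "\<And>x. R x \<le> U x"
  shows "\<exists>g. invariant_graph R g"
proof -
  have lipR: "\<bar>R x - R y\<bar> \<le> M * \<bar>x - y\<bar>" for x y
    by (rule tendsto_upperbound[of "\<lambda>n. \<bar>Q n x - Q n y\<bar>" _ sequentially])
      (auto intro!: tendsto_intros conv simp: lip)
  have M: "0 \<le> M" using lip[of 0 0 1] abs_ge_zero[of "Q 0 0 - Q 0 1"] by simp
  have Rc: "continuous_on UNIV R"
  proof (rule continuous_onI)
    fix x e :: real assume "e > 0"
    show "\<exists>d>0. \<forall>x'\<in>UNIV. dist x' x < d \<longrightarrow> dist (R x') (R x) \<le> e"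
    proof (intro exI[of _ "e / (M + 1)"] conjI ballI impI)
      fix x' assume "dist x' x < e / (M + 1)"
      then have "M * \<bar>x' - x\<bar> \<le> (M + 1) * (e / (M + 1))"
        using M by (intro mult_mono) (auto simp: dist_real_def)
      then show "dist (R x') (R x) \<le> e" using lipR[of x' x] M by (simp add: dist_real_def)
    qed (use M \<open>e > 0\<close> in simp)
  qed
  have Rp: "R (x + 2 * pi) = R x" for x
    using LIMSEQ_unique[OF conv[of "x + 2 * pi"], of "R x"] conv[of x] invariant_graphD(2)[OF ig] by simp
  have "\<exists>y. x < y \<and> y < x + 2 * pi \<and> p_in x y = R x" for x
  proof -
    have d: "x < fU x" "fU x < x + 2 * pi" "p_in x (fU x) = U x" "x < fL x" "fL x < x + 2 * pi" "p_in x (fL x) = L x"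
      using invariant_graphD(3-5)[OF U(1), of x] invariant_graphD(3-5)[OF L(1), of x] by auto
    have "fU x \<le> fL x"
      using above_f_iff[OF U(1), of x "fL x"] d L(2)[of x] U(2)[of x] p_in_less_iff[of x "fU x" "fL x"] by linarith
    then have "\<exists>y. fU x \<le> y \<and> y \<le> fL x \<and> p_in x y = R x"
      using d L(2)[of x] U(2)[of x] by (intro IVT2') (auto intro!: continuous_intros)
    then show ?thesis using d by (meson le_less_trans less_le_trans)
  qed
  then obtain g where g: "\<And>x. x < g x" "\<And>x. g x < x + 2 * pi" "\<And>x. p_in x (g x) = R x" by metis
  have fg: "(\<lambda>n. f n x) \<longlonglongrightarrow> g x" for x
  proof (rule order_tendstoI)
    fix l assume "l < g x"
    define l' where "l' = max l x"
    have l': "x \<le> l'" "l' < g x" "l \<le> l'" using \<open>l < g x\<close> g(1)[of x] by (auto simp: l'_def)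
    have "R x < p_in x l'" using p_in_strict[of x l' "g x"] g[of x] l' by simp
    then have "\<forall>\<^sub>F n in sequentially. Q n x < p_in x l'" using conv by (rule order_tendstoD(2)[rotated])
    then show "\<forall>\<^sub>F n in sequentially. l < f n x"
    proof eventually_elim
      case (elim n)
      then show ?case using below_f_iff[OF ig, of x l' n] l' g(2)[of x] by simp
    qed
  next
    fix l assume "g x < l"
    define l' where "l' = min l (x + 2 * pi)"
    have l': "l' \<le> x + 2 * pi" "g x < l'" "l' \<le> l" using \<open>g x < l\<close> g(2)[of x] by (auto simp: l'_def)
    have "p_in x l' < R x" using p_in_strict[of x "g x" l'] g[of x] l' by simp
    then have "\<forall>\<^sub>F n in sequentially. p_in x l' < Q n x" using conv by (rule order_tendstoD(1)[rotated])
    then show "\<forall>\<^sub>F n in sequentially. f n x < l"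
    proof eventually_elim
      case (elim n)
      then show ?case using above_f_iff[OF ig, of x l' n] l' g(1)[of x] by simp
    qed
  qed
  have "p_out x (g x) = R (g x)" for x
  proof -
    have "(\<lambda>n. Q n (f n x) - Q n (g x)) \<longlonglongrightarrow> 0"
    proof (rule tendsto_rabs_zero_cancel, rule tendsto_sandwich[OF _ _ tendsto_const])
      show "(\<lambda>n. M * \<bar>f n x - g x\<bar>) \<longlonglongrightarrow> 0"
        by (intro tendsto_mult_right_zero tendsto_rabs_zero) (simp add: LIM_zero fg)
    qed (use lip in auto)
    then have 1: "(\<lambda>n. (Q n (f n x) - Q n (g x)) + Q n (g x)) \<longlonglongrightarrow> 0 + R (g x)" by (intro tendsto_add conv)
    have "isCont (\<lambda>y. p_out x y) (g x)"
      by (rule continuous_on_interior[of UNIV]) (auto intro!: continuous_intros)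
    then have "(\<lambda>n. p_out x (f n x)) \<longlonglongrightarrow> p_out x (g x)" using fg by (rule isCont_tendsto_compose)
    then show ?thesis using 1 LIMSEQ_unique invariant_graphD(6)[OF ig] by simp
  qed
  then show ?thesis using Rc Rp g unfolding invariant_graph_def by blast
qed

end

text \<open>What is kept of the foliation: one graph for each rotation number. The Lipschitz
  constant reflects that the caustics lie in a bounded table, and the C1 charts survive in
  \<open>periodic\<close>.\<close>

locale caustic_family = oval +
  fixes P F :: "real \<Rightarrow> real \<Rightarrow> real" and M :: real
  assumes ig: "0 < r \<Longrightarrow> r \<le> 1/4 \<Longrightarrow> invariant_graph (P r) (F r)"
    and rot: "0 < r \<Longrightarrow> r \<le> 1/4 \<Longrightarrow> has_rotation (F r) r"
    and lip: "0 < r \<Longrightarrow> r \<le> 1/4 \<Longrightarrow> \<bar>P r x - P r y\<bar> \<le> M * \<bar>x - y\<bar>"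
    and periodic: "q > 0 \<Longrightarrow> 0 < of_int p / real q \<Longrightarrow> of_int p / real q \<le> (1/4 :: real) \<Longrightarrow>
      (F (of_int p / real q) ^^ q) x = x + 2 * pi * of_int p"
begin

lemma strict_anti: "0 < r \<Longrightarrow> r < r' \<Longrightarrow> r' \<le> 1/4 \<Longrightarrow> P r' x < P r x"
  by (rule smaller_rotation_above[OF ig ig rot rot]) auto

lemma anti: "0 < r \<Longrightarrow> r \<le> r' \<Longrightarrow> r' \<le> 1/4 \<Longrightarrow> P r' x \<le> P r x"
  using strict_anti[of r r' x] by (cases "r = r'") auto

lemma family_less_iff:
  "0 < r \<Longrightarrow> r \<le> 1/4 \<Longrightarrow> 0 < r' \<Longrightarrow> r' \<le> 1/4 \<Longrightarrow> P r' x < P r x \<longleftrightarrow> r < r'"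
  using strict_anti[of r r' x] anti[of r' r x] by (cases "r < r'") auto

text \<open>For rational \<open>r\<close> the periodicity of all orbits yields uniqueness. For
  irrational \<open>r\<close> the argument compares enclosed areas and needs ordered graphs, an
  order that monotone limits provide.\<close>

lemma family_unique:
  assumes r: "0 < r" "r \<le> 1/4" and Q: "invariant_graph Q g" "has_rotation g r"
    and comp: "(\<forall>x. Q x \<le> P r x) \<or> (\<forall>x. P r x \<le> Q x)"
  shows "Q x = P r x"
proof (cases "r \<in> \<rat>")
  case True
  then obtain p q where pq: "r = of_int p / of_int q" "0 < q" using Rats_cases' by metis
  then have e: "r = of_int p / real (nat q)" by simp
  show ?thesis
  proof (rule periodic_graph_unique[OF Q(1) ig[OF r]])
    show "has_rotation g (of_int p / real (nat q))" using Q(2) e by simp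
    show "0 < nat q" using pq by simp
    show "(F r ^^ nat q) x = x + 2 * pi * of_int p" for x
      using periodic[of "nat q" p x] r pq unfolding e by simp
  qed
next
  case False
  show ?thesis using comp
  proof
    assume "\<forall>x. Q x \<le> P r x"
    then show ?thesis by (intro irrational_graph_unique[OF Q(1) ig[OF r] Q(2) rot[OF r] False]) auto
  next
    assume "\<forall>x. P r x \<le> Q x"
    then show ?thesis by (intro irrational_graph_unique[OF ig[OF r] Q(1) rot[OF r] Q(2) False, symmetric]) auto
  qed
qed

text \<open>The monotone limit is again an invariant graph. It lies between \<open>P r\<close> and
  all \<open>P (s n)\<close>, which squeezes its rotation number to \<open>r\<close>, and uniqueness
  identifies it with \<open>P r\<close>.\<close>

lemma inc_limit:
  assumes s: "incseq s" "s \<longlonglongrightarrow> r" "\<And>n. 0 < s n" "r \<le> 1/4"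
  shows "(\<lambda>n. P (s n) x) \<longlonglongrightarrow> P r x"
proof -
  have sr: "s n \<le> r" for n using incseq_le[OF s(1,2)] .
  have r: "0 < r" using s(3)[of 0] sr[of 0] by linarith
  have s4: "s n \<le> 1/4" for n using sr[of n] s(4) by linarith
  have dec: "P (s n) x \<le> P (s m) x" if "m \<le> n" for m n x
    using s(3) s4 incseqD[OF s(1) that] by (intro anti) auto
  have lb: "P r x \<le> P (s n) x" for n x using s(3,4) sr by (intro anti) auto
  have d: "decseq (\<lambda>n. P (s n) x)" for x by (simp add: decseq_def dec)
  have "\<exists>l. (\<lambda>n. P (s n) x) \<longlonglongrightarrow> l" for x
    by (rule decseq_convergent[OF d, of "P r x" x]) (use lb in auto)
  then obtain R where conv: "\<And>x. (\<lambda>n. P (s n) x) \<longlonglongrightarrow> R x" by metis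
  have Rr: "P r x \<le> R x" for x by (rule LIMSEQ_le_const[OF conv]) (use lb in auto)
  have Rs: "R x \<le> P (s n) x" for n x by (rule LIMSEQ_le_const2[OF conv]) (use dec in auto)
  obtain g where g: "invariant_graph R g"
    using limit_graph[of "\<lambda>n. P (s n)" "\<lambda>n. F (s n)", OF ig[OF s(3) s4] lip[OF s(3) s4] conv ig[OF r s(4)] Rr
        ig[OF s(3) s4] Rs[of _ 0]] by blast
  obtain \<rho>' where \<rho>': "has_rotation g \<rho>'" using degree_one_rotation_exists[OF degree_one_f[OF g]] by blast
  have "s n \<le> \<rho>'" for n by (rule graph_le_imp_rotation_le[OF g ig[OF s(3) s4] Rs \<rho>' rot[OF s(3) s4]])
  then have "r \<le> \<rho>'" by (intro LIMSEQ_le_const2[OF s(2)]) auto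
  moreover have "\<rho>' \<le> r" by (rule graph_le_imp_rotation_le[OF ig[OF r s(4)] g Rr rot[OF r s(4)] \<rho>'])
  ultimately have "\<rho>' = r" by simp
  then have "R x = P r x" using \<rho>' Rr by (intro family_unique[OF r s(4) g] disjI2) auto
  then show ?thesis using conv[of x] by simp
qed

lemma dec_limit:
  assumes s: "decseq s" "s \<longlonglongrightarrow> r" "0 < r" "\<And>n. s n \<le> 1/4"
  shows "(\<lambda>n. P (s n) x) \<longlonglongrightarrow> P r x"
proof -
  have sr: "r \<le> s n" for n using decseq_ge[OF s(1,2)] .
  have r: "r \<le> 1/4" using s(4)[of 0] sr[of 0] by linarith
  have s0: "0 < s n" for n using sr[of n] s(3) by linarith
  have inc: "P (s m) x \<le> P (s n) x" if "m \<le> n" for m n x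
    using s(4) s0 decseqD[OF s(1) that] by (intro anti) auto
  have ub: "P (s n) x \<le> P r x" for n x using s(3,4) sr by (intro anti) auto
  have d: "incseq (\<lambda>n. P (s n) x)" for x by (simp add: incseq_def inc)
  have "\<exists>l. (\<lambda>n. P (s n) x) \<longlonglongrightarrow> l" for x
    by (rule incseq_convergent[OF d, of x "P r x"]) (use ub in auto)
  then obtain R where conv: "\<And>x. (\<lambda>n. P (s n) x) \<longlonglongrightarrow> R x" by metis
  have Rr: "R x \<le> P r x" for x by (rule LIMSEQ_le_const2[OF conv]) (use ub in auto)
  have Rs: "P (s n) x \<le> R x" for n x by (rule LIMSEQ_le_const[OF conv]) (use inc in auto)
  obtain g where g: "invariant_graph R g"
    using limit_graph[of "\<lambda>n. P (s n)" "\<lambda>n. F (s n)", OF ig[OF s0 s(4)] lip[OF s0 s(4)] conv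
        ig[OF s0 s(4)] Rs[of 0] ig[OF s(3) r] Rr] by blast
  obtain \<rho>' where \<rho>': "has_rotation g \<rho>'" using degree_one_rotation_exists[OF degree_one_f[OF g]] by blast
  have "\<rho>' \<le> s n" for n by (rule graph_le_imp_rotation_le[OF ig[OF s0 s(4)] g Rs rot[OF s0 s(4)] \<rho>'])
  then have "\<rho>' \<le> r" by (intro LIMSEQ_le_const[OF s(2)]) auto
  moreover have "r \<le> \<rho>'" by (rule graph_le_imp_rotation_le[OF g ig[OF s(3) r] Rr \<rho>' rot[OF s(3) r]])
  ultimately have "\<rho>' = r" by simp
  then have "R x = P r x" using \<rho>' Rr by (intro family_unique[OF s(3) r g] disjI1) auto
  then show ?thesis using conv[of x] by simp
qed

lemma family_cont_left:
  assumes r: "0 < r" "r \<le> 1/4" and e: "0 < e"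
  obtains r' where "0 < r'" "r' < r" "P r' x < P r x + e"
proof -
  \<comment> \<open>The offset 2 keeps the sequence strictly between 0 and \<open>r\<close> from its
    first term on.\<close>
  define s where "s n = r - r * (1 / real (n + 2))" for n
  have 1: "incseq s" unfolding s_def using r
    by (intro incseq_SucI diff_left_mono mult_left_mono divide_left_mono) auto
  have "(\<lambda>n. r - r * (1 / real (n + 2))) \<longlonglongrightarrow> r - r * 0"
    by (intro tendsto_intros LIMSEQ_ignore_initial_segment[OF lim_1_over_n])
  then have 2: "s \<longlonglongrightarrow> r" unfolding s_def by simp
  have 3: "0 < s n" for n using mult_strict_left_mono[of "1 / real (n + 2)" 1 r] r by (simp add: s_def)
  have "\<forall>\<^sub>F n in sequentially. P (s n) x < P r x + e"
    using e by (intro order_tendstoD(2)[OF inc_limit[OF 1 2 3 r(2)]]) simp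
  then obtain n where "P (s n) x < P r x + e" by (auto simp: eventually_sequentially)
  then show thesis using that[of "s n"] 3[of n] r by (simp add: s_def)
qed

lemma family_cont_right:
  assumes r: "0 < r" "r < 1/4" and e: "0 < e"
  obtains r' where "r < r'" "r' \<le> 1/4" "P r x - e < P r' x"
proof -
  define s where "s n = r + (1/4 - r) * (1 / real (n + 2))" for n
  have 1: "decseq s" unfolding s_def using r
    by (intro decseq_SucI add_left_mono mult_left_mono divide_left_mono) auto
  have "(\<lambda>n. r + (1/4 - r) * (1 / real (n + 2))) \<longlonglongrightarrow> r + (1/4 - r) * 0"
    by (intro tendsto_intros LIMSEQ_ignore_initial_segment[OF lim_1_over_n])
  then have 2: "s \<longlonglongrightarrow> r" unfolding s_def by simp
  have 3: "s n \<le> 1/4" for n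
  proof -
    have "(1/4 - r) * (1 / real (n + 2)) \<le> (1/4 - r) * 1" using r by (intro mult_left_mono) auto
    then have "s n \<le> r + (1/4 - r) * 1" unfolding s_def by (rule add_left_mono)
    then show ?thesis by simp
  qed
  have "\<forall>\<^sub>F n in sequentially. P r x - e < P (s n) x"
    using e by (intro order_tendstoD(1)[OF dec_limit[OF 1 2 r(1) 3]]) simp
  then obtain n where "P r x - e < P (s n) x" by (auto simp: eventually_sequentially)
  then show thesis using that[of "s n"] 3[of n] r by (simp add: s_def)
qed

lemma M_nonneg: "0 \<le> M"
  using lip[of "1/4" 0 1] abs_ge_zero[of "P (1/4) 0 - P (1/4) 1"] by simp

text \<open>Monotonicity in \<open>r\<close> turns one-sided estimates at a single \<open>x\<close>
  into a neighbourhood in \<open>r\<close>, and the uniform Lipschitz bound in \<open>x\<close>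
  makes the continuity joint.\<close>

lemma family_continuous: "continuous_on ({0<..1/4} \<times> UNIV) (\<lambda>(r, x). P r x)"
proof (rule continuous_onI)
  fix z :: "real \<times> real" and e :: real assume z: "z \<in> {0<..1/4} \<times> UNIV" and e: "0 < e"
  obtain r x where rx: "z = (r, x)" "0 < r" "r \<le> 1/4" using z by (cases z) auto
  have e2: "0 < e / 2" using e by simp
  obtain r1 where r1: "0 < r1" "r1 < r" "P r1 x < P r x + e / 2" using family_cont_left[OF rx(2,3) e2] .
  have "\<exists>r2>r. \<forall>s. r < s \<longrightarrow> s < r2 \<longrightarrow> s \<le> 1/4 \<longrightarrow> P r x - e / 2 < P s x"
  proof (cases "r < 1/4")
    case True
    obtain r2 where r2: "r < r2" "r2 \<le> 1/4" "P r x - e / 2 < P r2 x" using family_cont_right[OF rx(2) True e2] .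
    have "P r x - e / 2 < P s x" if "r < s" "s < r2" for s
      using anti[of s r2 x] r2 that rx by simp
    then show ?thesis using r2 by blast
  next
    case False
    then show ?thesis by (intro exI[of _ "r + 1"]) auto
  qed
  then obtain r2 where r2: "r < r2" "\<And>s. r < s \<Longrightarrow> s < r2 \<Longrightarrow> s \<le> 1/4 \<Longrightarrow> P r x - e / 2 < P s x" by blast
  have near: "\<bar>P s x - P r x\<bar> < e / 2" if "r1 < s" "s < r2" "s \<le> 1/4" for s
  proof (cases "s \<le> r")
    case True
    then have "P r x \<le> P s x" "P s x \<le> P r1 x" using anti[of s r x] anti[of r1 s x] that r1 rx by auto
    then show ?thesis using r1 by linarith
  next
    case False
    then have "P s x \<le> P r x" "P r x - e / 2 < P s x" using anti[of r s x] r2(2)[of s] that rx by auto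
    then show ?thesis by linarith
  qed
  define d where "d = min (min (r - r1) (r2 - r)) (e / 2 / (M + 1))"
  have d: "0 < d" "d \<le> r - r1" "d \<le> r2 - r" "d \<le> e / 2 / (M + 1)" using r1 r2 e M_nonneg by (auto simp: d_def)
  show "\<exists>d>0. \<forall>z'\<in>{0<..1/4} \<times> UNIV. dist z' z < d \<longrightarrow> dist (case z' of (r, x) \<Rightarrow> P r x) (case z of (r, x) \<Rightarrow> P r x) \<le> e"
  proof (intro exI[of _ d] conjI d(1) ballI impI)
    fix z' :: "real \<times> real" assume z': "z' \<in> {0<..1/4} \<times> UNIV" and dz: "dist z' z < d"
    obtain s y where sy: "z' = (s, y)" "0 < s" "s \<le> 1/4" using z' by (cases z') auto
    have "dist s r < d" "dist y x < d" using dist_fst_le[of z' z] dist_snd_le[of z' z] dz sy rx by auto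
    then have "\<bar>P s x - P r x\<bar> < e / 2" using d sy by (intro near) (auto simp: dist_real_def)
    moreover have "\<bar>P s y - P s x\<bar> \<le> e / 2"
    proof -
      have "\<bar>y - x\<bar> \<le> e / 2 / (M + 1)" using \<open>dist y x < d\<close> d(4) by (simp add: dist_real_def)
      then have "M * \<bar>y - x\<bar> \<le> (M + 1) * (e / 2 / (M + 1))" using M_nonneg e by (intro mult_mono) auto
      also have "\<dots> = e / 2"
      proof -
        have "M + 1 \<noteq> 0" using M_nonneg by simp
        then show ?thesis
by (metis nonzero_mult_div_cancel_left times_divide_eq_right)
      qed
      finally show ?thesis using lip[OF sy(2,3), of y x] by linarith
    qed
    ultimately show "dist (case z' of (r, x) \<Rightarrow> P r x) (case z of (r, x) \<Rightarrow> P r x) \<le> e"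
      unfolding sy rx dist_real_def prod.case by linarith
  qed
qed


lemma family_bounded: obtains B where "0 \<le> B" "\<And>r x. 0 < r \<Longrightarrow> r \<le> 1/4 \<Longrightarrow> \<bar>P r x\<bar> \<le> B" "\<And>x. \<bar>h x\<bar> \<le> B"
proof -
  obtain B1 where B1: "\<And>x. \<bar>P (1/4) x\<bar> \<le> B1" using graph_bounded[OF ig, of "1/4"] by auto
  have "continuous_on UNIV (\<lambda>x. \<bar>h x\<bar>)" by (intro continuous_intros h_cont)
  then obtain w where w: "\<And>x. \<bar>h x\<bar> \<le> \<bar>h w\<bar>"
    using periodic_attains_bounds(2)[of "\<lambda>x. \<bar>h x\<bar>"] h_periodic by auto
  show thesis
  proof (rule that[of "B1 + \<bar>h w\<bar>"])
    show "\<bar>P r x\<bar> \<le> B1 + \<bar>h w\<bar>" if "0 < r" "r \<le> 1/4" for r x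
      using anti[of r "1/4" x] graph_below_h[OF ig, of r x] that B1[of x] w[of x] by linarith
    show "\<bar>h x\<bar> \<le> B1 + \<bar>h w\<bar>" for x using w[of x] B1[of x] by linarith
    show "0 \<le> B1 + \<bar>h w\<bar>" using w[of 0] B1[of 0] by linarith
  qed
qed

lemma potential_increment_bounds:
  assumes "invariant_graph Q g" "s \<le> t" "\<And>y. s \<le> y \<Longrightarrow> y \<le> t \<Longrightarrow> Q y \<le> c"
  shows "potential Q t - potential Q s \<le> (t - s) * c"
proof (cases "s = t")
  case False
  then have lt: "s < t" using assms(2) by simp
  obtain y where y: "s < y" "y < t" "potential Q t - potential Q s = (t - s) * Q y"
    using MVT2[OF lt, of "potential Q" Q] u_deriv[OF assms(1)] by blast
  then show ?thesis using assms(3)[of y] lt by simp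
qed simp

text \<open>The mean advance is \<open>2 * pi * r\<close>, so some chord advances by less than twice
  that. Both terms of the gauged action are bounded by a constant times the advance, and
  \<open>crit\<close> may be evaluated at any chord of the graph.\<close>

lemma crit_small:
  obtains K where "0 \<le> K" "\<And>r. 0 < r \<Longrightarrow> r \<le> 1/4 \<Longrightarrow> crit (P r) (F r) \<le> K * r"
proof -
  obtain B where B: "0 \<le> B" "\<And>r x. 0 < r \<Longrightarrow> r \<le> 1/4 \<Longrightarrow> \<bar>P r x\<bar> \<le> B" "\<And>x. \<bar>h x\<bar> \<le> B"
    using family_bounded by metis
  have "crit (P r) (F r) \<le> 8 * pi * B * r" if r: "0 < r" "r \<le> 1/4" for r
  proof -
    have "\<exists>x. F r x < x + 4 * pi * r"
    proof (rule ccontr)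
      assume "\<nexists>x. F r x < x + 4 * pi * r"
      then have "4 * pi * r \<le> 2 * pi * r"
        by (intro has_rotation_ge[OF degree_one_f[OF ig[OF r]] rot[OF r]]) (auto simp: not_less)
      then show False using r by simp
    qed
    then obtain x where x: "F r x < x + 4 * pi * r" by blast
    define t where "t = F r x - x"
    have t: "0 < t" "t < 4 * pi * r" using invariant_graphD(3)[OF ig[OF r], of x] x by (auto simp: t_def)
    have "\<bar>action x (F r x)\<bar> \<le> (2 * B) * (t / 2)"
      unfolding action_def abs_mult t_def[symmetric] using B(3)[of "(x + F r x) / 2"] abs_sin_x_le_abs_x[of "t / 2"] t
      by (intro mult_mono) (auto simp: abs_mult)
    moreover have "potential (P r) x - potential (P r) (F r x) \<le> t * B"
    proof -
      obtain y where y: "potential (P r) (F r x) - potential (P r) x = (F r x - x) * P r y"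
        using MVT2[of x "F r x" "potential (P r)" "P r"] u_deriv[OF ig[OF r]] t by (auto simp: t_def)
      have "t * - P r y \<le> t * B" using B(2)[OF r, of y] t by (intro mult_left_mono) auto
      then show ?thesis using y by (simp add: t_def)
    qed
    ultimately have "crit (P r) (F r) \<le> 2 * B * t"
      unfolding gauged_graph[OF ig[OF r], of x, symmetric] gauged_action_def by (simp add: algebra_simps)
    also have "\<dots> \<le> 2 * B * (4 * pi * r)" using t B(1) by (intro mult_left_mono) auto
    finally show ?thesis by (simp add: mult.assoc mult.left_commute)
  qed
  then show thesis using that[of "8 * pi * B"] B(1) by simp
qed

text \<open>Maximality of the orbits on the graph of \<open>P r\<close> bounds short chords by the increments of the potential,
  up to \<open>crit\<close>, which tends to 0 with \<open>r\<close>.\<close>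

lemma family_fills:
  assumes "0 < e" shows "\<exists>r>0. r < 1/4 \<and> h x - e < P r x"
proof (rule ccontr)
  assume no: "\<not> ?thesis"
  \<comment> \<open>One third of the assumed gap pays for the Lipschitz variation of the graph over
    a short chord centred at \<open>x\<close> and part of another for replacing \<open>sin t\<close>
    by \<open>t\<close>; what remains contradicts the smallness of \<open>crit\<close>.\<close>
  define e3 where "e3 = e / 3"
  have e3: "0 < e3" using assms by (simp add: e3_def)
  have up: "P r x \<le> h x - 3 * e3" if "0 < r" "r < 1/4" for r 
  proof -
    have "\<not> h x - e < P r x" using no that by blast
    then show ?thesis by (simp add: e3_def)
  qed
  obtain K where K: "0 \<le> K" "\<And>r. 0 < r \<Longrightarrow> r \<le> 1/4 \<Longrightarrow> crit (P r) (F r) \<le> K * r" using crit_small by metis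
  have "((\<lambda>t. sin t / t) \<longlongrightarrow> 1) (at (0::real))"
    using DERIV_sin[of 0] by (simp add: has_field_derivative_iff)
  then have "((\<lambda>t. 2 * h x * (sin t / t - 1)) \<longlongrightarrow> 2 * h x * (1 - 1)) (at 0)" by (intro tendsto_intros)
  then have "\<forall>\<^sub>F t in at 0. - e3 < 2 * h x * (sin t / t - 1)" using e3 by (intro order_tendstoD(1)) auto
  then obtain d where d: "0 < d" "\<And>t. t \<noteq> 0 \<Longrightarrow> dist t 0 < d \<Longrightarrow> - e3 < 2 * h x * (sin t / t - 1)"
    by (auto simp: eventually_at)
  define t where "t = min (d / 2) (min (e3 / (M + 1)) 1)"
  have M1: "0 < M + 1" using M_nonneg by simp
  have t: "0 < t" "t < d" "t \<le> e3 / (M + 1)" "t \<le> 1" using d(1) e3 M1 by (auto simp: t_def)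
  have Mt: "M * t \<le> e3"
  proof -
    have "M * t \<le> (M + 1) * (e3 / (M + 1))" using t M_nonneg by (intro mult_mono) auto
    then show ?thesis using M1 by simp
  qed
  have sin: "2 * h x * sin t > 2 * h x * t - e3 * t"
  proof -
    have "- e3 < 2 * h x * (sin t / t - 1)" using d(2)[of t] t by simp
    then have "- e3 * t < 2 * h x * (sin t / t - 1) * t" using t(1) by (rule mult_strict_right_mono)
    also have "\<dots> = 2 * h x * sin t - 2 * h x * t" using t(1) by (simp add: field_simps)
    finally show ?thesis by simp
  qed
  have bound: "3 * t * e3 \<le> K * r" if r: "0 < r" "r < 1/4" for r
  proof -
    have r': "r \<le> 1/4" using r by simp
    note g = ig[OF r(1) r']
    have "P r y \<le> h x - 2 * e3" if "x - t \<le> y" "y \<le> x + t" for y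
    proof -
      have "\<bar>P r y - P r x\<bar> \<le> M * \<bar>y - x\<bar>" by (rule lip[OF r(1) r'])
      also have "\<dots> \<le> M * t" using that M_nonneg by (intro mult_left_mono) auto
      finally show ?thesis using Mt up[OF r] by linarith
    qed
    then have "potential (P r) (x + t) - potential (P r) (x - t) \<le> ((x + t) - (x - t)) * (h x - 2 * e3)"
      using t(1) by (intro potential_increment_bounds[OF g]) auto
    moreover have "gauged_action (P r) (x - t) (x + t) \<le> crit (P r) (F r)"
      using t pi_gt3 by (intro gauged_le[OF g]) auto
    moreover have "gauged_action (P r) (x - t) (x + t)
      = 2 * h x * sin t - (potential (P r) (x + t) - potential (P r) (x - t))"
      by (simp add: gauged_action_def action_def)
    ultimately have "2 * h x * sin t - 2 * t * (h x - 2 * e3) \<le> K * r" using K(2)[OF r(1) r'] by simp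
    then show ?thesis using sin by (simp add: algebra_simps)
  qed
  define r where "r = min (1/8) (t * e3 / (K + 1))"
  have r: "0 < r" "r < 1/4" using t e3 K(1) by (auto simp: r_def min_def)
  have "K * r \<le> (K + 1) * (t * e3 / (K + 1))" using K(1) r by (intro mult_mono) (auto simp: r_def)
  also have "\<dots> = t * e3" using K(1) by simp
  finally have "3 * t * e3 \<le> t * e3" using bound[OF r] by linarith
  then show False using t(1) e3 by simp
qed

section \<open>The leaf through a given line\<close>

lemma leaf_exists:
  assumes "P (1/4) x < p" "p < h x"
  shows "\<exists>!r. 0 < r \<and> r < 1/4 \<and> P r x = p"
proof -
  obtain r0 where r0: "0 < r0" "r0 < 1/4" "p < P r0 x" using family_fills[of "h x - p" x] assms by auto
  have "continuous_on {r0..1/4} (\<lambda>r. case (r, x) of (r, x) \<Rightarrow> P r x)"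
    by (rule continuous_on_compose2[OF family_continuous]) (use r0 in \<open>auto intro!: continuous_intros\<close>)
  then have "continuous_on {r0..1/4} (\<lambda>r. P r x)" by simp
  then have "\<exists>r. r0 \<le> r \<and> r \<le> 1/4 \<and> P r x = p" using r0 assms by (intro IVT2') auto
  then obtain r where r: "r0 \<le> r" "r \<le> 1/4" "P r x = p" by blast
  have "r < 1/4" using r assms by (cases "r = 1/4") auto
  show ?thesis
  proof (rule ex1I[of _ r])
    show "0 < r \<and> r < 1/4 \<and> P r x = p" using r r0 \<open>r < 1/4\<close> by simp
    show "s = r" if "0 < s \<and> s < 1/4 \<and> P s x = p" for s
      using strict_anti[of s r x] strict_anti[of r s x] that r r0 by (cases s r rule: linorder_cases) auto
  qed
qed

definition leaf :: "real \<Rightarrow> real \<Rightarrow> real" where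
  "leaf x p = (THE r. 0 < r \<and> r < 1/4 \<and> P r x = p)"

lemma leaf:
  assumes "P (1/4) x < p" "p < h x"
  shows "0 < leaf x p" "leaf x p < 1/4" "P (leaf x p) x = p"
  using theI'[OF leaf_exists[OF assms]] by (auto simp: leaf_def)

lemma leaf_eq: "0 < r \<Longrightarrow> r < 1/4 \<Longrightarrow> leaf x (P r x) = r"
  using leaf_exists[of x "P r x"] strict_anti[of r "1/4" x] graph_below_h[OF ig, of r x]
  by (auto simp: leaf_def intro!: the1_equality)

definition phase_region :: "(real \<times> real) set" where
  "phase_region = {(x, p). P (1/4) x < p \<and> p < h x}"

lemma phase_region_open: "open phase_region"
proof -
  have "continuous_on UNIV (P (1/4))" using invariant_graphD(1)[OF ig] by auto
  then have "open {z. P (1/4) (fst z) < snd z}" "open {z. snd z < h (fst z)}"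
    by (auto intro!: open_Collect_less continuous_intros continuous_on_compose2[of UNIV "P (1/4)"])
  moreover have "phase_region = {z. P (1/4) (fst z) < snd z} \<inter> {z. snd z < h (fst z)}"
    by (auto simp: phase_region_def)
  ultimately show ?thesis by auto
qed

text \<open>Since the graphs are strictly ordered, comparing the leaf of \<open>(y, q)\<close> with
  \<open>s\<close> means comparing \<open>q\<close> with \<open>P s y\<close>, an open
  condition.\<close>

lemma leaf_continuous: "continuous_on phase_region (\<lambda>(x, p). leaf x p)"
proof -
  have "isCont (\<lambda>(x, p). leaf x p) z" if z: "z \<in> phase_region" for z
  proof -
    obtain x p where xp: "z = (x, p)" "P (1/4) x < p" "p < h x" using z by (auto simp: phase_region_def)
    define r where "r = leaf x p"
    have r: "0 < r" "r < 1/4" "P r x = p" using leaf[OF xp(2,3)] by (auto simp: r_def)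
    have nh: "\<forall>\<^sub>F w in at z. w \<in> phase_region"
      using phase_region_open z by (intro eventually_at_in_open') auto
    have Pc: "continuous_on UNIV (P s)" if "0 < s" "s \<le> 1/4" for s using invariant_graphD(1)[OF ig[OF that]] .
    show ?thesis unfolding isCont_def
    proof (rule order_tendstoI)
      fix l assume "l < (case z of (x, p) \<Rightarrow> leaf x p)"
      then have "l < r" by (simp add: xp r_def)
      define s where "s = max l (r / 2)"
      have s: "0 < s" "s < r" "l \<le> s" "s \<le> 1/4" using \<open>l < r\<close> r by (auto simp: s_def)
      have "open {w. snd w < P s (fst w)}"
        by (intro open_Collect_less continuous_intros continuous_on_compose2[OF Pc[OF s(1,4)]]) auto
      moreover have "z \<in> {w. snd w < P s (fst w)}" using strict_anti[of s r x] s r xp by simp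
      ultimately have "\<forall>\<^sub>F w in at z. w \<in> {w. snd w < P s (fst w)}" by (intro eventually_at_in_open')
      then show "\<forall>\<^sub>F w in at z. l < (case w of (x, p) \<Rightarrow> leaf x p)"
        using nh
      proof eventually_elim
        case (elim w)
        obtain y q where w: "w = (y, q)" "P (1/4) y < q" "q < h y" using elim by (auto simp: phase_region_def)
        have "P (leaf y q) y < P s y" using elim w leaf(3)[OF w(2,3)] by simp
        then have "s < leaf y q" using family_less_iff[of s "leaf y q" y] leaf[OF w(2,3)] s by simp
        then show ?case using s w by simp
      qed
    next
      fix l assume "(case z of (x, p) \<Rightarrow> leaf x p) < l"
      then have "r < l" by (simp add: xp r_def)
      define s where "s = min l (1/4)"
      have s: "0 < s" "r < s" "s \<le> l" "s \<le> 1/4" using \<open>r < l\<close> r by (auto simp: s_def)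
      have "open {w. P s (fst w) < snd w}"
        by (intro open_Collect_less continuous_intros continuous_on_compose2[OF Pc[OF s(1,4)]]) auto
      moreover have "z \<in> {w. P s (fst w) < snd w}" using strict_anti[of r s x] s r xp by simp
      ultimately have "\<forall>\<^sub>F w in at z. w \<in> {w. P s (fst w) < snd w}" by (intro eventually_at_in_open')
      then show "\<forall>\<^sub>F w in at z. (case w of (x, p) \<Rightarrow> leaf x p) < l"
        using nh
      proof eventually_elim
        case (elim w)
        obtain y q where w: "w = (y, q)" "P (1/4) y < q" "q < h y" using elim by (auto simp: phase_region_def)
        have "P s y < P (leaf y q) y" using elim w leaf(3)[OF w(2,3)] by simp
        then have "leaf y q < s" using family_less_iff[of "leaf y q" s y] leaf[OF w(2,3)] s by simp
        then show ?case using s w by simp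
      qed
    qed
  qed
  then show ?thesis by (simp add: continuous_at_imp_continuous_on)
qed

text \<open>The leaf is a first integral of the billiard: incoming and outgoing line of a chord
  shorter than that of the caustic 1/4 lie on the same leaf, and the chord is a chord of that
  leaf.\<close>

lemma chord_leaf:
  assumes "x < y" "y < F (1/4) x"
  shows "(x, p_in x y) \<in> phase_region" "(y, p_out x y) \<in> phase_region"
    "leaf y (p_out x y) = leaf x (p_in x y)" "F (leaf x (p_in x y)) x = y"
proof -
  have g4: "invariant_graph (P (1/4)) (F (1/4))" by (rule ig) auto
  have b: "x \<le> y" "y \<le> x + 2 * pi" using assms invariant_graphD(4)[OF g4, of x] by auto
  have "P (1/4) x < p_in x y" using below_f_iff[OF g4 b] assms by simp
  moreover have "p_in x y < h x" using p_in_strict[of x x y] assms b by (simp add: p_in_diag)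
  ultimately show 1: "(x, p_in x y) \<in> phase_region" by (simp add: phase_region_def)
  have "P (1/4) y < p_out x y" using head_below_iff[OF g4 b] assms by simp
  moreover have "p_out x y < h y" using p_out_strict[of y x y] assms b by (simp add: p_out_diag)
  ultimately show "(y, p_out x y) \<in> phase_region" by (simp add: phase_region_def)
  define r where "r = leaf x (p_in x y)"
  have r: "0 < r" "r < 1/4" "P r x = p_in x y" using leaf[of x "p_in x y"] 1 by (auto simp: r_def phase_region_def)
  have g: "invariant_graph (P r) (F r)" using ig r by simp
  show F: "F (leaf x (p_in x y)) x = y" using eq_f_iff[OF g b] r by (simp add: r_def)
  have "p_out x y = P r y" using invariant_graphD(6)[OF g, of x] F by (simp add: r_def)
  then show "leaf y (p_out x y) = leaf x (p_in x y)" using leaf_eq[OF r(1,2), of y] by (simp add: r_def)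
qed

end

section \<open>Parametrizing the boundary by its normal angle\<close>

lemma real_antiderivative:
  fixes f :: "real \<Rightarrow> real"
  assumes "continuous_on UNIV f" shows "\<exists>u. \<forall>x. (u has_real_derivative f x) (at x)"
proof -
  have "\<exists>u. \<forall>x. - \<infinity> < ereal x \<longrightarrow> ereal x < \<infinity> \<longrightarrow> (u has_vector_derivative f x) (at x)"
    using assms by (intro einterval_antiderivative) (auto simp: continuous_on_eq_continuous_at)
  then show ?thesis by (simp add: has_real_derivative_iff_has_vector_derivative)
qed

lemma C1_on_UNIV:
  fixes f :: "real \<Rightarrow> complex"
  assumes "f C1_differentiable_on UNIV"
  shows "(f has_vector_derivative vector_derivative f (at t)) (at t)"
    "continuous_on UNIV (\<lambda>t. vector_derivative f (at t))"
proof -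
  obtain D where D: "\<And>x. (f has_vector_derivative D x) (at x)" "continuous_on UNIV D"
    using assms unfolding C1_differentiable_on_def by auto
  have "D = (\<lambda>t. vector_derivative f (at t))" using vector_derivative_at[OF D(1)] by auto
  then show "(f has_vector_derivative vector_derivative f (at t)) (at t)"
    "continuous_on UNIV (\<lambda>t. vector_derivative f (at t))" using D by auto
qed

lemma vector_deriv_Re_Im:
  assumes "(f has_vector_derivative d) (at t)"
  shows "((\<lambda>t. Re (f t)) has_real_derivative Re d) (at t)" "((\<lambda>t. Im (f t)) has_real_derivative Im d) (at t)"
  using bounded_linear.has_vector_derivative[OF bounded_linear_Re assms]
    bounded_linear.has_vector_derivative[OF bounded_linear_Im assms]
  by (simp_all add: has_real_derivative_iff_has_vector_derivative)

lemma sin_nonneg_connected: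
  fixes A :: "real set"
  assumes "connected A" "0 \<in> A" "\<And>a. a \<in> A \<Longrightarrow> 0 \<le> sin a" "a \<in> A" shows "0 \<le> a \<and> a \<le> pi"
proof (rule ccontr)
  assume "\<not> ?thesis"
  then consider "a < 0" | "pi < a" by linarith
  then show False
  proof cases
    case 1
    define b where "b = max a (- pi / 2)"
    have "b \<in> A" using connectedD_interval[OF assms(1) assms(4,2), of b] 1 by (auto simp: b_def)
    moreover have "0 < sin (- b)" using 1 by (intro sin_gt_zero) (auto simp: b_def max_def)
    ultimately show False using assms(3)[of b] by simp
  next
    case 2
    define b where "b = min a (3 * pi / 2)"
    have "b \<in> A" using connectedD_interval[OF assms(1) assms(2,4), of b] 2 pi_gt_zero by (auto simp: b_def)
    moreover have "0 < sin (b - pi)" using 2 by (intro sin_gt_zero) (auto simp: b_def min_def)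
    ultimately show False using assms(3)[of b] by (simp add: sin_diff)
  qed
qed

lemma cos_neg_connected:
  fixes A :: "real set"
  assumes "connected A" "\<And>a. a \<in> A \<Longrightarrow> cos a < 0" "a \<in> A" "b \<in> A" shows "b < a + pi"
proof (rule ccontr)
  assume "\<not> b < a + pi"
  then have "a + pi \<in> A" using connectedD_interval[OF assms(1,3,4), of "a + pi"] by auto
  then show False using assms(2)[of a] assms(2)[of "a + pi"] assms(3) by simp
qed

text \<open>Hopf's argument: the direction of the secants from \<open>s\<close> to \<open>t\<close> has a continuous angle on the triangle
  \<open>0 \<le> s \<le> t \<le> 1\<close>, cut off near the corner \<open>(0, 1)\<close>. On the diagonal it is the tangent angle; starting at a lowest
  point, it stays in one half plane along each of the two other sides.\<close>

lemma turning_le_one: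
  fixes \<gamma> V :: "real \<Rightarrow> complex" and \<theta> :: "real \<Rightarrow> real" and k :: int
  assumes deriv: "\<And>t. (\<gamma> has_vector_derivative V t) (at t)" and Vc: "continuous_on UNIV V"
    and per: "\<And>t. \<gamma> (t + 1) = \<gamma> t" and Vper: "\<And>t. V (t + 1) = V t"
    and inj: "\<And>s t. s < t \<Longrightarrow> t < s + 1 \<Longrightarrow> \<gamma> s \<noteq> \<gamma> t"
    and V: "\<And>t. V t = norm (V t) *\<^sub>R cis (\<theta> t)" "\<And>t. V t \<noteq> 0" and \<theta>: "continuous_on UNIV \<theta>"
    and k: "\<theta> 1 = \<theta> 0 + 2 * pi * of_int k"
    and low: "\<And>t. Im (\<gamma> 0) \<le> Im (\<gamma> t)" and V0: "Im (V 0) = 0" "0 < Re (V 0)"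
  shows "k \<le> 1"
proof -
  \<comment> \<open>The secant divided by \<open>t - s\<close>, as an integral of the velocity, so
    that it extends continuously to the diagonal.\<close>
  define D where "D = (\<lambda>(s, t). integral {0..1} (\<lambda>u. V (s + u * (t - s))))"
  have Dc: "continuous_on UNIV D"
    unfolding D_def split_def box_real[symmetric]
    by (rule integral_continuous_on_param)
      (auto simp: split_def intro!: continuous_intros continuous_on_compose2[OF Vc])
  have sec: "(t - s) *\<^sub>R D (s, t) = \<gamma> t - \<gamma> s" for s t
  proof -
    have "((\<lambda>u. (t - s) *\<^sub>R V (s + u * (t - s))) has_integral \<gamma> (s + 1 * (t - s)) - \<gamma> (s + 0 * (t - s))) {0..1}"
    proof (rule fundamental_theorem_of_calculus)
      fix u :: real
      have "((\<gamma> \<circ> (\<lambda>u. s + u * (t - s))) has_vector_derivative (t - s) *\<^sub>R V (s + u * (t - s))) (at u within {0..1})"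
        by (rule vector_diff_chain_within)
          (auto intro!: derivative_eq_intros has_vector_derivative_at_within[OF deriv])
      then show "((\<lambda>u. \<gamma> (s + u * (t - s))) has_vector_derivative (t - s) *\<^sub>R V (s + u * (t - s))) (at u within {0..1})"
        by (simp add: o_def)
    qed simp
    then have "integral {0..1} (\<lambda>u. (t - s) *\<^sub>R V (s + u * (t - s))) = \<gamma> (s + 1 * (t - s)) - \<gamma> (s + 0 * (t - s))"
      by (rule integral_unique)
    then show ?thesis unfolding D_def by simp
  qed
  have Ddiag: "D (s, s) = V s" for s by (simp add: D_def)
  have D0: "D (s, t) \<noteq> 0" if "s \<le> t" "t < s + 1" for s t
    using sec[where s = s and t = t] inj[of s t] that V(2)[of s] Ddiag by (cases "s = t") auto
  have "isCont D (0, 0)" using Dc by (simp add: continuous_on_eq_continuous_at)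
  then have ReD: "((\<lambda>z. Re (D z)) \<longlongrightarrow> Re (D (0, 0))) (at (0, 0))" unfolding isCont_def by (rule tendsto_Re)
  have "\<forall>\<^sub>F z in at (0, 0). 0 < Re (D z)"
    by (rule order_tendstoD(1)[OF ReD]) (use V0 Ddiag in simp)
  then obtain d where d: "d > 0" "\<And>z. z \<noteq> (0, 0) \<Longrightarrow> dist z (0, 0) < d \<Longrightarrow> 0 < Re (D z)"
    by (auto simp: eventually_at)
  define \<epsilon> where "\<epsilon> = min (d / 3) (1/4)"
  have \<epsilon>: "0 < \<epsilon>" "\<epsilon> \<le> 1/4" "3 * \<epsilon> \<le> d" using d by (auto simp: \<epsilon>_def)
  \<comment> \<open>Along the cut, by periodicity, the long secant is the reverse of a short one
    that runs close to the parameter 0, whose direction is near \<open>V 0\<close>.\<close>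
  have edge: "Re (D (s, s + 1 - \<epsilon>)) < 0" if s: "0 \<le> s" "s \<le> \<epsilon>" for s
  proof -
    have Dp: "D (s - \<epsilon>, s) = D (s + 1 - \<epsilon>, s + 1)"
    proof -
      have "V (s - \<epsilon> + u * (s - (s - \<epsilon>))) = V (s + 1 - \<epsilon> + u * (s + 1 - (s + 1 - \<epsilon>)))" for u
        using Vper[of "s - \<epsilon> + u * (s - (s - \<epsilon>))"] by (simp add: algebra_simps)
      then show ?thesis by (simp add: D_def)
    qed
    have "dist (s - \<epsilon>, s) (0, 0) \<le> \<bar>s - \<epsilon>\<bar> + \<bar>s\<bar>"
      by (simp add: dist_Pair_Pair dist_real_def sqrt_sum_squares_le_sum_abs)
    also have "\<dots> < d" using s \<epsilon> by simp
    finally have "0 < Re (D (s - \<epsilon>, s))" using d(2)[of "(s - \<epsilon>, s)"] \<epsilon>(1) by auto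
    moreover have "(1 - \<epsilon>) *\<^sub>R D (s, s + 1 - \<epsilon>) = - (\<epsilon> *\<^sub>R D (s + 1 - \<epsilon>, s + 1))"
      using sec[where s = s and t = "s + 1 - \<epsilon>"] sec[where s = "s + 1 - \<epsilon>" and t = "s + 1"] per[of s] by simp
    then have "(1 - \<epsilon>) * Re (D (s, s + 1 - \<epsilon>)) = - (\<epsilon> * Re (D (s - \<epsilon>, s)))"
      unfolding Dp by (metis scaleR_complex.sel(1) uminus_complex.sel(1))
    ultimately have "(1 - \<epsilon>) * Re (D (s, s + 1 - \<epsilon>)) < 0" using \<epsilon> by simp
    then show ?thesis using \<epsilon> by (simp add: mult_less_0_iff)
  qed
  \<comment> \<open>The corner is removed because the secant over the whole period vanishes; on the
    remaining convex set \<open>D\<close> has a continuous logarithm.\<close>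
  define T where "T = {z :: real \<times> real. 0 \<le> fst z \<and> fst z \<le> snd z \<and> snd z \<le> 1 \<and> snd z - fst z \<le> 1 - \<epsilon>}"
  have "convex T"
  proof -
    have "T = {z. inner (-1, 0) z \<le> 0} \<inter> {z. inner (1, -1) z \<le> 0} \<inter> {z. inner (0, 1) z \<le> 1} \<inter> {z. inner (-1, 1) z \<le> 1 - \<epsilon>}"
      by (auto simp: T_def inner_prod_def)
    then show ?thesis by (auto intro!: convex_Int convex_halfspace_le)
  qed
  then have "contractible T" by (rule convex_imp_contractible)
  moreover have "D z \<noteq> 0" if "z \<in> T" for z using that D0[of "fst z" "snd z"] \<epsilon> by (auto simp: T_def)
  ultimately obtain L where L: "continuous_on T L" "\<And>z. z \<in> T \<Longrightarrow> D z = exp (L z)"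
    using continuous_logarithm_on_contractible[OF continuous_on_subset[OF Dc subset_UNIV]] by metis
  define \<alpha> where "\<alpha> z = Im (L z) - Im (L (0, 0))" for z
  have T00: "(0, 0) \<in> T" using \<epsilon> by (simp add: T_def)
  have ac: "continuous_on T \<alpha>" unfolding \<alpha>_def by (intro continuous_intros L(1))
  have L0: "sin (Im (L (0, 0))) = 0" "0 < cos (Im (L (0, 0)))"
    using L(2)[OF T00] V0 Ddiag[of 0] by (auto simp: complex_eq_iff Re_exp Im_exp zero_less_mult_iff)
  then have cos1: "cos (Im (L (0, 0))) = 1"
    using sin_cos_squared_add[of "Im (L (0, 0))"] by (auto simp: power2_eq_1_iff)
  have sa: "sin (\<alpha> z) = sin (Im (L z))" "cos (\<alpha> z) = cos (Im (L z))" for z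
    by (simp_all add: \<alpha>_def sin_diff cos_diff L0 cos1)
  have Da: "Im (D z) = exp (Re (L z)) * sin (\<alpha> z)" "Re (D z) = exp (Re (L z)) * cos (\<alpha> z)" if "z \<in> T" for z
    using L(2)[OF that] sa by (simp_all add: Re_exp Im_exp)
  have conn: "connected (\<alpha> ` (g ` I))" if "connected I" "continuous_on I g" "g ` I \<subseteq> T" for g :: "real \<Rightarrow> real \<times> real" and I
    using that by (intro connected_continuous_image continuous_on_subset[OF ac]) auto
  have diag: "\<alpha> (1, 1) = 2 * pi * of_int k"
  proof -
    have TD: "(s, s) \<in> T" if "s \<in> {0..1}" for s using that \<epsilon> by (auto simp: T_def)
    define \<beta> where "\<beta> s = (\<alpha> (s, s) - \<theta> s) / (2 * pi)" for s
    have \<beta>Z: "\<beta> s \<in> \<int>" if s: "s \<in> {0..1}" for s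
    proof -
      have "norm (V s) * cos (\<theta> s) = exp (Re (L (s, s))) * cos (\<alpha> (s, s))"
        "norm (V s) * sin (\<theta> s) = exp (Re (L (s, s))) * sin (\<alpha> (s, s))"
        using Da[OF TD[OF s]] V(1)[of s] Ddiag[of s]
        by (metis cis.sel(1) scaleR_complex.sel(1), metis cis.sel(2) scaleR_complex.sel(2))
      moreover have "exp (Re (L (s, s))) = norm (V s)" using L(2)[OF TD[OF s]] Ddiag[of s] by simp
      ultimately have "cos (\<theta> s) = cos (\<alpha> (s, s))" "sin (\<theta> s) = sin (\<alpha> (s, s))" using V(2)[of s] by auto
      then have "cos (\<alpha> (s, s) - \<theta> s) = 1" by (simp add: cos_diff)
      then obtain j :: int where "\<alpha> (s, s) - \<theta> s = of_int j * 2 * pi" using cos_one_2pi_int by blast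
      then have "\<beta> s = of_int j" by (simp add: \<beta>_def)
      then show ?thesis by simp
    qed
    have \<beta>c: "continuous_on {0..1} \<beta>"
    proof -
      have "continuous_on {0..1} (\<lambda>s. \<alpha> (s, s))"
        by (rule continuous_on_compose2[OF ac]) (use TD in \<open>auto intro!: continuous_intros\<close>)
      then show ?thesis unfolding \<beta>_def by (intro continuous_intros continuous_on_subset[OF \<theta>]) auto
    qed
    have "\<beta> constant_on {0..1}"
    proof (rule continuous_discrete_range_constant[OF _ \<beta>c])
      fix x :: real assume x: "x \<in> {0..1}"
      have "1 \<le> norm (\<beta> y - \<beta> x)" if "y \<in> {0..1}" "\<beta> y \<noteq> \<beta> x" for y
        using Ints_nonzero_abs_ge1[OF Ints_diff[OF \<beta>Z[OF that(1)] \<beta>Z[OF x]]] that(2) by simp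
      then show "\<exists>e>0. \<forall>y. y \<in> {0..1} \<and> \<beta> y \<noteq> \<beta> x \<longrightarrow> e \<le> norm (\<beta> y - \<beta> x)"
        by (intro exI[of _ 1]) auto
    qed simp
    then have "\<beta> 1 = \<beta> 0" by (auto simp: constant_on_def)
    moreover have "\<alpha> (0, 0) = 0" by (simp add: \<alpha>_def)
    ultimately show ?thesis using k by (simp add: \<beta>_def field_simps)
  qed
  have side1: "\<alpha> (0, 1 - \<epsilon>) \<le> pi"
  proof -
    let ?A = "\<alpha> ` ((\<lambda>t. (0, t)) ` {0..1 - \<epsilon>})"
    have sub: "(\<lambda>t. (0, t)) ` {0..1 - \<epsilon>} \<subseteq> T" using \<epsilon> by (auto simp: T_def)
    have "0 \<le> \<alpha> (0, 1 - \<epsilon>) \<and> \<alpha> (0, 1 - \<epsilon>) \<le> pi"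
    proof (rule sin_nonneg_connected[of ?A])
      show "connected ?A" by (rule conn[OF _ _ sub]) (auto intro!: continuous_intros)
      show "0 \<in> ?A" using \<epsilon> by (intro image_eqI[of _ _ "(0, 0)"]) (auto simp: \<alpha>_def)
      fix a assume "a \<in> ?A"
      then obtain t where t: "0 \<le> t" "t \<le> 1 - \<epsilon>" "a = \<alpha> (0, t)" by auto
      have "0 \<le> Im (D (0, t))"
      proof (cases "t = 0")
        case False
        have "t * Im (D (0, t)) = Im (\<gamma> t) - Im (\<gamma> 0)"
          using arg_cong[OF sec[where s = 0 and t = t], of Im] by simp
        then show ?thesis using low[of t] t False by (metis diff_ge_0_iff_ge less_eq_real_def mult_pos_neg not_le)
      qed (use Ddiag V0 in simp)
      moreover have "(0, t) \<in> T" using sub t by auto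
      ultimately show "0 \<le> sin a" using Da(1)[of "(0, t)"] t by (simp add: zero_le_mult_iff)
    qed (use \<epsilon> in auto)
    then show ?thesis by simp
  qed
  have side2: "2 * pi * of_int k - pi \<le> \<alpha> (\<epsilon>, 1)"
  proof -
    let ?A = "(\<lambda>z. 2 * pi * of_int k - \<alpha> z) ` ((\<lambda>s. (s, 1)) ` {\<epsilon>..1})"
    have sub: "(\<lambda>s. (s, 1)) ` {\<epsilon>..1} \<subseteq> T" using \<epsilon> by (auto simp: T_def)
    have "0 \<le> 2 * pi * of_int k - \<alpha> (\<epsilon>, 1) \<and> 2 * pi * of_int k - \<alpha> (\<epsilon>, 1) \<le> pi"
    proof (rule sin_nonneg_connected[of ?A])
      show "connected ?A" using sub
        by (intro connected_continuous_image continuous_intros continuous_on_subset[OF ac]) auto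
      show "0 \<in> ?A" using \<epsilon> diag by (intro image_eqI[of _ _ "(1, 1)"]) auto
      fix a assume "a \<in> ?A"
      then obtain s where s: "\<epsilon> \<le> s" "s \<le> 1" "a = 2 * pi * of_int k - \<alpha> (s, 1)" by auto
      have "Im (D (s, 1)) \<le> 0"
      proof (cases "s = 1")
        case False
        have "(1 - s) * Im (D (s, 1)) = Im (\<gamma> 0) - Im (\<gamma> s)"
          using arg_cong[OF sec[where s = s and t = 1], of Im] per[of 0] by simp
        then show ?thesis using low[of s] s False by (smt (verit) mult_pos_pos)
      next
        case True
        then show ?thesis using Ddiag[of 1] Vper[of 0] V0 by simp
      qed
      moreover have "(s, 1) \<in> T" using sub s by auto
      ultimately have "sin (\<alpha> (s, 1)) \<le> 0" using Da(1)[of "(s, 1)"] by (simp add: mult_le_0_iff)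
      moreover have "sin (2 * pi * of_int k) = 0" "cos (2 * pi * of_int k) = 1"
        using sin_int_2pin[of k] cos_int_2pin[of k] by (simp_all add: mult_ac)
      ultimately show "0 \<le> sin a" using s by (simp add: sin_diff)
    qed (use \<epsilon> in auto)
    then show ?thesis by simp
  qed
  have "\<alpha> (\<epsilon>, 1) < \<alpha> (0, 1 - \<epsilon>) + pi"
  proof -
    let ?A = "\<alpha> ` ((\<lambda>s. (s, s + 1 - \<epsilon>)) ` {0..\<epsilon>})"
    have sub: "(\<lambda>s. (s, s + 1 - \<epsilon>)) ` {0..\<epsilon>} \<subseteq> T" using \<epsilon> by (auto simp: T_def)
    show ?thesis
    proof (rule cos_neg_connected[of ?A])
      show "connected ?A" by (rule conn[OF _ _ sub]) (auto intro!: continuous_intros)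
      show "cos a < 0" if "a \<in> ?A" for a
      proof -
        obtain s where s: "0 \<le> s" "s \<le> \<epsilon>" "a = \<alpha> (s, s + 1 - \<epsilon>)" using \<open>a \<in> ?A\<close> by auto
        have "(s, s + 1 - \<epsilon>) \<in> T" using sub s by auto
        then show ?thesis using Da(2)[of "(s, s + 1 - \<epsilon>)"] edge[OF s(1,2)] s(3) by (simp add: mult_less_0_iff)
      qed
      show "\<alpha> (0, 1 - \<epsilon>) \<in> ?A" using \<epsilon> by (intro image_eqI[of _ _ "(0, 1 - \<epsilon>)"]) (auto intro!: image_eqI[of _ _ 0])
      show "\<alpha> (\<epsilon>, 1) \<in> ?A" using \<epsilon> by (intro image_eqI[of _ _ "(\<epsilon>, 1)"]) (auto intro!: image_eqI[of _ _ \<epsilon>])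
    qed
  qed
  \<comment> \<open>Each of the two sides contributes at most half a turn and the cut corner less
    than another half, which leaves fewer than one and a half turns.\<close>
  then have "2 * pi * of_int k < 3 * pi" using side1 side2 by linarith
  then have "of_int k < (3/2 :: real)" by simp
  then show ?thesis by linarith
qed


text \<open>Integrating the logarithmic derivative \<open>A / V\<close> gives the angle together
  with its derivative, which a topological lift would not; \<open>V\<close> times the exponential of
  minus the integral is constant, and its argument is the constant of integration.\<close>

lemma tangent_angle_exists:
  fixes V A :: "real \<Rightarrow> complex"
  assumes deriv: "\<And>t. (V has_vector_derivative A t) (at t)" and Ac: "continuous_on UNIV A"
    and V0: "\<And>t. V t \<noteq> 0"
  shows "\<exists>\<theta>. (\<forall>t. (\<theta> has_real_derivative Im (A t / V t)) (at t)) \<and> (\<forall>t. V t = norm (V t) *\<^sub>R cis (\<theta> t))"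
proof -
  define q where "q t = A t / V t" for t
  have Vc: "continuous_on UNIV V"
    using deriv by (meson continuous_at_imp_continuous_on has_vector_derivative_continuous)
  have qc: "continuous_on UNIV q" unfolding q_def using V0 by (intro continuous_intros Ac Vc) auto
  obtain w where w: "\<And>t. (w has_real_derivative Re (q t)) (at t)"
    using real_antiderivative[of "\<lambda>t. Re (q t)"] qc by (auto intro: continuous_intros)
  obtain \<theta> where \<theta>: "\<And>t. (\<theta> has_real_derivative Im (q t)) (at t)"
    using real_antiderivative[of "\<lambda>t. Im (q t)"] qc by (auto intro: continuous_intros)
  define E where "E t = exp (- (of_real (w t) + \<i> * of_real (\<theta> t)))" for t
  have wv: "((\<lambda>t. - (of_real (w t) + \<i> * of_real (\<theta> t))) has_vector_derivative - q t) (at t)" for t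
  proof -
    have "((\<lambda>t. - (of_real (w t) + \<i> * of_real (\<theta> t))) has_vector_derivative
        - (of_real (Re (q t)) + \<i> * of_real (Im (q t)))) (at t)"
      by (intro has_vector_derivative_minus has_vector_derivative_add has_vector_derivative_mult_right
          has_vector_derivative_of_real w \<theta>)
    then show ?thesis by (simp add: complex_eq[symmetric])
  qed
  have E: "(E has_vector_derivative - q t * E t) (at t)" for t
    using field_vector_diff_chain_at[OF wv DERIV_exp, of t] unfolding E_def[abs_def] by (simp only: o_def)
  have "((\<lambda>t. V t * E t) has_vector_derivative 0) (at t within UNIV)" for t
  proof -
    have "((\<lambda>t. V t * E t) has_vector_derivative V t * (- q t * E t) + A t * E t) (at t)"
      by (intro has_vector_derivative_mult deriv E)
    then show ?thesis using V0[of t] by (simp add: q_def)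
  qed
  then obtain K where K: "\<And>t. V t * E t = K" using has_vector_derivative_zero_constant[of UNIV "\<lambda>t. V t * E t"] by auto
  have VK: "V t = K * exp (of_real (w t) + \<i> * of_real (\<theta> t))" for t
  proof -
    have "V t * E t * exp (of_real (w t) + \<i> * of_real (\<theta> t)) = V t"
      by (simp only: E_def mult.assoc exp_add[symmetric]) (simp add: exp_minus)
    then show ?thesis using K by simp
  qed
  have K0: "K \<noteq> 0" using VK V0 by force
  have e: "exp (of_real (w t) + \<i> * of_real (\<theta> t)) = exp (w t) *\<^sub>R cis (\<theta> t)" for t
    by (simp add: exp_add exp_of_real cis_conv_exp scaleR_conv_of_real)
  have n: "norm (V t) = norm K * exp (w t)" for t by (simp add: VK norm_mult e)
  have "V t = norm (V t) *\<^sub>R cis (\<theta> t + Arg K)" for t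
  proof -
    have "K = norm K *\<^sub>R cis (Arg K)" using K0 by (metis cis_Arg sgn_div_norm complex_norm_eq_1_exp scaleR_scaleR scaleR_one right_inverse norm_eq_zero)
    then have "V t = (norm K *\<^sub>R cis (Arg K)) * (exp (w t) *\<^sub>R cis (\<theta> t))" using VK e by metis
    then show ?thesis unfolding n by (simp add: cis_mult[symmetric] mult_ac)
  qed
  moreover have "((\<lambda>t. \<theta> t + Arg K) has_real_derivative Im (A t / V t)) (at t)" for t
    using DERIV_add[OF \<theta> DERIV_const] by (simp add: q_def)
  ultimately show ?thesis by blast
qed

lemma closed_curve_inj:
  fixes \<gamma> :: "real \<Rightarrow> complex"
  assumes per: "\<And>t. \<gamma> (t + 1) = \<gamma> t" and inj: "inj_on \<gamma> {0..<1}" and st: "s < t" "t < s + 1"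
  shows "\<gamma> s \<noteq> \<gamma> t"
proof
  assume e: "\<gamma> s = \<gamma> t"
  obtain j y where j: "s = y + 1 * of_int j" "0 \<le> y" "y < 1" by (rule reduce_mod_period[OF zero_less_one])
  obtain m z where m: "t = z + 1 * of_int m" "0 \<le> z" "z < 1" by (rule reduce_mod_period[OF zero_less_one])
  have "\<gamma> y = \<gamma> z" using e periodic_int[of \<gamma> 1 y j] periodic_int[of \<gamma> 1 z m] per j m by simp
  then have "y = z" using inj j m by (auto simp: inj_on_def)
  then have "of_int j < (of_int m :: real)" "(of_int m :: real) < of_int (j + 1)" using st j m by simp_all
  then show False unfolding of_int_less_iff by simp
qed

text \<open>The tangent angle grows by a whole number of turns. There is at least one since it
  increases, and at most one by Hopf's argument started at a lowest point.\<close>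

lemma positive_curvature_turning:
  fixes \<gamma> V A :: "real \<Rightarrow> complex" and \<theta> :: "real \<Rightarrow> real"
  assumes deriv: "\<And>t. (\<gamma> has_vector_derivative V t) (at t)" "\<And>t. (V has_vector_derivative A t) (at t)"
    and Ac: "continuous_on UNIV A"
    and per: "\<And>t. \<gamma> (t + 1) = \<gamma> t" and Vper: "\<And>t. V (t + 1) = V t" and Aper: "\<And>t. A (t + 1) = A t"
    and inj: "inj_on \<gamma> {0..<1}" and V0: "\<And>t. V t \<noteq> 0" and curv: "\<And>t. 0 < Im (cnj (V t) * A t)"
    and \<theta>: "\<And>t. (\<theta> has_real_derivative Im (A t / V t)) (at t)" and V: "\<And>t. V t = norm (V t) *\<^sub>R cis (\<theta> t)"
  shows "0 < Im (A t / V t)" "\<theta> (t + 1) = \<theta> t + 2 * pi"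
proof -
  show pos: "0 < Im (A t / V t)" for t
  proof -
    have "A t / V t = A t * cnj (V t) / of_real ((norm (V t))\<^sup>2)" by (rule complex_div_cnj)
    then have "Im (A t / V t) = Im (cnj (V t) * A t) / (norm (V t))\<^sup>2" by (simp add: mult.commute)
    then show ?thesis using curv V0 by simp
  qed
  have Vc: "continuous_on UNIV V"
    using deriv(2) by (meson continuous_at_imp_continuous_on has_vector_derivative_continuous)
  have \<theta>c: "continuous_on UNIV \<theta>" using \<theta> by (meson DERIV_isCont continuous_at_imp_continuous_on)
  have gc: "continuous_on UNIV \<gamma>"
    using deriv(1) by (meson continuous_at_imp_continuous_on has_vector_derivative_continuous)
  have \<theta>mono: "\<theta> s < \<theta> t" if "s < t" for s t
    by (rule DERIV_pos_imp_increasing[OF that]) (use \<theta> pos in blast)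
  have "((\<lambda>t. \<theta> (t + 1) - \<theta> t) has_real_derivative Im (A (t + 1) / V (t + 1)) - Im (A t / V t)) (at t)" for t
    by (intro DERIV_diff DERIV_shift[THEN iffD1] \<theta>)
  then have "((\<lambda>t. \<theta> (t + 1) - \<theta> t) has_real_derivative 0) (at t)" for t using Aper Vper by simp
  then have const: "\<theta> (t + 1) - \<theta> t = \<theta> (0 + 1) - \<theta> 0" for t by (rule DERIV_isconst_all[rule_format, of "\<lambda>t. \<theta> (t + 1) - \<theta> t"])
  have "cis (\<theta> 1) = cis (\<theta> 0)"
  proof -
    have "norm (V 0) *\<^sub>R cis (\<theta> 1) = norm (V 0) *\<^sub>R cis (\<theta> 0)" using V[of 0] V[of 1] Vper[of 0] by simp
    then show ?thesis using V0[of 0] by simp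
  qed
  then have "sin (\<theta> 1) = sin (\<theta> 0)" "cos (\<theta> 1) = cos (\<theta> 0)" by (simp_all add: complex_eq_iff)
  then have "cos (\<theta> 1 - \<theta> 0) = 1" by (simp add: cos_diff flip: power2_eq_square)
  then obtain k :: int where k': "\<theta> 1 - \<theta> 0 = of_int k * 2 * pi" using cos_one_2pi_int by blast
  have "\<theta> 0 < \<theta> 1" by (rule \<theta>mono) simp
  then have "0 < of_int k * (2 * pi)" using k' by linarith
  then have "1 \<le> k" by (simp add: zero_less_mult_iff)
  have imc: "continuous_on UNIV (\<lambda>t. Im (\<gamma> t))" by (intro continuous_intros gc)
  obtain t0 where t0: "\<And>t. Im (\<gamma> t0) \<le> Im (\<gamma> t)"
    using periodic_attains_inf[of "\<lambda>t. Im (\<gamma> t)" 1, OF imc, of "\<exists>t0. \<forall>t. Im (\<gamma> t0) \<le> Im (\<gamma> t)"] per by auto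
  have ImV: "Im (V t0) = 0"
    using DERIV_local_min[OF vector_deriv_Re_Im(2)[OF deriv(1)], of 1 t0] t0 by simp
  \<comment> \<open>At a lowest point the velocity is horizontal and the height cannot be concave.
    The curvature condition there reads \<open>0 < Re (V t0) * Im (A t0)\<close>, so the curve runs
    to the right, that is, counterclockwise.\<close>
  have "\<not> Im (A t0) < 0"
  proof
    assume "Im (A t0) < 0"
    then obtain d where d: "d > 0" "\<And>s. 0 < s \<Longrightarrow> s < d \<Longrightarrow> Im (V (t0 + s)) < Im (V t0)"
      using DERIV_neg_dec_right[OF vector_deriv_Re_Im(2)[OF deriv(2)]] by blast
    have "Im (\<gamma> (t0 + d / 2)) < Im (\<gamma> t0)"
    proof (rule DERIV_neg_imp_decreasing_open[of t0 "t0 + d / 2" "\<lambda>t. Im (\<gamma> t)"])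
      fix t assume "t0 < t" "t < t0 + d / 2"
      then have "Im (V t) < 0" using d(2)[of "t - t0"] d(1) ImV by simp
      then show "\<exists>D. ((\<lambda>t. Im (\<gamma> t)) has_real_derivative D) (at t) \<and> D < 0"
        using vector_deriv_Re_Im(2)[OF deriv(1)] by blast
    qed (use d imc in \<open>auto intro: continuous_on_subset\<close>)
    then show False using t0[of "t0 + d / 2"] by linarith
  qed
  then have ReV: "0 < Re (V t0)" using curv[of t0] ImV by (auto simp: zero_less_mult_iff)
  have "k \<le> 1"
  proof (rule turning_le_one[of "\<lambda>t. \<gamma> (t0 + t)" "\<lambda>t. V (t0 + t)" "\<lambda>t. \<theta> (t0 + t)"])
    show "((\<lambda>t. \<gamma> (t0 + t)) has_vector_derivative V (t0 + t)) (at t)" for t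
    proof -
      have "((\<lambda>t. t0 + t) has_vector_derivative 1) (at t)" by (auto intro!: derivative_eq_intros)
      then have "((\<gamma> \<circ> (\<lambda>t. t0 + t)) has_vector_derivative 1 *\<^sub>R V (t0 + t)) (at t)"
        by (rule vector_diff_chain_at[OF _ deriv(1)])
      then show ?thesis by (simp add: o_def)
    qed
    show "continuous_on UNIV (\<lambda>t. V (t0 + t))" "continuous_on UNIV (\<lambda>t. \<theta> (t0 + t))"
      by (auto intro!: continuous_on_compose2[OF Vc] continuous_on_compose2[OF \<theta>c] continuous_intros)
    show "\<theta> (t0 + 1) = \<theta> (t0 + 0) + 2 * pi * of_int k" using const[of t0] k' by (simp add: algebra_simps)
    show "\<gamma> (t0 + (t + 1)) = \<gamma> (t0 + t)" "V (t0 + (t + 1)) = V (t0 + t)" for t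
      using per[of "t0 + t"] Vper[of "t0 + t"] by (simp_all add: add.assoc)
    show "\<gamma> (t0 + s) \<noteq> \<gamma> (t0 + t)" if "s < t" "t < s + 1" for s t
      by (rule closed_curve_inj[OF per inj]) (use that in auto)
    show "V (t0 + t) = norm (V (t0 + t)) *\<^sub>R cis (\<theta> (t0 + t))" for t by (rule V)
  qed (use V0 t0 ImV ReV in auto)
  then have "k = 1" using \<open>1 \<le> k\<close> by simp
  then show "\<theta> (t + 1) = \<theta> t + 2 * pi" using const[of t] k' by (simp add: algebra_simps)
qed

text \<open>The tangent angle is an increasing bijection; its inverse parametrizes the curve by the
  outer normal, a quarter turn behind the tangent. \<open>h\<close> and \<open>h1\<close> are the
  coordinates relative to \<open>c\<close> in the moving frame. In this parameter the curve is only
  known to be C1, but \<open>h\<close> gains a derivative because the velocity has no component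
  along the normal.\<close>

lemma oval_parametrization:
  assumes "simple_closed_C2_curve \<gamma>" "\<forall>t. curvature \<gamma> t > 0"
  shows "\<exists>T h h1 \<rho>. oval h h1 \<rho> \<and> strict_mono T \<and> surj T \<and> (\<forall>x. T (x + 2 * pi) = T x + 1) \<and>
    (\<forall>x. \<gamma> (T x) = c + (h x *\<^sub>R cis x + h1 x *\<^sub>R (\<i> * cis x))) \<and>
    (\<forall>x. velocity \<gamma> (T x) = norm (velocity \<gamma> (T x)) *\<^sub>R (\<i> * cis x)) \<and> (\<forall>t. velocity \<gamma> t \<noteq> 0)"
proof -
  define V where "V = velocity \<gamma>"
  define A where "A = velocity V"
  have ass: "\<And>t. \<gamma> (t + 1) = \<gamma> t" "inj_on \<gamma> {0..<1}" "\<gamma> C1_differentiable_on UNIV" "V C1_differentiable_on UNIV"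
    "\<And>t. V t \<noteq> 0"
    using assms(1) by (auto simp: simple_closed_C2_curve_def V_def)
  have dg: "(\<gamma> has_vector_derivative V t) (at t)" for t using C1_on_UNIV(1)[OF ass(3)] by (simp add: V_def)
  have dV: "(V has_vector_derivative A t) (at t)" for t using C1_on_UNIV(1)[OF ass(4)] by (simp add: A_def)
  have Ac: "continuous_on UNIV A" using C1_on_UNIV(2)[OF ass(4)] by (simp add: A_def)
  have shift: "f' (t + 1) = f' t"
    if f: "\<And>t. f (t + 1) = f t" "\<And>t. (f has_vector_derivative f' t) (at t)" for f f' :: "real \<Rightarrow> complex" and t
  proof -
    have "((\<lambda>t. t + 1) has_vector_derivative 1) (at t)" by (auto intro!: derivative_eq_intros)
    then have "((f \<circ> (\<lambda>t. t + 1)) has_vector_derivative 1 *\<^sub>R f' (t + 1)) (at t)"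
      by (rule vector_diff_chain_at[OF _ f(2)])
    then have "(f has_vector_derivative f' (t + 1)) (at t)" by (simp add: o_def f(1))
    then show ?thesis using f(2) vector_derivative_unique_at by blast
  qed
  have Vper: "V (t + 1) = V t" for t by (rule shift[OF ass(1) dg])
  have Aper: "A (t + 1) = A t" for t by (rule shift[OF Vper dV])
  have curv: "0 < Im (cnj (V t) * A t)" for t
    using assms(2)[rule_format, of t] ass(5)[of t] by (simp add: curvature_def V_def A_def zero_less_divide_iff)
  obtain \<theta> where \<theta>: "\<And>t. (\<theta> has_real_derivative Im (A t / V t)) (at t)" "\<And>t. V t = norm (V t) *\<^sub>R cis (\<theta> t)"
    using tangent_angle_exists[OF dV Ac ass(5)] by blast
  note turn = positive_curvature_turning[OF dg dV Ac ass(1) Vper Aper ass(2,5) curv \<theta>]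
  have \<theta>mono: "strict_mono \<theta>"
    by (rule strict_monoI, rule DERIV_pos_imp_increasing) (use \<theta>(1) turn(1) in blast)+
  have \<theta>c: "continuous_on S \<theta>" for S using \<theta>(1) by (meson DERIV_isCont continuous_at_imp_continuous_on)
  have "\<exists>t. \<theta> t = x" for x
  proof -
    have sh: "\<theta> (0 + 1 * of_int k) = \<theta> 0 + 2 * pi * of_int k" for k by (rule shift_int[of \<theta>, OF turn(2)])
    obtain k y where k: "x - \<theta> 0 = y + 2 * pi * of_int k" "0 \<le> y" "y < 2 * pi"
      using reduce_mod_period[of "2 * pi" "x - \<theta> 0" thesis] by simp
    have "\<theta> (of_int k) \<le> x" "x \<le> \<theta> (of_int (k + 1))" using sh[of k] sh[of "k + 1"] k by (simp_all add: algebra_simps)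
    then show ?thesis using IVT'[of \<theta> "of_int k" x "of_int (k + 1)", OF _ _ _ \<theta>c] by auto
  qed
  then obtain g where g: "\<And>x. \<theta> (g x) = x" by metis
  have g': "g (\<theta> t) = t" for t using g \<theta>mono by (metis strict_mono_eq)
  have gc: "isCont g x" for x
  proof -
    have "isCont g (\<theta> (g x))"
      by (rule isCont_inverse_function[of 1]) (use g' \<theta>(1) in \<open>auto intro: DERIV_isCont\<close>)
    then show ?thesis by (simp add: g)
  qed
  have dgi: "(g has_real_derivative inverse (Im (A (g x) / V (g x)))) (at x)" for x
    by (rule DERIV_inverse_function[of \<theta> _ _ _ "x - 1" "x + 1"]) (use \<theta>(1) turn(1)[of "g x"] g gc in auto)
  define T where "T x = g (x + pi / 2)" for x
  have dT: "(T has_real_derivative inverse (Im (A (T x) / V (T x)))) (at x)" for x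
    unfolding T_def by (rule DERIV_shift[THEN iffD1, OF dgi])
  define \<rho> where "\<rho> x = norm (V (T x)) / Im (A (T x) / V (T x))" for x
  define Z where "Z x = \<gamma> (T x) - c" for x
  have VT: "V (T x) = norm (V (T x)) *\<^sub>R (\<i> * cis x)" for x
  proof -
    have "cis (\<theta> (T x)) = \<i> * cis x" by (simp add: T_def g complex_eq_iff cos_add sin_add)
    then show ?thesis using \<theta>(2)[of "T x"] by simp
  qed
  have dZ: "(Z has_vector_derivative \<rho> x *\<^sub>R (\<i> * cis x)) (at x)" for x
  proof -
    have "((\<gamma> \<circ> T) has_vector_derivative inverse (Im (A (T x) / V (T x))) *\<^sub>R V (T x)) (at x)"
      by (rule vector_diff_chain_at[OF dT[unfolded has_real_derivative_iff_has_vector_derivative] dg])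
    moreover have "inverse (Im (A (T x) / V (T x))) *\<^sub>R V (T x) = \<rho> x *\<^sub>R (\<i> * cis x)"
      by (subst (2) VT) (simp add: \<rho>_def divide_inverse mult.commute)
    ultimately have "((\<lambda>x. \<gamma> (T x)) has_vector_derivative \<rho> x *\<^sub>R (\<i> * cis x)) (at x)" by (simp add: o_def)
    then show ?thesis unfolding Z_def by (auto intro!: derivative_eq_intros)
  qed
  define h where "h x = Re (Z x) * cos x + Im (Z x) * sin x" for x
  define h1 where "h1 x = Im (Z x) * cos x - Re (Z x) * sin x" for x
  have ReZ: "((\<lambda>x. Re (Z x)) has_real_derivative - \<rho> x * sin x) (at x)"
    and ImZ: "((\<lambda>x. Im (Z x)) has_real_derivative \<rho> x * cos x) (at x)" for x
    using vector_deriv_Re_Im[OF dZ] by simp_all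
  have Tp: "T (x + 2 * pi) = T x + 1" for x
    using g'[of "T x + 1"] turn(2)[of "T x"] by (simp add: T_def g add.commute add.left_commute)
  have "oval h h1 \<rho>"
  proof
    fix x
    have one: "\<rho> x * cos x * cos x + \<rho> x * sin x * sin x = \<rho> x"
      using sin_cos_squared_add[of x] by (metis add.commute mult.assoc mult.right_neutral power2_eq_square ring_class.ring_distribs(1))
    show "(h has_real_derivative h1 x) (at x)"
      using DERIV_add[OF DERIV_mult[OF ReZ DERIV_cos] DERIV_mult[OF ImZ DERIV_sin], of x]
      unfolding h_def[abs_def] h1_def by (simp add: algebra_simps)
    have "(h1 has_real_derivative (\<rho> x * cos x * cos x + \<rho> x * sin x * sin x) - h x) (at x)"
      using DERIV_diff[OF DERIV_mult[OF ImZ DERIV_cos] DERIV_mult[OF ReZ DERIV_sin], of x]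
      unfolding h_def h1_def[abs_def] by (simp add: algebra_simps)
    then show "(h1 has_real_derivative \<rho> x - h x) (at x)" unfolding one .
    show "0 < \<rho> x" using turn(1)[of "T x"] ass(5)[of "T x"] by (simp add: \<rho>_def)
    show "h (x + 2 * pi) = h x" by (simp add: h_def Z_def Tp ass(1))
    have Tc: "continuous_on UNIV T" using dT by (meson DERIV_isCont continuous_at_imp_continuous_on)
    have Vc: "continuous_on UNIV V"
      using dV by (meson continuous_at_imp_continuous_on has_vector_derivative_continuous)
    have "Im (A (T x) / V (T x)) \<noteq> 0" for x using turn(1)[of "T x"] by simp
    then show "continuous_on UNIV \<rho>" unfolding \<rho>_def using ass(5)
      by (intro continuous_intros continuous_on_compose2[OF Ac Tc] continuous_on_compose2[OF Vc Tc]) auto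
  qed
  moreover have "strict_mono T"
  proof (rule strict_monoI)
    fix x y :: real assume "x < y"
    then have "\<theta> (T x) < \<theta> (T y)" by (simp add: T_def g)
    then show "T x < T y" using \<theta>mono strict_mono_less by blast
  qed
  moreover have "surj T" by (rule surjI[of _ "\<lambda>t. \<theta> t - pi / 2"]) (simp add: T_def g')
  moreover have "\<gamma> (T x) = c + (h x *\<^sub>R cis x + h1 x *\<^sub>R (\<i> * cis x))" for x
  proof -
    have e: "cos x * (cos x * a) + sin x * (sin x * a) = a" for a
    proof -
      have "cos x * (cos x * a) + sin x * (sin x * a) = ((sin x)\<^sup>2 + (cos x)\<^sup>2) * a" by algebra
      then show ?thesis by simp
    qed
    have "Z x = h x *\<^sub>R cis x + h1 x *\<^sub>R (\<i> * cis x)"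
      unfolding complex_eq_iff by (simp add: h_def h1_def algebra_simps e)
    then show ?thesis unfolding Z_def by (metis add.commute diff_add_cancel)
  qed
  ultimately show ?thesis using Tp VT ass(5) unfolding V_def by blast
qed

section \<open>Caustics as invariant graphs\<close>

lemma inner_cis: "z \<bullet> cis x = Re z * cos x + Im z * sin x"
  by (simp add: inner_complex_def)

lemma inner_icis: "z \<bullet> (\<i> * cis x) = Im z * cos x - Re z * sin x"
  by (simp add: inner_complex_def)

lemma inner_cis_cis: "(\<i> * cis x) \<bullet> cis y = sin (y - x)" "cis x \<bullet> cis y = cos (x - y)"
  "(\<i> * cis x) \<bullet> (\<i> * cis y) = cos (x - y)"
  by (simp_all add: inner_complex_def sin_diff cos_diff algebra_simps)

lemma inner_cis_add_pi: "z \<bullet> cis (x + pi) = - (z \<bullet> cis x)"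
  by (simp add: inner_cis)

lemma inner_cis_shift: "z \<bullet> cis (x + 2 * pi) = z \<bullet> cis x"
  by (simp add: inner_cis)

lemma inner_cis_le_norm: "z \<bullet> cis x \<le> norm z"
  using norm_cauchy_schwarz[of z "cis x"] by simp

context oval
begin

definition pt :: "real \<Rightarrow> complex" where
  "pt x = h x *\<^sub>R cis x + h1 x *\<^sub>R (\<i> * cis x)"

lemma pt_inner: "pt m \<bullet> cis x = h m * cos (m - x) - h1 m * sin (m - x)"
  by (simp add: pt_def inner_add_left inner_cis_cis sin_diff algebra_simps)

text \<open>The reflection law: both lines pass through the boundary point whose normal angle is the
  mean of theirs, and make equal angles with its normal.\<close>

lemma pt_inner_chord: "pt ((x + y) / 2) \<bullet> cis x = p_in x y" "pt ((x + y) / 2) \<bullet> cis y = p_out x y"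
proof -
  have e: "(x + y) / 2 - x = (y - x) / 2" "(x + y) / 2 - y = - ((y - x) / 2)" by (simp_all add: field_simps)
  show "pt ((x + y) / 2) \<bullet> cis x = p_in x y" unfolding pt_inner p_in_def e ..
  show "pt ((x + y) / 2) \<bullet> cis y = p_out x y" unfolding pt_inner p_out_def e cos_minus sin_minus by simp
qed

lemma pt_inner_self: "pt x \<bullet> cis x = h x" by (simp add: pt_inner)

lemma pt_shift: "pt (x + 2 * pi) = pt x"
  by (simp add: pt_def h_periodic h1_periodic complex_eq_iff)

text \<open>Strict convexity read off from the twist: the boundary point of normal angle
  \<open>m\<close> lies on the line that is reflected from \<open>x\<close> to
  \<open>2 * m - x\<close>. Beyond half a turn the roles of incoming and outgoing line are
  exchanged.\<close>

lemma pt_inner_less: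
  assumes "x < m" "m < x + 2 * pi" shows "pt m \<bullet> cis x < h x"
proof (cases "m \<le> x + pi")
  case True
  have "pt m \<bullet> cis x = p_in x (2 * m - x)" using pt_inner_chord(1)[of x "2 * m - x"] by simp
  also have "\<dots> < p_in x x" using assms True by (intro p_in_strict) auto
  finally show ?thesis by (simp add: p_in_diag)
next
  case False
  have "pt m \<bullet> cis x = pt (m - 2 * pi) \<bullet> cis x" using pt_shift[of "m - 2 * pi"] by simp
  also have "\<dots> = p_out (2 * (m - 2 * pi) - x) x" 
  proof -
    have "((2 * (m - 2 * pi) - x) + x) / 2 = m - 2 * pi" by simp
    then show ?thesis using pt_inner_chord(2)[of "2 * (m - 2 * pi) - x" x] by metis
  qed
  also have "\<dots> < p_out x x" using assms False by (intro p_out_strict) auto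
  finally show ?thesis by (simp add: p_out_diag)
qed

lemma pt_inner_le: "pt m \<bullet> cis x \<le> h x"
proof -
  obtain k y where k: "m - x = y + 2 * pi * of_int k" "0 \<le> y" "y < 2 * pi"
    by (rule reduce_mod_period[of "2 * pi" "m - x"]) auto
  have "m = (x + y) + 2 * pi * of_int k" using k by simp
  then have "pt m = pt (x + y)" using periodic_int[of pt "2 * pi", OF pt_shift] by metis
  then show ?thesis using pt_inner_less[of x "x + y"] k by (cases "y = 0") (auto simp: pt_inner_self less_imp_le)
qed

end

section \<open>The table as a convex body, and its oriented lines\<close>

locale table = oval +
  fixes \<gamma> :: "real \<Rightarrow> complex" and T :: "real \<Rightarrow> real" and c :: complex
  assumes T_mono: "strict_mono T" and T_surj: "surj T" and T_shift: "T (x + 2 * pi) = T x + 1"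
    and point: "\<gamma> (T x) = c + pt x"
    and vel: "velocity \<gamma> (T x) = norm (velocity \<gamma> (T x)) *\<^sub>R (\<i> * cis x)"
    and vel_nz: "velocity \<gamma> t \<noteq> 0"
begin

definition body :: "complex set" where "body = {z. \<forall>x. (z - c) \<bullet> cis x \<le> h x}"

lemma range_curve: "range \<gamma> = range (\<lambda>x. c + pt x)"
proof -
  have "range \<gamma> = \<gamma> ` (range T)" using T_surj by simp
  then show ?thesis by (simp add: image_image point)
qed

lemma interior_body: "interior body = {z. \<forall>x. (z - c) \<bullet> cis x < h x}"
proof
  show "interior body \<subseteq> {z. \<forall>x. (z - c) \<bullet> cis x < h x}"
  proof safe
    fix z x assume "z \<in> interior body"
    then obtain e where e: "0 < e" "ball z e \<subseteq> body" using mem_interior by blast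
    have "z + (e / 2) *\<^sub>R cis x \<in> ball z e" using e by (simp add: dist_norm)
    then have "(z + (e / 2) *\<^sub>R cis x - c) \<bullet> cis x \<le> h x" using e by (auto simp: body_def)
    moreover have "(z + (e / 2) *\<^sub>R cis x - c) \<bullet> cis x = (z - c) \<bullet> cis x + e / 2"
      by (simp add: inner_add_left inner_diff_left inner_cis_cis)
    ultimately show "(z - c) \<bullet> cis x < h x" using e by simp
  qed
  show "{z. \<forall>x. (z - c) \<bullet> cis x < h x} \<subseteq> interior body"
  proof safe
    fix z assume z: "\<forall>x. (z - c) \<bullet> cis x < h x"
    have kc: "continuous_on UNIV (\<lambda>x. h x - (z - c) \<bullet> cis x)"
      unfolding inner_cis by (intro continuous_intros h_cont)
    have kp: "h (x + 2 * pi) - (z - c) \<bullet> cis (x + 2 * pi) = h x - (z - c) \<bullet> cis x" for x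
      unfolding inner_cis_shift h_periodic ..
    obtain w where w: "\<And>x. h w - (z - c) \<bullet> cis w \<le> h x - (z - c) \<bullet> cis x"
      using periodic_attains_bounds(1)[OF kc kp] by blast
    define e where "e = h w - (z - c) \<bullet> cis w"
    have "0 < e" using z by (simp add: e_def)
    moreover have "ball z e \<subseteq> body"
    proof
      fix y assume "y \<in> ball z e"
      then have "norm (y - z) < e" by (simp add: dist_norm norm_minus_commute)
      then have 1: "(y - z) \<bullet> cis x < e" for x using inner_cis_le_norm[of "y - z" x] by simp
      have 2: "(y - c) \<bullet> cis x = (y - z) \<bullet> cis x + (z - c) \<bullet> cis x" for x by (simp add: inner_diff_left)
      have "(y - c) \<bullet> cis x \<le> h x" for x using 1[of x] 2[of x] w[of x] unfolding e_def by linarith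
      then show "y \<in> body" by (simp add: body_def)
    qed
    ultimately show "z \<in> interior body" using mem_interior by blast
  qed
qed

lemma closed_body: "closed body"
proof -
  have "body = (\<Inter>x. {z. (z - c) \<bullet> cis x \<le> h x})" by (auto simp: body_def)
  then show ?thesis by (auto intro!: closed_INT closed_Collect_le continuous_intros)
qed

lemma convex_body: "convex body"
proof (rule convexI)
  fix y z :: complex and u v :: real assume *: "y \<in> body" "z \<in> body" "0 \<le> u" "0 \<le> v" "u + v = 1"
  have "u *\<^sub>R y + v *\<^sub>R z - c = u *\<^sub>R (y - c) + v *\<^sub>R (z - c)"
    using *(5) by (simp add: algebra_simps) (metis scaleR_add_left scaleR_one)
  moreover have "u * ((y - c) \<bullet> cis x) + v * ((z - c) \<bullet> cis x) \<le> u * h x + v * h x" for x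
    using * by (intro add_mono mult_left_mono) (auto simp: body_def)
  moreover have "u * h x + v * h x = h x" for x using *(5) by (metis distrib_right mult_1)
  ultimately show "u *\<^sub>R y + v *\<^sub>R z \<in> body" by (simp add: body_def inner_add_left)
qed

lemma body_bounded: obtains B where "0 < B" "\<And>z. z \<in> body \<Longrightarrow> norm (z - c) \<le> B"
proof -
  have "norm (z - c) \<le> \<bar>h 0\<bar> + \<bar>h pi\<bar> + \<bar>h (pi / 2)\<bar> + \<bar>h (- pi / 2)\<bar> + 1" if "z \<in> body" for z
  proof -
    have "(z - c) \<bullet> cis x \<le> h x" for x using that by (simp add: body_def)
    from this[of 0] this[of pi] this[of "pi / 2"] this[of "- pi / 2"]
    have "\<bar>Re (z - c)\<bar> \<le> \<bar>h 0\<bar> + \<bar>h pi\<bar>" "\<bar>Im (z - c)\<bar> \<le> \<bar>h (pi / 2)\<bar> + \<bar>h (- pi / 2)\<bar>"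
      by (auto simp: inner_cis)
    then show ?thesis using cmod_le[of "z - c"] by linarith
  qed
  moreover have "0 < \<bar>h 0\<bar> + \<bar>h pi\<bar> + \<bar>h (pi / 2)\<bar> + \<bar>h (- pi / 2)\<bar> + 1" by linarith
  ultimately show thesis by (rule that[rotated])
qed

text \<open>Equality in direction \<open>x\<close> makes the slack
  \<open>h y - (z - c) \<bullet> cis y\<close> minimal at \<open>y = x\<close>. Its vanishing
  derivative supplies the second coordinate of \<open>z\<close> in the frame, so \<open>z\<close> is
  the point of the envelope of the support lines.\<close>

lemma frontier_body: "frontier body = range \<gamma>"
proof -
  have "frontier body = {z \<in> body. \<exists>x. (z - c) \<bullet> cis x = h x}"
  proof (intro set_eqI)
    fix z
    have "z \<in> frontier body \<longleftrightarrow> z \<in> body \<and> \<not> (\<forall>x. (z - c) \<bullet> cis x < h x)"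
      unfolding frontier_def interior_body closure_closed[OF closed_body] by simp
    also have "\<dots> \<longleftrightarrow> z \<in> body \<and> (\<exists>x. (z - c) \<bullet> cis x = h x)"
      unfolding body_def mem_Collect_eq using less_le by fastforce
    finally show "z \<in> frontier body \<longleftrightarrow> z \<in> {z \<in> body. \<exists>x. (z - c) \<bullet> cis x = h x}" by simp
  qed
  also have "\<dots> = range (\<lambda>x. c + pt x)"
  proof (intro set_eqI iffI)
    fix z assume "z \<in> {z \<in> body. \<exists>x. (z - c) \<bullet> cis x = h x}"
    then obtain x where z: "\<And>y. (z - c) \<bullet> cis y \<le> h y" and x: "(z - c) \<bullet> cis x = h x" by (auto simp: body_def)
    have "((\<lambda>y. h y - (Re (z - c) * cos y + Im (z - c) * sin y)) has_real_derivative
        h1 x - (Re (z - c) * - sin x + Im (z - c) * cos x)) (at x)"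
      by (auto intro!: derivative_eq_intros)
    moreover have "h x - (Re (z - c) * cos x + Im (z - c) * sin x) \<le> h y - (Re (z - c) * cos y + Im (z - c) * sin y)" for y
      using z[of y] x by (simp only: inner_cis)
    ultimately have "h1 x - (Re (z - c) * - sin x + Im (z - c) * cos x) = 0"
      by (intro DERIV_local_min[of "\<lambda>y. h y - (Re (z - c) * cos y + Im (z - c) * sin y)" _ x 1]) auto
    then have e: "h x = Re (z - c) * cos x + Im (z - c) * sin x" "h1 x = Im (z - c) * cos x - Re (z - c) * sin x"
      using x by (simp_all only: inner_cis)
    have id: "cos x * (cos x * a) + sin x * (sin x * a) = a" for a
    proof -
      have "cos x * (cos x * a) + sin x * (sin x * a) = ((sin x)\<^sup>2 + (cos x)\<^sup>2) * a" by algebra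
      then show ?thesis by simp
    qed
    have "pt x = z - c" unfolding pt_def e complex_eq_iff using id[of "Re (z - c)"] id[of "Im (z - c)"]
      by (simp add: algebra_simps)
    then have "z = c + pt x" by simp
    then show "z \<in> range (\<lambda>x. c + pt x)" by blast
  next
    fix z assume "z \<in> range (\<lambda>x. c + pt x)"
    then obtain x where "z = c + pt x" by blast
    then show "z \<in> {z \<in> body. \<exists>x. (z - c) \<bullet> cis x = h x}"
      using pt_inner_le pt_inner_self[of x] by (auto simp: body_def)
  qed
  finally show ?thesis by (simp add: range_curve)
qed

lemma domain_iff: "z \<in> domain \<gamma> \<longleftrightarrow> (\<forall>x. (z - c) \<bullet> cis x < h x)"
proof -
  obtain B where B: "\<And>z. z \<in> body \<Longrightarrow> norm (z - c) \<le> B" using body_bounded by blast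
  have "bounded body"
  proof (rule boundedI[of _ "B + norm c"])
    fix z assume "z \<in> body"
    then show "norm z \<le> B + norm c" using B[of z] norm_triangle_sub[of z c] by linarith
  qed
  then have "inside (frontier body) = interior body" using convex_body by (rule inside_frontier_eq_interior)
  then show ?thesis unfolding frontier_body interior_body by simp
qed

text \<open>The oriented line with outer normal \<open>cis x\<close> at distance \<open>p\<close> from the center.\<close>

definition normal_line :: "real \<Rightarrow> real \<Rightarrow> oriented_line" where
  "normal_line x p = (\<i> * cis x, - (p + c \<bullet> cis x))"

lemma normal_line_height: "line_height (normal_line x p) z = p - (z - c) \<bullet> cis x"
  by (simp add: line_height_def direction_def normal_line_def inner_complex_def algebra_simps)

lemma normal_line_points: "z \<in> line_points (normal_line x p) \<longleftrightarrow> (z - c) \<bullet> cis x = p"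
  by (auto simp: line_points_def normal_line_height)

lemma normal_line_direction: "direction (normal_line x p) = \<i> * cis x"
  by (simp add: direction_def normal_line_def)

lemma normal_line_oriented: "normal_line x p \<in> oriented_lines"
  by (simp add: oriented_lines_def normal_line_def norm_mult)

lemma oriented_line_normal_line:
  assumes "l \<in> oriented_lines" obtains x p where "l = normal_line x p"
proof -
  obtain v r where l: "l = (v, r)" "norm v = 1" using assms by (auto simp: oriented_lines_def)
  have "v = cis (Arg v)" using cis_Arg[of v] l(2) by (metis norm_zero sgn_div_norm inverse_1 scaleR_one zero_neq_one)
  then have "v = \<i> * cis (Arg v - pi / 2)"
    by (metis cis_mult cis_pi_half diff_add_cancel add.commute)
  then have "l = normal_line (Arg v - pi / 2) (- r - c \<bullet> cis (Arg v - pi / 2))" by (simp add: normal_line_def l)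
  then show thesis using that by blast
qed

lemma normal_line_eq_iff: "normal_line x p = normal_line y q \<longleftrightarrow> cis x = cis y \<and> p = q"
  by (auto simp: normal_line_def)

lemma line_point_param:
  assumes "(z - c) \<bullet> cis x = pt m \<bullet> cis x"
  obtains s where "z = c + pt m + s *\<^sub>R (\<i> * cis x)"
proof
  let ?w = "z - c - pt m"
  have "?w \<bullet> cis x = 0" using assms by (simp add: inner_diff_left)
  then have e: "Re ?w * cos x + Im ?w * sin x = 0" by (simp only: inner_cis)
  define a b where "a = Re ?w" and "b = Im ?w"
  have ab: "a * cos x + b * sin x = 0" using e by (simp only: a_def b_def)
  define k where "k = b * cos x - a * sin x"
  have A: "a = - k * sin x"
  proof -
    have "a = a * ((sin x)\<^sup>2 + (cos x)\<^sup>2)" by simp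
    also have "\<dots> = - k * sin x + (a * cos x + b * sin x) * cos x" unfolding k_def by algebra
    finally show ?thesis using ab by simp
  qed
  have B: "b = k * cos x"
  proof -
    have "b = b * ((sin x)\<^sup>2 + (cos x)\<^sup>2)" by simp
    also have "\<dots> = k * cos x + (a * cos x + b * sin x) * sin x" unfolding k_def by algebra
    finally show ?thesis using ab by simp
  qed
  have "?w = k *\<^sub>R (\<i> * cis x)"
  proof (rule complex_eqI)
    show "Re ?w = Re (k *\<^sub>R (\<i> * cis x))" unfolding a_def[symmetric] A by simp
    show "Im ?w = Im (k *\<^sub>R (\<i> * cis x))" unfolding b_def[symmetric] B by simp
  qed
  then show "z = c + pt m + (b * cos x - a * sin x) *\<^sub>R (\<i> * cis x)"
    unfolding k_def[symmetric] by (simp add: algebra_simps)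
qed

lemma reduce_to:
  obtains k :: int and m where "m' = m + 2 * pi * of_int k" "x \<le> m" "m < x + 2 * pi"
proof -
  obtain k y where k: "m' - x = y + 2 * pi * of_int k" "0 \<le> y" "y < 2 * pi"
    by (rule reduce_mod_period[of "2 * pi" "m' - x"]) auto
  show thesis by (rule that[of "x + y" k]) (use k in auto)
qed

lemma T_int: "T (x + 2 * pi * of_int k) = T x + of_int k"
  using shift_int[of T "2 * pi" 1, OF T_shift] by simp

lemma pt_int: "pt (x + 2 * pi * of_int k) = pt x"
  by (rule periodic_int[of pt, OF pt_shift])

lemma sin_pos_imp: "x \<le> m \<Longrightarrow> m < x + 2 * pi \<Longrightarrow> 0 < sin (m - x) \<Longrightarrow> x < m \<and> m < x + pi"
  using sin_le_zero[of "m - x"] by (cases "m = x") force+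

context
  fixes x y :: real and z :: complex
  assumes xy: "x < y" "y < x + 2 * pi" and z: "z \<in> domain \<gamma>"
begin

lemma domain_segment:
  assumes "z = c + pt m + s0 *\<^sub>R v" "0 < s0" "0 < s" "s < s0"
  shows "c + pt m + s *\<^sub>R v \<in> domain \<gamma>"
proof -
  have "z \<in> interior body" using z by (simp add: interior_body domain_iff)
  moreover have "c + pt m \<in> closure body" using pt_inner_le by (intro subsetD[OF closure_subset]) (simp add: body_def)
  ultimately have "open_segment z (c + pt m) \<subseteq> interior body"
    by (rule in_interior_closure_convex_segment[OF convex_body])
  moreover have "c + pt m + s *\<^sub>R v \<in> open_segment z (c + pt m)"
  proof -
    have ne: "z \<noteq> c + pt m"
    proof
      assume "z = c + pt m"
      then have "(z - c) \<bullet> cis m = h m" by (simp add: pt_inner_self)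
      then show False using z unfolding domain_iff by (metis less_irrefl)
    qed
    moreover have "c + pt m + s *\<^sub>R v = (1 - (1 - s / s0)) *\<^sub>R z + (1 - s / s0) *\<^sub>R (c + pt m)"
      using assms by (simp add: algebra_simps)
    ultimately show ?thesis unfolding in_segment using assms
      by (intro conjI exI[of _ "1 - s / s0"]) auto
  qed
  ultimately show ?thesis by (auto simp: interior_body domain_iff)
qed

lemma leaves_at_exit:
  assumes "(z - c) \<bullet> cis x = p_in x y" shows "leaves_at \<gamma> (normal_line x (p_in x y)) (T ((x + y) / 2))"
proof -
  let ?m = "(x + y) / 2"
  obtain s where s: "z = c + pt ?m + s *\<^sub>R (\<i> * cis x)"
    using line_point_param[of z x ?m] assms pt_inner_chord by metis
  have "(z - c) \<bullet> cis ?m = h ?m + s * sin (?m - x)"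
    by (simp add: s inner_add_left pt_inner_self inner_cis_cis)
  moreover have "(z - c) \<bullet> cis ?m < h ?m" using z by (simp add: domain_iff)
  moreover have "0 < sin (?m - x)" using xy by (intro sin_gt_zero) auto
  ultimately have s0: "s < 0" by (simp add: mult_less_0_iff)
  have "\<gamma> (T ?m) - t *\<^sub>R direction (normal_line x (p_in x y)) \<in> domain \<gamma>" if "t \<in> {0<..<- s}" for t
    using domain_segment[of ?m "- s" "- (\<i> * cis x)" t] that s s0 by (simp add: point normal_line_direction)
  then show ?thesis unfolding leaves_at_def using s0
    by (intro conjI exI[of _ "- s"]) (auto simp: normal_line_points point pt_inner_chord)
qed

text \<open>The exit point is recognized by \<open>0 < sin (m - x)\<close>, since stepping back from
  it must decrease the support functional of its normal. So \<open>m\<close> lies within half a turn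
  after \<open>x\<close>, where \<open>p_in\<close> is injective.\<close>

lemma leaves_at_unique:
  assumes "leaves_at \<gamma> (normal_line x (p_in x y)) t"
  shows "\<exists>k. t = T ((x + y) / 2 + 2 * pi * of_int k)"
proof -
  obtain m' where m': "t = T m'" using T_surj by (metis surjD)
  obtain k m where m: "m' = m + 2 * pi * of_int k" "x \<le> m" "m < x + 2 * pi" by (rule reduce_to)
  have g: "\<gamma> t = c + pt m" by (simp add: m' point m pt_int)
  have on: "pt m \<bullet> cis x = p_in x y" using assms by (simp add: leaves_at_def normal_line_points g)
  obtain e where e: "0 < e" "\<And>s. s \<in> {0<..<e} \<Longrightarrow> \<gamma> t - s *\<^sub>R direction (normal_line x (p_in x y)) \<in> domain \<gamma>"
    using assms by (auto simp: leaves_at_def)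
  have "(\<gamma> t - (e / 2) *\<^sub>R direction (normal_line x (p_in x y)) - c) \<bullet> cis m < h m"
    using e(2)[of "e / 2"] e(1) by (simp add: domain_iff)
  then have "0 < sin (m - x)" using e(1) by (simp add: g normal_line_direction inner_diff_left inner_add_left pt_inner_self inner_cis_cis zero_less_mult_iff)
  then have mx: "x < m \<and> m < x + pi" using sin_pos_imp m by simp
  have "p_in x (2 * m - x) = p_in x y" using on pt_inner_chord(1)[of x "2 * m - x"] by simp
  then have "2 * m - x = y"
    using p_in_less_iff[of x y "2 * m - x"] p_in_less_iff[of x "2 * m - x" y] mx xy by auto
  then have "m = (x + y) / 2" by simp
  then have "t = T ((x + y) / 2 + 2 * pi * of_int k)" using m' m(1) by metis
  then show ?thesis by blast
qed

lemma enters_at_iff: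
  assumes "(z - c) \<bullet> cis y = p_out x y"
  shows "enters_at \<gamma> (normal_line y (p_out x y)) t \<longleftrightarrow> (\<exists>k. t = T ((x + y) / 2 + 2 * pi * of_int k))"
proof
  let ?m = "(x + y) / 2"
  assume "\<exists>k. t = T (?m + 2 * pi * of_int k)"
  then have g: "\<gamma> t = c + pt ?m" by (auto simp: point pt_int)
  obtain s where s: "z = c + pt ?m + s *\<^sub>R (\<i> * cis y)"
    using line_point_param[of z y ?m] assms pt_inner_chord by metis
  have "(z - c) \<bullet> cis ?m = h ?m + s * sin (?m - y)"
    by (simp add: s inner_add_left pt_inner_self inner_cis_cis)
  moreover have "(z - c) \<bullet> cis ?m < h ?m" using z by (simp add: domain_iff)
  moreover have "0 < sin (y - ?m)" using xy by (intro sin_gt_zero) (simp_all add: field_simps)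
  then have "sin (?m - y) < 0" by (metis minus_diff_eq neg_less_0_iff_less sin_minus)
  ultimately have s0: "0 < s" by (simp add: mult_less_0_iff)
  have "\<gamma> t + u *\<^sub>R direction (normal_line y (p_out x y)) \<in> domain \<gamma>" if "u \<in> {0<..<s}" for u
    using domain_segment[of ?m s "\<i> * cis y" u] that s s0 by (simp add: g normal_line_direction)
  then show "enters_at \<gamma> (normal_line y (p_out x y)) t" unfolding enters_at_def using s0
    by (intro conjI exI[of _ s]) (auto simp: normal_line_points g pt_inner_chord)
next
  assume ent: "enters_at \<gamma> (normal_line y (p_out x y)) t"
  obtain m' where m': "t = T m'" using T_surj by (metis surjD)
  obtain k m where m: "m' = m + 2 * pi * of_int k" "y - pi \<le> m" "m < y - pi + 2 * pi" by (rule reduce_to)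
  have g: "\<gamma> t = c + pt m" by (simp add: m' point m pt_int)
  have on: "pt m \<bullet> cis y = p_out x y" using ent by (simp add: enters_at_def normal_line_points g)
  obtain e where e: "0 < e" "\<And>s. s \<in> {0<..<e} \<Longrightarrow> \<gamma> t + s *\<^sub>R direction (normal_line y (p_out x y)) \<in> domain \<gamma>"
    using ent by (auto simp: enters_at_def)
  have "(\<gamma> t + (e / 2) *\<^sub>R direction (normal_line y (p_out x y)) - c) \<bullet> cis m < h m"
    using e(2)[of "e / 2"] e(1) by (simp add: domain_iff)
  then have "sin (m - y) < 0" using e(1) by (simp add: g normal_line_direction inner_diff_left inner_add_left pt_inner_self inner_cis_cis mult_less_0_iff)
  then have "0 < sin (m - (y - pi))" by (simp add: sin_diff sin_add)
  then have my: "y - pi < m \<and> m < y" using sin_pos_imp[of "y - pi" m] m by simp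
  have "p_out (2 * m - y) y = p_out x y" using on pt_inner_chord(2)[of "2 * m - y" y] by simp
  then have "2 * m - y = x"
    using p_out_less_iff[of y x "2 * m - y"] p_out_less_iff[of y "2 * m - y" x] my xy by auto
  then have "m = (x + y) / 2" by simp
  then have "t = T ((x + y) / 2 + 2 * pi * of_int k)" using m' m(1) by metis
  then show "\<exists>k. t = T ((x + y) / 2 + 2 * pi * of_int k)" by blast
qed

lemma billiard_map_chord:
  assumes "(z - c) \<bullet> cis x = p_in x y" shows "billiard_map \<gamma> (normal_line x (p_in x y)) = normal_line y (p_out x y)"
proof -
  let ?l = "normal_line x (p_in x y)" and ?m = "(x + y) / 2"
  define t where "t = (SOME t. leaves_at \<gamma> ?l t)"
  have "leaves_at \<gamma> ?l t" unfolding t_def using leaves_at_exit[OF assms] by (rule someI)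
  then obtain k where t: "t = T (?m + 2 * pi * of_int k)" using leaves_at_unique by blast
  have g: "\<gamma> t = c + pt ?m" by (simp add: t point pt_int)
  have cisk: "cis (?m + 2 * pi * of_int k) = cis ?m"
    using periodic_int[of cis "2 * pi" ?m k] by (simp add: complex_eq_iff)
  have v: "velocity \<gamma> t = norm (velocity \<gamma> t) *\<^sub>R (\<i> * cis ?m)" using vel[of "?m + 2 * pi * of_int k"] unfolding t cisk .
  have sg: "sgn (velocity \<gamma> t) = \<i> * cis ?m"
    by (subst v) (use vel_nz in \<open>simp add: sgn_scaleR sgn_div_norm norm_mult\<close>)
  have "reflect (velocity \<gamma> t) (\<i> * cis x) = \<i> * cis y"
  proof -
    have "m - (x - m) = y" if "m + m = x + y" for m using that by simp
    from this[OF field_sum_of_halves] have e: "?m - (x - ?m) = y" .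
    have "2 * cos (x - ?m) * cos ?m - cos x = cos y" "2 * cos (x - ?m) * sin ?m - sin x = sin y"
    proof -
      have "cos x = cos (?m + (x - ?m))" "sin x = sin (?m + (x - ?m))" by simp_all
      moreover have "cos y = cos (?m - (x - ?m))" "sin y = sin (?m - (x - ?m))" unfolding e by (rule refl)+
      ultimately show "2 * cos (x - ?m) * cos ?m - cos x = cos y" "2 * cos (x - ?m) * sin ?m - sin x = sin y"
        by (simp_all only: cos_add cos_diff[of ?m "x - ?m"] sin_add sin_diff[of ?m "x - ?m"]) (simp_all add: algebra_simps)
    qed
    then show ?thesis unfolding reflect_def sg inner_cis_cis by (simp add: complex_eq_iff)
  qed
  then have "billiard_map \<gamma> ?l = line_through (c + pt ?m) (\<i> * cis y)"
    unfolding billiard_map_def t_def[symmetric] Let_def normal_line_direction g by simp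
  also have "\<dots> = normal_line y (p_out x y)"
    using pt_inner_chord(2)[of x y] by (simp add: line_through_def normal_line_def inner_complex_def algebra_simps)
  finally show ?thesis .
qed

end

text \<open>For \<open>y\<close> running from \<open>x\<close> to \<open>x + 2 * pi\<close> the
  distance falls from that of the support line with normal angle \<open>x\<close> to that of the
  opposite support line; a line through the domain lies strictly between them.\<close>

lemma chord_exists:
  assumes "z \<in> domain \<gamma>" shows "\<exists>y. x < y \<and> y < x + 2 * pi \<and> p_in x y = (z - c) \<bullet> cis x"
proof -
  have mid: "(x + (x + 2 * pi)) / 2 = x + pi" "(x + 2 * pi - x) / 2 = pi" by simp_all
  have e: "p_in x (x + 2 * pi) = - h (x + pi)" unfolding p_in_def mid by simp
  have 1: "(z - c) \<bullet> cis x < p_in x x" "p_in x (x + 2 * pi) < (z - c) \<bullet> cis x"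
    using assms[unfolded domain_iff, rule_format, of x] assms[unfolded domain_iff, rule_format, of "x + pi"]
    by (simp_all add: p_in_diag e inner_cis_add_pi)
  then have "\<exists>y. x \<le> y \<and> y \<le> x + 2 * pi \<and> p_in x y = (z - c) \<bullet> cis x"
    by (intro IVT2') (auto intro!: continuous_intros)
  then show ?thesis using 1 by (metis less_irrefl order_le_less)
qed

end

section \<open>Support functions of closed curves in the table\<close>

context table
begin

definition supp :: "complex set \<Rightarrow> real \<Rightarrow> real" where
  "supp C x = Sup ((\<lambda>z. (z - c) \<bullet> cis x) ` C)"

lemma supp_attained:
  assumes "compact C" "C \<noteq> {}" obtains z where "z \<in> C" "(z - c) \<bullet> cis x = supp C x"
proof -
  have k: "compact ((\<lambda>z. (z - c) \<bullet> cis x) ` C)"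
    by (intro compact_continuous_image assms continuous_intros)
  have "supp C x \<in> (\<lambda>z. (z - c) \<bullet> cis x) ` C"
    unfolding supp_def using compact_imp_closed[OF k] bounded_imp_bdd_above[OF compact_imp_bounded[OF k]] assms(2)
    by (intro closed_contains_Sup) auto
  then obtain z where "z \<in> C" "supp C x = (z - c) \<bullet> cis x" by (elim imageE)
  then show thesis using that by simp
qed

lemma supp_ge:
  assumes "compact C" "z \<in> C" shows "(z - c) \<bullet> cis x \<le> supp C x"
  unfolding supp_def using assms
  by (intro cSup_upper imageI bounded_imp_bdd_above compact_imp_bounded compact_continuous_image continuous_intros) auto

lemma supp_le:
  assumes "compact C" "C \<noteq> {}" "\<And>z. z \<in> C \<Longrightarrow> (z - c) \<bullet> cis x \<le> b" shows "supp C x \<le> b"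
  using supp_attained[OF assms(1,2), of x] assms(3) by metis

lemma inner_cis_lipschitz: "\<bar>w \<bullet> cis x - w \<bullet> cis y\<bar> \<le> norm w * \<bar>x - y\<bar>"
proof -
  have "norm (w \<bullet> cis x - w \<bullet> cis y) \<le> norm w * norm (x - y)"
  proof (rule field_differentiable_bound[where S = UNIV and f' = "\<lambda>t. w \<bullet> (\<i> * cis t)"])
    show "((\<lambda>t. w \<bullet> cis t) has_real_derivative w \<bullet> (\<i> * cis t)) (at t within UNIV)" for t
      unfolding inner_cis inner_icis by (auto intro!: derivative_eq_intros)
    show "norm (w \<bullet> (\<i> * cis t)) \<le> norm w" for t
      using Cauchy_Schwarz_ineq2[of w "\<i> * cis t"] by (simp add: norm_mult)
  qed auto
  then show ?thesis by simp
qed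

lemma supp_lipschitz:
  assumes C: "compact C" "C \<noteq> {}" and B: "\<And>z. z \<in> C \<Longrightarrow> norm (z - c) \<le> B"
  shows "\<bar>supp C x - supp C y\<bar> \<le> B * \<bar>x - y\<bar>"
proof -
  have "supp C x - supp C y \<le> B * \<bar>x - y\<bar>" for x y
  proof -
    obtain z where z: "z \<in> C" "(z - c) \<bullet> cis x = supp C x" by (rule supp_attained[OF C])
    have "(z - c) \<bullet> cis x - (z - c) \<bullet> cis y \<le> norm (z - c) * \<bar>x - y\<bar>"
      using inner_cis_lipschitz[of "z - c" x y] by (simp add: abs_le_iff)
    also have "\<dots> \<le> B * \<bar>x - y\<bar>" using B[OF z(1)] by (intro mult_right_mono) auto
    finally show ?thesis using supp_ge[OF C(1) z(1), of y] z(2) by linarith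
  qed
  from this[of x y] this[of y x] show ?thesis by (simp add: abs_le_iff abs_minus_commute)
qed

lemma supp_continuous:
  assumes "compact C" "C \<noteq> {}" shows "continuous_on UNIV (supp C)"
proof -
  obtain B where "\<forall>z\<in>(\<lambda>z. z - c) ` C. norm z \<le> B"
    using compact_imp_bounded[OF compact_translation_subtract[OF assms(1), of c]] unfolding bounded_iff by blast
  then have B: "\<And>z. z \<in> C \<Longrightarrow> norm (z - c) \<le> max B 0" by (metis image_eqI max.coboundedI1)
  have "(max B 0)-lipschitz_on UNIV (supp C)"
    using supp_lipschitz[OF assms B] by (auto simp: lipschitz_on_def dist_real_def)
  then show ?thesis by (rule lipschitz_on_continuous_on)
qed

lemma supp_shift: "supp C (x + 2 * pi) = supp C x"
  by (simp add: supp_def inner_cis_shift)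

lemma ccw_tangents_iff:
  assumes C: "compact C" "C \<noteq> {}"
  shows "l \<in> ccw_tangents C \<longleftrightarrow> (\<exists>x. l = normal_line x (supp C x))"
proof
  assume l: "l \<in> ccw_tangents C"
  obtain x p where x: "l = normal_line x p" using oriented_line_normal_line l unfolding ccw_tangents_def by blast
  have 1: "\<And>z. z \<in> C \<Longrightarrow> (z - c) \<bullet> cis x \<le> p" using l by (simp add: ccw_tangents_def x normal_line_height)
  obtain z where "z \<in> line_points (normal_line x p)" "z \<in> C" using l unfolding ccw_tangents_def x by blast
  then have z: "z \<in> C" "(z - c) \<bullet> cis x = p" by (simp_all add: normal_line_points)
  have "supp C x = p" using supp_le[OF C 1] supp_ge[OF C(1) z(1), of x] z(2) by simp
  then show "\<exists>x. l = normal_line x (supp C x)" using x by blast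
next
  assume "\<exists>x. l = normal_line x (supp C x)"
  then obtain x where x: "l = normal_line x (supp C x)" by blast
  obtain z where z: "z \<in> C" "(z - c) \<bullet> cis x = supp C x" by (rule supp_attained[OF C])
  have "z \<in> line_points l \<inter> C" using z by (simp add: x normal_line_points)
  then have "line_points l \<inter> C \<noteq> {}" by blast
  then show "l \<in> ccw_tangents C" using supp_ge[OF C(1)] by (simp add: ccw_tangents_def normal_line_oriented normal_line_height x)
qed

lemma cw_tangents_iff:
  assumes C: "compact C" "C \<noteq> {}"
  shows "l \<in> cw_tangents C \<longleftrightarrow> (\<exists>x. l = normal_line x (- supp C (x + pi)))"
proof
  assume l: "l \<in> cw_tangents C"
  obtain x p where x: "l = normal_line x p" using oriented_line_normal_line l unfolding cw_tangents_def by blast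
  have 1: "\<And>z. z \<in> C \<Longrightarrow> (z - c) \<bullet> cis (x + pi) \<le> - p"
    using l by (simp add: cw_tangents_def x normal_line_height inner_cis_add_pi)
  obtain z where "z \<in> line_points (normal_line x p)" "z \<in> C" using l unfolding cw_tangents_def x by blast
  then have z: "z \<in> C" "(z - c) \<bullet> cis x = p" by (simp_all add: normal_line_points)
  have "supp C (x + pi) = - p"
    using supp_le[OF C 1] supp_ge[OF C(1) z(1), of "x + pi"] z(2) by (simp add: inner_cis_add_pi)
  then have "l = normal_line x (- supp C (x + pi))" using x by simp
  then show "\<exists>x. l = normal_line x (- supp C (x + pi))" by blast
next
  assume "\<exists>x. l = normal_line x (- supp C (x + pi))"
  then obtain x where x: "l = normal_line x (- supp C (x + pi))" by blast
  obtain z where z: "z \<in> C" "(z - c) \<bullet> cis (x + pi) = supp C (x + pi)" by (rule supp_attained[OF C])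
  have "z \<in> line_points l \<inter> C" using z by (simp add: x normal_line_points inner_cis_add_pi)
  then have "line_points l \<inter> C \<noteq> {}" by blast
  moreover have "- supp C (x + pi) \<le> (z - c) \<bullet> cis x" if "z \<in> C" for z
    using supp_ge[OF C(1) that, of "x + pi"] by (simp add: inner_cis_add_pi)
  ultimately show "l \<in> cw_tangents C" by (simp add: cw_tangents_def normal_line_oriented normal_line_height x)
qed

end

lemma simple_closed_curve_facts:
  assumes "simple_closed_convex_curve C"
  shows "compact C" "C \<noteq> {}" "connected C" "open (inside C)" "inside C \<noteq> {}" "bounded (inside C)"
    "convex (inside C)" "frontier (inside C) = C" "C \<inter> inside C = {}"
proof -
  obtain g where g: "simple_path g" "pathfinish g = pathstart g" "path_image g = C"
    using assms by (auto simp: simple_closed_convex_curve_def)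
  have "path g" using g(1) by (rule simple_path_imp_path)
  then show "compact C" "C \<noteq> {}" "connected C" using g(3) compact_path_image path_image_nonempty connected_path_image by auto
  show "open (inside C)" "inside C \<noteq> {}" "bounded (inside C)" "frontier (inside C) = C"
    using Jordan_inside_outside[OF g(1,2)] g(3) by auto
  show "convex (inside C)" using assms by (simp add: simple_closed_convex_curve_def)
  show "C \<inter> inside C = {}" using inside_no_overlap[of C] by blast
qed

context table
begin

text \<open>A curve of zero width lies on a line and encloses no open set, contrary to the Jordan
  curve theorem.\<close>

lemma supp_width:
  assumes "simple_closed_convex_curve C" shows "- supp C (x + pi) < supp C x"
proof (rule ccontr)
  note C = simple_closed_curve_facts[OF assms]
  assume n: "\<not> - supp C (x + pi) < supp C x"
  have eq: "(z - c) \<bullet> cis x = supp C x" if "z \<in> C" for z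
    using supp_ge[OF C(1) that, of x] supp_ge[OF C(1) that, of "x + pi"] n by (simp add: inner_cis_add_pi)
  let ?L = "{z. cis x \<bullet> z = supp C x + c \<bullet> cis x}"
  have "C \<subseteq> ?L" using eq by (auto simp: inner_diff_left inner_commute algebra_simps)
  then have "- ?L \<subseteq> outside C" by (intro outside_subset_convex convex_hyperplane)
  then have "inside C \<subseteq> ?L" by (auto simp: outside_inside)
  then have "interior (inside C) \<subseteq> interior ?L" by (rule interior_mono)
  then show False using interior_open[OF C(4)] C(5) interior_hyperplane[of "cis x"] by simp
qed

text \<open>If the reflection of one line swapped the sides of the caustic, so would the reflection of every line, by
  connectedness; then all lines would meet the boundary at a right angle.\<close>

lemma caustic_invariant_graph:
  assumes "convex_caustic \<gamma> C"
  shows "\<exists>f. invariant_graph (supp C) f \<and> (\<forall>x. billiard_map \<gamma> (normal_line x (supp C x)) = normal_line (f x) (supp C (f x)))"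
proof -
  have scc: "simple_closed_convex_curve C" and sub: "C \<subseteq> domain \<gamma>"
    and inv: "\<And>l. l \<in> tangents C \<Longrightarrow> billiard_map \<gamma> l \<in> tangents C"
    using assms by (auto simp: convex_caustic_def)
  note C = simple_closed_curve_facts[OF scc]
  have "\<exists>y. x < y \<and> y < x + 2 * pi \<and> p_in x y = supp C x" for x
  proof -
    obtain z where z: "z \<in> C" "(z - c) \<bullet> cis x = supp C x" by (rule supp_attained[OF C(1,2)])
    then show ?thesis using chord_exists[of z x] sub by auto
  qed
  then obtain f where f: "\<And>x. x < f x" "\<And>x. f x < x + 2 * pi" "\<And>x. p_in x (f x) = supp C x" by metis
  have bm: "billiard_map \<gamma> (normal_line x (supp C x)) = normal_line (f x) (p_out x (f x))" for x
  proof -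
    obtain z where z: "z \<in> C" "(z - c) \<bullet> cis x = supp C x" by (rule supp_attained[OF C(1,2)])
    then show ?thesis using billiard_map_chord[OF f(1,2)[of x], of z] sub f(3)[of x] by auto
  qed
  note fc = chord_map_cont[OF supp_continuous[OF C(1,2)] f]
  \<comment> \<open>\<open>A\<close> collects the lines that keep the caustic on the same side when
    reflected, \<open>B\<close> those that change sides. Both sets are closed, and positive width
    makes them disjoint.\<close>
  define A where "A = {x. p_out x (f x) = supp C (f x)}"
  define B where "B = {x. p_out x (f x) = - supp C (f x + pi)}"
  have cover: "A \<union> B = UNIV"
  proof -
    have "x \<in> A \<union> B" for x
    proof -
      have "normal_line x (supp C x) \<in> tangents C" using ccw_tangents_iff[OF C(1,2)] by (auto simp: tangents_def)
      then have "normal_line (f x) (p_out x (f x)) \<in> ccw_tangents C \<union> cw_tangents C"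
        using inv bm[of x] by (metis tangents_def)
      moreover have "p_out x (f x) = supp C (f x)" if cc: "normal_line (f x) (p_out x (f x)) \<in> ccw_tangents C"
      proof -
        obtain y where "normal_line (f x) (p_out x (f x)) = normal_line y (supp C y)" using ccw_tangents_iff[OF C(1,2)] cc by blast
        then have "cis (f x) = cis y" "p_out x (f x) = supp C y" by (auto simp: normal_line_eq_iff)
        then show ?thesis by (simp add: supp_def)
      qed
      moreover have "p_out x (f x) = - supp C (f x + pi)" if cc: "normal_line (f x) (p_out x (f x)) \<in> cw_tangents C"
      proof -
        obtain y where "normal_line (f x) (p_out x (f x)) = normal_line y (- supp C (y + pi))" using cw_tangents_iff[OF C(1,2)] cc by blast
        then have "cis (f x) = cis y" "p_out x (f x) = - supp C (y + pi)" by (auto simp: normal_line_eq_iff)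
        then show ?thesis by (simp add: supp_def inner_cis_add_pi)
      qed
      ultimately show ?thesis by (auto simp: A_def B_def)
    qed
    then show ?thesis by blast
  qed
  have disj: "A \<inter> B = {}" 
  proof (rule ccontr)
    assume "A \<inter> B \<noteq> {}"
    then obtain x where "p_out x (f x) = supp C (f x)" "p_out x (f x) = - supp C (f x + pi)"
      unfolding A_def B_def by blast
    then show False using supp_width[OF scc, of "f x"] by simp
  qed
  have clA: "closed A" unfolding A_def
    by (intro closed_Collect_eq continuous_intros fc continuous_on_compose2[OF supp_continuous[OF C(1,2)]]) auto
  have clB: "closed B" unfolding B_def
    by (intro closed_Collect_eq continuous_intros fc continuous_on_compose2[OF supp_continuous[OF C(1,2)]]) auto
  have "A = {} \<or> B = {}"
    using connected_UNIV[where 'a = real] clA clB cover disj unfolding connected_closed by (metis Int_UNIV_right UNIV_I subset_refl sup_commute)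
  moreover have "A \<noteq> {}"
  proof
    assume "A = {}"
    then have B: "p_out x (f x) = - supp C (f x + pi)" for x using cover by (auto simp: B_def)
    \<comment> \<open>\<open>z1\<close> and \<open>z2\<close> are contact points of the incoming
      line before the impact and of the outgoing line after it. As the caustic lies on opposite
      sides of the two lines, these points force opposite signs on \<open>sin (f x - x)\<close>; so
      \<open>f x = x + pi\<close>, a right-angled impact.\<close>
    have perp: "supp C x = - h1 (x + pi / 2)" for x
    proof -
      let ?y = "f x" let ?m = "(x + f x) / 2"
      obtain z1 where z1: "z1 \<in> C" "(z1 - c) \<bullet> cis x = supp C x" by (rule supp_attained[OF C(1,2)])
      obtain z2 where z2: "z2 \<in> C" "(z2 - c) \<bullet> cis (?y + pi) = supp C (?y + pi)" by (rule supp_attained[OF C(1,2)])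
      have z2': "(z2 - c) \<bullet> cis ?y = p_out x ?y" using z2(2) B[of x] by (simp add: inner_cis_add_pi)
      obtain s1 where s1: "z1 = c + pt ?m + s1 *\<^sub>R (\<i> * cis x)"
        using line_point_param[of z1 x ?m] z1(2) f(3)[of x] pt_inner_chord by metis
      obtain s2 where s2: "z2 = c + pt ?m + s2 *\<^sub>R (\<i> * cis ?y)"
        using line_point_param[of z2 ?y ?m] z2' pt_inner_chord by metis
      have half: "0 < sin (?m - x)" "sin (?m - ?y) = - sin (?m - x)"
      proof -
        show "0 < sin (?m - x)" using f(1,2)[of x] by (intro sin_gt_zero) (simp_all add: field_simps)
        have "m - ?y = - (m - x)" if "m + m = x + ?y" for m using that by simp
        from this[OF field_sum_of_halves] have "?m - ?y = - (?m - x)" .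
        then show "sin (?m - ?y) = - sin (?m - x)" by (metis sin_minus)
      qed
      have "z1 \<in> domain \<gamma>" using z1(1) sub by blast
      then have "(z1 - c) \<bullet> cis ?m < h ?m" by (simp add: domain_iff)
      moreover have "(z1 - c) \<bullet> cis ?m = h ?m + s1 * sin (?m - x)"
        by (simp add: s1 inner_add_left pt_inner_self inner_cis_cis)
      ultimately have "s1 * sin (?m - x) < 0" by simp
      then have "s1 < 0" using half by (simp add: mult_less_0_iff)
      have "z2 \<in> domain \<gamma>" using z2(1) sub by blast
      then have "(z2 - c) \<bullet> cis ?m < h ?m" by (simp add: domain_iff)
      moreover have "(z2 - c) \<bullet> cis ?m = h ?m + s2 * sin (?m - ?y)"
        by (simp add: s2 inner_add_left pt_inner_self inner_cis_cis)
      ultimately have "s2 * sin (?m - ?y) < 0" by simp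
      then have "0 < s2" unfolding half(2) using half(1) by (simp add: zero_less_mult_iff)
      have "(z1 - c) \<bullet> cis (?y + pi) \<le> supp C (?y + pi)" by (rule supp_ge[OF C(1) z1(1)])
      then have "p_out x ?y \<le> (z1 - c) \<bullet> cis ?y" using B[of x] by (simp add: inner_cis_add_pi)
      then have "0 \<le> s1 * sin (?y - x)"
        by (simp add: s1 inner_add_left inner_cis_cis pt_inner_chord)
      then have 1: "sin (?y - x) \<le> 0" using \<open>s1 < 0\<close> by (simp add: zero_le_mult_iff)
      have "(z2 - c) \<bullet> cis x \<le> supp C x" by (rule supp_ge[OF C(1) z2(1)])
      then have "s2 * sin (x - ?y) \<le> 0"
        using f(3)[of x] by (simp add: s2 inner_add_left inner_cis_cis pt_inner_chord)
      then have "sin (x - ?y) \<le> 0" using \<open>0 < s2\<close> by (simp add: mult_le_0_iff)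
      then have 2: "0 \<le> sin (?y - x)" by (metis minus_diff_eq neg_0_le_iff_le sin_minus)
      have "sin (?y - x) = 0" using 1 2 by simp
      moreover have "0 < ?y - x" "?y - x < 2 * pi" using f(1,2)[of x] by auto
      ultimately have "?y - x = pi"
        using sin_gt_zero[of "?y - x"] sin_lt_zero[of "?y - x"]
        by (cases "?y - x" pi rule: linorder_cases) simp_all
      then have y: "?y = x + pi" by simp
      have mid: "(x + (x + pi)) / 2 = x + pi / 2" "(x + pi - x) / 2 = pi / 2" by (simp_all add: field_simps)
      then show ?thesis using f(3)[of x] unfolding y p_in_def mid by simp
    qed
    \<comment> \<open>The width of the table in direction \<open>x + pi / 2\<close>. Its derivative
      is minus the width of \<open>C\<close> in direction \<open>x\<close>, so this periodic
      function would be strictly decreasing.\<close>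
    define k where "k x = h (x + pi / 2) + h (x + pi + pi / 2)" for x
    have dk: "(k has_real_derivative h1 (x + pi / 2) + h1 (x + pi + pi / 2)) (at x)" for x
      unfolding k_def by (auto intro!: derivative_eq_intros)
    have "k (2 * pi) < k 0"
    proof (rule DERIV_neg_imp_decreasing[of 0 "2 * pi" k])
      fix x
      have "h1 (x + pi / 2) + h1 (x + pi + pi / 2) < 0"
        using supp_width[OF scc, of x] perp[of x] perp[of "x + pi"] by simp
      then show "\<exists>y. (k has_real_derivative y) (at x) \<and> y < 0" using dk by blast
    qed simp
    moreover have "k (0 + 2 * pi) = k 0"
      using h_periodic[of "pi / 2"] h_periodic[of "pi + pi / 2"] by (simp add: k_def add_ac)
    ultimately show False by simp
  qed
  ultimately have "B = {}" by blast
  then have "p_out x (f x) = supp C (f x)" for x using cover by (auto simp: A_def)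
  then show ?thesis using f bm supp_continuous[OF C(1,2)] supp_shift
    unfolding invariant_graph_def by (intro exI[of _ f]) simp
qed

lemma T_affine_bound: "\<bar>T x - x / (2 * pi) - T 0\<bar> \<le> 1"
proof -
  obtain k y where k: "x = y + 2 * pi * of_int k" "0 \<le> y" "y < 2 * pi"
    by (rule reduce_mod_period[of "2 * pi" x]) auto
  have m: "T 0 \<le> T y" "T y \<le> T (0 + 2 * pi)"
    using k T_mono by (auto simp: strict_mono_less_eq)
  have "T x = T y + of_int k" using T_int k by simp
  moreover have "x / (2 * pi) = y / (2 * pi) + of_int k" using k by (simp add: field_simps)
  moreover have "0 \<le> y / (2 * pi)" "y / (2 * pi) \<le> 1" using k by (auto simp: field_simps)
  ultimately show ?thesis using m T_shift[of 0] unfolding abs_le_iff by linarith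
qed

text \<open>The definition follows the entry points. The entry point of a line has as normal angle
  the mean of two consecutive angles of the orbit of \<open>f\<close>, so it stays within bounded
  distance of this orbit, and \<open>T\<close> is linear up to a bounded error.\<close>

lemma caustic_rotation:
  assumes cc: "convex_caustic \<gamma> C" and ig: "invariant_graph (supp C) f"
    and bm: "\<And>x. billiard_map \<gamma> (normal_line x (supp C x)) = normal_line (f x) (supp C (f x))"
  shows "has_rotation f (rotation_number \<gamma> C)"
proof -
  have scc: "simple_closed_convex_curve C" and sub: "C \<subseteq> domain \<gamma>"
    using cc by (auto simp: convex_caustic_def)
  note C = simple_closed_curve_facts[OF scc]
  obtain r where r: "has_rotation f r" using degree_one_rotation_exists[OF degree_one_f[OF ig]] by blast
  have orb: "(billiard_map \<gamma> ^^ n) (normal_line x (supp C x)) = normal_line ((f ^^ n) x) (supp C ((f ^^ n) x))" for n x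
    by (induction n) (auto simp: bm)
  have ent: "enters_at \<gamma> ((billiard_map \<gamma> ^^ n) (normal_line (f w) (supp C (f w)))) t
      \<longleftrightarrow> (\<exists>k. t = T (((f ^^ n) w + (f ^^ Suc n) w) / 2 + 2 * pi * of_int k))" for n w t
  proof -
    let ?x = "(f ^^ n) w"
    obtain z where z: "z \<in> C" "(z - c) \<bullet> cis (f ?x) = supp C (f ?x)" by (rule supp_attained[OF C(1,2)])
    have e: "(f ^^ n) (f w) = f ?x" by (metis funpow_swap1)
    have "enters_at \<gamma> (normal_line (f ?x) (p_out ?x (f ?x))) t \<longleftrightarrow> (\<exists>k. t = T ((?x + f ?x) / 2 + 2 * pi * of_int k))"
      using enters_at_iff[of ?x "f ?x" z t] z sub invariant_graphD(3-6)[OF ig, of ?x] by auto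
    then show ?thesis using invariant_graphD(6)[OF ig, of ?x] by (simp add: orb e)
  qed
  define \<mu> where "\<mu> w n = ((f ^^ n) w + (f ^^ Suc n) w) / 2" for w n
  have mid: "(u1 + u2) / 2 < (u2 + u3) / 2" "(u2 + u3) / 2 < (u1 + u2) / 2 + 2 * pi"
    if "u1 < u2" "u2 < u1 + 2 * pi" "u2 < u3" "u3 < u2 + 2 * pi" for u1 u2 u3 :: real
    using that by (simp_all add: field_simps)
  have \<mu>step: "\<mu> w n < \<mu> w (Suc n)" "\<mu> w (Suc n) < \<mu> w n + 2 * pi" for w n
    unfolding \<mu>_def using mid[of "(f ^^ n) w" "(f ^^ Suc n) w" "(f ^^ Suc (Suc n)) w"] invariant_graphD(3,4)[OF ig, of "(f ^^ n) w"] invariant_graphD(3,4)[OF ig, of "f ((f ^^ n) w)"]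
    by simp_all
  have lim: "(\<lambda>n. T (\<mu> w n + 2 * pi * of_int k) / real n) \<longlonglongrightarrow> r" for w k
  proof -
    obtain K where K: "\<And>n x. \<bar>(f ^^ n) x - x - 2 * pi * r * real n\<bar> \<le> K"
      using r unfolding has_rotation_def by metis
    define D where "D = \<bar>T 0\<bar> + 1 + \<bar>of_int k\<bar> + (K + \<bar>w\<bar> + 2 * pi) / (2 * pi)"
    have b: "\<bar>T (\<mu> w n + 2 * pi * of_int k) - r * real n\<bar> \<le> D" for n
    proof -
      have "\<bar>(f ^^ n) w - 2 * pi * r * real n\<bar> \<le> K + \<bar>w\<bar>" using K[of n w] by linarith
      moreover have "(f ^^ n) w < \<mu> w n" "\<mu> w n < (f ^^ n) w + 2 * pi"
        using invariant_graphD(3,4)[OF ig, of "(f ^^ n) w"] by (simp_all add: \<mu>_def)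
      ultimately have "\<bar>\<mu> w n - 2 * pi * r * real n\<bar> \<le> K + \<bar>w\<bar> + 2 * pi" by linarith
      then have "\<bar>\<mu> w n - 2 * pi * r * real n\<bar> / (2 * pi) \<le> (K + \<bar>w\<bar> + 2 * pi) / (2 * pi)"
        by (intro divide_right_mono) auto
      moreover have "\<bar>\<mu> w n - 2 * pi * r * real n\<bar> / (2 * pi) = \<bar>\<mu> w n / (2 * pi) - r * real n\<bar>"
      proof -
        have "\<mu> w n / (2 * pi) - r * real n = (\<mu> w n - 2 * pi * r * real n) / (2 * pi)" by (simp add: field_simps)
        then show ?thesis by simp
      qed
      moreover have "\<bar>T (\<mu> w n) - \<mu> w n / (2 * pi) - T 0\<bar> \<le> 1" by (rule T_affine_bound)
      ultimately show ?thesis unfolding T_int D_def by linarith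
    qed
    have "(\<lambda>n. T (\<mu> w n + 2 * pi * of_int k) / real n - r) \<longlonglongrightarrow> 0"
    proof (rule tendsto_rabs_zero_cancel, rule tendsto_sandwich[OF _ _ tendsto_const])
      show "(\<lambda>n. D * (1 / real n)) \<longlonglongrightarrow> 0" by (rule tendsto_mult_right_zero[OF lim_1_over_n])
      show "\<forall>\<^sub>F n in sequentially. \<bar>T (\<mu> w n + 2 * pi * of_int k) / real n - r\<bar> \<le> D * (1 / real n)"
        using eventually_gt_at_top[of 0]
      proof eventually_elim
        case (elim n)
        have "T (\<mu> w n + 2 * pi * of_int k) / real n - r = (T (\<mu> w n + 2 * pi * of_int k) - r * real n) / real n"
          using elim by (simp add: field_simps)
        then show ?case using b[of n] elim by (simp add: divide_right_mono)
      qed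
    qed auto
    then show ?thesis by (simp add: LIM_zero_iff)
  qed
  have "rotation_number \<gamma> C = r"
    unfolding rotation_number_def
  proof (rule the_equality)
    show "\<forall>l\<in>ccw_tangents C. \<forall>\<tau>. (\<forall>n. enters_at \<gamma> ((billiard_map \<gamma> ^^ n) l) (\<tau> n) \<and> \<tau> n < \<tau> (Suc n) \<and> \<tau> (Suc n) < \<tau> n + 1)
      \<longrightarrow> (\<lambda>n. \<tau> n / real n) \<longlonglongrightarrow> r"
    proof (intro ballI allI impI)
      fix l \<tau> assume l: "l \<in> ccw_tangents C"
        and t: "\<forall>n. enters_at \<gamma> ((billiard_map \<gamma> ^^ n) l) (\<tau> n) \<and> \<tau> n < \<tau> (Suc n) \<and> \<tau> (Suc n) < \<tau> n + 1"
      obtain x where "l = normal_line x (supp C x)" using l ccw_tangents_iff[OF C(1,2)] by blast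
      moreover obtain w where "f w = x" by (rule surj_f[OF ig])
      ultimately have lw: "l = normal_line (f w) (supp C (f w))" by simp
      have "\<forall>n. \<exists>k. \<tau> n = T (\<mu> w n + 2 * pi * of_int k)" using t ent unfolding lw \<mu>_def by blast
      then obtain k where k: "\<And>n. \<tau> n = T (\<mu> w n + 2 * pi * of_int (k n))" by metis
      \<comment> \<open>Both the midpoints and the chosen parameters advance by a positive amount
        less than a full turn, which leaves no freedom for the integer.\<close>
      have "k (Suc n) = k n" for n
      proof -
        have "T (\<mu> w n + 2 * pi * of_int (k n)) < T (\<mu> w (Suc n) + 2 * pi * of_int (k (Suc n)))"
          using t k by metis
        then have 1: "\<mu> w n + 2 * pi * of_int (k n) < \<mu> w (Suc n) + 2 * pi * of_int (k (Suc n))"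
          using T_mono strict_mono_less by blast
        have "T (\<mu> w (Suc n) + 2 * pi * of_int (k (Suc n))) < T (\<mu> w n + 2 * pi * of_int (k n) + 2 * pi)"
          using t k T_shift by metis
        then have 2: "\<mu> w (Suc n) + 2 * pi * of_int (k (Suc n)) < \<mu> w n + 2 * pi * of_int (k n) + 2 * pi"
          using T_mono strict_mono_less by blast
        have "2 * pi * of_int (k (Suc n)) < 2 * pi * of_int (k n + 1)" using 2 \<mu>step(1)[of w n] by (simp add: algebra_simps)
        moreover have "2 * pi * of_int (k n) < 2 * pi * of_int (k (Suc n) + 1)" using 1 \<mu>step(2)[of w n] by (simp add: algebra_simps)
        moreover have p: "0 < 2 * pi" by simp
        ultimately have "k (Suc n) < k n + 1" "k n < k (Suc n) + 1"
          unfolding mult_less_cancel_left_pos[OF p] of_int_less_iff by auto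
        then show ?thesis by simp
      qed
      then have "k n = k 0" for n by (induction n) auto
      then have "\<tau> n = T (\<mu> w n + 2 * pi * of_int (k 0))" for n using k[of n] by metis
      then show "(\<lambda>n. \<tau> n / real n) \<longlonglongrightarrow> r" using lim[of w "k 0"] by simp
    qed
    fix r' assume r': "\<forall>l\<in>ccw_tangents C. \<forall>\<tau>. (\<forall>n. enters_at \<gamma> ((billiard_map \<gamma> ^^ n) l) (\<tau> n) \<and> \<tau> n < \<tau> (Suc n) \<and> \<tau> (Suc n) < \<tau> n + 1)
      \<longrightarrow> (\<lambda>n. \<tau> n / real n) \<longlonglongrightarrow> r'"
    \<comment> \<open>An admissible orbit exists, so the condition under \<open>THE\<close> is not
      vacuous and determines the number.\<close>
    define \<tau> where "\<tau> n = T (\<mu> 0 n)" for n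
    have "normal_line (f 0) (supp C (f 0)) \<in> ccw_tangents C" using ccw_tangents_iff[OF C(1,2)] by blast
    moreover have "enters_at \<gamma> ((billiard_map \<gamma> ^^ n) (normal_line (f 0) (supp C (f 0)))) (\<tau> n)" for n
      unfolding ent by (intro exI[of _ 0]) (simp add: \<tau>_def \<mu>_def)
    moreover have "\<tau> n < \<tau> (Suc n)" for n using \<mu>step(1)[of 0 n] T_mono strict_mono_less unfolding \<tau>_def by blast
    moreover have "\<tau> (Suc n) < \<tau> n + 1" for n
      using \<mu>step(2)[of 0 n] T_mono strict_mono_less T_shift unfolding \<tau>_def by metis
    ultimately have "(\<lambda>n. \<tau> n / real n) \<longlonglongrightarrow> r'" using r' by blast
    moreover have "(\<lambda>n. \<tau> n / real n) \<longlonglongrightarrow> r" using lim[of 0 0] by (simp add: \<tau>_def)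
    ultimately show "r' = r" by (rule LIMSEQ_unique)
  qed
  then show ?thesis using r by simp
qed

end

section \<open>Neighbouring leaves of a foliation of class C1\<close>

lemma C1_map_locally_lipschitz:
  fixes f :: "'a::euclidean_space \<Rightarrow> 'b::euclidean_space"
  assumes "C1_map_on S f" "open S" "z \<in> S"
  shows "\<exists>r A. 0 < r \<and> 0 < A \<and> ball z r \<subseteq> S \<and>
    (\<forall>x\<in>ball z r. \<forall>y\<in>ball z r. norm (f x - f y) \<le> A * norm (x - y))"
proof -
  obtain f' :: "'a \<Rightarrow> 'a \<Rightarrow>\<^sub>L 'b" where f': "\<And>x. x \<in> S \<Longrightarrow> (f has_derivative blinfun_apply (f' x)) (at x)"
    "continuous_on S f'" using assms(1) unfolding C1_map_on_def by blast
  have "isCont f' z" using f'(2) assms(2,3) continuous_on_eq_continuous_at by blast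
  then obtain d where d: "0 < d" "\<And>x. dist x z < d \<Longrightarrow> dist (f' x) (f' z) < 1"
    unfolding continuous_at_eps_delta using zero_less_one by blast
  obtain e where e: "0 < e" "ball z e \<subseteq> S" using assms(2,3) open_contains_ball by blast
  define r where "r = min d e"
  define A where "A = norm (f' z) + 1"
  have sub: "ball z r \<subseteq> S" using e by (auto simp: r_def)
  have lip: "norm (f x - f y) \<le> A * norm (x - y)" if "x \<in> ball z r" "y \<in> ball z r" for x y
  proof (rule differentiable_bound[where S = "ball z r" and f' = "\<lambda>x. blinfun_apply (f' x)"])
    fix w assume w: "w \<in> ball z r"
    show "(f has_derivative blinfun_apply (f' w)) (at w within ball z r)"
      using f'(1) w sub by (meson has_derivative_at_withinI subsetD)
    have "norm (f' w) \<le> norm (f' z) + dist (f' w) (f' z)"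
      by (metis dist_norm norm_triangle_sub add.commute norm_minus_commute)
    also have "dist (f' w) (f' z) < 1" using d(2)[of w] w by (simp add: r_def dist_commute)
    finally show "onorm (blinfun_apply (f' w)) \<le> A" by (simp add: A_def norm_blinfun.rep_eq)
  qed (use that in auto)
  have "0 < r" using d(1) e(1) by (simp add: r_def)
  moreover have "0 < A" unfolding A_def using norm_ge_zero[of "f' z"] by linarith
  ultimately show ?thesis using sub lip by blast
qed

locale planar_foliation =
  fixes U :: "complex set" and \<F> :: "complex set set"
  assumes foliation: "C1_foliation U \<F>"
    and leaf_curve: "C \<in> \<F> \<Longrightarrow> simple_closed_convex_curve C"
begin

lemma chart:
  assumes "p \<in> U"
  shows "\<exists>V (\<phi> :: complex \<Rightarrow> real \<times> real) \<psi>. open V \<and> p \<in> V \<and>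
    homeomorphism V ({-1<..<1} \<times> {-1<..<1}) \<phi> \<psi> \<and> C1_map_on V \<phi> \<and> C1_map_on ({-1<..<1} \<times> {-1<..<1}) \<psi> \<and>
    (U \<inter> V = V \<or> U \<inter> V = {z \<in> V. snd (\<phi> z) \<ge> 0}) \<and>
    (\<forall>L\<in>\<F>. \<forall>K\<in>components (L \<inter> V). \<exists>c. K = {z \<in> V. snd (\<phi> z) = c})"
  by (rule foliation[unfolded C1_foliation_def, THEN conjunct2, THEN conjunct2, rule_format, OF assms])

lemmas leaf_compact = simple_closed_curve_facts(1)[OF leaf_curve]
lemmas leaf_nonempty = simple_closed_curve_facts(2)[OF leaf_curve]

lemma leaf_closed: "L \<in> \<F> \<Longrightarrow> closed L"
  using leaf_compact compact_imp_closed by blast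

lemma partition_leaves: "partition_on U \<F>"
  using foliation by (simp add: C1_foliation_def)

lemma leaves_disjoint: "L \<in> \<F> \<Longrightarrow> C \<in> \<F> \<Longrightarrow> L \<noteq> C \<Longrightarrow> L \<inter> C = {}"
  using partition_onD2[OF partition_leaves] by (rule disjointD)

lemma leaves_Union: "\<Union>\<F> = U"
  using partition_onD1[OF partition_leaves] by simp

lemma leaf_in_plaque:
  assumes plaques: "\<forall>L\<in>\<F>. \<forall>K\<in>components (L \<inter> V). \<exists>c. K = {z \<in> V. snd (\<phi> z) = c}"
    and L: "L \<in> \<F>" and w: "w \<in> L" "w \<in> V"
  shows "{z \<in> V. snd (\<phi> z) = snd (\<phi> w)} \<subseteq> L"
    and "connected B \<Longrightarrow> B \<subseteq> L \<inter> V \<Longrightarrow> w \<in> B \<Longrightarrow> B \<subseteq> {z \<in> V. snd (\<phi> z) = snd (\<phi> w)}"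
proof -
  let ?K = "connected_component_set (L \<inter> V) w"
  have wK: "w \<in> ?K" using w by simp
  have "?K \<in> components (L \<inter> V)" using w by (simp add: componentsI)
  then obtain c where c: "?K = {z \<in> V. snd (\<phi> z) = c}" using plaques L by blast
  then have e: "?K = {z \<in> V. snd (\<phi> z) = snd (\<phi> w)}" using wK by auto
  then show "{z \<in> V. snd (\<phi> z) = snd (\<phi> w)} \<subseteq> L" using connected_component_subset[of "L \<inter> V" w] by auto
  show "B \<subseteq> {z \<in> V. snd (\<phi> z) = snd (\<phi> w)}" if "connected B" "B \<subseteq> L \<inter> V" "w \<in> B"
    using connected_component_maximal[OF that(3,1,2)] e by simp
qed

text \<open>Within a chart, the distances of two points of one plaque to another leaf are comparable: both are
  comparable to the difference of the transversal coordinates.\<close>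

lemma chart_comparable:
  assumes "p \<in> U"
  shows "\<exists>V (\<phi> :: complex \<Rightarrow> real \<times> real) \<epsilon> K. 0 < \<epsilon> \<and> 0 < K \<and> ball p \<epsilon> \<subseteq> V \<and>
    (\<forall>L\<in>\<F>. \<forall>K\<in>components (L \<inter> V). \<exists>c. K = {z \<in> V. snd (\<phi> z) = c}) \<and>
    (\<forall>z\<in>ball p \<epsilon>. \<forall>z'\<in>ball p \<epsilon>. \<forall>L\<in>\<F>. snd (\<phi> z) = snd (\<phi> z') \<longrightarrow> infdist z L < \<epsilon> \<longrightarrow>
      infdist z' L \<le> K * infdist z L)"
proof -
  let ?Q = "{-1<..<1} \<times> {-1<..<1} :: (real \<times> real) set"
  obtain V and \<phi> :: "complex \<Rightarrow> real \<times> real" and \<psi> where V: "open V" "p \<in> V"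
    "homeomorphism V ?Q \<phi> \<psi>" "C1_map_on V \<phi>" "C1_map_on ?Q \<psi>"
    "U \<inter> V = V \<or> U \<inter> V = {z \<in> V. snd (\<phi> z) \<ge> 0}"
    and plaques: "\<forall>L\<in>\<F>. \<forall>K\<in>components (L \<inter> V). \<exists>c. K = {z \<in> V. snd (\<phi> z) = c}"
    using chart[OF assms] by (elim exE conjE)
  have opQ: "open ?Q" by (intro open_Times) auto
  have pQ: "\<phi> p \<in> ?Q" using V(2,3) unfolding homeomorphism_def by blast
  obtain r A where rA: "0 < r" "0 < A" "ball p r \<subseteq> V"
    "\<forall>x\<in>ball p r. \<forall>y\<in>ball p r. norm (\<phi> x - \<phi> y) \<le> A * norm (x - y)"
    using C1_map_locally_lipschitz[OF V(4,1,2)] by (elim exE conjE)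
  obtain r' B where rB: "0 < r'" "0 < B" "ball (\<phi> p) r' \<subseteq> ?Q"
    "\<forall>x\<in>ball (\<phi> p) r'. \<forall>y\<in>ball (\<phi> p) r'. norm (\<psi> x - \<psi> y) \<le> B * norm (x - y)"
    using C1_map_locally_lipschitz[OF V(5) opQ pQ] by (elim exE conjE)
  define \<epsilon> where "\<epsilon> = min (r / 2) (r' / (4 * A))"
  have \<epsilon>: "0 < \<epsilon>" "2 * \<epsilon> \<le> r" "3 * (A * \<epsilon>) < r'"
  proof -
    show "0 < \<epsilon>" "2 * \<epsilon> \<le> r" using rA rB by (auto simp: \<epsilon>_def)
    have "A * \<epsilon> \<le> A * (r' / (4 * A))" using rA by (intro mult_left_mono) (auto simp: \<epsilon>_def)
    also have "\<dots> = r' / 4" using rA by simp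
    finally show "3 * (A * \<epsilon>) < r'" using rB(1) by simp
  qed
  have norm_le: "norm (fst q) \<le> norm q" "norm (snd q) \<le> norm q" for q :: "real \<times> real"
    by (metis norm_fst_le prod.collapse, metis norm_snd_le prod.collapse)
  have main: "infdist z' L \<le> (B * A) * infdist z L"
    if z: "z \<in> ball p \<epsilon>" "z' \<in> ball p \<epsilon>" and e: "snd (\<phi> z) = snd (\<phi> z')" and L: "L \<in> \<F>" and d: "infdist z L < \<epsilon>" for z z' L
  proof -
    obtain w where w: "w \<in> L" "infdist z L = dist z w" using infdist_attains_inf[OF leaf_closed leaf_nonempty] L by blast
    have wb: "dist p w < 2 * \<epsilon>" using dist_triangle[of p w z] z(1) d w(2) by simp
    have inr: "z \<in> ball p r" "z' \<in> ball p r" "w \<in> ball p r" "p \<in> ball p r" using z \<epsilon> wb rA(1) by auto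
    have wV: "w \<in> V" "z' \<in> V" using inr rA(3) by auto
    have near: "norm (\<phi> p - \<phi> w) \<le> 2 * (A * \<epsilon>)" "norm (\<phi> p - \<phi> z') \<le> A * \<epsilon>"
    proof -
      have "norm (\<phi> p - \<phi> w) \<le> A * norm (p - w)" by (rule rA(4)[rule_format, OF inr(4,3)])
      also have "\<dots> \<le> A * (2 * \<epsilon>)" using wb rA(2) by (intro mult_left_mono) (auto simp: dist_norm)
      finally show "norm (\<phi> p - \<phi> w) \<le> 2 * (A * \<epsilon>)" by simp
      have "norm (\<phi> p - \<phi> z') \<le> A * norm (p - z')" by (rule rA(4)[rule_format, OF inr(4,2)])
      also have "\<dots> \<le> A * \<epsilon>" using z rA(2) by (intro mult_left_mono) (auto simp: dist_norm)
      finally show "norm (\<phi> p - \<phi> z') \<le> A * \<epsilon>" .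
    qed
    \<comment> \<open>Crossing the plaques from \<open>z'\<close> with the first coordinate fixed,
      up to the level of \<open>w\<close>, leads to a point of \<open>L\<close>; the length of this
      path in the chart is the transversal distance of \<open>z\<close> and
      \<open>w\<close>.\<close>
    define q where "q = (fst (\<phi> z'), snd (\<phi> w))"
    have zb: "\<phi> z' \<in> ball (\<phi> p) r'"
      using near(2) \<epsilon>(3) mult_pos_pos[OF rA(2) \<epsilon>(1)] unfolding mem_ball dist_norm by linarith
    have qb: "q \<in> ball (\<phi> p) r'"
    proof -
      have "norm (\<phi> p - q) \<le> norm (fst (\<phi> p - q)) + norm (snd (\<phi> p - q))"
        by (metis norm_Pair_le prod.collapse)
      also have "\<dots> = norm (fst (\<phi> p - \<phi> z')) + norm (snd (\<phi> p - \<phi> w))" by (simp add: q_def)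
      also have "\<dots> \<le> norm (\<phi> p - \<phi> z') + norm (\<phi> p - \<phi> w)" by (intro add_mono norm_le)
      also have "\<dots> < r'" using near \<epsilon>(3) by simp
      finally show ?thesis by (simp add: dist_norm)
    qed
    have hom: "\<psi> (\<phi> z') = z'" "\<phi> (\<psi> q) = q" "\<psi> q \<in> V"
      using V(3) wV(2) qb rB(3) unfolding homeomorphism_def by blast+
    have "\<psi> q \<in> {z \<in> V. snd (\<phi> z) = snd (\<phi> w)}" using hom by (simp add: q_def)
    then have "\<psi> q \<in> L" using leaf_in_plaque(1)[OF plaques L w(1) wV(1)] by blast
    then have "infdist z' L \<le> dist z' (\<psi> q)" by (rule infdist_le)
    also have "\<dots> = norm (\<psi> (\<phi> z') - \<psi> q)" by (simp add: hom dist_norm)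
    also have "\<dots> \<le> B * norm (\<phi> z' - q)" by (rule rB(4)[rule_format, OF zb qb])
    also have "\<dots> = B * norm (snd (\<phi> z - \<phi> w))" using e by (simp add: q_def norm_prod_def)
    also have "\<dots> \<le> B * norm (\<phi> z - \<phi> w)" using rB(2) by (intro mult_left_mono norm_le) auto
    also have "\<dots> \<le> B * (A * norm (z - w))" using rB(2) by (intro mult_left_mono rA(4)[rule_format, OF inr(1,3)]) auto
    finally show ?thesis using w(2) by (simp add: dist_norm mult.assoc)
  qed
  have "ball p \<epsilon> \<subseteq> V" using \<epsilon> rA(1,3) by (intro order_trans[OF subset_ball rA(3)]) auto
  moreover have "\<forall>z\<in>ball p \<epsilon>. \<forall>z'\<in>ball p \<epsilon>. \<forall>L\<in>\<F>. snd (\<phi> z) = snd (\<phi> z') \<longrightarrow> infdist z L < \<epsilon> \<longrightarrow>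
      infdist z' L \<le> (B * A) * infdist z L" using main by blast
  ultimately have "0 < \<epsilon> \<and> 0 < B * A \<and> ball p \<epsilon> \<subseteq> V \<and>
    (\<forall>L\<in>\<F>. \<forall>K\<in>components (L \<inter> V). \<exists>c. K = {z \<in> V. snd (\<phi> z) = c}) \<and>
    (\<forall>z\<in>ball p \<epsilon>. \<forall>z'\<in>ball p \<epsilon>. \<forall>L\<in>\<F>. snd (\<phi> z) = snd (\<phi> z') \<longrightarrow> infdist z L < \<epsilon> \<longrightarrow>
      infdist z' L \<le> (B * A) * infdist z L)"
    using \<epsilon>(1) mult_pos_pos[OF rB(2) rA(2)] plaques by (intro conjI)
  then show ?thesis by (intro exI)
qed

text \<open>Compactness of the leaf in the form of bisection: comparability on parameter intervals
  holds locally by a chart and passes to adjacent intervals, where the constants multiply.\<close>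

lemma leaf_comparable:
  assumes C: "C \<in> \<F>"
  shows "\<exists>\<epsilon> K. 0 < \<epsilon> \<and> 0 < K \<and>
    (\<forall>z\<in>C. \<forall>z'\<in>C. \<forall>L\<in>\<F>. infdist z L < \<epsilon> \<longrightarrow> infdist z' L \<le> K * infdist z L)"
proof -
  obtain g where "simple_path g" and gi: "path_image g = C"
    using leaf_curve[OF C] unfolding simple_closed_convex_curve_def by blast
  then have g: "path g" "path_image g = C" using simple_path_imp_path by blast+
  have gc: "continuous_on {0..1} g" using g(1) by (simp add: path_def)
  have gC: "g ` {0..1} = C" using g(2) by (simp add: path_image_def)
  define P where "P a b \<longleftrightarrow> (\<exists>\<epsilon> K. 0 < \<epsilon> \<and> 0 < K \<and> (\<forall>s\<in>{a..b} \<inter> {0..1}. \<forall>t\<in>{a..b} \<inter> {0..1}. \<forall>L\<in>\<F>.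
    infdist (g s) L < \<epsilon> \<longrightarrow> infdist (g t) L \<le> K * infdist (g s) L))" for a b :: real
  have "P 0 1"
  proof (rule Bolzano)
    fix a b c assume ab: "P a b" and bc: "P b c" and le: "a \<le> b" "b \<le> c"
    obtain e1 K1 where 1: "0 < e1" "0 < K1" "\<And>s t L. s \<in> {a..b} \<inter> {0..1} \<Longrightarrow> t \<in> {a..b} \<inter> {0..1} \<Longrightarrow> L \<in> \<F> \<Longrightarrow>
      infdist (g s) L < e1 \<Longrightarrow> infdist (g t) L \<le> K1 * infdist (g s) L" using ab unfolding P_def by blast
    obtain e2 K2 where 2: "0 < e2" "0 < K2" "\<And>s t L. s \<in> {b..c} \<inter> {0..1} \<Longrightarrow> t \<in> {b..c} \<inter> {0..1} \<Longrightarrow> L \<in> \<F> \<Longrightarrow>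
      infdist (g s) L < e2 \<Longrightarrow> infdist (g t) L \<le> K2 * infdist (g s) L" using bc unfolding P_def by blast
    \<comment> \<open>At the junction \<open>b\<close> the distance may have grown by the factor
      \<open>K1\<close> or \<open>K2\<close>; the divided thresholds keep it admissible on the other
      interval.\<close>
    define e where "e = min (min e1 e2) (min (e2 / K1) (e1 / K2))"
    define K where "K = max (max K1 K2) (K1 * K2)"
    have e: "0 < e" "e \<le> e1" "e \<le> e2" "e \<le> e2 / K1" "e \<le> e1 / K2" using 1 2 by (auto simp: e_def)
    have K: "0 < K" "K1 \<le> K" "K2 \<le> K" "K1 * K2 \<le> K" using 1 2 by (auto simp: K_def max_def)
    have "infdist (g t) L \<le> K * infdist (g s) L"
      if s: "s \<in> {a..c} \<inter> {0..1}" and t: "t \<in> {a..c} \<inter> {0..1}" and L: "L \<in> \<F>" and d: "infdist (g s) L < e" for s t L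
    proof -
      let ?d = "infdist (g s) L"
      have d0: "0 \<le> ?d" by (rule infdist_nonneg)
      have up: "x \<le> K * ?d" if "x \<le> k * ?d" "k \<le> K" for x k
        using that mult_right_mono[OF that(2) d0] by linarith
      consider "s \<le> b" "t \<le> b" | "b \<le> s" "b \<le> t" | "s \<le> b" "b \<le> t" | "b \<le> s" "t \<le> b" by linarith
      then show ?thesis
      proof cases
        case 1
        then show ?thesis using \<open>0 < e1\<close> s t d e L by (intro up[OF _ K(2)] \<open>\<And>s t L. s \<in> {a..b} \<inter> {0..1} \<Longrightarrow> t \<in> {a..b} \<inter> {0..1} \<Longrightarrow> L \<in> \<F> \<Longrightarrow>
      infdist (g s) L < e1 \<Longrightarrow> infdist (g t) L \<le> K1 * infdist (g s) L\<close>) auto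
      next
        case 2
        then show ?thesis using s t d e L by (intro up[OF _ K(3)] \<open>\<And>s t L. s \<in> {b..c} \<inter> {0..1} \<Longrightarrow> t \<in> {b..c} \<inter> {0..1} \<Longrightarrow> L \<in> \<F> \<Longrightarrow>
      infdist (g s) L < e2 \<Longrightarrow> infdist (g t) L \<le> K2 * infdist (g s) L\<close>) auto
      next
        case 3
        then have bI: "b \<in> {a..b} \<inter> {0..1}" "b \<in> {b..c} \<inter> {0..1}" "s \<in> {a..b} \<inter> {0..1}" "t \<in> {b..c} \<inter> {0..1}" using s t le by auto
        have i: "infdist (g b) L \<le> K1 * ?d" using 1(3)[OF bI(3,1) L] d e by simp
        also have "\<dots> < K1 * (e2 / K1)" using d e 1(2) by (intro mult_strict_left_mono) auto
        finally have "infdist (g b) L < e2" using 1(2) by simp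
        then have "infdist (g t) L \<le> K2 * infdist (g b) L" by (rule 2(3)[OF bI(2,4) L])
        also have "\<dots> \<le> K2 * (K1 * ?d)" using i 2(2) by (intro mult_left_mono) auto
        finally show ?thesis by (intro up[OF _ K(4)]) (simp add: mult_ac)
      next
        case 4
        then have bI: "b \<in> {a..b} \<inter> {0..1}" "b \<in> {b..c} \<inter> {0..1}" "t \<in> {a..b} \<inter> {0..1}" "s \<in> {b..c} \<inter> {0..1}" using s t le by auto
        have i: "infdist (g b) L \<le> K2 * ?d" using 2(3)[OF bI(4,2) L] d e by simp
        also have "\<dots> < K2 * (e1 / K2)" using d e 2(2) by (intro mult_strict_left_mono) auto
        finally have "infdist (g b) L < e1" using 2(2) by simp
        then have "infdist (g t) L \<le> K1 * infdist (g b) L" by (rule 1(3)[OF bI(1,3) L])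
        also have "\<dots> \<le> K1 * (K2 * ?d)" using i 1(2) by (intro mult_left_mono) auto
        finally show ?thesis by (intro up[OF _ K(4)]) (simp add: mult_ac)
      qed
    qed
    then show "P a c" unfolding P_def using e(1) K(1) by blast
  next
    fix x :: real assume x: "0 \<le> x" "x \<le> 1"
    have "g x \<in> C" using gC x by auto
    then have "g x \<in> U" using leaves_Union C by blast
    then obtain V and \<phi> :: "complex \<Rightarrow> real \<times> real" and \<epsilon> K where ch: "0 < \<epsilon>" "0 < K" "ball (g x) \<epsilon> \<subseteq> V"
      and plaques: "\<forall>L\<in>\<F>. \<forall>K\<in>components (L \<inter> V). \<exists>c. K = {z \<in> V. snd (\<phi> z) = c}"
      and cmp: "\<forall>z\<in>ball (g x) \<epsilon>. \<forall>z'\<in>ball (g x) \<epsilon>. \<forall>L\<in>\<F>. snd (\<phi> z) = snd (\<phi> z') \<longrightarrow> infdist z L < \<epsilon> \<longrightarrow>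
        infdist z' L \<le> K * infdist z L"
      using chart_comparable[OF \<open>g x \<in> U\<close>] by (elim exE conjE)
    obtain d where d: "0 < d" "\<And>y. y \<in> {0..1} \<Longrightarrow> dist y x < d \<Longrightarrow> dist (g y) (g x) < \<epsilon>"
      using gc x ch(1) unfolding continuous_on_iff by (metis atLeastAtMost_iff)
    have "P a b" if ab: "a \<le> x" "x \<le> b" "b - a < d" for a b
    proof -
      let ?I = "{a..b} \<inter> {0..1}"
      have gI: "g ` ?I \<subseteq> ball (g x) \<epsilon>" using d(2) ab by (auto simp: dist_real_def dist_commute)
      have "connected (g ` ?I)"
        by (intro connected_continuous_image continuous_on_subset[OF gc]) (auto simp: Int_atLeastAtMost)
      moreover have "g ` ?I \<subseteq> C \<inter> V" using gI ch(3) gC by auto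
      moreover have "g x \<in> g ` ?I" using x ab by auto
      moreover have "g x \<in> V" using ch(1,3) by auto
      ultimately have "g ` ?I \<subseteq> {z \<in> V. snd (\<phi> z) = snd (\<phi> (g x))}"
        using leaf_in_plaque(2)[OF plaques C \<open>g x \<in> C\<close>] by blast
      then have e: "snd (\<phi> (g s)) = snd (\<phi> (g x))" if "s \<in> ?I" for s using that by blast
      have "infdist (g t) L \<le> K * infdist (g s) L" if "s \<in> ?I" "t \<in> ?I" "L \<in> \<F>" "infdist (g s) L < \<epsilon>" for s t L

      proof -
        have "g s \<in> ball (g x) \<epsilon>" "g t \<in> ball (g x) \<epsilon>" using gI that(1,2) by blast+
        then show ?thesis using cmp that e[OF that(1)] e[OF that(2)] by simp
      qed
      then show ?thesis unfolding P_def using ch(1,2) by blast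
    qed
    then show "\<exists>d>0. \<forall>a b. a \<le> x \<and> x \<le> b \<and> b - a < d \<longrightarrow> P a b" using d(1) by blast
  qed simp
  then obtain \<epsilon> K where *: "0 < \<epsilon>" "0 < K" "\<And>s t L. s \<in> {0..1} \<Longrightarrow> t \<in> {0..1} \<Longrightarrow> L \<in> \<F> \<Longrightarrow>
    infdist (g s) L < \<epsilon> \<Longrightarrow> infdist (g t) L \<le> K * infdist (g s) L" unfolding P_def by auto
  have "infdist z' L \<le> K * infdist z L"
    if zz: "z \<in> C" "z' \<in> C" "L \<in> \<F>" "infdist z L < \<epsilon>" for z z' L
  proof -
    obtain s t where "s \<in> {0..1}" "z = g s" "t \<in> {0..1}" "z' = g t" using zz(1,2) gC by blast
    then show ?thesis using *(3) zz(3,4) by simp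
  qed
  then show ?thesis using *(1,2) by blast
qed

text \<open>Points of larger transversal coordinate are used, because these belong to
  \<open>U\<close> in a half-chart as well. \<open>C\<close> cannot cover an open set of them, since
  it is the frontier of its inside.\<close>

lemma nearby_leaf:
  assumes C: "C \<in> \<F>" and p: "p \<in> C" and \<eta>: "0 < \<eta>"
  shows "\<exists>L\<in>\<F>. L \<noteq> C \<and> 0 < infdist p L \<and> infdist p L < \<eta>"
proof -
  let ?Q = "{-1<..<1} \<times> {-1<..<1} :: (real \<times> real) set"
  have pU: "p \<in> U" using leaves_Union C p by blast
  obtain V and \<phi> :: "complex \<Rightarrow> real \<times> real" and \<psi> where V: "open V" "p \<in> V"
    "homeomorphism V ?Q \<phi> \<psi>" "C1_map_on V \<phi>" "C1_map_on ?Q \<psi>"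
    "U \<inter> V = V \<or> U \<inter> V = {z \<in> V. snd (\<phi> z) \<ge> 0}"
    using chart[OF pU] by (elim exE conjE)
  have \<phi>c: "continuous_on V \<phi>" and \<psi>c: "continuous_on ?Q \<psi>" and inv: "\<And>z. z \<in> V \<Longrightarrow> \<psi> (\<phi> z) = z"
    "\<And>q. q \<in> ?Q \<Longrightarrow> \<phi> (\<psi> q) = q" "\<And>q. q \<in> ?Q \<Longrightarrow> \<psi> q \<in> V" and pQ: "\<phi> p \<in> ?Q"
    using V(2,3) unfolding homeomorphism_def by blast+
  define N where "N = {w \<in> V. snd (\<phi> p) < snd (\<phi> w)} \<inter> ball p \<eta>"
  have "open {w \<in> V. snd (\<phi> p) < snd (\<phi> w)}"
  proof -
    have "continuous_on V (\<lambda>w. snd (\<phi> w))" by (intro continuous_intros \<phi>c)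
    then have "open (V \<inter> (\<lambda>w. snd (\<phi> w)) -` {snd (\<phi> p)<..})" by (intro continuous_open_preimage V(1)) auto
    moreover have "V \<inter> (\<lambda>w. snd (\<phi> w)) -` {snd (\<phi> p)<..} = {w \<in> V. snd (\<phi> p) < snd (\<phi> w)}" by auto
    ultimately show ?thesis by simp
  qed
  then have "open N" unfolding N_def by (intro open_Int open_ball)
  have "N \<noteq> {}"
  proof -
    have opQ: "open ?Q" by (intro open_Times) auto
    have "isCont \<psi> (\<phi> p)" using \<psi>c pQ unfolding continuous_on_eq_continuous_at[OF opQ] by (rule bspec)
    then obtain d where d: "0 < d" "\<And>q. dist q (\<phi> p) < d \<Longrightarrow> dist (\<psi> q) (\<psi> (\<phi> p)) < \<eta>"
      unfolding continuous_at_eps_delta using \<eta> by blast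
    define t where "t = min (d / 2) ((1 - snd (\<phi> p)) / 2)"
    have t: "0 < t" "t < d" "snd (\<phi> p) + t < 1" using d(1) pQ by (auto simp: t_def mem_Times_iff min_def field_simps)
    define q where "q = (fst (\<phi> p), snd (\<phi> p) + t)"
    have "q \<in> ?Q" using pQ t by (auto simp: q_def mem_Times_iff)
    moreover have "dist q (\<phi> p) < d" using t by (cases "\<phi> p") (simp add: q_def dist_Pair_Pair dist_real_def)
    ultimately have "\<psi> q \<in> N" using inv d(2)[of q] V(2) t(1) by (simp add: N_def q_def dist_commute)
    then show ?thesis by blast
  qed
  note Cf = simple_closed_curve_facts[OF leaf_curve[OF C]]
  have "\<not> N \<subseteq> C"
  proof
    assume "N \<subseteq> C"
    then have "N \<inter> closure (inside C) \<noteq> {}" using Cf(8) \<open>N \<noteq> {}\<close> by (auto simp: frontier_def)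
    then have "N \<inter> inside C \<noteq> {}" using open_Int_closure_eq_empty[OF \<open>open N\<close>] by blast
    then show False using \<open>N \<subseteq> C\<close> Cf(9) by blast
  qed
  then obtain w where "w \<in> N" "w \<notin> C" by blast
  then have w: "w \<in> V" "snd (\<phi> p) < snd (\<phi> w)" "dist p w < \<eta>" "w \<notin> C" by (simp_all add: N_def)
  have "w \<in> U" using V(6)
  proof
    assume "U \<inter> V = V"
    then show ?thesis using w(1) by blast
  next
    assume e: "U \<inter> V = {z \<in> V. snd (\<phi> z) \<ge> 0}"
    have "p \<in> U \<inter> V" using pU V(2) by blast
    then have "0 \<le> snd (\<phi> p)" unfolding e by simp
    then have "w \<in> U \<inter> V" unfolding e using w(1,2) by simp
    then show ?thesis by blast
  qed
  then obtain L where L: "L \<in> \<F>" "w \<in> L" using leaves_Union by blast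
  have "L \<noteq> C" using L w by blast
  then have "p \<notin> L" using leaves_disjoint[OF L(1) C] p by blast
  then have "0 < infdist p L" using in_closed_iff_infdist_zero[OF leaf_closed leaf_nonempty] L(1) infdist_nonneg[of p L]
    by (metis less_eq_real_def)
  moreover have "infdist p L < \<eta>" using infdist_le[OF L(2), of p] w(3) by simp
  ultimately show ?thesis using L(1) \<open>L \<noteq> C\<close> by blast
qed

end


section \<open>From distances between leaves to support functions\<close>

text \<open>The two convex curves are nested. Distances are known only from points of
  \<open>C\<close> to \<open>L\<close>, which suffices if \<open>C\<close> is the outer curve. If
  \<open>L\<close> is the outer one, a point \<open>w\<close> of \<open>L\<close> is joined to the
  centre of a ball inside \<open>C\<close>: about the point where the segment crosses
  \<open>C\<close> a shrunken ball lies inside \<open>L\<close>, its radius is at most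
  \<open>e\<close>, and so \<open>w\<close> is within \<open>2 * B * e / \<rho>0\<close> of the
  crossing point. Hence the factor \<open>1 + 2 * B / \<rho>0\<close>.\<close>

lemma (in table) convex_leaf_perturbation:
  assumes C: "simple_closed_convex_curve C" "C \<subseteq> domain \<gamma>" and L: "simple_closed_convex_curve L" "L \<subseteq> domain \<gamma>"
    and disj: "C \<inter> L = {}" and B: "\<And>z. z \<in> body \<Longrightarrow> norm (z - c) \<le> B" and B0: "0 < B"
    and ball: "ball x0 \<rho>0 \<subseteq> inside C" "0 < \<rho>0"
    and near: "\<And>z. z \<in> C \<Longrightarrow> d \<le> infdist z L" "\<And>z. z \<in> C \<Longrightarrow> infdist z L \<le> e" and e: "e < \<rho>0" "0 < d"
  shows "(\<forall>x. d \<le> supp L x - supp C x \<and> supp L x - supp C x \<le> (1 + 2 * B / \<rho>0) * e) \<or>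
    (\<forall>x. d \<le> supp C x - supp L x \<and> supp C x - supp L x \<le> (1 + 2 * B / \<rho>0) * e)"
proof -
  note Cf = simple_closed_curve_facts[OF C(1)] and Lf = simple_closed_curve_facts[OF L(1)]
  have e0: "0 < e"
  proof -
    obtain z where "z \<in> C" using Cf(2) by blast
    then show ?thesis using near[of z] e(2) by linarith
  qed
  have fac: "e \<le> (1 + 2 * B / \<rho>0) * e" "2 * B * e / \<rho>0 \<le> (1 + 2 * B / \<rho>0) * e"
    using e0 B0 ball(2) by (simp_all add: distrib_right)
  have body: "z \<in> body" if "z \<in> domain \<gamma>" for z using that by (auto simp: domain_iff body_def intro: less_imp_le)
  have x0: "x0 \<in> inside C" using ball by auto
  have ray: "\<exists>\<tau>>0. w + \<tau> *\<^sub>R l \<in> K \<and> (\<forall>t. 0 \<le> t \<longrightarrow> t < \<tau> \<longrightarrow> w + t *\<^sub>R l \<in> inside K)"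
    if K: "simple_closed_convex_curve K" and w: "w \<in> inside K" and l: "l \<noteq> 0" for w l K
  proof -
    note Kf = simple_closed_curve_facts[OF K]
    have i: "interior (inside K) = inside K" by (rule interior_open[OF Kf(4)])
    have "w \<in> interior (inside K)" using w i by simp
    then obtain \<tau> where "0 < \<tau>" "w + \<tau> *\<^sub>R l \<in> frontier (inside K)" "\<And>t. 0 \<le> t \<Longrightarrow> t < \<tau> \<Longrightarrow> w + t *\<^sub>R l \<in> interior (inside K)"
      using ray_to_frontier[OF Kf(6) _ l, of w thesis] by metis
    then show ?thesis using Kf(8) i by metis
  qed
  have shift: "(w + \<tau> *\<^sub>R cis x - c) \<bullet> cis x = (w - c) \<bullet> cis x + \<tau>" for w \<tau> x
    by (simp add: inner_add_left inner_diff_left inner_cis_cis)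
  have cis0: "cis x \<noteq> 0" for x by simp
  show ?thesis
  proof (cases "L \<inter> inside C = {}")
    case False
    have Lin: "L \<subseteq> inside C"
    proof (rule ccontr)
      assume "\<not> L \<subseteq> inside C"
      then have "L \<inter> frontier (inside C) \<noteq> {}"
        using connected_Int_frontier[OF Lf(3), of "inside C"] False by blast
      then show False using Cf(8) disj by auto
    qed
    have "d \<le> supp C x - supp L x \<and> supp C x - supp L x \<le> (1 + 2 * B / \<rho>0) * e" for x
    proof
      obtain w where w: "w \<in> L" "(w - c) \<bullet> cis x = supp L x" by (rule supp_attained[OF Lf(1,2)])
      obtain \<tau> where \<tau>: "0 < \<tau>" "w + \<tau> *\<^sub>R cis x \<in> C" using ray[OF C(1) _ cis0, of w x] Lin w(1) by blast
      have "d \<le> infdist (w + \<tau> *\<^sub>R cis x) L" by (rule near(1)[OF \<tau>(2)])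
      also have "\<dots> \<le> dist (w + \<tau> *\<^sub>R cis x) w" by (rule infdist_le[OF w(1)])
      also have "\<dots> = \<tau>" using \<tau>(1) by (simp add: dist_norm)
      finally show "d \<le> supp C x - supp L x" using supp_ge[OF Cf(1) \<tau>(2), of x] w(2) shift[of w \<tau> x] by linarith
      obtain z where z: "z \<in> C" "(z - c) \<bullet> cis x = supp C x" by (rule supp_attained[OF Cf(1,2)])
      obtain y where y: "y \<in> L" "infdist z L = dist z y"
        using infdist_attains_inf[OF compact_imp_closed[OF Lf(1)] Lf(2)] by metis
      have "(z - c) \<bullet> cis x - (y - c) \<bullet> cis x \<le> norm (z - y)"
        using inner_cis_le_norm[of "z - y" x] by (simp add: inner_diff_left)
      then show "supp C x - supp L x \<le> (1 + 2 * B / \<rho>0) * e"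
        using near(2)[OF z(1)] y(2) supp_ge[OF Lf(1) y(1), of x] z(2) fac(1) by (simp add: dist_norm)
    qed
    then show ?thesis by blast
  next
    case True
    \<comment> \<open>Otherwise a line separates \<open>x0\<close> from \<open>L\<close>. The ray
      from \<open>x0\<close> pointing away from \<open>L\<close> meets \<open>C\<close> at distance
      at least \<rho>0 from \<open>x0\<close>, in a point even farther than that from
      \<open>L\<close>, against \<open>e < \<rho>0\<close>.\<close>
    have x0L: "x0 \<in> inside L"
    proof (rule ccontr)
      assume n: "x0 \<notin> inside L"
      have cl: "closure (inside L) = inside L \<union> L" using closure_Un_frontier[of "inside L"] Lf(8) by simp
      have "x0 \<notin> closure (inside L)" using n cl True x0 by blast
      then obtain a b where ab: "a \<bullet> x0 < b" "\<And>w. w \<in> closure (inside L) \<Longrightarrow> b < a \<bullet> w"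
        using separating_hyperplane_closed_point[of "closure (inside L)" x0] Lf(7) by (metis closed_closure convex_closure)
      have aw: "a \<bullet> x0 < a \<bullet> w" if "w \<in> L" for w using ab(1) ab(2)[of w] cl that by auto
      have "a \<noteq> 0" using aw Lf(2) by auto
      define l where "l = - sgn a"
      have l0: "l \<noteq> 0" "norm l = 1" using \<open>a \<noteq> 0\<close> by (simp_all add: l_def norm_sgn sgn_zero_iff)
      obtain \<tau> where \<tau>: "0 < \<tau>" "x0 + \<tau> *\<^sub>R l \<in> C" using ray[OF C(1) x0 l0(1)] by blast
      have "\<rho>0 \<le> \<tau>"
      proof (rule ccontr)
        assume "\<not> \<rho>0 \<le> \<tau>"
        then have "x0 + \<tau> *\<^sub>R l \<in> ball x0 \<rho>0" using \<tau>(1) l0(2) by (simp add: dist_norm)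
        then show False using ball(1) Cf(9) \<tau>(2) by blast
      qed
      obtain w where w: "w \<in> L" "infdist (x0 + \<tau> *\<^sub>R l) L = dist (x0 + \<tau> *\<^sub>R l) w"
        using infdist_attains_inf[OF compact_imp_closed[OF Lf(1)] Lf(2)] by metis
      have "sgn a \<bullet> sgn a = 1" using \<open>a \<noteq> 0\<close> by (simp add: norm_sgn flip: power2_norm_eq_inner)
      then have "sgn a \<bullet> (w - (x0 + \<tau> *\<^sub>R l)) = sgn a \<bullet> (w - x0) + \<tau>" by (simp add: l_def inner_diff_right inner_add_right)
      moreover have "0 < sgn a \<bullet> (w - x0)"
        using aw[OF w(1)] \<open>a \<noteq> 0\<close> by (simp add: sgn_div_norm inner_diff_right)
      moreover have "sgn a \<bullet> (w - (x0 + \<tau> *\<^sub>R l)) \<le> norm (w - (x0 + \<tau> *\<^sub>R l))"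
        using norm_cauchy_schwarz[of "sgn a"] \<open>a \<noteq> 0\<close> by (metis norm_sgn mult_1)
      ultimately have "\<tau> < dist (x0 + \<tau> *\<^sub>R l) w" by (simp add: dist_norm norm_minus_commute)
      then show False using near(2)[OF \<tau>(2)] w(2) e(1) \<open>\<rho>0 \<le> \<tau>\<close> by linarith
    qed
    have Kc: "inside C \<union> C = closure (inside C)" using closure_Un_frontier[of "inside C"] Cf(8) by simp
    have Cin: "inside C \<union> C \<subseteq> inside L"
    proof (rule ccontr)
      assume "\<not> inside C \<union> C \<subseteq> inside L"
      moreover have "connected (inside C \<union> C)"
        unfolding Kc by (intro convex_connected convex_closure Cf(7))
      ultimately have "(inside C \<union> C) \<inter> frontier (inside L) \<noteq> {}"
        using connected_Int_frontier[of "inside C \<union> C" "inside L"] x0 x0L by blast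
      then show False using Lf(8) True disj by auto
    qed
    have "d \<le> supp L x - supp C x \<and> supp L x - supp C x \<le> (1 + 2 * B / \<rho>0) * e" for x
    proof
      obtain z where z: "z \<in> C" "(z - c) \<bullet> cis x = supp C x" by (rule supp_attained[OF Cf(1,2)])
      obtain \<tau> where \<tau>: "0 < \<tau>" "z + \<tau> *\<^sub>R cis x \<in> L" using ray[OF L(1) _ cis0, of z x] Cin z(1) by blast
      have "d \<le> infdist z L" by (rule near(1)[OF z(1)])
      also have "\<dots> \<le> dist z (z + \<tau> *\<^sub>R cis x)" by (rule infdist_le[OF \<tau>(2)])
      also have "\<dots> = \<tau>" using \<tau>(1) by (simp add: dist_norm)
      finally show "d \<le> supp L x - supp C x" using supp_ge[OF Lf(1) \<tau>(2), of x] z(2) shift[of z \<tau> x] by linarith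
      obtain w where w: "w \<in> L" "(w - c) \<bullet> cis x = supp L x" by (rule supp_attained[OF Lf(1,2)])
      have wx: "w - x0 \<noteq> 0" using w(1) x0 True by auto
      obtain t where t: "0 < t" "x0 + t *\<^sub>R (w - x0) \<in> C" "\<And>s. 0 \<le> s \<Longrightarrow> s < t \<Longrightarrow> x0 + s *\<^sub>R (w - x0) \<in> inside C"
        using ray[OF C(1) x0 wx] by blast
      have "\<not> 1 < t" using t(3)[of 1] w(1) True by auto
      moreover have "t \<noteq> 1" using t(2) w(1) disj by auto
      ultimately have t1: "t < 1" by simp
      define z1 where "z1 = x0 + t *\<^sub>R (w - x0)"
      \<comment> \<open>The image of the ball about \<open>x0\<close> under the homothety with
        centre \<open>w\<close> that carries \<open>x0\<close> to \<open>z1\<close>.\<close>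
      have sub: "ball z1 ((1 - t) * \<rho>0) \<subseteq> inside L"
      proof
        fix y assume "y \<in> ball z1 ((1 - t) * \<rho>0)"
        then have yn: "norm (y - z1) < (1 - t) * \<rho>0" by (simp add: dist_norm norm_minus_commute)
        define v where "v = x0 + (1 / (1 - t)) *\<^sub>R (y - z1)"
        have "norm (v - x0) = norm (y - z1) / (1 - t)" using t1 by (simp add: v_def)
        also have "\<dots> < \<rho>0" using yn t1 by (simp add: pos_divide_less_eq mult.commute)
        finally have "norm (v - x0) < \<rho>0" .
        then have "v \<in> ball x0 \<rho>0" by (simp add: dist_norm norm_minus_commute)
        then have v: "v \<in> interior (inside L)" using ball(1) Cin interior_open[OF Lf(4)] by blast
        have wc: "w \<in> closure (inside L)" using w(1) Lf(8) closure_Un_frontier[of "inside L"] by blast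
        have "(1 - t) *\<^sub>R v = (1 - t) *\<^sub>R x0 + (y - z1)" using t1 by (simp add: v_def scaleR_add_right)
        then have ye: "y = (1 - t) *\<^sub>R v + t *\<^sub>R w" by (simp add: z1_def algebra_simps)
        have "v \<noteq> w"
        proof
          assume "v = w"
          then show False using v interior_open[OF Lf(4)] w(1) Lf(9) by blast
        qed
        then have "y \<in> open_segment v w" unfolding in_segment using ye t(1) t1 by blast
        then show "y \<in> inside L"
          using in_interior_closure_convex_segment[OF Lf(7) v wc] interior_open[OF Lf(4)] by blast
      qed
      obtain y where y: "y \<in> L" "infdist z1 L = dist z1 y"
        using infdist_attains_inf[OF compact_imp_closed[OF Lf(1)] Lf(2)] by metis
      have "(1 - t) * \<rho>0 \<le> dist z1 y"
      proof (rule ccontr)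
        assume "\<not> (1 - t) * \<rho>0 \<le> dist z1 y"
        then have "y \<in> inside L" using sub by auto
        then show False using y(1) Lf(9) by blast
      qed
      then have "(1 - t) * \<rho>0 \<le> e" using near(2)[OF t(2)] y(2) by (simp add: z1_def)
      then have t2: "1 - t \<le> e / \<rho>0" using ball(2) by (simp add: field_simps)
      have wz: "w - z1 = (1 - t) *\<^sub>R (w - x0)" by (simp add: z1_def algebra_simps)
      have x0b: "x0 \<in> body"
      proof -
        have "domain \<gamma> = interior body" unfolding interior_body using domain_iff by blast
        then have "convex (domain \<gamma>)" using convex_interior[OF convex_body] by simp
        then have "- domain \<gamma> \<subseteq> outside C" using C(2) by (rule outside_subset_convex)
        then show ?thesis using x0 body inside_Int_outside[of C] by blast
      qed
      have "norm (w - x0) \<le> norm (w - c) + norm (x0 - c)" using norm_triangle_ineq4[of "w - c" "x0 - c"] by simp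
      also have "\<dots> \<le> 2 * B" using B[OF x0b] B[OF body[OF subsetD[OF L(2) w(1)]]] by simp
      finally have "norm (w - z1) \<le> (e / \<rho>0) * (2 * B)"
        unfolding wz norm_scaleR using t2 t1 B0 e0 ball(2) by (intro mult_mono) auto
      moreover have "(w - c) \<bullet> cis x - (z1 - c) \<bullet> cis x \<le> norm (w - z1)"
        using inner_cis_le_norm[of "w - z1" x] by (simp add: inner_diff_left)
      moreover have "(z1 - c) \<bullet> cis x \<le> supp C x" using supp_ge[OF Cf(1) t(2)] by (simp add: z1_def)
      moreover have "(e / \<rho>0) * (2 * B) = 2 * B * e / \<rho>0" by simp
      ultimately show "supp L x - supp C x \<le> (1 + 2 * B / \<rho>0) * e" using w(2) fac(2) by linarith
    qed
    then show ?thesis by blast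
  qed
qed

locale caustic_foliation = table + planar_foliation +
  assumes caustic: "C \<in> \<F> \<Longrightarrow> convex_caustic \<gamma> C"
begin

text \<open>Both \<open>d\<close> and \<open>D\<close> are constant multiples of the distance
  \<open>s\<close> from one fixed point \<open>p\<close> to the neighbouring leaf. So
  \<open>D\<close> squared over \<open>d\<close> is of order \<open>s\<close>, and \<open>s\<close>
  can be made arbitrarily small.\<close>

lemma leaf_perturbation:
  assumes C: "C \<in> \<F>" and \<eta>: "0 < \<eta>"
  shows "\<exists>L\<in>\<F>. \<exists>d D. 0 < d \<and> D\<^sup>2 \<le> \<eta> * d \<and>
    ((\<forall>x. d \<le> supp L x - supp C x \<and> supp L x - supp C x \<le> D) \<or>
     (\<forall>x. d \<le> supp C x - supp L x \<and> supp C x - supp L x \<le> D))"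
proof -
  have cv: "simple_closed_convex_curve L" "L \<subseteq> domain \<gamma>" if "L \<in> \<F>" for L
    using caustic[OF that] by (auto simp: convex_caustic_def)
  note Cf = simple_closed_curve_facts[OF cv(1)[OF C]]
  obtain B where B: "0 < B" "\<And>z. z \<in> body \<Longrightarrow> norm (z - c) \<le> B" using body_bounded by metis
  obtain x0 where x0: "x0 \<in> inside C" using Cf(5) by blast
  obtain \<rho>0 where \<rho>0: "0 < \<rho>0" "ball x0 \<rho>0 \<subseteq> inside C" using Cf(4) x0 open_contains_ball by blast
  obtain p where p: "p \<in> C" using Cf(2) by blast
  obtain \<epsilon> K where cmp: "0 < \<epsilon>" "0 < K"
    "\<And>z z' L. z \<in> C \<Longrightarrow> z' \<in> C \<Longrightarrow> L \<in> \<F> \<Longrightarrow> infdist z L < \<epsilon> \<Longrightarrow> infdist z' L \<le> K * infdist z L"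
    using leaf_comparable[OF C] by blast
  define M' where "M' = (1 + 2 * B / \<rho>0) * K"
  have M': "0 < M'" using B \<rho>0 cmp by (simp add: M'_def add_pos_nonneg)
  \<comment> \<open>The four bounds allow, in this order, comparison from \<open>p\<close>,
    comparison back to \<open>p\<close>, nesting of the two curves, and the final estimate of
    \<open>D\<close> squared.\<close>
  define \<sigma> where "\<sigma> = min (min \<epsilon> (\<epsilon> / K)) (min (\<rho>0 / K) (\<eta> / (K * M'\<^sup>2)))"
  have \<sigma>: "0 < \<sigma>" "\<sigma> \<le> \<epsilon>" "\<sigma> \<le> \<epsilon> / K" "\<sigma> \<le> \<rho>0 / K" "\<sigma> \<le> \<eta> / (K * M'\<^sup>2)"
    using cmp \<rho>0 \<eta> M' by (auto simp: \<sigma>_def)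
  obtain L where L: "L \<in> \<F>" "L \<noteq> C" "0 < infdist p L" "infdist p L < \<sigma>" using nearby_leaf[OF C p \<sigma>(1)] by blast
  define s where "s = infdist p L"
  have s: "0 < s" "s < \<sigma>" using L by (auto simp: s_def)
  have Ks: "K * s < \<epsilon>" "K * s < \<rho>0"
  proof -
    have "s < \<epsilon> / K" "s < \<rho>0 / K" using s \<sigma> by linarith+
    then show "K * s < \<epsilon>" "K * s < \<rho>0" using cmp(2) by (simp_all add: pos_less_divide_eq mult.commute)
  qed
  have up: "infdist z L \<le> K * s" if "z \<in> C" for z
    using cmp(3)[OF p that L(1)] s \<sigma> by (simp add: s_def)
  have lo: "s / K \<le> infdist z L" if "z \<in> C" for z
    using cmp(3)[OF that p L(1)] up[OF that] Ks cmp(2) by (simp add: s_def field_simps)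
  have "C \<inter> L = {}" using leaves_disjoint[OF C L(1)] L(2) by simp
  then have alt: "(\<forall>x. s / K \<le> supp L x - supp C x \<and> supp L x - supp C x \<le> (1 + 2 * B / \<rho>0) * (K * s)) \<or>
    (\<forall>x. s / K \<le> supp C x - supp L x \<and> supp C x - supp L x \<le> (1 + 2 * B / \<rho>0) * (K * s))"
    by (rule convex_leaf_perturbation[OF cv[OF C] cv[OF L(1)] _ B(2,1) \<rho>0(2,1) lo up Ks(2)])
      (use s cmp(2) in auto)
  have "((1 + 2 * B / \<rho>0) * (K * s))\<^sup>2 \<le> \<eta> * (s / K)"
  proof -
    have "((1 + 2 * B / \<rho>0) * (K * s))\<^sup>2 = M'\<^sup>2 * s * s" by (simp add: M'_def power2_eq_square mult_ac)
    also have "\<dots> \<le> M'\<^sup>2 * (\<eta> / (K * M'\<^sup>2)) * s" using s \<sigma> by (intro mult_right_mono mult_left_mono) auto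
    also have "\<dots> = \<eta> * (s / K)" using M' by simp
    finally show ?thesis .
  qed
  moreover have "0 < s / K" using s cmp(2) by simp
  ultimately show ?thesis using alt L(1) by blast
qed

end

section \<open>The caustic with rotation number 1/4\<close>

context caustic_foliation
begin

text \<open>One leaf is chosen for each rotation number; the remaining leaves still serve as
  perturbations of the chosen ones.\<close>

lemma family_exists:
  assumes rot: "rotation_number \<gamma> ` \<F> = {0<..1/4}"
  shows "\<exists>P F M. caustic_family h h1 \<rho> P F M"
proof -
  have "\<exists>f. \<forall>C\<in>\<F>. invariant_graph (supp C) (f C) \<and> has_rotation (f C) (rotation_number \<gamma> C)"
  proof (rule bchoice, rule ballI)
    fix C assume "C \<in> \<F>"
    then have cc: "convex_caustic \<gamma> C" by (rule caustic)
    obtain f where f: "invariant_graph (supp C) f" "\<forall>x. billiard_map \<gamma> (normal_line x (supp C x)) = normal_line (f x) (supp C (f x))"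
      using caustic_invariant_graph[OF cc] by blast
    have "has_rotation f (rotation_number \<gamma> C)" by (rule caustic_rotation[OF cc f(1)]) (use f(2) in blast)
    then show "\<exists>f. invariant_graph (supp C) f \<and> has_rotation f (rotation_number \<gamma> C)" using f(1) by blast
  qed
  then obtain f where f: "\<And>C. C \<in> \<F> \<Longrightarrow> invariant_graph (supp C) (f C)"
    "\<And>C. C \<in> \<F> \<Longrightarrow> has_rotation (f C) (rotation_number \<gamma> C)" by blast
  have "\<exists>Cs. \<forall>r\<in>{0<..1/4}. Cs r \<in> \<F> \<and> rotation_number \<gamma> (Cs r) = r"
  proof (rule bchoice, rule ballI)
    fix r :: real assume "r \<in> {0<..1/4}"
    then show "\<exists>C. C \<in> \<F> \<and> rotation_number \<gamma> C = r" unfolding rot[symmetric] by blast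
  qed
  then obtain Cs where Cs: "\<And>r. r \<in> {0<..1/4} \<Longrightarrow> Cs r \<in> \<F>" "\<And>r. r \<in> {0<..1/4} \<Longrightarrow> rotation_number \<gamma> (Cs r) = r"
    by blast
  obtain B where B: "0 < B" "\<And>z. z \<in> body \<Longrightarrow> norm (z - c) \<le> B" using body_bounded by metis
  have "caustic_family h h1 \<rho> (\<lambda>r. supp (Cs r)) (\<lambda>r. f (Cs r)) B"
  proof
    fix r :: real assume r: "0 < r" "r \<le> 1/4"
    then have C: "Cs r \<in> \<F>" "rotation_number \<gamma> (Cs r) = r" using Cs by auto
    show "invariant_graph (supp (Cs r)) (f (Cs r))" by (rule f(1)[OF C(1)])
    show "has_rotation (f (Cs r)) r" using f(2)[OF C(1)] C(2) by simp
    fix x y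
    have "Cs r \<subseteq> domain \<gamma>" using caustic[OF C(1)] by (simp add: convex_caustic_def)
    then have "norm (z - c) \<le> B" if "z \<in> Cs r" for z
    proof -
      have "z \<in> domain \<gamma>" using that \<open>Cs r \<subseteq> domain \<gamma>\<close> by blast
      then show ?thesis by (intro B(2)) (auto simp: body_def domain_iff intro: less_imp_le)
    qed
    then show "\<bar>supp (Cs r) x - supp (Cs r) y\<bar> \<le> B * \<bar>x - y\<bar>"
      by (rule supp_lipschitz[OF leaf_compact[OF C(1)] leaf_nonempty[OF C(1)]])
  next
    fix q :: nat and p :: int and x
    assume q: "0 < q" and r: "0 < of_int p / real q" "of_int p / real q \<le> (1/4 :: real)"
    let ?r = "of_int p / real q"
    have C: "Cs ?r \<in> \<F>" "rotation_number \<gamma> (Cs ?r) = ?r" using Cs[of ?r] r by auto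
    show "(f (Cs ?r) ^^ q) x = x + 2 * pi * of_int p"
    proof (rule perturbation_periodic[OF f(1)[OF C(1)] _ q])
      show "has_rotation (f (Cs ?r)) ?r" using f(2)[OF C(1)] C(2) by simp
      fix \<eta> :: real assume "0 < \<eta>"
      then obtain L d D where "L \<in> \<F>" "0 < d" "D\<^sup>2 \<le> \<eta> * d"
        "(\<forall>x. d \<le> supp L x - supp (Cs ?r) x \<and> supp L x - supp (Cs ?r) x \<le> D) \<or>
         (\<forall>x. d \<le> supp (Cs ?r) x - supp L x \<and> supp (Cs ?r) x - supp L x \<le> D)"
        using leaf_perturbation[OF C(1)] by blast
      then show "\<exists>P' f' d D. invariant_graph P' f' \<and> 0 < d \<and> D\<^sup>2 \<le> \<eta> * d \<and>
        ((\<forall>x. d \<le> P' x - supp (Cs ?r) x \<and> P' x - supp (Cs ?r) x \<le> D) \<or>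
         (\<forall>x. d \<le> supp (Cs ?r) x - P' x \<and> supp (Cs ?r) x - P' x \<le> D))"
        using f(1)[of L] by (intro exI[of _ "supp L"] exI[of _ "f L"] exI[of _ d] exI[of _ D]) simp
    qed
  qed
  then show ?thesis by blast
qed

lemma symmetric_support:
  assumes "\<And>z. z \<in> range \<gamma> \<Longrightarrow> 2 * c - z \<in> range \<gamma>"
  shows "h (x + pi) = h x"
proof -
  have "h x \<le> h (x + pi)" for x
  proof -
    have "2 * c - (c + pt x) \<in> range (\<lambda>x. c + pt x)" using assms unfolding range_curve by blast
    then obtain m where "2 * c - (c + pt x) = c + pt m" by blast
    then have "pt m = - pt x" by (simp add: algebra_simps eq_neg_iff_add_eq_0)
    then have "h x = pt m \<bullet> cis (x + pi)" by (simp add: inner_cis_add_pi pt_inner_self)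
    then show ?thesis using pt_inner_le[of m "x + pi"] by simp
  qed
  from this[of x] this[of "x + pi"] h_periodic[of x] show ?thesis by (simp add: add.assoc)
qed

end

locale symmetric_caustic_family = caustic_family +
  assumes h_sym: "h (x + pi) = h x"
begin

abbreviation "f4 \<equiv> F (1/4)"
abbreviation "P4 \<equiv> P (1/4)"

lemma h1_sym: "h1 (x + pi) = h1 x"
proof -
  have "((\<lambda>x. h (x + pi)) has_real_derivative h1 (x + pi) * 1) (at x)"
    by (auto intro!: derivative_eq_intros)
  then have "(h has_real_derivative h1 (x + pi)) (at x)" by (simp add: h_sym)
  then show ?thesis using DERIV_unique[OF _ h_deriv] by blast
qed

lemma h_pos: "0 < h x"
proof -
  have "p_in x (x + 2 * pi) < p_in x x" by (rule p_in_strict) auto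
  moreover have mid: "(x + (x + 2 * pi)) / 2 = x + pi" "(x + 2 * pi - x) / 2 = pi" by simp_all
  have "p_in x (x + 2 * pi) = - h x" unfolding p_in_def mid by (simp add: h_sym)
  ultimately show ?thesis by (simp add: p_in_diag)
qed

lemma ig4: "invariant_graph P4 f4" by (rule ig) auto

lemma f4_periodic: "(f4 ^^ 4) x = x + 2 * pi"
  using periodic[of 4 1 x] by simp

lemma p_sym: "p_in (x + pi) (y + pi) = p_in x y" "p_out (x + pi) (y + pi) = p_out x y"
proof -
  have "(x + pi + (y + pi)) / 2 = (x + y) / 2 + pi" by simp
  then show "p_in (x + pi) (y + pi) = p_in x y" "p_out (x + pi) (y + pi) = p_out x y"
    unfolding p_in_def p_out_def by (simp_all only: h_sym h1_sym add_diff_cancel_right)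
qed

text \<open>The translate of the graph by half a turn is again an invariant graph with rotation
  number 1/4, so it equals the original because periodic graphs are unique.\<close>

lemma f4_sym: "P4 (x + pi) = P4 x" "f4 (x + pi) = f4 x + pi"
proof -
  define P' where "P' x = P4 (x + pi)" for x
  define f' where "f' x = f4 (x + pi) - pi" for x
  note igD = invariant_graphD[OF ig4]
  have ig': "invariant_graph P' f'"
    unfolding invariant_graph_def
  proof (intro conjI allI)
    show "continuous_on UNIV P'" unfolding P'_def
      by (rule continuous_on_compose2[OF igD(1)[of UNIV]]) (auto intro!: continuous_intros)
    fix x
    show "P' (x + 2 * pi) = P' x" using igD(2)[of "x + pi"] by (simp add: P'_def add_ac)
    show "x < f' x" "f' x < x + 2 * pi" using igD(3,4)[of "x + pi"] by (auto simp: f'_def)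
    show "p_in x (f' x) = P' x" using igD(5)[of "x + pi"] p_sym(1)[of x "f' x"] by (simp add: f'_def P'_def)
    show "p_out x (f' x) = P' (f' x)" using igD(6)[of "x + pi"] p_sym(2)[of x "f' x"] by (simp add: f'_def P'_def)
  qed
  have it: "(f' ^^ n) x = (f4 ^^ n) (x + pi) - pi" for n x
    by (induction n) (auto simp: f'_def)
  have rot': "has_rotation f' (1/4)"
  proof -
    obtain K where K: "\<And>n x. \<bar>(f4 ^^ n) x - x - 2 * pi * (1/4) * real n\<bar> \<le> K"
      using rot[of "1/4"] unfolding has_rotation_def by auto
    have "\<bar>(f' ^^ n) x - x - 2 * pi * (1/4) * real n\<bar> \<le> K" for n x
      using K[of n "x + pi"] unfolding it by (simp add: algebra_simps)
    then show ?thesis unfolding has_rotation_def by blast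
  qed
  have "P' x = P4 x" for x
    by (rule periodic_graph_unique[OF ig' ig4, of 1 4]) (use rot' f4_periodic in auto)
  then show "P4 (x + pi) = P4 x" for x by (simp add: P'_def)
  then have "P' x = P4 x" for x by (simp add: P'_def)
  then have "f' x = f4 x" using graph_eq_iff_map_eq[OF ig' ig4] by blast
  then show "f4 (x + pi) = f4 x + pi" by (simp add: f'_def)
qed

text \<open>\<open>f4\<close> preserves order and commutes with the half turn, so a strict
  inequality between \<open>f4 (f4 x)\<close> and \<open>x + pi\<close> would remain strict for the
  fourth iterate, which is exactly one turn.\<close>

lemma f4_twice: "f4 (f4 x) = x + pi"
proof -
  have m: "f4 x < f4 y \<longleftrightarrow> x < y" for x y by (rule f_less_iff[OF ig4])
  have four: "f4 (f4 (f4 (f4 x))) = x + 2 * pi"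
    using f4_periodic[of x] by (simp add: numeral_eq_Suc)
  show ?thesis
  proof (cases "f4 (f4 x)" "x + pi" rule: linorder_cases)
    case less
    then have "f4 (f4 (f4 (f4 x))) < f4 (f4 (x + pi))" using m by simp
    then show ?thesis using less four by (simp add: f4_sym)
  next
    case greater
    then have "f4 (f4 (x + pi)) < f4 (f4 (f4 (f4 x)))" using m by simp
    then show ?thesis using greater four by (simp add: f4_sym)
  qed
qed

lemma f4_less_pi: "f4 x < x + pi"
  using invariant_graphD(3)[OF ig4, of "f4 x"] f4_twice[of x] by simp

text \<open>The parallelograms inscribed by the caustic give the relation between the support function and itself
  a quarter turn later.\<close>

lemma quarter_relations:
  fixes x defines "m \<equiv> (x + f4 x) / 2" and "\<delta> \<equiv> (f4 x - x) / 2"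
  shows "h (m + pi / 2) * sin \<delta> = h m * cos \<delta>" "h1 (m + pi / 2) * cos \<delta> = - h1 m * sin \<delta>"
    "0 < \<delta>" "\<delta> < pi / 2" "x = m - \<delta>" "f4 x = m + \<delta>"
proof -
  let ?y = "f4 x"
  note igD = invariant_graphD[OF ig4]
  show "0 < \<delta>" using igD(3)[of x] by (simp add: \<delta>_def)
  show "\<delta> < pi / 2" using f4_less_pi[of x] by (simp add: \<delta>_def)
  show "x = m - \<delta>" "f4 x = m + \<delta>" by (simp_all add: m_def \<delta>_def field_simps)
  have mid: "(?y + (x + pi)) / 2 = m + pi / 2" "(x + pi - ?y) / 2 = pi / 2 - \<delta>"
    by (simp_all add: m_def \<delta>_def field_simps)
  have "p_out x ?y = p_in ?y (x + pi)" using igD(6)[of x] igD(5)[of ?y] f4_twice[of x] by simp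
  then have 1: "h m * cos \<delta> + h1 m * sin \<delta> = h (m + pi / 2) * sin \<delta> - h1 (m + pi / 2) * cos \<delta>"
    unfolding p_out_def p_in_def mid by (simp add: m_def \<delta>_def cos_diff sin_diff)
  have "p_out ?y (x + pi) = p_in x ?y" using igD(6)[of ?y] igD(5)[of x] f4_twice[of x] f4_sym(1)[of x] by simp
  then have 2: "h (m + pi / 2) * sin \<delta> + h1 (m + pi / 2) * cos \<delta> = h m * cos \<delta> - h1 m * sin \<delta>"
    unfolding p_out_def p_in_def mid by (simp add: m_def \<delta>_def cos_diff sin_diff)
  show "h (m + pi / 2) * sin \<delta> = h m * cos \<delta>" using 1 2 by linarith
  show "h1 (m + pi / 2) * cos \<delta> = - h1 m * sin \<delta>" using 1 2 by linarith
qed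

lemma mid_surj: obtains x where "m = (x + f4 x) / 2"
proof -
  have "continuous_on {m - 2 * pi..m + 2 * pi} (\<lambda>x. (x + f4 x) / 2)"
    by (intro continuous_intros f_cont[OF ig4]) auto
  moreover have "m - 2 * pi + f4 (m - 2 * pi) \<le> 2 * m" "2 * m \<le> m + 2 * pi + f4 (m + 2 * pi)"
    using f4_less_pi[of "m - 2 * pi"] invariant_graphD(3)[OF ig4, of "m + 2 * pi"] pi_gt_zero by linarith+
  then have "(m - 2 * pi + f4 (m - 2 * pi)) / 2 \<le> m" "m \<le> (m + 2 * pi + f4 (m + 2 * pi)) / 2" by simp_all
  ultimately have "\<exists>x\<ge>m - 2 * pi. x \<le> m + 2 * pi \<and> (x + f4 x) / 2 = m" by (intro IVT') auto
  then obtain x where "(x + f4 x) / 2 = m" by blast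
  then show thesis by (intro that[of x]) simp
qed

lemma h_h1_quarter: "h (m + pi / 2) * h1 (m + pi / 2) = - (h m * h1 m)"
proof -
  obtain x where x: "m = (x + f4 x) / 2" by (rule mid_surj)
  define \<delta> where "\<delta> = (f4 x - x) / 2"
  note q = quarter_relations[of x, folded x \<delta>_def]
  have sc: "0 < sin \<delta>" "0 < cos \<delta>" using q(3,4) by (auto intro: sin_gt_zero cos_gt_zero)
  have "(h (m + pi / 2) * sin \<delta>) * (h1 (m + pi / 2) * cos \<delta>) = (h m * cos \<delta>) * (- h1 m * sin \<delta>)"
    unfolding q(1,2) ..
  then have "(h (m + pi / 2) * h1 (m + pi / 2)) * (sin \<delta> * cos \<delta>) = (- (h m * h1 m)) * (sin \<delta> * cos \<delta>)"
    by (simp add: mult_ac)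
  moreover have "sin \<delta> * cos \<delta> \<noteq> 0" using sc by simp
  ultimately show ?thesis using mult_right_cancel[of "sin \<delta> * cos \<delta>"] by blast
qed

text \<open>The radius of the director circle: by \<open>quarter_sum\<close>, all corners of
  circumscribed rectangles have this distance from the centre.\<close>

definition R :: real where "R = sqrt ((h 0)\<^sup>2 + (h (pi / 2))\<^sup>2)"

lemma R_pos: "0 < R"
  unfolding R_def using h_pos[of 0] by (simp add: add_pos_nonneg)

lemma quarter_sum: "(h m)\<^sup>2 + (h (m + pi / 2))\<^sup>2 = R\<^sup>2"
proof -
  have e: "2 * (h m * h1 m) + 2 * (h (m + pi / 2) * h1 (m + pi / 2)) = 0" for m using h_h1_quarter[of m] by simp
  have D: "((\<lambda>m. (h m)\<^sup>2 + (h (m + pi / 2))\<^sup>2) has_real_derivative 2 * (h m * h1 m) + 2 * (h (m + pi / 2) * h1 (m + pi / 2))) (at m)" for m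
    by (auto intro!: derivative_eq_intros)
  have "((\<lambda>m. (h m)\<^sup>2 + (h (m + pi / 2))\<^sup>2) has_real_derivative 0) (at m)" for m
    using D[of m] unfolding e .
  then have "(h m)\<^sup>2 + (h (m + pi / 2))\<^sup>2 = (h 0)\<^sup>2 + (h (0 + pi / 2))\<^sup>2"
    using DERIV_isconst_all[of "\<lambda>m. (h m)\<^sup>2 + (h (m + pi / 2))\<^sup>2"] by blast
  then show ?thesis by (simp add: R_def)
qed

text \<open>Half the angular advance along the caustic 1/4 as a function of the middle
  \<open>m\<close> of the chord. By the quarter relations its tangent is
  \<open>h m / h (m + pi / 2)\<close>; the form with \<open>arcsin\<close> makes its regularity
  evident.\<close>

definition d :: "real \<Rightarrow> real" where "d m = arcsin (h m / R)"

lemma h_less_R: "h m < R"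
proof -
  have "(h m)\<^sup>2 < R\<^sup>2" using quarter_sum[of m] h_pos[of "m + pi / 2"] by (smt (verit) zero_less_power)
  then show ?thesis using R_pos by (simp add: power_less_imp_less_base)
qed

lemma d_props: "0 < d m" "d m < pi / 2" "R * sin (d m) = h m" "R * cos (d m) = h (m + pi / 2)"
proof -
  have b: "0 < h m / R" "h m / R < 1" using h_pos[of m] h_less_R[of m] R_pos by simp_all
  have s: "sin (d m) = h m / R" unfolding d_def using b by (intro sin_arcsin) auto
  show "0 < d m" unfolding d_def using arcsin_less_mono[of 0 "h m / R"] b by simp
  show "d m < pi / 2" unfolding d_def using arcsin_less_mono[of "h m / R" 1] b by simp
  show "R * sin (d m) = h m" using s R_pos by simp
  have c: "0 < cos (d m)" using \<open>0 < d m\<close> \<open>d m < pi / 2\<close> by (intro cos_gt_zero) auto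
  have "(R * cos (d m))\<^sup>2 = R\<^sup>2 - (R * sin (d m))\<^sup>2" by (simp add: power_mult_distrib cos_squared_eq algebra_simps)
  also have "\<dots> = (h (m + pi / 2))\<^sup>2" using quarter_sum[of m] \<open>R * sin (d m) = h m\<close> by simp
  finally show "R * cos (d m) = h (m + pi / 2)"
    using c R_pos h_pos[of "m + pi / 2"] by (simp add: power2_eq_iff_nonneg less_imp_le)
qed

lemma d_mid:
  assumes "m = (x + f4 x) / 2" shows "d m = (f4 x - x) / 2"
proof -
  define \<delta> where "\<delta> = (f4 x - x) / 2"
  note q = quarter_relations[of x, folded assms \<delta>_def]
  have "sin (d m - \<delta>) * R = (R * sin (d m)) * cos \<delta> - (R * cos (d m)) * sin \<delta>"
    by (simp add: sin_diff algebra_simps)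
  also have "\<dots> = 0" using q(1) by (simp add: d_props)
  finally have "sin (d m - \<delta>) = 0" using R_pos by simp
  moreover have "\<bar>d m - \<delta>\<bar> < pi" using q(3,4) d_props(1,2)[of m] by linarith
  ultimately have "d m - \<delta> = 0" using sin_eq_0_pi[of "d m - \<delta>"] by (simp add: abs_less_iff)
  then show ?thesis by (simp add: \<delta>_def)
qed

text \<open>Moving the tail of the extremal chord with middle \<open>m\<close> forward raises its
  image under the increasing map \<open>f4\<close>, while the head moves back; so the symmetric
  chords below \<open>f4\<close> are the shorter ones.\<close>

lemma region_iff: "m + \<delta> < f4 (m - \<delta>) \<longleftrightarrow> \<delta> < d m"
proof -
  obtain x where x: "m = (x + f4 x) / 2" by (rule mid_surj)
  note dm = d_mid[OF x]
  have "x = (x + f4 x) / 2 - (f4 x - x) / 2" "f4 x = (x + f4 x) / 2 + (f4 x - x) / 2" by (simp_all add: field_simps)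
  note e = this[folded x dm]
  have mono: "f4 s < f4 t \<longleftrightarrow> s < t" for s t by (rule f_less_iff[OF ig4])
  show ?thesis
  proof
    assume "\<delta> < d m"
    then have "x < m - \<delta>" using e(1) by simp
    then have "f4 x < f4 (m - \<delta>)" using mono by simp
    then show "m + \<delta> < f4 (m - \<delta>)" using e(2) \<open>\<delta> < d m\<close> by simp
  next
    assume a: "m + \<delta> < f4 (m - \<delta>)"
    show "\<delta> < d m"
    proof (rule ccontr)
      assume "\<not> \<delta> < d m"
      then have "\<not> x < m - \<delta>" using e(1) by simp
      then have "\<not> f4 x < f4 (m - \<delta>)" using mono by simp
      then show False using a e(2) \<open>\<not> \<delta> < d m\<close> by simp
    qed
  qed
qed

lemma d_quarter: "d (m + pi / 2) = pi / 2 - d m"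
proof -
  have "h (m + pi / 2) / R = cos (d m)" using d_props(4)[of m] R_pos by (simp add: field_simps)
  then have "d (m + pi / 2) = arcsin (sin (pi / 2 - d m))" by (simp add: d_def sin_diff)
  also have "\<dots> = pi / 2 - d m" using d_props(1,2)[of m] by (intro arcsin_sin) auto
  finally show ?thesis .
qed

end

section \<open>The integral inequality\<close>

lemma nn_integral_periodic_shift:
  fixes k :: "real \<Rightarrow> ennreal"
  assumes [measurable]: "k \<in> borel_measurable borel" and per: "\<And>x. k (x + T) = k x" and s: "0 \<le> s" "s \<le> T"
  shows "(\<integral>\<^sup>+x. k (x + s) * indicator {0..<T} x \<partial>lborel) = (\<integral>\<^sup>+x. k x * indicator {0..<T} x \<partial>lborel)"
proof -
  have tr: "(\<integral>\<^sup>+x. k x * indicator {a + t..<b + t} x \<partial>lborel) = (\<integral>\<^sup>+x. k (x + t) * indicator {a..<b} x \<partial>lborel)" for a b t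
  proof -
    have "(\<integral>\<^sup>+x. k x * indicator {a + t..<b + t} x \<partial>lborel)
        = (\<integral>\<^sup>+x. k (t + x) * indicator {a + t..<b + t} (t + x) \<partial>lborel)"
      using nn_integral_real_affine[of "\<lambda>x. k x * indicator {a + t..<b + t} x" 1 t] by simp
    also have "\<dots> = (\<integral>\<^sup>+x. k (x + t) * indicator {a..<b} x \<partial>lborel)"
      by (auto intro!: nn_integral_cong simp: add.commute indicator_def)
    finally show ?thesis .
  qed
  have split: "(\<integral>\<^sup>+x. k x * indicator {a..<b} x \<partial>lborel)
      = (\<integral>\<^sup>+x. k x * indicator {a..<m} x \<partial>lborel) + (\<integral>\<^sup>+x. k x * indicator {m..<b} x \<partial>lborel)"
    if "a \<le> m" "m \<le> b" for a m b
  proof -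
    have "k x * indicator {a..<b} x = k x * indicator {a..<m} x + k x * indicator {m..<b} x" for x
      using that by (auto simp: indicator_def)
    then show ?thesis by (simp add: nn_integral_add)
  qed
  have "(\<integral>\<^sup>+x. k (x + s) * indicator {0..<T} x \<partial>lborel) = (\<integral>\<^sup>+x. k x * indicator {0 + s..<T + s} x \<partial>lborel)"
    by (rule tr[symmetric])
  also have "\<dots> = (\<integral>\<^sup>+x. k x * indicator {s..<T} x \<partial>lborel) + (\<integral>\<^sup>+x. k x * indicator {0 + T..<s + T} x \<partial>lborel)"
    using split[of s T "s + T"] s by (simp add: add.commute)
  also have "(\<integral>\<^sup>+x. k x * indicator {0 + T..<s + T} x \<partial>lborel) = (\<integral>\<^sup>+x. k x * indicator {0..<s} x \<partial>lborel)"
    unfolding tr per ..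
  also have "(\<integral>\<^sup>+x. k x * indicator {s..<T} x \<partial>lborel) + (\<integral>\<^sup>+x. k x * indicator {0..<s} x \<partial>lborel)
      = (\<integral>\<^sup>+x. k x * indicator {0..<T} x \<partial>lborel)"
    using split[of 0 s T] s by (simp add: add.commute)
  finally show ?thesis .
qed

text \<open>Passing from the middle of a chord to one of its ends is a shear with unit Jacobian;
  after exchanging the integrals it is a translation of a periodic function.\<close>

lemma nn_integral_shear:
  fixes K :: "real \<times> real \<Rightarrow> ennreal"
  assumes [measurable]: "K \<in> borel_measurable borel" and per: "\<And>x s. K (x + T, s) = K (x, s)"
    and supp: "\<And>x s. s < 0 \<or> T < s \<Longrightarrow> K (x, s) = 0"
  shows "(\<integral>\<^sup>+x. (\<integral>\<^sup>+s. K (x + s, s) * indicator {0..<T} x \<partial>lborel) \<partial>lborel)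
    = (\<integral>\<^sup>+x. (\<integral>\<^sup>+s. K (x, s) * indicator {0..<T} x \<partial>lborel) \<partial>lborel)"
proof -
  have [measurable]: "K \<in> borel_measurable (borel \<Otimes>\<^sub>M borel)" using assms(1) by (simp add: borel_prod)
  have "(\<integral>\<^sup>+x. (\<integral>\<^sup>+s. K (x + s, s) * indicator {0..<T} x \<partial>lborel) \<partial>lborel)
      = (\<integral>\<^sup>+s. (\<integral>\<^sup>+x. K (x + s, s) * indicator {0..<T} x \<partial>lborel) \<partial>lborel)"
    by (rule lborel_pair.Fubini'[symmetric]) measurable
  also have "\<dots> = (\<integral>\<^sup>+s. (\<integral>\<^sup>+x. K (x, s) * indicator {0..<T} x \<partial>lborel) \<partial>lborel)"
  proof (rule nn_integral_cong)
    fix s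
    show "(\<integral>\<^sup>+x. K (x + s, s) * indicator {0..<T} x \<partial>lborel) = (\<integral>\<^sup>+x. K (x, s) * indicator {0..<T} x \<partial>lborel)"
    proof (cases "0 \<le> s \<and> s \<le> T")
      case True
      show ?thesis by (rule nn_integral_periodic_shift[of "\<lambda>x. K (x, s)"]) (use True per in auto)
    next
      case False
      then have "K (x, s) = 0" for x using supp by auto
      then show ?thesis by simp
    qed
  qed
  also have "\<dots> = (\<integral>\<^sup>+x. (\<integral>\<^sup>+s. K (x, s) * indicator {0..<T} x \<partial>lborel) \<partial>lborel)"
    by (rule lborel_pair.Fubini') measurable
  finally show ?thesis .
qed

text \<open>The Taylor remainder is taken on each side separately, hence two intermediate points;
  bounds for the second derivative then dominate the difference quotients.\<close>

lemma second_difference: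
  fixes \<phi> \<phi>1 \<phi>2 :: "real \<Rightarrow> real"
  assumes d: "\<And>t. (\<phi> has_real_derivative \<phi>1 t) (at t)" "\<And>t. (\<phi>1 has_real_derivative \<phi>2 t) (at t)" and e: "0 < e"
  shows "\<exists>s t. \<bar>s\<bar> < e \<and> \<bar>t\<bar> < e \<and> \<phi> e + \<phi> (- e) - 2 * \<phi> 0 = e\<^sup>2 * ((\<phi>2 s + \<phi>2 t) / 2)"
proof -
  have tay: "\<exists>t>0. t < e \<and> g e = g 0 + g1 0 * e + g2 t / 2 * e\<^sup>2"
    if g: "\<And>t. (g has_real_derivative g1 t) (at t)" "\<And>t. (g1 has_real_derivative g2 t) (at t)" for g g1 g2 :: "real \<Rightarrow> real"
  proof -
    define df where "df m = (if m = 0 then g else if m = 1 then g1 else g2)" for m :: nat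
    have "\<exists>t>0. t < e \<and> g e = (\<Sum>m<2. df m 0 / fact m * e ^ m) + df 2 t / fact 2 * e ^ 2"
      by (rule Maclaurin[OF e]) (use g in \<open>auto simp: df_def less_2_cases_iff\<close>)
    then show ?thesis by (simp add: df_def numeral_2_eq_2)
  qed
  obtain s where s: "0 < s" "s < e" "\<phi> e = \<phi> 0 + \<phi>1 0 * e + \<phi>2 s / 2 * e\<^sup>2" using tay[OF d] by blast
  have m1: "((\<lambda>t. \<phi> (- t)) has_real_derivative - \<phi>1 (- t)) (at t)" for t
    using d(1)[of "- t"] by (simp add: DERIV_mirror)
  have m2: "((\<lambda>t. - \<phi>1 (- t)) has_real_derivative \<phi>2 (- t)) (at t)" for t
    using DERIV_minus[OF iffD1[OF DERIV_mirror d(2)[of "- t"]]] by simp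
  obtain t where t: "0 < t" "t < e" "\<phi> (- e) = \<phi> (- 0) + - \<phi>1 (- 0) * e + \<phi>2 (- t) / 2 * e\<^sup>2" using tay[OF m1 m2] by blast
  have "\<phi> e + \<phi> (- e) - 2 * \<phi> 0 = e\<^sup>2 * ((\<phi>2 s + \<phi>2 (- t)) / 2)" using s(3) t(3) by (simp add: field_simps)
  then show ?thesis using s t by (intro exI[of _ s] exI[of _ "- t"]) auto
qed

section \<open>Displacing a line along its leaf\<close>

context symmetric_caustic_family
begin

lemma d_cont: "continuous_on S d"
proof -
  have "0 < h m / R" "h m / R < 1" for m using h_pos[of m] h_less_R[of m] R_pos by simp_all
  then have b: "-1 \<le> h m / R" "h m / R \<le> 1" for m by (simp_all add: order.strict_implies_order order.trans[of "-1" 0])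
  have c: "continuous_on S (\<lambda>m. h m / R)" using R_pos by (intro continuous_intros h_cont) auto
  show ?thesis unfolding d_def[abs_def] by (rule continuous_on_arcsin[OF c]) (use b in blast)
qed

lemma d_shift: "d (m + 2 * pi) = d m" by (simp add: d_def h_periodic)

text \<open>The displacement \<open>\<epsilon> * p\<close> depends on the line only, so this is a
  function on phase space, usable at both ends of a chord. With it the middle of a chord moves by
  \<open>\<epsilon> * (h m * cos \<delta>)\<close> and its half difference by
  \<open>\<epsilon> * (h1 m * sin \<delta>)\<close>.\<close>

definition increment :: "real \<Rightarrow> real \<Rightarrow> real \<Rightarrow> real" where
  "increment \<epsilon> x p = potential (P (leaf x p)) (x + \<epsilon> * p) - potential (P (leaf x p)) x"

lemma family_graph: "(x, p) \<in> phase_region \<Longrightarrow> invariant_graph (P (leaf x p)) (F (leaf x p))"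
  using leaf[of x p] ig[of "leaf x p"] by (simp add: phase_region_def)

text \<open>The integral form removes the constants chosen arbitrarily in \<open>potential\<close>
  and shows that the increment depends continuously on the line.\<close>

lemma increment_integral:
  assumes "(x, p) \<in> phase_region"
  shows "increment \<epsilon> x p = integral {0..1} (\<lambda>t. \<epsilon> * p * P (leaf x p) (x + t * (\<epsilon> * p)))"
proof -
  note g = family_graph[OF assms]
  have "((\<lambda>t. \<epsilon> * p * P (leaf x p) (x + t * (\<epsilon> * p))) has_integral
      potential (P (leaf x p)) (x + 1 * (\<epsilon> * p)) - potential (P (leaf x p)) (x + 0 * (\<epsilon> * p))) {0..1}"
  proof (rule fundamental_theorem_of_calculus)
    fix t :: real
    have "((\<lambda>t. potential (P (leaf x p)) (x + t * (\<epsilon> * p))) has_real_derivative P (leaf x p) (x + t * (\<epsilon> * p)) * (\<epsilon> * p)) (at t)"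
    proof (rule DERIV_chain2[where f = "potential (P (leaf x p))" and g = "\<lambda>t. x + t * (\<epsilon> * p)"])
      show "(potential (P (leaf x p)) has_real_derivative P (leaf x p) (x + t * (\<epsilon> * p))) (at (x + t * (\<epsilon> * p)))"
        by (rule u_deriv[OF g])
      show "((\<lambda>t. x + t * (\<epsilon> * p)) has_real_derivative \<epsilon> * p) (at t)" by (auto intro!: derivative_eq_intros)
    qed
    then show "((\<lambda>t. potential (P (leaf x p)) (x + t * (\<epsilon> * p))) has_vector_derivative
        \<epsilon> * p * P (leaf x p) (x + t * (\<epsilon> * p))) (at t within {0..1})"
      unfolding has_real_derivative_iff_has_vector_derivative[symmetric] mult.commute[of "\<epsilon> * p"]
      by (rule has_field_derivative_at_within)
  qed simp
  then show ?thesis unfolding increment_def mult_1 mult_zero_left add_0_right by (rule integral_unique[symmetric])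
qed

lemma increment_continuous: "continuous_on phase_region (\<lambda>z. increment \<epsilon> (fst z) (snd z))"
proof -
  have lc: "continuous_on (phase_region \<times> cbox 0 (1::real)) (\<lambda>w. leaf (fst (fst w)) (snd (fst w)))"
  proof -
    have "continuous_on (phase_region \<times> cbox 0 (1::real)) (\<lambda>w. case fst w of (x, p) \<Rightarrow> leaf x p)"
      by (rule continuous_on_compose2[OF leaf_continuous]) (auto intro!: continuous_intros)
    then show ?thesis by (simp add: split_def)
  qed
  have "continuous_on (phase_region \<times> cbox 0 (1::real))
      (\<lambda>w. case (leaf (fst (fst w)) (snd (fst w)), fst (fst w) + snd w * (\<epsilon> * snd (fst w))) of (r, x) \<Rightarrow> P r x)"
  proof (rule continuous_on_compose2[OF family_continuous])
    show "continuous_on (phase_region \<times> cbox 0 (1::real)) (\<lambda>w. (leaf (fst (fst w)) (snd (fst w)), fst (fst w) + snd w * (\<epsilon> * snd (fst w))))"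
      by (intro continuous_intros lc)
    show "(\<lambda>w. (leaf (fst (fst w)) (snd (fst w)), fst (fst w) + snd w * (\<epsilon> * snd (fst w)))) ` (phase_region \<times> cbox 0 1) \<subseteq> {0<..1/4} \<times> UNIV"
      using leaf by (auto simp: phase_region_def less_imp_le)
  qed
  then have "continuous_on (phase_region \<times> cbox 0 (1::real))
      (\<lambda>(z, t). \<epsilon> * snd z * P (leaf (fst z) (snd z)) (fst z + t * (\<epsilon> * snd z)))"
    by (auto simp: split_def intro!: continuous_intros)
  then have "continuous_on phase_region (\<lambda>z. integral (cbox 0 1) (\<lambda>t. \<epsilon> * snd z * P (leaf (fst z) (snd z)) (fst z + t * (\<epsilon> * snd z))))"
    by (rule integral_continuous_on_param)
  then show ?thesis
    by (rule continuous_on_eq) (auto simp: increment_integral)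
qed

lemma increment_bound:
  obtains B where "0 \<le> B" "\<And>\<epsilon> x p. \<bar>\<epsilon>\<bar> \<le> 1 \<Longrightarrow> (x, p) \<in> phase_region \<Longrightarrow> \<bar>increment \<epsilon> x p\<bar> \<le> B"
proof -
  obtain B where B: "0 \<le> B" "\<And>r x. 0 < r \<Longrightarrow> r \<le> 1/4 \<Longrightarrow> \<bar>P r x\<bar> \<le> B" "\<And>x. \<bar>h x\<bar> \<le> B"
    using family_bounded by metis
  have "\<bar>increment \<epsilon> x p\<bar> \<le> B * B" if e: "\<bar>\<epsilon>\<bar> \<le> 1" and xp: "(x, p) \<in> phase_region" for \<epsilon> x p
  proof -
    note g = family_graph[OF xp]
    have l: "0 < leaf x p" "leaf x p \<le> 1/4" "P (leaf x p) x = p" using leaf[of x p] xp by (auto simp: phase_region_def)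
    have "norm (potential (P (leaf x p)) (x + \<epsilon> * p) - potential (P (leaf x p)) x) \<le> B * norm (x + \<epsilon> * p - x)"
      by (rule field_differentiable_bound[where S = UNIV and f' = "P (leaf x p)"])
        (use u_deriv[OF g] B(2)[OF l(1,2)] in auto)
    also have "\<dots> = B * (\<bar>\<epsilon>\<bar> * \<bar>p\<bar>)" by (simp add: abs_mult)
    also have "\<dots> \<le> B * (1 * B)" using e B(1) B(2)[OF l(1,2), of x] l(3) by (intro mult_left_mono mult_mono) auto
    finally show ?thesis by (simp add: increment_def)
  qed
  then show thesis using that[of "B * B"] B(1) by simp
qed

lemma leaf_shift: "leaf (x + 2 * pi) p = leaf x p"
proof -
  have "(0 < r \<and> r < 1/4 \<and> P r (x + 2 * pi) = p) \<longleftrightarrow> (0 < r \<and> r < 1/4 \<and> P r x = p)" for r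
    using invariant_graphD(2)[OF ig, of r x] by auto
  then show ?thesis by (simp add: leaf_def)
qed

lemma phase_region_shift: "(x + 2 * pi, p) \<in> phase_region \<longleftrightarrow> (x, p) \<in> phase_region"
  by (simp add: phase_region_def h_periodic invariant_graphD(2)[OF ig4])

lemma increment_shift:
  assumes "(x, p) \<in> phase_region" shows "increment \<epsilon> (x + 2 * pi) p = increment \<epsilon> x p"
  using u_shift[OF family_graph[OF assms], of x] u_shift[OF family_graph[OF assms], of "x + \<epsilon> * p"]
  by (simp add: increment_def leaf_shift add_ac)

text \<open>Calibration by the leaf through the original chord: there the gauged action equals
  \<open>crit\<close>, and for the displaced chord it is at most \<open>crit\<close>. The bound on
  \<epsilon> keeps the displaced half difference between 0 and \<pi>, where calibration
  applies.\<close>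

lemma variation_le:
  assumes \<delta>: "0 < \<delta>" "\<delta> < d m" and e: "\<bar>\<epsilon> * h1 m\<bar> \<le> 1/2"
  defines "x \<equiv> m - \<delta>" and "y \<equiv> m + \<delta>"
  shows "2 * h (m + \<epsilon> * (h m * cos \<delta>)) * sin (\<delta> + \<epsilon> * (h1 m * sin \<delta>)) - 2 * h m * sin \<delta>
    \<le> increment \<epsilon> y (p_out x y) - increment \<epsilon> x (p_in x y)"
proof -
  have mid: "(x + y) / 2 = m" "(y - x) / 2 = \<delta>" by (simp_all add: x_def y_def)
  have pin: "p_in x y = h m * cos \<delta> - h1 m * sin \<delta>" and pout: "p_out x y = h m * cos \<delta> + h1 m * sin \<delta>"
    unfolding p_in_def p_out_def mid by simp_all
  have xy: "x < y" "y < f4 x" using \<delta> region_iff[of m \<delta>] by (simp_all add: x_def y_def)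
  note ch = chord_leaf[OF xy]
  define r where "r = leaf x (p_in x y)"
  have g: "invariant_graph (P r) (F r)" unfolding r_def by (rule family_graph[OF ch(1)])
  define x' where "x' = x + \<epsilon> * p_in x y"
  define y' where "y' = y + \<epsilon> * p_out x y"
  have "(x' + y') / 2 = (x + y) / 2 + \<epsilon> * (h m * cos \<delta>)" by (simp add: x'_def y'_def pin pout field_simps)
  moreover have "(y' - x') / 2 = (y - x) / 2 + \<epsilon> * (h1 m * sin \<delta>)" by (simp add: x'_def y'_def pin pout field_simps)
  ultimately have mid': "(x' + y') / 2 = m + \<epsilon> * (h m * cos \<delta>)" "(y' - x') / 2 = \<delta> + \<epsilon> * (h1 m * sin \<delta>)" unfolding mid by simp_all
  have "\<bar>\<epsilon> * (h1 m * sin \<delta>)\<bar> = \<bar>\<epsilon> * h1 m\<bar> * \<bar>sin \<delta>\<bar>" by (simp add: abs_mult)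
  also have "\<dots> \<le> 1/2 * \<delta>" using e \<delta>(1) abs_sin_x_le_abs_x[of \<delta>] by (intro mult_mono) auto
  finally have small: "\<bar>\<epsilon> * (h1 m * sin \<delta>)\<bar> \<le> \<delta> / 2" by simp
  have "\<delta> < pi / 2" using \<delta> d_props(2)[of m] by simp
  then have "0 \<le> (y' - x') / 2" "(y' - x') / 2 \<le> pi" unfolding mid'(2) using small \<delta>(1) by linarith+
  then have le: "gauged_action (P r) x' y' \<le> crit (P r) (F r)" by (intro gauged_le[OF g]) auto
  have "gauged_action (P r) x y = crit (P r) (F r)" using gauged_graph[OF g, of x] ch(4) by (simp add: r_def)
  then have "action x' y' - action x y \<le> (potential (P r) y' - potential (P r) y) - (potential (P r) x' - potential (P r) x)"
    using le by (simp add: gauged_action_def)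
  then show ?thesis
    unfolding action_def mid mid' increment_def ch(3) r_def[symmetric] x'_def[symmetric] y'_def[symmetric] .
qed

section \<open>The invariant measure on the space of lines\<close>

text \<open>The density of the invariant area \<open>dx dp\<close> in the coordinates middle and
  half difference: at a fixed end the derivative of the distance in \<delta> is, up to sign,
  \<open>\<rho> m * sin \<delta>\<close>, and passing from the middle to the end has unit
  Jacobian.\<close>

definition weight :: "real \<Rightarrow> real \<Rightarrow> real" where
  "weight m \<delta> = \<rho> m * sin \<delta>"

definition region :: "(real \<times> real) set" where
  "region = {z. 0 < snd z \<and> snd z < d (fst z)}"

lemma region_open: "open region"
proof -
  have "open {z :: real \<times> real. 0 < snd z}" "open {z :: real \<times> real. snd z < d (fst z)}"
    by (auto intro!: open_Collect_less continuous_intros continuous_on_compose2[OF d_cont[of UNIV]])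
  then have "open ({z :: real \<times> real. 0 < snd z} \<inter> {z. snd z < d (fst z)})" by (rule open_Int)
  moreover have "region = {z :: real \<times> real. 0 < snd z} \<inter> {z. snd z < d (fst z)}" by (auto simp: region_def)
  ultimately show ?thesis by simp
qed

text \<open>Invariance of the measure \<open>weight m \<delta> dm d\<delta>\<close>, seen from both ends of a chord: for a function on the space of
  lines, integrating its value at the incoming or at the outgoing line gives the same result.\<close>

lemma invariant_measure:
  fixes \<Theta> :: "real \<times> real \<Rightarrow> real"
  assumes [measurable]: "\<Theta> \<in> borel_measurable borel" and nonneg: "\<And>z. 0 \<le> \<Theta> z"
    and per: "\<And>x p. \<Theta> (x + 2 * pi, p) = \<Theta> (x, p)" and out: "\<And>z. z \<notin> phase_region \<Longrightarrow> \<Theta> z = 0"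
  shows "(\<integral>\<^sup>+m. (\<integral>\<^sup>+\<delta>. ennreal (\<Theta> (m - \<delta>, p_in (m - \<delta>) (m + \<delta>)) * weight m \<delta>) * indicator region (m, \<delta>) * indicator {0..<2 * pi} m \<partial>lborel) \<partial>lborel)
    = (\<integral>\<^sup>+m. (\<integral>\<^sup>+\<delta>. ennreal (\<Theta> (m + \<delta>, p_out (m - \<delta>) (m + \<delta>)) * weight m \<delta>) * indicator region (m, \<delta>) * indicator {0..<2 * pi} m \<partial>lborel) \<partial>lborel)"
proof -
  have [measurable]: "region \<in> sets borel" by (rule borel_open[OF region_open])
  have [measurable]: "(\<lambda>z. weight (fst z) (snd z)) \<in> borel_measurable borel"
    unfolding weight_def by (intro borel_measurable_continuous_onI continuous_intros)
  have [measurable]: "(\<lambda>z. (fst z - snd z, p_in (fst z - snd z) (fst z + snd z))) \<in> borel_measurable borel"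
    by (intro borel_measurable_continuous_onI continuous_intros)
  have [measurable]: "(\<lambda>z. (fst z + snd z, p_out (fst z - snd z) (fst z + snd z))) \<in> borel_measurable borel"
    by (intro borel_measurable_continuous_onI continuous_intros)
  define K1 where "K1 z = ennreal (\<Theta> (fst z - snd z, p_in (fst z - snd z) (fst z + snd z)) * weight (fst z) (snd z)) * indicator region z" for z
  define K2 where "K2 z = ennreal (\<Theta> (fst z + snd z, p_out (fst z - snd z) (fst z + snd z)) * weight (fst z) (snd z)) * indicator region z" for z
  have [measurable]: "K1 \<in> borel_measurable borel" "K2 \<in> borel_measurable borel"
    unfolding K1_def[abs_def] K2_def[abs_def] by measurable
  have regs: "indicator region (x + 2 * pi, s) = (indicator region (x, s) :: ennreal)" for x s
    by (simp add: region_def d_shift indicator_def)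
  have rhos: "weight (x + 2 * pi) s = weight x s" for x s by (simp add: weight_def rho_periodic)
  have e1: "x + 2 * pi - s = (x - s) + 2 * pi" "x + 2 * pi + s = (x + s) + 2 * pi" for x s :: real by simp_all
  have K1p: "K1 (x + 2 * pi, s) = K1 (x, s)" for x s
    unfolding K1_def fst_conv snd_conv e1 p_in_shift per regs rhos ..
  have K2p: "K2 (x + 2 * pi, s) = K2 (x, s)" for x s
    unfolding K2_def fst_conv snd_conv e1 p_out_shift per regs rhos ..
  have nreg: "(x, s) \<notin> region" if "s < 0 \<or> 2 * pi < s" for x s
    using that d_props(2)[of x] pi_gt_zero by (auto simp: region_def)
  have K10: "K1 (x, s) = 0" if "s < 0 \<or> 2 * pi < s" for x s using nreg[OF that] by (simp add: K1_def)
  have K20: "K2 (x, s) = 0" if "s < 0 \<or> 2 * pi < s" for x s using nreg[OF that] by (simp add: K2_def)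
  \<comment> \<open>The integral over all lines with normal angle \<open>x\<close>, to which both
    sides reduce. The sign of the distance is reversed because it decreases in \<delta>, whereas the
    substitution needs an increasing map.\<close>
  define J where "J x = (\<integral>\<^sup>+q. ennreal (\<Theta> (x, - q) * indicator {- h x..- P4 x} q) \<partial>lborel)" for x
  have \<Theta>q: "set_borel_measurable borel S (\<lambda>q. \<Theta> (x, - q))" if [measurable]: "S \<in> sets borel" for x S
  proof -
    have [measurable]: "(\<lambda>q :: real. (x, - q)) \<in> borel_measurable borel"
      by (intro borel_measurable_continuous_onI continuous_intros)
    have "(\<lambda>q. \<Theta> (x, - q)) \<in> borel_measurable borel" by measurable
    then show ?thesis unfolding set_borel_measurable_def by measurable
  qed
  have in1: "(\<integral>\<^sup>+\<delta>. K1 (x + \<delta>, \<delta>) \<partial>lborel) = J x" for x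
  proof -
    define t where "t = (f4 x - x) / 2"
    have t: "0 < t" "t < pi / 2" using invariant_graphD(3)[OF ig4, of x] f4_less_pi[of x] by (simp_all add: t_def)
    have reg: "(x + \<delta>, \<delta>) \<in> region \<longleftrightarrow> 0 < \<delta> \<and> \<delta> < t" for \<delta>
      using region_iff[of "x + \<delta>" \<delta>] by (auto simp: region_def t_def)
    define g where "g \<delta> = - p_in x (x + 2 * \<delta>)" for \<delta>
    have g0: "g 0 = - h x" by (simp add: g_def p_in_diag)
    have "x + 2 * t = f4 x" by (simp add: t_def field_simps)
    then have gt: "g t = - P4 x" using invariant_graphD(5)[OF ig4, of x] by (simp add: g_def)
    have mid: "(x + (x + 2 * s)) / 2 = x + s" "(x + 2 * s - x) / 2 = s" for s by simp_all
    have "J x = (\<integral>\<^sup>+\<delta>. ennreal (\<Theta> (x, - g \<delta>) * weight (x + \<delta>) \<delta> * indicator {0..t} \<delta>) \<partial>lborel)"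
      unfolding J_def g0[symmetric] gt[symmetric]
    proof (rule nn_integral_substitution[where f = "\<lambda>q. \<Theta> (x, - q)" and g = g and g' = "\<lambda>\<delta>. weight (x + \<delta>) \<delta>" and a = 0 and b = t])
      show "set_borel_measurable borel {g 0..g t} (\<lambda>q. \<Theta> (x, - q))" by (rule \<Theta>q) simp
      show "(g has_real_derivative weight (x + s) s) (at s)" for s
      proof -
        have "((\<lambda>s. p_in x (x + 2 * s)) has_real_derivative - (\<rho> ((x + (x + 2 * s)) / 2) * sin ((x + 2 * s - x) / 2) / 2) * 2) (at s)"
          by (rule DERIV_chain2[where f = "p_in x" and g = "\<lambda>s. x + 2 * s", OF p_in_deriv2]) (auto intro!: derivative_eq_intros)
        then have "((\<lambda>s. - p_in x (x + 2 * s)) has_real_derivative - (- (\<rho> ((x + (x + 2 * s)) / 2) * sin ((x + 2 * s - x) / 2) / 2) * 2)) (at s)"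
          by (rule DERIV_minus)
        then show ?thesis unfolding mid by (simp add: g_def[abs_def] weight_def)
      qed
      show "continuous_on {0..t} (\<lambda>\<delta>. weight (x + \<delta>) \<delta>)" unfolding weight_def by (intro continuous_intros)
      show "0 \<le> weight (x + s) s" if "s \<in> {0..t}" for s
        unfolding weight_def using that t rho_pos[of "x + s"] by (intro mult_nonneg_nonneg sin_ge_zero) auto
    qed (use t in auto)
    also have "\<dots> = (\<integral>\<^sup>+\<delta>. K1 (x + \<delta>, \<delta>) \<partial>lborel)"
    proof (rule nn_integral_cong)
      fix \<delta>
      have e: "x + \<delta> - \<delta> = x" "x + \<delta> + \<delta> = x + 2 * \<delta>" by simp_all
      consider "0 < \<delta> \<and> \<delta> < t" | "\<delta> = 0 \<or> \<delta> = t" | "\<delta> \<notin> {0..t}" by force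
      then show "ennreal (\<Theta> (x, - g \<delta>) * weight (x + \<delta>) \<delta> * indicator {0..t} \<delta>) = K1 (x + \<delta>, \<delta>)"
      proof cases
        case 1
        then have "0 \<le> weight (x + \<delta>) \<delta>"
          unfolding weight_def using t rho_pos[of "x + \<delta>"] by (intro mult_nonneg_nonneg sin_ge_zero) auto
        then show ?thesis using 1 reg[of \<delta>] nonneg by (simp add: K1_def e g_def ennreal_mult)
      next
        case 2
        then have "(x, - g \<delta>) \<notin> phase_region" using g0 gt by (auto simp: phase_region_def)
        then show ?thesis using 2 reg[of \<delta>] out by (auto simp: K1_def)
      next
        case 3
        then show ?thesis using reg[of \<delta>] by (auto simp: K1_def)
      qed
    qed
    finally show ?thesis by simp
  qed
  have in2: "(\<integral>\<^sup>+\<delta>. K2 (y - \<delta>, \<delta>) \<partial>lborel) = J y" for y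
  proof -
    obtain w where w: "f4 w = y" "w < y" "y < w + 2 * pi" by (rule surj_f[OF ig4])
    define t where "t = (y - w) / 2"
    have t: "0 < t" "t < pi / 2" using w f4_less_pi[of w] by (simp_all add: t_def)
    have reg: "(y - \<delta>, \<delta>) \<in> region \<longleftrightarrow> 0 < \<delta> \<and> \<delta> < t" for \<delta>
    proof -
      have "y < f4 (y - 2 * \<delta>) \<longleftrightarrow> w < y - 2 * \<delta>" using f_less_iff[OF ig4, of w "y - 2 * \<delta>"] w(1) by simp
      then show ?thesis using region_iff[of "y - \<delta>" \<delta>] by (auto simp: region_def t_def)
    qed
    define g where "g \<delta> = - p_out (y - 2 * \<delta>) y" for \<delta>
    have g0: "g 0 = - h y" by (simp add: g_def p_out_diag)
    have "y - 2 * t = w" by (simp add: t_def field_simps)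
    then have gt: "g t = - P4 y" using invariant_graphD(6)[OF ig4, of w] w by (simp add: g_def)
    have mid: "(y - 2 * s + y) / 2 = y - s" "(y - (y - 2 * s)) / 2 = s" for s by simp_all
    have "J y = (\<integral>\<^sup>+\<delta>. ennreal (\<Theta> (y, - g \<delta>) * weight (y - \<delta>) \<delta> * indicator {0..t} \<delta>) \<partial>lborel)"
      unfolding J_def g0[symmetric] gt[symmetric]
    proof (rule nn_integral_substitution[where f = "\<lambda>q. \<Theta> (y, - q)" and g = g and g' = "\<lambda>\<delta>. weight (y - \<delta>) \<delta>" and a = 0 and b = t])
      show "set_borel_measurable borel {g 0..g t} (\<lambda>q. \<Theta> (y, - q))" by (rule \<Theta>q) simp
      show "(g has_real_derivative weight (y - s) s) (at s)" for s
      proof -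
        have "((\<lambda>s. p_out (y - 2 * s) y) has_real_derivative (\<rho> ((y - 2 * s + y) / 2) * sin ((y - (y - 2 * s)) / 2) / 2) * - 2) (at s)"
          by (rule DERIV_chain2[where f = "\<lambda>x. p_out x y" and g = "\<lambda>s. y - 2 * s", OF p_out_deriv1]) (auto intro!: derivative_eq_intros)
        then have "((\<lambda>s. - p_out (y - 2 * s) y) has_real_derivative - ((\<rho> ((y - 2 * s + y) / 2) * sin ((y - (y - 2 * s)) / 2) / 2) * - 2)) (at s)"
          by (rule DERIV_minus)
        then show ?thesis unfolding mid by (simp add: g_def[abs_def] weight_def)
      qed
      show "continuous_on {0..t} (\<lambda>\<delta>. weight (y - \<delta>) \<delta>)" unfolding weight_def by (intro continuous_intros)
      show "0 \<le> weight (y - s) s" if "s \<in> {0..t}" for s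
        unfolding weight_def using that t rho_pos[of "y - s"] by (intro mult_nonneg_nonneg sin_ge_zero) auto
    qed (use t in auto)
    also have "\<dots> = (\<integral>\<^sup>+\<delta>. K2 (y - \<delta>, \<delta>) \<partial>lborel)"
    proof (rule nn_integral_cong)
      fix \<delta>
      have e: "y - \<delta> + \<delta> = y" "y - \<delta> - \<delta> = y - 2 * \<delta>" by simp_all
      consider "0 < \<delta> \<and> \<delta> < t" | "\<delta> = 0 \<or> \<delta> = t" | "\<delta> \<notin> {0..t}" by force
      then show "ennreal (\<Theta> (y, - g \<delta>) * weight (y - \<delta>) \<delta> * indicator {0..t} \<delta>) = K2 (y - \<delta>, \<delta>)"
      proof cases
        case 1
        then have "0 \<le> weight (y - \<delta>) \<delta>"
          unfolding weight_def using t rho_pos[of "y - \<delta>"] by (intro mult_nonneg_nonneg sin_ge_zero) auto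
        then show ?thesis using 1 reg[of \<delta>] nonneg by (simp add: K2_def e g_def ennreal_mult)
      next
        case 2
        then have "(y, - g \<delta>) \<notin> phase_region" using g0 gt by (auto simp: phase_region_def)
        then show ?thesis using 2 reg[of \<delta>] out by (auto simp: K2_def)
      next
        case 3
        then show ?thesis using reg[of \<delta>] by (auto simp: K2_def)
      qed
    qed
    finally show ?thesis by simp
  qed
  have [measurable]: "(\<lambda>z. K2 (fst z - snd z, snd z)) \<in> borel_measurable borel"
    by (rule measurable_compose[OF _ \<open>K2 \<in> borel_measurable borel\<close>]) (intro borel_measurable_continuous_onI continuous_intros)
  have mm: "(\<lambda>s. K1 (x + s, s)) \<in> borel_measurable lborel" "(\<lambda>s. K2 (x - s, s)) \<in> borel_measurable lborel" for x
    using measurable_compose[OF borel_measurable_continuous_onI \<open>K1 \<in> borel_measurable borel\<close>, of "\<lambda>s. (x + s, s)"]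
      measurable_compose[OF borel_measurable_continuous_onI \<open>K2 \<in> borel_measurable borel\<close>, of "\<lambda>s. (x - s, s)"]
    by (auto intro!: continuous_intros)
  have "(\<integral>\<^sup>+m. (\<integral>\<^sup>+\<delta>. K1 (m, \<delta>) * indicator {0..<2 * pi} m \<partial>lborel) \<partial>lborel)
      = (\<integral>\<^sup>+x. (\<integral>\<^sup>+s. K1 (x + s, s) * indicator {0..<2 * pi} x \<partial>lborel) \<partial>lborel)"
    by (rule nn_integral_shear[symmetric]) (auto simp: K1p K10)
  also have "\<dots> = (\<integral>\<^sup>+x. J x * indicator {0..<2 * pi} x \<partial>lborel)"
    using in1 by (intro nn_integral_cong) (simp add: nn_integral_multc mm)
  also have "\<dots> = (\<integral>\<^sup>+x. (\<integral>\<^sup>+s. K2 (x - s, s) * indicator {0..<2 * pi} x \<partial>lborel) \<partial>lborel)"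
    using in2 by (intro nn_integral_cong) (simp add: nn_integral_multc mm)
  also have "\<dots> = (\<integral>\<^sup>+m. (\<integral>\<^sup>+\<delta>. K2 (m, \<delta>) * indicator {0..<2 * pi} m \<partial>lborel) \<partial>lborel)"
  proof -
    have per': "K2 (fst (x + 2 * pi, s) - snd (x + 2 * pi, s), snd (x + 2 * pi, s)) = K2 (fst (x, s) - snd (x, s), snd (x, s))" for x s
      using K2p[of "x - s" s] by (simp add: add_diff_eq diff_add_eq)
    show ?thesis
      using nn_integral_shear[of "\<lambda>z. K2 (fst z - snd z, snd z)" "2 * pi", OF _ per'] K20 by simp
  qed
  finally show ?thesis unfolding K1_def K2_def fst_conv snd_conv .
qed

end

section \<open>The averaged second variation\<close>

context symmetric_caustic_family
begin

definition strip :: "(real \<times> real) set" where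
  "strip = region \<inter> {0..<2 * pi} \<times> UNIV"

lemma strip_borel [measurable]: "strip \<in> sets borel"
  unfolding strip_def using borel_open[OF region_open]
  by (intro sets.Int) (auto simp: borel_prod[symmetric] intro!: pair_measureI)

lemma strip_subset: "strip \<subseteq> {0..2 * pi} \<times> {0..pi / 2}"
proof
  fix z assume z: "z \<in> strip"
  then have "snd z < pi / 2" using d_props(2)[of "fst z"] by (auto simp: strip_def region_def)
  then show "z \<in> {0..2 * pi} \<times> {0..pi / 2}" using z by (auto simp: strip_def region_def)
qed

lemma box_compact: "compact ({0..2 * pi} \<times> {0..pi / 2})"
  by (intro compact_Times compact_Icc)

lemma strip_integrable:
  fixes f :: "real \<times> real \<Rightarrow> real"
  assumes "continuous_on UNIV f" shows "integrable lborel (\<lambda>z. indicator strip z * f z)"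
proof -
  have "set_integrable lborel ({0..2 * pi} \<times> {0..pi / 2}) f"
    unfolding set_integrable_def by (rule borel_integrable_compact[OF box_compact continuous_on_subset[OF assms]]) simp
  then have "set_integrable lborel strip f" by (rule set_integrable_subset) (use strip_subset in auto)
  then show ?thesis by (simp add: set_integrable_def)
qed

lemma weight_nonneg: "z \<in> strip \<Longrightarrow> 0 \<le> weight (fst z) (snd z)"
  unfolding weight_def using strip_subset rho_pos[of "fst z"]
  by (intro mult_nonneg_nonneg sin_ge_zero) (auto dest!: subsetD)

lemma weight_cont [continuous_intros]:
  fixes S :: "'a::t2_space set"
  shows "continuous_on S f \<Longrightarrow> continuous_on S g \<Longrightarrow> continuous_on S (\<lambda>z. weight (f z) (g z))"
  unfolding weight_def by (intro continuous_on_sin continuous_intros)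

definition variation :: "real \<Rightarrow> real \<Rightarrow> real \<Rightarrow> real" where
  "variation m \<delta> \<epsilon> = 2 * h (m + \<epsilon> * (h m * cos \<delta>)) * sin (\<delta> + \<epsilon> * (h1 m * sin \<delta>))"

lemma variation_cont [continuous_intros]:
  fixes S :: "'a::t2_space set"
  shows "continuous_on S f \<Longrightarrow> continuous_on S g \<Longrightarrow> continuous_on S k \<Longrightarrow> continuous_on S (\<lambda>z. variation (f z) (g z) (k z))"
  unfolding variation_def by (intro continuous_on_sin continuous_on_cos continuous_intros)

text \<open>Integrating \<open>variation_le\<close> leaves the mean of the increment at outgoing
  lines minus its mean at incoming lines; the invariance of the measure makes them equal.\<close>

lemma variation_integral_le:
  assumes e1: "\<bar>\<epsilon>\<bar> \<le> 1" and e2: "\<And>m. \<bar>\<epsilon> * h1 m\<bar> \<le> 1/2"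
  shows "(\<integral>z. indicator strip z * ((variation (fst z) (snd z) \<epsilon> - variation (fst z) (snd z) 0) * weight (fst z) (snd z)) \<partial>lborel) \<le> 0"
proof -
  obtain B where B: "0 \<le> B" "\<And>\<epsilon> x p. \<bar>\<epsilon>\<bar> \<le> 1 \<Longrightarrow> (x, p) \<in> phase_region \<Longrightarrow> \<bar>increment \<epsilon> x p\<bar> \<le> B"
    using increment_bound by blast
  \<comment> \<open>Adding \<open>B\<close> makes the function nonnegative, as integration in the
    extended reals requires; it cancels between the two ends.\<close>
  define \<Theta> where "\<Theta> z = (if z \<in> phase_region then increment \<epsilon> (fst z) (snd z) + B else 0)" for z
  have [measurable]: "\<Theta> \<in> borel_measurable borel"
    unfolding \<Theta>_def[abs_def]
    by (intro borel_measurable_continuous_on_if borel_open phase_region_open continuous_on_add increment_continuous continuous_on_const)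
  have \<Theta>b: "0 \<le> \<Theta> z" "\<Theta> z \<le> 2 * B" for z
    using B(2)[OF e1, of "fst z" "snd z"] B(1) by (auto simp: \<Theta>_def abs_le_iff)
  have [measurable]: "(\<lambda>z. weight (fst z) (snd z)) \<in> borel_measurable borel"
    by (intro borel_measurable_continuous_onI continuous_intros)
  have [measurable]: "(\<lambda>z. (fst z - snd z, p_in (fst z - snd z) (fst z + snd z))) \<in> borel_measurable borel"
    "(\<lambda>z. (fst z + snd z, p_out (fst z - snd z) (fst z + snd z))) \<in> borel_measurable borel"
    by (intro borel_measurable_continuous_onI continuous_intros)+
  define a1 where "a1 z = indicator strip z * (\<Theta> (fst z - snd z, p_in (fst z - snd z) (fst z + snd z)) * weight (fst z) (snd z))" for z
  define a2 where "a2 z = indicator strip z * (\<Theta> (fst z + snd z, p_out (fst z - snd z) (fst z + snd z)) * weight (fst z) (snd z))" for z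
  have [measurable]: "a1 \<in> borel_measurable borel" "a2 \<in> borel_measurable borel"
    unfolding a1_def[abs_def] a2_def[abs_def] by measurable
  have a0: "0 \<le> a1 z" "0 \<le> a2 z" for z
    using weight_nonneg[of z] \<Theta>b(1) by (auto simp: a1_def a2_def indicator_def)
  have wi: "integrable lborel (\<lambda>z. indicator strip z * (2 * B * weight (fst z) (snd z)))"
    by (intro strip_integrable continuous_intros)
  have int: "integrable lborel a1" "integrable lborel a2"
    by (rule Bochner_Integration.integrable_bound[OF wi],
        use a0 weight_nonneg \<Theta>b B(1) in \<open>auto simp: a1_def a2_def indicator_def abs_mult intro!: mult_right_mono\<close>)+
  have nn: "(\<integral>\<^sup>+z. ennreal (a z) \<partial>lborel) = (\<integral>\<^sup>+m. (\<integral>\<^sup>+\<delta>. ennreal (a (m, \<delta>)) \<partial>lborel) \<partial>lborel)"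
    if [measurable]: "a \<in> borel_measurable borel" for a :: "real \<times> real \<Rightarrow> real"
  proof -
    have "(\<lambda>z. ennreal (a z)) \<in> borel_measurable (lborel \<Otimes>\<^sub>M lborel)" unfolding lborel_prod by measurable
    from lborel.nn_integral_fst[OF this] show ?thesis by (simp add: lborel_prod)
  qed
  have ind: "ennreal (indicator strip (m, \<delta>) * k) = ennreal k * indicator region (m, \<delta>) * indicator {0..<2 * pi} m" for m \<delta> k
    by (auto simp: strip_def indicator_def)
  have "(\<integral>\<^sup>+z. ennreal (a1 z) \<partial>lborel) = (\<integral>\<^sup>+z. ennreal (a2 z) \<partial>lborel)"
    unfolding nn[OF \<open>a1 \<in> borel_measurable borel\<close>] nn[OF \<open>a2 \<in> borel_measurable borel\<close>]
    unfolding a1_def a2_def ind fst_conv snd_conv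
  proof (rule invariant_measure)
    show "\<Theta> (x + 2 * pi, p) = \<Theta> (x, p)" for x p
      using phase_region_shift[of x p] increment_shift[of x p \<epsilon>] by (simp add: \<Theta>_def)
    show "\<Theta> z = 0" if "z \<notin> phase_region" for z using that by (simp add: \<Theta>_def)
  qed (use \<Theta>b in auto)
  then have eq: "(\<integral>z. a1 z \<partial>lborel) = (\<integral>z. a2 z \<partial>lborel)"
    using a0 by (simp add: integral_eq_nn_integral)
  have "(\<integral>z. indicator strip z * ((variation (fst z) (snd z) \<epsilon> - variation (fst z) (snd z) 0) * weight (fst z) (snd z)) \<partial>lborel)
      \<le> (\<integral>z. a2 z - a1 z \<partial>lborel)"
  proof (rule integral_mono)
    show "integrable lborel (\<lambda>z. indicator strip z * ((variation (fst z) (snd z) \<epsilon> - variation (fst z) (snd z) 0) * weight (fst z) (snd z)))"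
      by (intro strip_integrable continuous_intros)
    show "integrable lborel (\<lambda>z. a2 z - a1 z)" using int by simp
    fix z :: "real \<times> real"
    show "indicator strip z * ((variation (fst z) (snd z) \<epsilon> - variation (fst z) (snd z) 0) * weight (fst z) (snd z)) \<le> a2 z - a1 z"
    proof (cases "z \<in> strip")
      case True
      obtain m \<delta> where z: "z = (m, \<delta>)" by (cases z)
      have \<delta>: "0 < \<delta>" "\<delta> < d m" using True by (auto simp: z strip_def region_def)
      have xy: "m - \<delta> < m + \<delta>" "m + \<delta> < f4 (m - \<delta>)" using \<delta> region_iff[of m \<delta>] by simp_all
      note ch = chord_leaf[OF xy]
      have "variation m \<delta> \<epsilon> - variation m \<delta> 0 \<le> \<Theta> (m + \<delta>, p_out (m - \<delta>) (m + \<delta>)) - \<Theta> (m - \<delta>, p_in (m - \<delta>) (m + \<delta>))"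
        using variation_le[OF \<delta> e2] ch(1,2) by (simp add: variation_def \<Theta>_def)
      from mult_right_mono[OF this weight_nonneg[OF True]] show ?thesis
        using True by (simp add: a1_def a2_def z left_diff_distrib)
    qed (simp add: a1_def a2_def)
  qed
  also have "\<dots> = 0" using int eq by simp
  finally show ?thesis .
qed

definition variation2 :: "real \<Rightarrow> real \<Rightarrow> real \<Rightarrow> real" where
  "variation2 m \<delta> t = (let a = h m * cos \<delta>; b = h1 m * sin \<delta> in
     2 * (a\<^sup>2 * (\<rho> (m + t * a) - h (m + t * a)) * sin (\<delta> + t * b) + 2 * a * b * h1 (m + t * a) * cos (\<delta> + t * b)
       - b\<^sup>2 * h (m + t * a) * sin (\<delta> + t * b)))"

lemma variation2_cont [continuous_intros]:
  fixes S :: "'a::t2_space set"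
  shows "continuous_on S f \<Longrightarrow> continuous_on S g \<Longrightarrow> continuous_on S k \<Longrightarrow> continuous_on S (\<lambda>z. variation2 (f z) (g z) (k z))"
  unfolding variation2_def Let_def by (intro continuous_on_sin continuous_on_cos continuous_intros)

lemma variation_second_difference:
  assumes "0 < e"
  shows "\<exists>s t. \<bar>s\<bar> < e \<and> \<bar>t\<bar> < e \<and>
    variation m \<delta> e + variation m \<delta> (- e) - 2 * variation m \<delta> 0 = e\<^sup>2 * ((variation2 m \<delta> s + variation2 m \<delta> t) / 2)"
proof (rule second_difference[OF _ _ assms])
  define a where "a = h m * cos \<delta>"
  define b where "b = h1 m * sin \<delta>"
  define v1 where "v1 t = 2 * (a * h1 (m + t * a) * sin (\<delta> + t * b) + b * h (m + t * a) * cos (\<delta> + t * b))" for t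
  have L: "((\<lambda>t. m + t * a) has_real_derivative a) (at t)" "((\<lambda>t. \<delta> + t * b) has_real_derivative b) (at t)" for t
    by (auto intro!: derivative_eq_intros)
  note D = DERIV_chain2[OF h_deriv L(1)] DERIV_chain2[OF h1_deriv L(1)]
    DERIV_chain2[OF DERIV_sin L(2)] DERIV_chain2[OF DERIV_cos L(2)]
  show "(variation m \<delta> has_real_derivative v1 t) (at t)" for t
    unfolding variation_def[abs_def] a_def[symmetric] b_def[symmetric] v1_def
    by (rule DERIV_cong[OF DERIV_mult[OF DERIV_cmult[OF D(1)] D(3)]]) (simp add: algebra_simps)
  show "(v1 has_real_derivative variation2 m \<delta> t) (at t)" for t
    unfolding variation2_def Let_def a_def[symmetric] b_def[symmetric] v1_def[abs_def]
    by (rule DERIV_cong[OF DERIV_cmult[OF DERIV_add[OF DERIV_mult[OF DERIV_cmult[OF D(2)] D(3)] DERIV_mult[OF DERIV_cmult[OF D(1)] D(4)]]]])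
      (simp add: algebra_simps power2_eq_square)
qed

text \<open>Adding the inequalities for a displacement and its opposite cancels the first order, and
  division by the square gives the second derivative in the limit. The potentials have already
  disappeared, so only the action is differentiated.\<close>

lemma variation2_integral_le:
  "(\<integral>z. indicator strip z * (variation2 (fst z) (snd z) 0 * weight (fst z) (snd z)) \<partial>lborel) \<le> 0"
proof -
  obtain z1 z2 where z12: "\<And>x. h1 z1 \<le> h1 x" "\<And>x. h1 x \<le> h1 z2"
    using periodic_attains_bounds[OF h1_cont h1_periodic] by blast
  define H where "H = \<bar>h1 z1\<bar> + \<bar>h1 z2\<bar> + 1"
  have H: "0 < H" "\<bar>h1 x\<bar> \<le> H" for x unfolding H_def using z12[of x] by linarith+
  \<comment> \<open>The factor ensures both smallness conditions of
    \<open>variation_integral_le\<close>.\<close>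
  define e where "e n = inverse (real (Suc n)) * (1 / (2 * (H + 1)))" for n
  have e0: "0 < e n" for n using H by (simp add: e_def)
  have eH: "e n * (2 * (H + 1)) \<le> 1" for n using H by (simp add: e_def divide_simps)
  have e1: "e n \<le> 1" for n
  proof -
    have "e n * 1 \<le> e n * (2 * (H + 1))" using e0[of n] H by (intro mult_left_mono) auto
    then show ?thesis using eH[of n] by linarith
  qed
  have e2: "\<bar>e n * h1 m\<bar> \<le> 1/2" for n m
  proof -
    have "\<bar>e n * h1 m\<bar> = e n * \<bar>h1 m\<bar>" using e0[of n] by (simp add: abs_mult)
    also have "\<dots> \<le> e n * (H + 1)" using e0[of n] H(2)[of m] by (intro mult_left_mono) auto
    finally show ?thesis using eH[of n] by linarith
  qed
  have elim: "e \<longlonglongrightarrow> 0"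
    unfolding e_def[abs_def] using tendsto_mult_right[OF LIMSEQ_inverse_real_of_nat, of "1 / (2 * (H + 1))"] by simp
  let ?S = "\<lambda>n z. (variation (fst z) (snd z) (e n) + variation (fst z) (snd z) (- e n) - 2 * variation (fst z) (snd z) 0) / (e n)\<^sup>2"
  define s where "s n z = indicator strip z * (?S n z * weight (fst z) (snd z))" for n z
  have q: "\<exists>a b. \<bar>a\<bar> < e n \<and> \<bar>b\<bar> < e n \<and> ?S n z = (variation2 (fst z) (snd z) a + variation2 (fst z) (snd z) b) / 2" for n z
  proof -
    obtain a b where "\<bar>a\<bar> < e n" "\<bar>b\<bar> < e n"
      "variation (fst z) (snd z) (e n) + variation (fst z) (snd z) (- e n) - 2 * variation (fst z) (snd z) 0
        = (e n)\<^sup>2 * ((variation2 (fst z) (snd z) a + variation2 (fst z) (snd z) b) / 2)"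
      using variation_second_difference[OF e0[of n], of "fst z" "snd z"] by blast
    then show ?thesis using e0[of n] by (intro exI[of _ a] exI[of _ b]) simp
  qed
  have cont: "continuous_on UNIV (\<lambda>z. ?S n z * weight (fst z) (snd z))" for n
    using e0[of n] by (intro continuous_intros) auto
  have le: "(\<integral>z. s n z \<partial>lborel) \<le> 0" for n
  proof -
    let ?A = "\<lambda>e z. indicator strip z * ((variation (fst z) (snd z) e - variation (fst z) (snd z) 0) * weight (fst z) (snd z))"
    have i: "integrable lborel (?A c)" for c by (intro strip_integrable continuous_intros)
    have "(\<integral>z. s n z \<partial>lborel) = (\<integral>z. (?A (e n) z + ?A (- e n) z) / (e n)\<^sup>2 \<partial>lborel)"
      by (intro Bochner_Integration.integral_cong refl) (simp add: s_def field_simps)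
    also have "\<dots> = ((\<integral>z. ?A (e n) z \<partial>lborel) + (\<integral>z. ?A (- e n) z \<partial>lborel)) / (e n)\<^sup>2"
      by (simp only: integral_divide_zero Bochner_Integration.integral_add[OF i i])
    also have "\<dots> \<le> 0"
      using variation_integral_le[of "e n"] variation_integral_le[of "- e n"] e0[of n] e1[of n] e2[of n]
      by (intro divide_nonpos_nonneg add_nonpos_nonpos) auto
    finally show ?thesis .
  qed
  define K where "K = ({0..2 * pi} \<times> {0..pi / 2}) \<times> {-1..1::real}"
  have "compact ((\<lambda>w. variation2 (fst (fst w)) (snd (fst w)) (snd w)) ` K)"
    unfolding K_def by (intro compact_continuous_image continuous_intros compact_Times box_compact compact_Icc)
  then have "bounded ((\<lambda>w. variation2 (fst (fst w)) (snd (fst w)) (snd w)) ` K)" by (rule compact_imp_bounded)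
  then obtain B where B: "\<And>w. w \<in> K \<Longrightarrow> \<bar>variation2 (fst (fst w)) (snd (fst w)) (snd w)\<bar> \<le> B"
    unfolding bounded_iff by auto
  have Bz: "\<bar>variation2 (fst z) (snd z) t\<bar> \<le> B" if "z \<in> strip" "\<bar>t\<bar> \<le> 1" for z t
    using B[of "(z, t)"] subsetD[OF strip_subset that(1)] that(2) by (auto simp: K_def abs_le_iff)
  have avg: "\<bar>(x + y) / 2\<bar> \<le> B" if "\<bar>x\<bar> \<le> B" "\<bar>y\<bar> \<le> B" for x y
  proof -
    have "\<bar>x + y\<bar> \<le> B * 2" using that by (simp add: abs_le_iff)
    then show ?thesis by (simp only: abs_divide abs_numeral) simp
  qed
  have lim: "(\<lambda>n. \<integral>z. s n z \<partial>lborel) \<longlonglongrightarrow> (\<integral>z. indicator strip z * (variation2 (fst z) (snd z) 0 * weight (fst z) (snd z)) \<partial>lborel)"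
  proof (rule integral_dominated_convergence[where w = "\<lambda>z. indicator strip z * (B * weight (fst z) (snd z))"])
    show "(\<lambda>z. indicator strip z * (variation2 (fst z) (snd z) 0 * weight (fst z) (snd z))) \<in> borel_measurable lborel"
      by (intro borel_measurable_integrable strip_integrable continuous_intros)
    show "s n \<in> borel_measurable lborel" for n
      unfolding s_def[abs_def] by (intro borel_measurable_integrable strip_integrable cont)
    show "integrable lborel (\<lambda>z. indicator strip z * (B * weight (fst z) (snd z)))"
      by (intro strip_integrable continuous_intros)
    show "AE z in lborel. norm (s n z) \<le> indicator strip z * (B * weight (fst z) (snd z))" for n
    proof (rule AE_I2)
      fix z :: "real \<times> real"
      show "norm (s n z) \<le> indicator strip z * (B * weight (fst z) (snd z))"
      proof (cases "z \<in> strip")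
        case True
        obtain a b where ab: "\<bar>a\<bar> < e n" "\<bar>b\<bar> < e n" "?S n z = (variation2 (fst z) (snd z) a + variation2 (fst z) (snd z) b) / 2"
          using q[where n = n and z = z] by blast
        have "\<bar>variation2 (fst z) (snd z) a\<bar> \<le> B" "\<bar>variation2 (fst z) (snd z) b\<bar> \<le> B"
          using ab e1[of n] by (auto intro!: Bz[OF True])
        then have "\<bar>?S n z\<bar> \<le> B" unfolding ab(3) by (rule avg)
        from mult_right_mono[OF this weight_nonneg[OF True]] show ?thesis
          using True weight_nonneg[OF True] by (simp add: s_def abs_mult)
      qed (simp add: s_def)
    qed
    show "AE z in lborel. (\<lambda>n. s n z) \<longlonglongrightarrow> indicator strip z * (variation2 (fst z) (snd z) 0 * weight (fst z) (snd z))"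
    proof (rule AE_I2)
      fix z :: "real \<times> real"
      obtain a b where ab: "\<And>n. \<bar>a n\<bar> < e n" "\<And>n. \<bar>b n\<bar> < e n"
        "\<And>n. ?S n z = (variation2 (fst z) (snd z) (a n) + variation2 (fst z) (snd z) (b n)) / 2"
        using q[where z = z] by metis
      have l0: "a \<longlonglongrightarrow> 0" "b \<longlonglongrightarrow> 0"
        by (rule Lim_null_comparison[OF _ elim], intro always_eventually allI, simp add: ab(1,2) less_imp_le)+
      have "isCont (variation2 (fst z) (snd z)) 0"
        by (rule continuous_on_interior[of UNIV]) (auto intro!: continuous_intros)
      then have "(\<lambda>n. variation2 (fst z) (snd z) (a n)) \<longlonglongrightarrow> variation2 (fst z) (snd z) 0"
        "(\<lambda>n. variation2 (fst z) (snd z) (b n)) \<longlonglongrightarrow> variation2 (fst z) (snd z) 0"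
        using l0 by (auto intro: isCont_tendsto_compose)
      then have "(\<lambda>n. ?S n z) \<longlonglongrightarrow> (variation2 (fst z) (snd z) 0 + variation2 (fst z) (snd z) 0) / 2"
        unfolding ab(3) by (intro tendsto_intros) auto
      then have "(\<lambda>n. ?S n z) \<longlonglongrightarrow> variation2 (fst z) (snd z) 0" by simp
      then show "(\<lambda>n. s n z) \<longlonglongrightarrow> indicator strip z * (variation2 (fst z) (snd z) 0 * weight (fst z) (snd z))"
        unfolding s_def by (intro tendsto_mult tendsto_const)
    qed
  qed
  show ?thesis by (rule LIMSEQ_le_const2[OF lim]) (use le in blast)
qed

end

section \<open>Integration over the angle of incidence\<close>

text \<open>The antiderivative of sin^2 cos^2 vanishing at 0; \<open>quartic_sin\<close> is that of
  sin^4. These are the powers occurring in the product of second variation and weight.\<close>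

definition quartic_mixed :: "real \<Rightarrow> real" where
  "quartic_mixed t = (t - sin t * cos t * ((cos t)\<^sup>2 - (sin t)\<^sup>2)) / 8"

definition quartic_sin :: "real \<Rightarrow> real" where
  "quartic_sin t = (3 * t - 4 * (sin t * cos t) + sin t * cos t * ((cos t)\<^sup>2 - (sin t)\<^sup>2)) / 8"

lemma quartic_deriv:
  "(quartic_mixed has_real_derivative (sin t)\<^sup>2 * (cos t)\<^sup>2) (at t)"
  "(quartic_sin has_real_derivative (sin t) ^ 4) (at t)"
proof -
  define s c where "s = sin t" and "c = cos t"
  have 1: "s\<^sup>2 + c\<^sup>2 = 1" by (simp add: s_def c_def)
  have i1: "(1 - ((c\<^sup>2 - s\<^sup>2) * (c\<^sup>2 - s\<^sup>2) - 4 * s\<^sup>2 * c\<^sup>2)) / 8 = s\<^sup>2 * c\<^sup>2"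
    using 1 by algebra
  have i2: "(3 - 4 * (c\<^sup>2 - s\<^sup>2) + ((c\<^sup>2 - s\<^sup>2) * (c\<^sup>2 - s\<^sup>2) - 4 * s\<^sup>2 * c\<^sup>2)) / 8 = s ^ 4"
    using 1 by algebra
  have D: "((\<lambda>t. sin t * cos t) has_real_derivative c\<^sup>2 - s\<^sup>2) (at t)"
    "((\<lambda>t. sin t * cos t * ((cos t)\<^sup>2 - (sin t)\<^sup>2)) has_real_derivative (c\<^sup>2 - s\<^sup>2) * (c\<^sup>2 - s\<^sup>2) - 4 * s\<^sup>2 * c\<^sup>2) (at t)"
    by (auto intro!: derivative_eq_intros simp: s_def c_def power2_eq_square algebra_simps)
  show "(quartic_mixed has_real_derivative (sin t)\<^sup>2 * (cos t)\<^sup>2) (at t)"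
    unfolding quartic_mixed_def[abs_def] i1[unfolded s_def c_def, symmetric]
    by (rule DERIV_cdivide[OF DERIV_diff[OF DERIV_ident D(2), unfolded s_def c_def]])
  have "((\<lambda>t. 3 * t - 4 * (sin t * cos t) + sin t * cos t * ((cos t)\<^sup>2 - (sin t)\<^sup>2)) has_real_derivative
      3 * 1 - 4 * (c\<^sup>2 - s\<^sup>2) + ((c\<^sup>2 - s\<^sup>2) * (c\<^sup>2 - s\<^sup>2) - 4 * s\<^sup>2 * c\<^sup>2)) (at t)"
    by (intro DERIV_add DERIV_diff DERIV_cmult D DERIV_ident)
  then have "(quartic_sin has_real_derivative (3 * 1 - 4 * (c\<^sup>2 - s\<^sup>2) + ((c\<^sup>2 - s\<^sup>2) * (c\<^sup>2 - s\<^sup>2) - 4 * s\<^sup>2 * c\<^sup>2)) / 8) (at t)"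
    unfolding quartic_sin_def[abs_def] by (rule DERIV_cdivide)
  then show "(quartic_sin has_real_derivative (sin t) ^ 4) (at t)"
    unfolding mult_1_right i2 by (simp add: s_def)
qed

context symmetric_caustic_family
begin

definition fibre :: "real \<Rightarrow> real" where
  "fibre m = 2 * h m * \<rho> m * ((h m * (\<rho> m - h m) + 2 * (h1 m)\<^sup>2) * quartic_mixed (d m) - (h1 m)\<^sup>2 * quartic_sin (d m))"

lemma fibre_integral:
  "(\<integral>\<delta>. indicator {0<..<d m} \<delta> * (variation2 m \<delta> 0 * weight m \<delta>) \<partial>lborel) = fibre m"
proof -
  let ?k = "\<lambda>\<delta>. 2 * h m * \<rho> m * ((h m * (\<rho> m - h m) + 2 * (h1 m)\<^sup>2) * ((sin \<delta>)\<^sup>2 * (cos \<delta>)\<^sup>2) - (h1 m)\<^sup>2 * (sin \<delta>) ^ 4)"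
  have k: "variation2 m \<delta> 0 * weight m \<delta> = ?k \<delta>" for \<delta>
    by (simp add: variation2_def weight_def Let_def algebra_simps power2_eq_square power4_eq_xxxx)
  have "(\<integral>\<delta>. indicator {0<..<d m} \<delta> * (variation2 m \<delta> 0 * weight m \<delta>) \<partial>lborel) = (\<integral>\<delta>. indicator {0..d m} \<delta> *\<^sub>R ?k \<delta> \<partial>lborel)"
  proof (rule integral_cong_AE)
    show "AE \<delta> in lborel. indicator {0<..<d m} \<delta> * (variation2 m \<delta> 0 * weight m \<delta>) = indicator {0..d m} \<delta> *\<^sub>R ?k \<delta>"
      using AE_lborel_singleton[of 0] AE_lborel_singleton[of "d m"] by eventually_elim (auto simp: indicator_def k)
  qed (unfold k, measurable)
  also have "\<dots> = 2 * h m * \<rho> m * ((h m * (\<rho> m - h m) + 2 * (h1 m)\<^sup>2) * quartic_mixed (d m) - (h1 m)\<^sup>2 * quartic_sin (d m))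
      - 2 * h m * \<rho> m * ((h m * (\<rho> m - h m) + 2 * (h1 m)\<^sup>2) * quartic_mixed 0 - (h1 m)\<^sup>2 * quartic_sin 0)"
  proof (rule integral_FTC_Icc)
    show "0 \<le> d m" using d_props(1)[of m] by simp
    show "continuous_on {0..d m} ?k" by (intro continuous_intros)
    fix x
    have "((\<lambda>x. 2 * h m * \<rho> m * ((h m * (\<rho> m - h m) + 2 * (h1 m)\<^sup>2) * quartic_mixed x - (h1 m)\<^sup>2 * quartic_sin x)) has_real_derivative ?k x) (at x)"
      by (intro DERIV_cmult DERIV_diff quartic_deriv)
    then show "((\<lambda>x. 2 * h m * \<rho> m * ((h m * (\<rho> m - h m) + 2 * (h1 m)\<^sup>2) * quartic_mixed x - (h1 m)\<^sup>2 * quartic_sin x)) has_vector_derivative ?k x) (at x within {0..d m})"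
      unfolding has_real_derivative_iff_has_vector_derivative[symmetric] by (rule has_field_derivative_at_within)
  qed
  finally show ?thesis by (simp add: fibre_def quartic_mixed_def quartic_sin_def)
qed

lemma fibre_cont: "continuous_on S fibre"
  unfolding fibre_def quartic_mixed_def quartic_sin_def
  by (intro continuous_on_sin continuous_on_cos continuous_intros d_cont h_cont h1_cont continuous_on_subset[OF rho_cont]) auto

lemma fibre_integral_nonpos: "integral {0..2 * pi} fibre \<le> 0"
proof -
  let ?f = "\<lambda>z. indicator strip z * (variation2 (fst z) (snd z) 0 * weight (fst z) (snd z))"
  have "integrable lborel ?f" by (intro strip_integrable continuous_intros)
  then have "integrable (lborel \<Otimes>\<^sub>M lborel) ?f" by (simp add: lborel_prod)
  from lborel_pair.integral_fst'[OF this]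
  have "(\<integral>m. (\<integral>\<delta>. ?f (m, \<delta>) \<partial>lborel) \<partial>lborel) \<le> 0"
    using variation2_integral_le by (simp add: lborel_prod)
  also have "(\<integral>m. (\<integral>\<delta>. ?f (m, \<delta>) \<partial>lborel) \<partial>lborel) = (\<integral>m. indicator {0..<2 * pi} m * fibre m \<partial>lborel)"
  proof (rule Bochner_Integration.integral_cong[OF refl])
    fix m
    have "(\<integral>\<delta>. ?f (m, \<delta>) \<partial>lborel) = (\<integral>\<delta>. indicator {0..<2 * pi} m * (indicator {0<..<d m} \<delta> * (variation2 m \<delta> 0 * weight m \<delta>)) \<partial>lborel)"
      by (rule Bochner_Integration.integral_cong[OF refl]) (auto simp: strip_def region_def indicator_def)
    also have "\<dots> = indicator {0..<2 * pi} m * fibre m" by (simp only: integral_mult_right_zero fibre_integral)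
    finally show "(\<integral>\<delta>. ?f (m, \<delta>) \<partial>lborel) = indicator {0..<2 * pi} m * fibre m" .
  qed
  also have "\<dots> = (LINT m:{0..2 * pi}|lborel. fibre m)"
    unfolding set_lebesgue_integral_def
  proof (rule integral_cong_AE)
    have [measurable]: "fibre \<in> borel_measurable borel" by (intro borel_measurable_continuous_onI fibre_cont)
    show "(\<lambda>m. indicator {0..<2 * pi} m * fibre m) \<in> borel_measurable lborel"
      "(\<lambda>m. indicator {0..2 * pi} m *\<^sub>R fibre m) \<in> borel_measurable lborel" by measurable
    show "AE m in lborel. indicator {0..<2 * pi} m * fibre m = indicator {0..2 * pi} m *\<^sub>R fibre m"
      using AE_lborel_singleton[of "2 * pi"] by eventually_elim (auto simp: indicator_def)
  qed
  also have "\<dots> = integral {0..2 * pi} fibre"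
    by (intro set_borel_integral_eq_integral(2)) (unfold set_integrable_def, rule borel_integrable_compact[OF compact_Icc fibre_cont])
  finally show ?thesis .
qed

end

lemma quartic_sin_eq: "quartic_sin t = 3 * quartic_mixed t - (sin t) ^ 3 * cos t"
proof -
  define s c where "s = sin t" and "c = cos t"
  have "s\<^sup>2 + c\<^sup>2 = 1" unfolding s_def c_def by (rule sin_cos_squared_add)
  then have "3 * t - 4 * (s * c) + s * c * (c\<^sup>2 - s\<^sup>2) = 3 * (t - s * c * (c\<^sup>2 - s\<^sup>2)) - 8 * (s ^ 3 * c)" by algebra
  then have "quartic_sin t = (3 * (t - s * c * (c\<^sup>2 - s\<^sup>2)) - 8 * (s ^ 3 * c)) / 8" unfolding quartic_sin_def s_def c_def by simp
  then show ?thesis unfolding quartic_mixed_def s_def c_def by (simp add: diff_divide_distrib)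
qed

text \<open>The constant is the integral of sin^2 cos^2 from 0 to \<pi>/2. A quarter turn replaces
  \<open>d\<close> by \<open>pi / 2 - d\<close>, so the nonelementary parts of two fibres combine to
  it.\<close>

lemma quartic_mixed_complement: "quartic_mixed (pi / 2 - t) = pi / 16 - quartic_mixed t"
proof -
  have "cos (pi / 2 - t) = sin t" "sin (pi / 2 - t) = cos t" by (simp_all add: cos_diff sin_diff)
  then show ?thesis by (simp add: quartic_mixed_def field_simps)
qed

text \<open>With \<open>s\<close>, \<open>c\<close> the sine and cosine of \<open>d m\<close>,
  \<open>p\<close> and \<open>q\<close> the first two derivatives of \<open>d\<close>,
  \<open>A\<close> the value of \<open>quartic_mixed\<close> and \<open>K = pi / 16\<close>, the
  left side is \<open>fibre m + fibre (m + pi / 2)\<close> divided by \<open>R ^ 4\<close>. On the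
  right, the first line is \<open>2 * K\<close> times \<open>v'^2 - 4 v^2\<close> for
  \<open>v = s * c * p\<close>, which is \<open>h * h1\<close> divided by the square of
  \<open>R\<close>. The other two lines are minus the derivatives of
  \<open>2 * s * c * p * (K * c^2 - A)\<close> and
  \<open>2 * s * c * p^3 * (A - K * s^2)\<close>.\<close>

lemma fibre_identity:
  fixes s c p q A K :: real
  assumes "s\<^sup>2 + c\<^sup>2 = 1"
  shows "2 * s * (s + q * c - p\<^sup>2 * s) * ((s * (q * c - p\<^sup>2 * s) + 2 * (p * c)\<^sup>2) * A - (p * c)\<^sup>2 * (3 * A - s ^ 3 * c))
    + 2 * c * (c - q * s - p\<^sup>2 * c) * ((c * (- q * s - p\<^sup>2 * c) + 2 * (p * s)\<^sup>2) * (K - A) - (p * s)\<^sup>2 * (3 * (K - A) - c ^ 3 * s))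
    = 2 * K * ((p\<^sup>2 * (c\<^sup>2 - s\<^sup>2) + s * c * q)\<^sup>2 - 4 * (s * c * p)\<^sup>2)
     - 2 * ((c\<^sup>2 - s\<^sup>2) * p\<^sup>2 * (K * c\<^sup>2 - A) + s * c * q * (K * c\<^sup>2 - A) + s * c * p * (- 2 * K * s * c * p - s\<^sup>2 * c\<^sup>2 * p))
     - 2 * ((c\<^sup>2 - s\<^sup>2) * p ^ 4 * (A - K * s\<^sup>2) + 3 * s * c * p\<^sup>2 * q * (A - K * s\<^sup>2) + s * c * p ^ 3 * (s\<^sup>2 * c\<^sup>2 * p - 2 * K * s * c * p))"
  using assms by algebra

context symmetric_caustic_family
begin

text \<open>In terms of \<open>d\<close> and its derivatives a quarter turn merely exchanges sine
  and cosine up to signs, which makes the sum of two fibres accessible to polynomial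
  algebra.\<close>

lemma h_derivs_by_d:
  defines "s \<equiv> \<lambda>m. sin (d m)" and "c \<equiv> \<lambda>m. cos (d m)"
  shows "\<exists>p q. \<forall>m. (d has_real_derivative p m) (at m) \<and> (p has_real_derivative q m) (at m) \<and>
    h m = R * s m \<and> h (m + pi / 2) = R * c m \<and> h1 m = R * (p m * c m) \<and> h1 (m + pi / 2) = - (R * (p m * s m)) \<and>
    \<rho> m - h m = R * (q m * c m - (p m)\<^sup>2 * s m) \<and> \<rho> (m + pi / 2) - h (m + pi / 2) = R * (- q m * s m - (p m)\<^sup>2 * c m)"
proof -
  define k where "k m = h (m + pi / 2)" for m
  define k1 where "k1 m = h1 (m + pi / 2)" for m
  have L: "((\<lambda>m. m + pi / 2) has_real_derivative 1) (at m)" for m by (auto intro!: derivative_eq_intros)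
  have kd: "(k has_real_derivative k1 m) (at m)" "(k1 has_real_derivative \<rho> (m + pi / 2) - k m) (at m)" for m
    using DERIV_chain2[OF h_deriv L] DERIV_chain2[OF h1_deriv L] by (simp_all add: k_def[abs_def] k1_def[abs_def])
  define p where "p m = h1 m / k m" for m
  define q where "q m = ((\<rho> m - h m) * k m - h1 m * k1 m) / (k m * k m)" for m
  have kpos: "0 < k m" for m by (simp add: k_def h_pos)
  have hs: "h m = R * s m" "k m = R * c m" for m
    unfolding s_def c_def k_def by (rule d_props(3)[symmetric], rule d_props(4)[symmetric])
  have cpos: "0 < c m" for m
    using zero_less_mult_pos[OF _ R_pos] kpos[of m] unfolding hs(2) by blast
  have Rn: "R \<noteq> 0" and cn: "c m \<noteq> 0" for m using R_pos cpos[of m] by simp_all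
  then have Rc: "R * c m \<noteq> 0" for m by simp
  have h1e: "h1 m = R * (p m * c m)" for m
  proof -
    have "h1 m = p m * k m" using kpos[of m] by (simp add: p_def)
    then show ?thesis unfolding hs(2) by (simp only: mult_ac)
  qed
  have sc: "(s m)\<^sup>2 + (c m)\<^sup>2 = 1" for m by (simp add: s_def c_def)
  have "c m * (R * k1 m) = c m * (- (R * R * (p m * s m)))" for m
  proof -
    have "k m * k1 m = - (h m * h1 m)" unfolding k_def k1_def by (rule h_h1_quarter)
    then show ?thesis unfolding hs(2) hs(1)[of m] h1e by algebra
  qed
  then have "R * k1 m = - (R * R * (p m * s m))" for m using cn[of m] mult_left_cancel[of "c m"] by blast
  then have "R * k1 m = R * (- (R * (p m * s m)))" for m by simp
  then have k1e: "k1 m = - (R * (p m * s m))" for m using Rn mult_left_cancel[of R] by blast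
  have pd: "(p has_real_derivative q m) (at m)" for m
    unfolding p_def[abs_def] q_def using DERIV_divide[OF h1_deriv kd(1)] kpos[of m] by simp
  have dd: "(d has_real_derivative p m) (at m)" for m
  proof -
    have x: "0 < h m / R" "h m / R < 1" using h_pos[of m] h_less_R[of m] R_pos by simp_all
    have "1 - (h m / R)\<^sup>2 = (c m)\<^sup>2" using sc[of m] R_pos hs(1)[of m] by simp
    then have "sqrt (1 - (h m / R)\<^sup>2) = c m" using cpos[of m] by simp
    then have "(arcsin has_real_derivative inverse (c m)) (at (h m / R))"
      using DERIV_arcsin[of "h m / R"] x by simp
    from DERIV_chain2[OF this DERIV_cdivide[OF h_deriv]]
    have "(d has_real_derivative inverse (c m) * (h1 m / R)) (at m)" by (simp add: d_def[abs_def])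
    moreover have "inverse (c m) * (h1 m / R) = p m" using cpos[of m] R_pos by (simp add: h1e)
    ultimately show ?thesis by simp
  qed
  have r1: "\<rho> m - h m = R * (q m * c m - (p m)\<^sup>2 * s m)" for m
  proof -
    have "q m * (k m * k m) = (\<rho> m - h m) * k m - h1 m * k1 m" using kpos[of m] by (simp add: q_def)
    then have "(R * c m) * (\<rho> m - h m) = (R * c m) * (R * (q m * c m - (p m)\<^sup>2 * s m))"
      unfolding hs(2) hs(1)[of m] h1e k1e by (simp add: algebra_simps power2_eq_square)
    then show ?thesis using Rc[of m] mult_left_cancel[of "R * c m"] by blast
  qed
  have r2: "\<rho> (m + pi / 2) - k m = R * (- q m * s m - (p m)\<^sup>2 * c m)" for m
  proof -
    have z: "h m * h1 m + k m * k1 m = 0" for m using h_h1_quarter[of m] by (simp add: k_def k1_def)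
    have "((\<lambda>m. h m * h1 m + k m * k1 m) has_real_derivative
        (h1 m * h1 m + (\<rho> m - h m) * h m) + (k1 m * k1 m + (\<rho> (m + pi / 2) - k m) * k m)) (at m)"
      by (intro DERIV_add DERIV_mult h_deriv h1_deriv kd)
    then have "((\<lambda>m :: real. 0) has_real_derivative
        (h1 m * h1 m + (\<rho> m - h m) * h m) + (k1 m * k1 m + (\<rho> (m + pi / 2) - k m) * k m)) (at m)"
      unfolding z .
    from DERIV_unique[OF this DERIV_const]
    have e: "(h1 m * h1 m + (\<rho> m - h m) * h m) + (k1 m * k1 m + (\<rho> (m + pi / 2) - k m) * k m) = 0" .
    have "(R * c m) * (\<rho> (m + pi / 2) - k m) = (R * c m) * (R * (- q m * s m - (p m)\<^sup>2 * c m))"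
      using e[unfolded r1, unfolded h1e k1e hs(1)[of m] hs(2)] sc[of m] unfolding hs(2) by algebra
    then show ?thesis using Rc[of m] mult_left_cancel[of "R * c m"] by blast
  qed
  show ?thesis
    using dd pd hs h1e k1e r1 r2 unfolding k_def k1_def by blast
qed

text \<open>The reverse Wirtinger inequality for \<open>v = h * h1\<close>, expressed by a primitive
  of \<open>v'^2 - 4 v^2\<close>.\<close>

lemma quarter_primitive:
  "\<exists>G. (\<forall>m. (G has_real_derivative (h1 m * h1 m + (\<rho> m - h m) * h m)\<^sup>2 - 4 * (h m * h1 m)\<^sup>2) (at m)) \<and> G (2 * pi) \<le> G 0"
proof -
  obtain p q where pq: "\<And>m. (d has_real_derivative p m) (at m)" "\<And>m. (p has_real_derivative q m) (at m)"
    "\<And>m. h m = R * sin (d m)" "\<And>m. h (m + pi / 2) = R * cos (d m)" "\<And>m. h1 m = R * (p m * cos (d m))"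
    "\<And>m. h1 (m + pi / 2) = - (R * (p m * sin (d m)))"
    "\<And>m. \<rho> m - h m = R * (q m * cos (d m) - (p m)\<^sup>2 * sin (d m))"
    "\<And>m. \<rho> (m + pi / 2) - h (m + pi / 2) = R * (- q m * sin (d m) - (p m)\<^sup>2 * cos (d m))"
    using h_derivs_by_d by blast
  have r: "\<rho> m = R * (sin (d m) + q m * cos (d m) - (p m)\<^sup>2 * sin (d m))"
    "\<rho> (m + pi / 2) = R * (cos (d m) - q m * sin (d m) - (p m)\<^sup>2 * cos (d m))" for m
    using pq(3)[of m] pq(4)[of m] pq(7)[of m] pq(8)[of m] by (simp_all add: algebra_simps)
  define K :: real where "K = pi / 16"
  define N where "N m = 2 * (sin (d m) * cos (d m) * p m * (K * cos (d m) * cos (d m) - quartic_mixed (d m)))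
    + 2 * (sin (d m) * cos (d m) * p m * p m * p m * (quartic_mixed (d m) - K * sin (d m) * sin (d m)))" for m
  note D = DERIV_chain2[OF DERIV_sin pq(1)] DERIV_chain2[OF DERIV_cos pq(1)] DERIV_chain2[OF quartic_deriv(1) pq(1)]
  define \<Phi> where "\<Phi> = potential fibre"
  have \<Phi>d: "(\<Phi> has_real_derivative fibre m) (at m)" for m
    unfolding \<Phi>_def by (rule potential_deriv[OF fibre_cont])
  have L: "((\<lambda>m. m + u) has_real_derivative 1) (at m)" for m u :: real by (auto intro!: derivative_eq_intros)
  \<comment> \<open>Over a full turn the translated primitive grows as much as \<Phi> itself and the
    periodic \<open>N\<close> contributes nothing, so the increment of \<open>G\<close> has the sign
    of the fibre integral.\<close>
  define G where "G m = (\<Phi> m + \<Phi> (m + pi / 2) + R ^ 4 * N m) / (2 * K)" for m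
  have K: "0 < K" by (simp add: K_def)
  have main: "fibre m + fibre (m + pi / 2) * 1 + R ^ 4 *
      (2 * ((c\<^sup>2 - s\<^sup>2) * p m ^ 2 * (K * c\<^sup>2 - A) + s * c * q m * (K * c\<^sup>2 - A) + s * c * p m * (- 2 * K * s * c * p m - s\<^sup>2 * c\<^sup>2 * p m))
     + 2 * ((c\<^sup>2 - s\<^sup>2) * p m ^ 4 * (A - K * s\<^sup>2) + 3 * s * c * (p m)\<^sup>2 * q m * (A - K * s\<^sup>2) + s * c * p m ^ 3 * (s\<^sup>2 * c\<^sup>2 * p m - 2 * K * s * c * p m)))
     = 2 * K * ((h1 m * h1 m + (\<rho> m - h m) * h m)\<^sup>2 - 4 * (h m * h1 m)\<^sup>2)"
    if s: "s = sin (d m)" and c: "c = cos (d m)" and A: "A = quartic_mixed (d m)" for m s c A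
  proof -
    have sc: "s\<^sup>2 + c\<^sup>2 = 1" by (simp add: s c)
    have A': "quartic_mixed (d (m + pi / 2)) = K - A" unfolding d_quarter quartic_mixed_complement K_def A ..
    have E: "quartic_sin (d m) = 3 * A - s ^ 3 * c" unfolding quartic_sin_eq A s c ..
    have E': "quartic_sin (d (m + pi / 2)) = 3 * (K - A) - c ^ 3 * s"
      unfolding quartic_sin_eq A' unfolding d_quarter s c by (simp add: cos_diff sin_diff)
    have f1: "fibre m = R ^ 4 * (2 * s * (s + q m * c - (p m)\<^sup>2 * s) * ((s * (q m * c - (p m)\<^sup>2 * s) + 2 * (p m * c)\<^sup>2) * A - (p m * c)\<^sup>2 * (3 * A - s ^ 3 * c)))"
      unfolding fibre_def E A[symmetric] pq(7) r(1) pq(3)[of m] pq(5) s[symmetric] c[symmetric] by algebra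
    have f2: "fibre (m + pi / 2) = R ^ 4 * (2 * c * (c - q m * s - (p m)\<^sup>2 * c) * ((c * (- q m * s - (p m)\<^sup>2 * c) + 2 * (p m * s)\<^sup>2) * (K - A) - (p m * s)\<^sup>2 * (3 * (K - A) - c ^ 3 * s)))"
      unfolding fibre_def E' A' pq(8) r(2) pq(4) pq(6) s[symmetric] c[symmetric] by algebra
    have f3: "(h1 m * h1 m + (\<rho> m - h m) * h m)\<^sup>2 - 4 * (h m * h1 m)\<^sup>2
        = R ^ 4 * (((p m)\<^sup>2 * (c\<^sup>2 - s\<^sup>2) + s * c * q m)\<^sup>2 - 4 * (s * c * p m)\<^sup>2)"
      unfolding pq(7) unfolding pq(3)[of m] pq(5) s[symmetric] c[symmetric] by algebra
    show ?thesis using fibre_identity[OF sc, of "q m" "p m" A K] unfolding f1 f2 f3 by algebra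
  qed
  define n where "n m = (let s = sin (d m); c = cos (d m); A = quartic_mixed (d m) in
      2 * ((c\<^sup>2 - s\<^sup>2) * p m ^ 2 * (K * c\<^sup>2 - A) + s * c * q m * (K * c\<^sup>2 - A) + s * c * p m * (- 2 * K * s * c * p m - s\<^sup>2 * c\<^sup>2 * p m))
     + 2 * ((c\<^sup>2 - s\<^sup>2) * p m ^ 4 * (A - K * s\<^sup>2) + 3 * s * c * (p m)\<^sup>2 * q m * (A - K * s\<^sup>2) + s * c * p m ^ 3 * (s\<^sup>2 * c\<^sup>2 * p m - 2 * K * s * c * p m)))" for m
  note SCP = DERIV_mult[OF DERIV_mult[OF D(1,2)] pq(2)]
  note T1 = DERIV_diff[OF DERIV_mult[OF DERIV_cmult[OF D(2)] D(2)] D(3)]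
  note T2 = DERIV_diff[OF D(3) DERIV_mult[OF DERIV_cmult[OF D(1)] D(1)]]
  have Nd: "(N has_real_derivative n m) (at m)" for m
    unfolding N_def[abs_def] n_def Let_def
    by (rule DERIV_cong[OF DERIV_add[OF DERIV_cmult[OF DERIV_mult[OF SCP T1]]
      DERIV_cmult[OF DERIV_mult[OF DERIV_mult[OF DERIV_mult[OF SCP pq(2)] pq(2)] T2]]]]) algebra
  have Gd: "(G has_real_derivative (h1 m * h1 m + (\<rho> m - h m) * h m)\<^sup>2 - 4 * (h m * h1 m)\<^sup>2) (at m)" for m
  proof -
    have "fibre m + fibre (m + pi / 2) * 1 + R ^ 4 * n m = 2 * K * ((h1 m * h1 m + (\<rho> m - h m) * h m)\<^sup>2 - 4 * (h m * h1 m)\<^sup>2)"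
      unfolding n_def Let_def by (rule main) (rule refl)+
    then have e: "(fibre m + fibre (m + pi / 2) * 1 + R ^ 4 * n m) / (2 * K) = (h1 m * h1 m + (\<rho> m - h m) * h m)\<^sup>2 - 4 * (h m * h1 m)\<^sup>2"
      using K by simp
    show ?thesis unfolding e[symmetric] G_def[abs_def]
      by (intro DERIV_cdivide DERIV_add DERIV_cmult \<Phi>d Nd DERIV_chain2[where f = \<Phi>, OF \<Phi>d L])
  qed
  have fper: "fibre (x + 2 * pi) = fibre x" for x
    by (simp add: fibre_def h_periodic rho_periodic h1_periodic d_shift)
  have "\<forall>x. ((\<lambda>x. \<Phi> (x + 2 * pi) - \<Phi> x) has_real_derivative 0) (at x)"
  proof
    fix x
    have "((\<lambda>x. \<Phi> (x + 2 * pi) - \<Phi> x) has_real_derivative fibre (x + 2 * pi) * 1 - fibre x) (at x)"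
      by (intro DERIV_diff \<Phi>d DERIV_chain2[where f = \<Phi>, OF \<Phi>d L])
    then show "((\<lambda>x. \<Phi> (x + 2 * pi) - \<Phi> x) has_real_derivative 0) (at x)" by (simp add: fper)
  qed
  then have "\<Phi> (pi / 2 + 2 * pi) - \<Phi> (pi / 2) = \<Phi> (0 + 2 * pi) - \<Phi> 0" by (rule DERIV_isconst_all)
  moreover have "\<Phi> (2 * pi) - \<Phi> 0 \<le> 0"
  proof -
    have "(fibre has_integral \<Phi> (2 * pi) - \<Phi> 0) {0..2 * pi}"
      by (rule fundamental_theorem_of_calculus)
        (auto intro!: has_field_derivative_at_within[OF \<Phi>d] simp: has_real_derivative_iff_has_vector_derivative[symmetric])
    then show ?thesis using fibre_integral_nonpos by (simp add: integral_unique)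
  qed
  moreover have "N (2 * pi) = N 0"
  proof -
    have d0: "d (2 * pi) = d 0" using d_shift[of 0] by simp
    have "cos (d 0) \<noteq> 0" using h_pos[of "0 + pi / 2"] unfolding pq(4) by auto
    then have "p (2 * pi) = p 0" using pq(5)[of "2 * pi"] pq(5)[of 0] h1_periodic[of 0] R_pos by (simp add: d0)
    then show ?thesis by (simp add: N_def d0)
  qed
  ultimately have "G (2 * pi) \<le> G 0" unfolding G_def using K by (intro divide_right_mono) (simp_all add: add.commute)
  then show ?thesis using Gd by blast
qed

end

section \<open>The equality case of Wirtinger's inequality\<close>

lemma sin_quotient_limit:
  fixes v v1 :: "real \<Rightarrow> real"
  assumes d: "(v has_real_derivative v1 c) (at c)" and z: "v c = 0" and s: "sin (2 * (c - a)) = 0"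
  shows "((\<lambda>x. v x / sin (2 * (x - a))) \<longlongrightarrow> v1 c / (2 * cos (2 * (c - a)))) (at c)"
proof -
  have "((\<lambda>x. sin (2 * (x - a))) has_real_derivative 2 * cos (2 * (c - a))) (at c)"
    by (auto intro!: derivative_eq_intros)
  then have "((\<lambda>x. (sin (2 * (x - a)) - sin (2 * (c - a))) / (x - c)) \<longlongrightarrow> 2 * cos (2 * (c - a))) (at c)"
    by (simp only: has_field_derivative_iff)
  moreover have "((\<lambda>x. (v x - v c) / (x - c)) \<longlongrightarrow> v1 c) (at c)"
    using d by (simp only: has_field_derivative_iff)
  moreover have "2 * cos (2 * (c - a)) \<noteq> 0" using sin_zero_norm_cos_one[OF s] by auto
  ultimately have "((\<lambda>x. ((v x - v c) / (x - c)) / ((sin (2 * (x - a)) - sin (2 * (c - a))) / (x - c))) \<longlongrightarrow> v1 c / (2 * cos (2 * (c - a)))) (at c)"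
    by (intro tendsto_divide)
  then show ?thesis
  proof (rule Lim_transform_eventually)
    show "\<forall>\<^sub>F x in at c. ((v x - v c) / (x - c)) / ((sin (2 * (x - a)) - sin (2 * (c - a))) / (x - c)) = v x / sin (2 * (x - a))"
      unfolding z s eventually_at by (intro exI[of _ 1]) auto
  qed
qed

text \<open>Wirtinger's inequality with its equality case, for functions changing sign after a quarter turn: with \<open>S = sin 2(x - a)\<close>,
  \<open>C = cos 2(x - a)\<close> one has \<open>v'^2 - 4 v^2 = (v' - 2 v C / S)^2 + (2 v^2 C / S)'\<close>.\<close>

lemma wirtinger_equality:
  fixes v v1 G :: "real \<Rightarrow> real"
  assumes vd: "\<And>x. (v has_real_derivative v1 x) (at x)" and anti: "\<And>x. v (x + pi / 2) = - v x"
    and Gd: "\<And>x. (G has_real_derivative (v1 x)\<^sup>2 - 4 * (v x)\<^sup>2) (at x)" and le: "G (2 * pi) \<le> G 0"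
  shows "\<exists>k a. \<forall>x. v x = k * sin (2 * (x - a))"
proof -
  have L: "((\<lambda>x. x + pi / 2) has_real_derivative 1) (at x)" for x by (auto intro!: derivative_eq_intros)
  have anti1: "v1 (x + pi / 2) = - v1 x" for x
  proof -
    have "((\<lambda>x. v (x + pi / 2)) has_real_derivative v1 (x + pi / 2) * 1) (at x)" by (rule DERIV_chain2[where f = v, OF vd L])
    then have "((\<lambda>x. - v x) has_real_derivative v1 (x + pi / 2)) (at x)" by (simp add: anti)
    then show ?thesis by (rule DERIV_unique[OF _ DERIV_minus[OF vd]])
  qed
  have "\<forall>x. ((\<lambda>x. G (x + pi / 2) - G x) has_real_derivative 0) (at x)"
  proof
    fix x
    have "((\<lambda>x. G (x + pi / 2) - G x) has_real_derivative ((v1 (x + pi / 2))\<^sup>2 - 4 * (v (x + pi / 2))\<^sup>2) * 1 - ((v1 x)\<^sup>2 - 4 * (v x)\<^sup>2)) (at x)"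
      by (intro DERIV_diff Gd DERIV_chain2[where f = G, OF Gd L])
    then show "((\<lambda>x. G (x + pi / 2) - G x) has_real_derivative 0) (at x)" by (simp add: anti anti1)
  qed
  then have G0: "G (x + pi / 2) - G x = G (0 + pi / 2) - G 0" for x by (rule DERIV_isconst_all)
  define \<kappa> where "\<kappa> = G (0 + pi / 2) - G 0"
  have \<kappa>: "G (x + pi / 2) = G x + \<kappa>" for x using G0[of x, folded \<kappa>_def] by linarith
  have e: "0 + pi / 2 + pi / 2 + pi / 2 + pi / 2 = 2 * pi" by simp
  have "G (0 + pi / 2 + pi / 2 + pi / 2 + pi / 2) = G 0 + \<kappa> + \<kappa> + \<kappa> + \<kappa>" by (simp only: \<kappa>)
  \<comment> \<open>The derivative of \<open>G\<close> is the same on all four quarter turns, so the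
    inequality over a full turn passes to each quarter.\<close>
  then have "\<kappa> \<le> 0" using le unfolding e by linarith
  then have Gle: "G (x + pi / 2) \<le> G x" for x unfolding \<kappa> by linarith
  obtain a where a: "v a = 0"
  proof -
    have c: "continuous_on S v" for S using vd by (meson DERIV_isCont continuous_at_imp_continuous_on)
    have "\<exists>x. v x = 0"
    proof (cases "v 0 \<le> 0")
      case True
      then show ?thesis using IVT'[of v 0 0 "pi / 2"] anti[of 0] c by auto
    next
      case False
      then show ?thesis using IVT2'[of v "pi / 2" 0 0] anti[of 0] c by auto
    qed
    then show thesis using that by blast
  qed
  define b where "b = a + pi / 2"
  have ab: "a < b" and vb: "v b = 0" using anti[of a] a by (simp_all add: b_def)
  define S C where "S x = sin (2 * (x - a))" and "C x = cos (2 * (x - a))" for x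
  have Sab: "S a = 0" "S b = 0" by (simp_all add: S_def b_def)
  have Spos: "0 < S x" if "a < x" "x < b" for x
    unfolding S_def using that by (intro sin_gt_zero) (auto simp: b_def)
  have Sd: "(S has_real_derivative 2 * C x) (at x)" "(C has_real_derivative - (2 * S x)) (at x)" for x
    unfolding S_def[abs_def] C_def[abs_def] by (auto intro!: derivative_eq_intros)
  \<comment> \<open>At \<open>a\<close> and \<open>b\<close> the quotient is 0 divided by 0, which
    has the value 0; \<Psi> is continuous there because the quotient has a finite limit while its
    factor \<open>v\<close> tends to 0.\<close>
  define \<Psi> where "\<Psi> x = G x - 2 * (v x * (v x / S x) * C x)" for x
  have \<Psi>d: "(\<Psi> has_real_derivative (v1 x - 2 * v x * C x / S x)\<^sup>2) (at x)" if x: "a < x" "x < b" for x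
  proof -
    have n: "S x \<noteq> 0" using Spos[OF x] by simp
    have "(v1 x)\<^sup>2 - 4 * (v x)\<^sup>2 - 2 * ((v1 x * (v x / S x) + (v1 x * S x - v x * (2 * C x)) / (S x * S x) * v x) * C x + - (2 * S x) * (v x * (v x / S x)))
        = (v1 x - 2 * v x * C x / S x)\<^sup>2"
    proof -
      define w where "w = v x / S x"
      have w: "v x = w * S x" using n by (simp add: w_def)
      have e: "(v1 x * S x - v x * (2 * C x)) / (S x * S x) * v x = (v1 x - 2 * w * C x) * w"
        "2 * v x * C x / S x = 2 * w * C x"
        using n unfolding w by (simp_all add: field_simps)
      show ?thesis unfolding e unfolding w_def[symmetric] unfolding w by (simp add: power2_eq_square algebra_simps)
    qed
    moreover have "(\<Psi> has_real_derivative (v1 x)\<^sup>2 - 4 * (v x)\<^sup>2 - 2 * ((v1 x * (v x / S x) + (v1 x * S x - v x * (2 * C x)) / (S x * S x) * v x) * C x + - (2 * S x) * (v x * (v x / S x)))) (at x)"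
      unfolding \<Psi>_def[abs_def] by (intro DERIV_diff Gd DERIV_cmult DERIV_mult DERIV_divide vd Sd n)
    ultimately show ?thesis by simp
  qed
  have \<Psi>end: "(\<Psi> \<longlongrightarrow> \<Psi> c) (at c)" if "c = a \<or> c = b" for c
  proof -
    have c: "v c = 0" "S c = 0" using that a vb Sab by auto
    have q: "((\<lambda>x. v x / S x) \<longlongrightarrow> v1 c / (2 * C c)) (at c)"
      unfolding S_def C_def by (rule sin_quotient_limit[where v = v and c = c and ?v1.0 = v1 and a = a, OF vd[of c] c(1) c(2)[unfolded S_def]])
    have "(\<Psi> \<longlongrightarrow> G c - 2 * (v c * (v1 c / (2 * C c)) * C c)) (at c)"
      unfolding \<Psi>_def[abs_def]
      by (intro tendsto_diff tendsto_mult tendsto_const q DERIV_isCont[OF Gd, unfolded isCont_def]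
        DERIV_isCont[OF vd, unfolded isCont_def] DERIV_isCont[OF Sd(2), unfolded isCont_def])
    then show ?thesis by (simp add: \<Psi>_def c)
  qed
  have \<Psi>c: "continuous_on {a..b} \<Psi>"
  proof (rule continuous_at_imp_continuous_on, rule ballI)
    fix x assume "x \<in> {a..b}"
    then consider "x = a \<or> x = b" | "a < x" "x < b" by fastforce
    then show "isCont \<Psi> x"
    proof cases
      case 1
      then show ?thesis unfolding isCont_def by (rule \<Psi>end)
    next
      case 2
      then show ?thesis by (rule DERIV_isCont[OF \<Psi>d])
    qed
  qed
  have mono: "\<Psi> x \<le> \<Psi> y" if "a \<le> x" "x \<le> y" "y \<le> b" for x y
  proof (rule DERIV_nonneg_imp_increasing_open[OF that(2)])
    show "\<exists>D. (\<Psi> has_real_derivative D) (at z) \<and> 0 \<le> D" if z: "x < z" "z < y" for z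
    proof -
      have "a < z" "z < b" using z \<open>a \<le> x\<close> \<open>y \<le> b\<close> by linarith+
      then show ?thesis using \<Psi>d zero_le_power2 by blast
    qed
    show "continuous_on {x..y} \<Psi>" using continuous_on_subset[OF \<Psi>c] that by auto
  qed
  have \<Psi>ab: "\<Psi> a = G a" "\<Psi> b = G b" using a vb by (simp_all add: \<Psi>_def)
  \<comment> \<open>\<Psi> is nondecreasing, but equals \<open>G\<close> at the ends, where it does
    not increase.\<close>
  have const: "\<Psi> x = \<Psi> a" if "a \<le> x" "x \<le> b" for x
    using mono[of a x] mono[of x b] that Gle[of a] \<Psi>ab by (simp add: b_def)
  have v1e: "v1 x - 2 * v x * C x / S x = 0" if x: "a < x" "x < b" for x
  proof -
    have "(v1 x - 2 * v x * C x / S x)\<^sup>2 = 0"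
    proof (rule DERIV_local_const[OF \<Psi>d[OF x], of "min (x - a) (b - x)"])
      show "0 < min (x - a) (b - x)" using x by simp
      show "\<forall>y. \<bar>x - y\<bar> < min (x - a) (b - x) \<longrightarrow> \<Psi> x = \<Psi> y"
      proof (intro allI impI)
        fix y assume "\<bar>x - y\<bar> < min (x - a) (b - x)"
        then have "a \<le> y" "y \<le> b" by (auto simp: abs_less_iff)
        then show "\<Psi> x = \<Psi> y" using const[of x] const[of y] x by simp
      qed
    qed
    then show ?thesis by simp
  qed
  define mid where "mid = (a + b) / 2"
  have mid: "mid \<in> {a<..<b}" using ab by (simp add: mid_def field_simps)
  define k where "k = v mid / S mid"
  have in1: "v x = k * S x" if x: "a < x" "x < b" for x
  proof -
    have "v x / S x = v mid / S mid"
    proof (rule DERIV_isconst3[OF ab _ mid, of x])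
      show "x \<in> {a<..<b}" using x by simp
      fix y assume "y \<in> {a<..<b}"
      then have y: "a < y" "y < b" by simp_all
      have n: "S y \<noteq> 0" using Spos[OF y] by simp
      have "v1 y * S y = v y * (2 * C y)" using v1e[OF y] n by (simp add: field_simps)
      then show "((\<lambda>x. v x / S x) has_real_derivative 0) (at y)"
        using DERIV_divide[OF vd Sd(1) n] by simp
    qed
    then show ?thesis using Spos[OF x] by (simp add: k_def field_simps)
  qed
  have in2: "(v x - k * S x)\<^sup>2 = 0" if "a \<le> x" "x < b" for x
    using that in1[of x] a Sab by (cases "x = a") auto
  have Santi: "S (x + pi / 2) = - S x" for x
    using sin_periodic_pi[of "2 * (x - a)"] by (simp add: S_def algebra_simps)
  \<comment> \<open>Both functions change sign after a quarter turn, so the square of their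
    difference is periodic and one interval decides.\<close>
  have per: "(v (x + pi / 2) - k * S (x + pi / 2))\<^sup>2 = (v x - k * S x)\<^sup>2" for x
    unfolding anti Santi by algebra
  have "v x = k * S x" for x
  proof -
    obtain i :: int and y where i: "x - a = y + (pi / 2) * of_int i" "0 \<le> y" "y < pi / 2"
      by (rule reduce_mod_period[of "pi / 2" "x - a"]) auto
    have "x = (a + y) + (pi / 2) * of_int i" using i(1) by linarith
    then have "(v x - k * S x)\<^sup>2 = (v (a + y) - k * S (a + y))\<^sup>2"
      using periodic_int[of "\<lambda>x. (v x - k * S x)\<^sup>2" "pi / 2" "a + y" i] per by simp
    also have "\<dots> = 0" using in2[of "a + y"] i by (simp add: b_def)
    finally show ?thesis by simp
  qed
  then show ?thesis unfolding S_def by blast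
qed

context symmetric_caustic_family
begin

lemma h_square: "\<exists>A B b. 0 \<le> B \<and> (\<forall>x. (h x)\<^sup>2 = A + B * cos (2 * (x - b)))"
proof -
  obtain G where G: "\<And>m. (G has_real_derivative (h1 m * h1 m + (\<rho> m - h m) * h m)\<^sup>2 - 4 * (h m * h1 m)\<^sup>2) (at m)"
    "G (2 * pi) \<le> G 0" using quarter_primitive by blast
  have "\<exists>k a. \<forall>x. h x * h1 x = k * sin (2 * (x - a))"
  proof (rule wirtinger_equality[OF _ _ G])
    show "((\<lambda>x. h x * h1 x) has_real_derivative h1 x * h1 x + (\<rho> x - h x) * h x) (at x)" for x
      by (rule DERIV_mult[OF h_deriv h1_deriv])
    show "h (x + pi / 2) * h1 (x + pi / 2) = - (h x * h1 x)" for x by (rule h_h1_quarter)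
  qed
  then obtain k a where ka: "\<And>x. h x * h1 x = k * sin (2 * (x - a))" by blast
  have D: "\<forall>x. ((\<lambda>x. (h x)\<^sup>2 + k * cos (2 * (x - a))) has_real_derivative 0) (at x)"
  proof
    fix x
    have "((\<lambda>x. (h x)\<^sup>2 + k * cos (2 * (x - a))) has_real_derivative 2 * (h x * h1 x) - 2 * (k * sin (2 * (x - a)))) (at x)"
      by (auto intro!: derivative_eq_intros)
    then show "((\<lambda>x. (h x)\<^sup>2 + k * cos (2 * (x - a))) has_real_derivative 0) (at x)" by (simp add: ka)
  qed
  define A where "A = (h 0)\<^sup>2 + k * cos (2 * (0 - a))"
  have A: "(h x)\<^sup>2 = A - k * cos (2 * (x - a))" for x
    using DERIV_isconst_all[OF D, of x 0] unfolding A_def by linarith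
  show ?thesis
  \<comment> \<open>Shifting the phase by a quarter turn reverses the sign of the coefficient;
    \<open>0 \<le> B\<close> puts the maximum of \<open>h\<close> at \<open>b\<close>, along the
    major axis.\<close>
  proof (cases "k \<le> 0")
    case True
    then show ?thesis using A by (intro exI[of _ A] exI[of _ "- k"] exI[of _ a]) simp
  next
    case False
    have "cos (2 * (x - (a + pi / 2))) = - cos (2 * (x - a))" for x
      using cos_periodic_pi[of "2 * (x - (a + pi / 2))"] by (simp add: algebra_simps)
    then show ?thesis using A False by (intro exI[of _ A] exI[of _ k] exI[of _ "a + pi / 2"]) simp
  qed
qed

end

section \<open>Recognizing the ellipse\<close>

text \<open>With \<open>a = sqrt \<alpha>\<close>, the distances of a point of the ellipse from the
  foci are \<open>a - e * X / a\<close> and \<open>a + e * X / a\<close>; either direction passes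
  through these values.\<close>

lemma ellipse_equation:
  fixes X Y \<alpha> \<beta> :: real
  assumes b: "0 < \<beta>" "\<beta> \<le> \<alpha>"
  defines "e \<equiv> sqrt (\<alpha> - \<beta>)"
  shows "sqrt ((X - e)\<^sup>2 + Y\<^sup>2) + sqrt ((X + e)\<^sup>2 + Y\<^sup>2) = 2 * sqrt \<alpha> \<longleftrightarrow> \<beta> * X\<^sup>2 + \<alpha> * Y\<^sup>2 = \<alpha> * \<beta>"
proof -
  define a where "a = sqrt \<alpha>"
  have a: "0 < a" "\<alpha> = a\<^sup>2" using b by (simp_all add: a_def)
  have e: "0 \<le> e" "\<beta> = a\<^sup>2 - e\<^sup>2" using b by (simp_all add: e_def a_def)
  have "e\<^sup>2 < a\<^sup>2" using b e(2) by linarith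
  then have ea: "e < a" using a(1) by (simp add: power_less_imp_less_base)
  have split: "a\<^sup>2 * ((X - e)\<^sup>2 + Y\<^sup>2) - (a\<^sup>2 - e * X)\<^sup>2 = \<beta> * X\<^sup>2 + \<alpha> * Y\<^sup>2 - \<alpha> * \<beta>"
    "a\<^sup>2 * ((X + e)\<^sup>2 + Y\<^sup>2) - (a\<^sup>2 + e * X)\<^sup>2 = \<beta> * X\<^sup>2 + \<alpha> * Y\<^sup>2 - \<alpha> * \<beta>"
    unfolding a(2) e(2) by algebra+
  show ?thesis
  proof
    assume eq: "\<beta> * X\<^sup>2 + \<alpha> * Y\<^sup>2 = \<alpha> * \<beta>"
    have "\<beta> * X\<^sup>2 \<le> \<beta> * \<alpha>" using eq b by (smt (verit) mult.commute mult_nonneg_nonneg zero_le_power2)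
    then have "X\<^sup>2 \<le> a\<^sup>2" using b a(2) by simp
    then have Xa: "\<bar>X\<bar> \<le> a" using power2_le_iff_abs_le[of a X] a(1) by simp
    have "\<bar>e * X\<bar> \<le> a * a" unfolding abs_mult using e(1) ea Xa by (intro mult_mono) auto
    then have n: "0 \<le> a\<^sup>2 - e * X" "0 \<le> a\<^sup>2 + e * X" by (auto simp: power2_eq_square abs_le_iff)
    have "a * sqrt ((X - e)\<^sup>2 + Y\<^sup>2) = sqrt (a\<^sup>2 * ((X - e)\<^sup>2 + Y\<^sup>2))" using a(1) by (simp add: real_sqrt_mult)
    also have "\<dots> = sqrt ((a\<^sup>2 - e * X)\<^sup>2)" using split(1) eq by simp
    finally have 1: "a * sqrt ((X - e)\<^sup>2 + Y\<^sup>2) = a\<^sup>2 - e * X" using n by simp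
    have "a * sqrt ((X + e)\<^sup>2 + Y\<^sup>2) = sqrt (a\<^sup>2 * ((X + e)\<^sup>2 + Y\<^sup>2))" using a(1) by (simp add: real_sqrt_mult)
    also have "\<dots> = sqrt ((a\<^sup>2 + e * X)\<^sup>2)" using split(2) eq by simp
    finally have 2: "a * sqrt ((X + e)\<^sup>2 + Y\<^sup>2) = a\<^sup>2 + e * X" using n by simp
    have "a * (sqrt ((X - e)\<^sup>2 + Y\<^sup>2) + sqrt ((X + e)\<^sup>2 + Y\<^sup>2)) = a * (2 * a)"
      using 1 2 by (simp only: distrib_left) (simp add: power2_eq_square)
    then show "sqrt ((X - e)\<^sup>2 + Y\<^sup>2) + sqrt ((X + e)\<^sup>2 + Y\<^sup>2) = 2 * sqrt \<alpha>"
      using a(1) mult_left_cancel[of a] unfolding a_def[symmetric] by simp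
  next
    define u w where "u = sqrt ((X - e)\<^sup>2 + Y\<^sup>2)" and "w = sqrt ((X + e)\<^sup>2 + Y\<^sup>2)"
    assume "sqrt ((X - e)\<^sup>2 + Y\<^sup>2) + sqrt ((X + e)\<^sup>2 + Y\<^sup>2) = 2 * sqrt \<alpha>"
    then have s: "u + w = 2 * a" by (simp add: u_def w_def a_def)
    have sq: "u\<^sup>2 = (X - e)\<^sup>2 + Y\<^sup>2" "w\<^sup>2 = (X + e)\<^sup>2 + Y\<^sup>2" by (simp_all add: u_def w_def)
    have "a * u = a\<^sup>2 - e * X" using s sq by algebra
    then have "a\<^sup>2 * u\<^sup>2 = (a\<^sup>2 - e * X)\<^sup>2" by (metis power_mult_distrib)
    then show "\<beta> * X\<^sup>2 + \<alpha> * Y\<^sup>2 = \<alpha> * \<beta>" using split(1) unfolding sq by simp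
  qed
qed

context table
begin

text \<open>In the frame turned by \<open>b\<close> the contact point with normal angle
  \<open>t\<close> is \<open>(\<alpha> * cos t / h, \<beta> * sin t / h)\<close>, which lies on the
  ellipse whose squared semi-axes are \<alpha> and \<beta>.\<close>

lemma is_ellipse_if_h_square:
  assumes hp: "\<And>x. 0 < h x" and B: "0 \<le> B" and sq: "\<And>x. (h x)\<^sup>2 = A + B * cos (2 * (x - b))"
  shows "is_ellipse (range \<gamma>)"
proof -
  define \<alpha> \<beta> where "\<alpha> = A + B" and "\<beta> = A - B"
  have sqt: "(h (b + t))\<^sup>2 = \<alpha> * (cos t)\<^sup>2 + \<beta> * (sin t)\<^sup>2" for t
  proof -
    have "(h (b + t))\<^sup>2 = A + B * ((cos t)\<^sup>2 - (sin t)\<^sup>2)" using sq[of "b + t"] by (simp add: cos_double)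
    then show ?thesis using sin_cos_squared_add[of t] unfolding \<alpha>_def \<beta>_def by algebra
  qed
  have \<beta>: "0 < \<beta>" "\<beta> \<le> \<alpha>"
  proof -
    have "(h (b + pi / 2))\<^sup>2 = \<beta>" using sqt[of "pi / 2"] by simp
    then show "0 < \<beta>" using hp[of "b + pi / 2"] by (metis zero_less_power)
    show "\<beta> \<le> \<alpha>" using B by (simp add: \<alpha>_def \<beta>_def)
  qed
  have h1e: "h (b + t) * h1 (b + t) = - ((\<alpha> - \<beta>) * (sin t * cos t))" for t
  proof -
    have "((\<lambda>x. (h x)\<^sup>2) has_real_derivative 2 * (h (b + t) * h1 (b + t))) (at (b + t))"
      by (auto intro!: derivative_eq_intros)
    moreover have "((\<lambda>x. A + B * cos (2 * (x - b))) has_real_derivative - (2 * (B * sin (2 * t)))) (at (b + t))"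
      by (auto intro!: derivative_eq_intros)
    ultimately have "2 * (h (b + t) * h1 (b + t)) = - (2 * (B * sin (2 * t)))"
      unfolding sq by (rule DERIV_unique)
    then show ?thesis by (simp add: \<alpha>_def \<beta>_def sin_double)
  qed
  define e where "e = sqrt (\<alpha> - \<beta>)"
  define pos where "pos X Y = c + cis b * Complex X Y" for X Y
  have pte: "c + pt (b + t) = pos (\<alpha> * cos t / h (b + t)) (\<beta> * sin t / h (b + t))" for t
  proof -
    have n: "h (b + t) \<noteq> 0" using hp[of "b + t"] by simp
    have sc: "(sin t)\<^sup>2 + (cos t)\<^sup>2 = 1" by simp
    have "h (b + t) * (h (b + t) * cos t - h1 (b + t) * sin t) = \<alpha> * cos t"
      using sqt[of t] h1e[of t] sc by algebra
    then have re: "h (b + t) * cos t - h1 (b + t) * sin t = \<alpha> * cos t / h (b + t)" using n by (simp add: field_simps)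
    have "h (b + t) * (h (b + t) * sin t + h1 (b + t) * cos t) = \<beta> * sin t"
      using sqt[of t] h1e[of t] sc by algebra
    then have im: "h (b + t) * sin t + h1 (b + t) * cos t = \<beta> * sin t / h (b + t)" using n by (simp add: field_simps)
    have "pt (b + t) = cis b * (Complex (h (b + t)) (h1 (b + t)) * cis t)"
      unfolding pt_def cis_mult[symmetric] by (simp add: complex_eq_iff algebra_simps)
    also have "Complex (h (b + t)) (h1 (b + t)) * cis t = Complex (\<alpha> * cos t / h (b + t)) (\<beta> * sin t / h (b + t))"
      unfolding re[symmetric] im[symmetric] by (simp add: complex_eq_iff)
    finally show ?thesis by (simp add: pos_def)
  qed
  have nat: "dist (pos X Y) (pos X' Y') = sqrt ((X - X')\<^sup>2 + (Y - Y')\<^sup>2)" for X Y X' Y'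
  proof -
    have "pos X Y - pos X' Y' = cis b * Complex (X - X') (Y - Y')" by (simp add: pos_def complex_eq_iff algebra_simps)
    then show ?thesis by (simp add: dist_norm norm_mult complex_norm)
  qed
  have on: "dist (pos X Y) (pos e 0) + dist (pos X Y) (pos (- e) 0) = 2 * sqrt \<alpha> \<longleftrightarrow> \<beta> * X\<^sup>2 + \<alpha> * Y\<^sup>2 = \<alpha> * \<beta>" for X Y
    using ellipse_equation[OF \<beta>, of X Y, folded e_def] by (simp add: nat)
  have \<alpha>: "0 < \<alpha>" using \<beta> by linarith
  have E: "range \<gamma> = {z. dist z (pos e 0) + dist z (pos (- e) 0) = 2 * sqrt \<alpha>}"
  proof (intro set_eqI iffI)
    fix z assume "z \<in> range \<gamma>"
    then obtain x where "z = c + pt x" unfolding range_curve by blast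
    then have z: "z = c + pt (b + (x - b))" by simp
    define t where "t = x - b"
    define k where "k = h (b + t)"
    have k: "k \<noteq> 0" "k\<^sup>2 = \<alpha> * (cos t)\<^sup>2 + \<beta> * (sin t)\<^sup>2" using hp[of "b + t"] sqt[of t] by (simp_all add: k_def)
    have "\<beta> * (\<alpha> * cos t / k)\<^sup>2 + \<alpha> * (\<beta> * sin t / k)\<^sup>2 = (\<beta> * (\<alpha> * cos t)\<^sup>2 + \<alpha> * (\<beta> * sin t)\<^sup>2) / k\<^sup>2"
      by (simp add: power_divide add_divide_distrib)
    also have "\<beta> * (\<alpha> * cos t)\<^sup>2 + \<alpha> * (\<beta> * sin t)\<^sup>2 = \<alpha> * \<beta> * (\<alpha> * (cos t)\<^sup>2 + \<beta> * (sin t)\<^sup>2)"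
      by algebra
    also have "\<alpha> * \<beta> * (\<alpha> * (cos t)\<^sup>2 + \<beta> * (sin t)\<^sup>2) / k\<^sup>2 = \<alpha> * \<beta>" unfolding k(2)[symmetric] using k(1) by simp
    finally show "z \<in> {z. dist z (pos e 0) + dist z (pos (- e) 0) = 2 * sqrt \<alpha>}"
      unfolding z pte t_def[symmetric] k_def[symmetric] mem_Collect_eq on .
  next
    fix z assume z: "z \<in> {z. dist z (pos e 0) + dist z (pos (- e) 0) = 2 * sqrt \<alpha>}"
    define w where "w = cis (- b) * (z - c)"
    have "cis b * w = z - c" by (simp add: w_def mult.assoc[symmetric] cis_mult)
    then have zw: "z = pos (Re w) (Im w)" by (simp only: pos_def complex.collapse) simp
    have eq: "\<beta> * (Re w)\<^sup>2 + \<alpha> * (Im w)\<^sup>2 = \<alpha> * \<beta>" using z on unfolding zw by simp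
    \<comment> \<open>The normal of the ellipse at \<open>(X, Y)\<close> has the direction
      \<open>(X / \<alpha>, Y / \<beta>)\<close>. Its angle is the parameter of the point, and its
      length turns out to be \<open>1 / h\<close>.\<close>
    define r where "r = cmod (Complex (Re w / \<alpha>) (Im w / \<beta>))"
    define t where "t = Arg (Complex (Re w / \<alpha>) (Im w / \<beta>))"
    have "Complex (Re w / \<alpha>) (Im w / \<beta>) = rcis r t" by (simp add: r_def t_def rcis_cmod_Arg)
    then have rw: "Re w = \<alpha> * r * cos t" "Im w = \<beta> * r * sin t"
      using \<alpha> \<beta> by (simp_all add: complex_eq_iff field_simps)
    have "(\<alpha> * \<beta>) * (r * h (b + t))\<^sup>2 = \<alpha> * \<beta>"
      using eq sqt[of t] unfolding rw by algebra
    then have "(r * h (b + t))\<^sup>2 = 1\<^sup>2" using \<alpha> \<beta>(1) by simp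
    moreover have "0 \<le> r * h (b + t)" using hp[of "b + t"] by (simp add: r_def)
    ultimately have "r * h (b + t) = 1" by (simp only: power2_eq_iff_nonneg zero_le_one)
    then have "r = 1 / h (b + t)" using hp[of "b + t"] by (simp add: field_simps)
    then have "z = c + pt (b + t)" unfolding pte zw rw by simp
    then show "z \<in> range \<gamma>" unfolding range_curve by blast
  qed
  have "dist (pos e 0) (pos (- e) 0) < 2 * sqrt \<alpha>"
  proof -
    have "0 \<le> e" using \<beta> by (simp add: e_def)
    then have "dist (pos e 0) (pos (- e) 0) = 2 * e" by (simp add: nat real_sqrt_mult)
    also have "\<dots> < 2 * sqrt \<alpha>" using \<beta> by (simp add: e_def)
    finally show ?thesis .
  qed
  then show ?thesis unfolding is_ellipse_def E by blast
qed

end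

theorem corollary1p2:
  fixes \<gamma> :: "real \<Rightarrow> complex" and U W :: "complex set" and \<F> :: "complex set set"
  assumes "simple_closed_C2_curve \<gamma>"
    and "\<forall>t. curvature \<gamma> t > 0"
    and "centrally_symmetric (range \<gamma>)"
    and "open W" "range \<gamma> \<subseteq> W" "W \<inter> domain \<gamma> \<subseteq> U" "U \<subseteq> domain \<gamma>"
    and "C1_foliation U \<F>"
    and "\<forall>C\<in>\<F>. convex_caustic \<gamma> C"
    and "rotation_number \<gamma> ` \<F> = {0<..1/4}"
  shows "is_ellipse (range \<gamma>)"
proof -
  obtain c where c: "\<And>z. z \<in> range \<gamma> \<Longrightarrow> 2 * c - z \<in> range \<gamma>"
    using assms(3) unfolding centrally_symmetric_def by blast
  \<comment> \<open>The support function is taken about the centre of symmetry, so that it is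
    invariant under a half turn.\<close>
  obtain T h h1 \<rho> where o: "oval h h1 \<rho>" "strict_mono T" "surj T" "\<And>x. T (x + 2 * pi) = T x + 1"
    "\<And>x. \<gamma> (T x) = c + (h x *\<^sub>R cis x + h1 x *\<^sub>R (\<i> * cis x))"
    "\<And>x. velocity \<gamma> (T x) = norm (velocity \<gamma> (T x)) *\<^sub>R (\<i> * cis x)" "\<And>t. velocity \<gamma> t \<noteq> 0"
    using oval_parametrization[OF assms(1,2), where c = c] by (elim exE conjE) blast
  interpret oval h h1 \<rho> by (rule o(1))
  interpret caustic_foliation h h1 \<rho> \<gamma> T c U \<F>
  proof
    show "\<gamma> (T x) = c + pt x" for x using o(5) by (simp add: pt_def)
    show "simple_closed_convex_curve C" if "C \<in> \<F>" for C using assms(9) that by (simp add: convex_caustic_def)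
  qed (use o assms in blast)+
  obtain P F M where f: "caustic_family h h1 \<rho> P F M" using family_exists[OF assms(10)] by blast
  interpret f: caustic_family h h1 \<rho> P F M by (rule f)
  interpret s: symmetric_caustic_family h h1 \<rho> P F M
    by unfold_locales (rule symmetric_support[OF c])
  obtain A B b where AB: "0 \<le> B" "\<And>x. (h x)\<^sup>2 = A + B * cos (2 * (x - b))" using s.h_square by blast
  show ?thesis by (rule is_ellipse_if_h_square[OF s.h_pos AB])
qed

end
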